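(* Fix $T>0$ and $s>2$. Let $\bar u\in L^\infty(0,T;H^s(\mathbb{H}))$ be a classical solution of the two-dimensional incompressible Euler equations $$\partial_t \bar u+\bar u\cdot\nabla\bar u+\nabla\bar p=0,\qquad \nabla\cdot\bar u=0 \quad\text{in } \mathbb{H},\qquad \bar u_2|_{\partial\mathbb{H}}=0,$$ and, for each $\nu>0$, let $u=u^{\nu}\in L^\infty(0,T;H^s(\mathbb{H}))$ be a classical solution of the two-dimensional incompressible Navier--Stokes equations $$\partial_t u-\nu\Delta u+u\cdot\nabla u+\nabla p=0,\qquad \nabla\cdot u=0\quad\text{in }\mathbb{H},\qquad u|_{\partial\mathbb{H}}=0,$$ with the same initial condition $u|_{t=0}=\bar u|_{t=0}$. Assume that the trace $U=\bar u_1|_{\partial\mathbb{H}}$ of the Euler tangential velocity satisfies $U(x_1,t)\ge 0$ for all $x_1\in\mathbb{R}$ and $t\in[0,T]$, and that for all sufficiently small $\nu>0$ the trace on $\partial\mathbb{H}$ of the Navier--Stokes vorticity $\omega=\partial_1u_2-\partial_2u_1$ satisfies $\omega|_{\partial\mathbb{H}}(x_1,t)\ge 0$ for all $x_1\in\mathbb{R}$ and $t\in[0,T]$. Then $$\|u-\bar u\|_{L^\infty(0,T;L^2(\mathbb{H}))}^2\to 0\qquad\text{as }\nu\to0.$$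
   Context: $\mathbb{H}=\{x=(x_1,x_2)\in\mathbb{R}^2: x_2>0\}$ is the upper half plane. Velocity fields $u=(u_1,u_2)$ and $\bar u=(\bar u_1,\bar u_2)$ take values in $\mathbb{R}^2$; $p$ and $\bar p$ are the scalar pressures. The Navier--Stokes solution $u$ (and hence $\omega$) depends on $\nu$, while the Euler solution $\bar u$, the common initial datum, and $T$ do not. All quantities are dimensionless, and $\nu>0$ plays the role of the inverse Reynolds number. *)

theory Defs
  imports "HOL-Probability.Essential_Supremum"
begin

section \<open>Partial derivatives\<close>

text \<open>
  The partial derivative relative to a set. At interior points of \<open>S\<close> it is the ordinary one; at
  points of the boundary of a closed half space it is the one-sided one, so that for a function
  that is \<open>C\<^sup>1\<close> up to the boundary it agrees with the trace of the interior partial derivative.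
  Meaningful only where \<open>f\<close> is differentiable within \<open>S\<close>.
\<close>

definition partial_deriv ::
    "(real^'n) set \<Rightarrow> 'n::finite \<Rightarrow> (real^'n \<Rightarrow> 'b::real_normed_vector) \<Rightarrow> real^'n \<Rightarrow> 'b" where
  "partial_deriv S i f x = frechet_derivative f (at x within S) (axis i 1)"

text \<open>
  Higher partial derivatives are indexed by lists of directions: \<open>[i\<^sub>1, \<dots>, i\<^sub>k]\<close> stands for
  \<open>\<partial>\<^bsub>i\<^sub>1\<^esub> \<dots> \<partial>\<^bsub>i\<^sub>k\<^esub>\<close>.
\<close>

definition iter_partial ::
    "'n::finite list \<Rightarrow> (real^'n \<Rightarrow> 'b::real_normed_vector) \<Rightarrow> real^'n \<Rightarrow> 'b" where
  "iter_partial is f = foldr (partial_deriv UNIV) is f"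


section \<open>Sobolev spaces of real order on an open set\<close>

definition test_function :: "(real^'n::finite) set \<Rightarrow> (real^'n \<Rightarrow> real) \<Rightarrow> bool" where
  "test_function \<Omega> \<phi> \<longleftrightarrow>
     (\<forall>is. iter_partial is \<phi> differentiable_on UNIV) \<and>
     compact (closure {x. \<phi> x \<noteq> 0}) \<and> closure {x. \<phi> x \<noteq> 0} \<subseteq> \<Omega>"

definition locally_integrable_on ::
    "(real^'n::finite \<Rightarrow> 'b::euclidean_space) \<Rightarrow> (real^'n) set \<Rightarrow> bool" where
  "locally_integrable_on f \<Omega> \<longleftrightarrow> (\<forall>K. compact K \<and> K \<subseteq> \<Omega> \<longrightarrow> set_integrable lebesgue K f)"

definition has_weak_derivative ::
    "(real^'n::finite) set \<Rightarrow> 'n list \<Rightarrow> (real^'n \<Rightarrow> 'b::euclidean_space) \<Rightarrow> (real^'n \<Rightarrow> 'b) \<Rightarrow> bool"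
  where
  "has_weak_derivative \<Omega> is f g \<longleftrightarrow>
     locally_integrable_on f \<Omega> \<and> locally_integrable_on g \<Omega> \<and>
     (\<forall>\<phi>. test_function \<Omega> \<phi> \<longrightarrow>
        (LINT x|lebesgue_on \<Omega>. iter_partial is \<phi> x *\<^sub>R f x) =
        (-1) ^ length is *\<^sub>R (LINT x|lebesgue_on \<Omega>. \<phi> x *\<^sub>R g x))"

text \<open>The weak derivative is unique up to null sets, and is only used under integrals.\<close>

definition weak_derivative ::
    "(real^'n::finite) set \<Rightarrow> 'n list \<Rightarrow> (real^'n \<Rightarrow> 'b::euclidean_space) \<Rightarrow> real^'n \<Rightarrow> 'b" where
  "weak_derivative \<Omega> is f = (SOME g. has_weak_derivative \<Omega> is f g)"

definition ennreal_sqrt :: "ennreal \<Rightarrow> ennreal" where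
  "ennreal_sqrt a = (if a = \<infinity> then \<infinity> else ennreal (sqrt (enn2real a)))"

definition L2_norm ::
    "(real^'n::finite) set \<Rightarrow> (real^'n \<Rightarrow> 'b::euclidean_space) \<Rightarrow> ennreal" where
  "L2_norm \<Omega> f = ennreal_sqrt (\<integral>\<^sup>+x. ennreal ((norm (f x))\<^sup>2) \<partial>lebesgue_on \<Omega>)"

text \<open>The Gagliardo seminorm of order \<open>\<sigma> \<in> (0,1)\<close>.\<close>

definition gagliardo_seminorm ::
    "(real^'n::finite) set \<Rightarrow> real \<Rightarrow> (real^'n \<Rightarrow> 'b::euclidean_space) \<Rightarrow> ennreal" where
  "gagliardo_seminorm \<Omega> \<sigma> g = ennreal_sqrt
     (\<integral>\<^sup>+x. \<integral>\<^sup>+y. ennreal ((norm (g x - g y))\<^sup>2 / norm (x - y) powr (real CARD('n) + 2 * \<sigma>))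
        \<partial>lebesgue_on \<Omega> \<partial>lebesgue_on \<Omega>)"

text \<open>
  The Sobolev--Slobodeckij norm of order \<open>s \<ge> 0\<close>, with integer part \<open>k = \<lfloor>s\<rfloor>\<close>. Summing over lists of
  directions counts mixed derivatives with multiplicity, which gives an equivalent norm.
\<close>

definition sobolev_norm ::
    "(real^'n::finite) set \<Rightarrow> real \<Rightarrow> (real^'n \<Rightarrow> 'b::euclidean_space) \<Rightarrow> ennreal" where
  "sobolev_norm \<Omega> s f =
     (let k = nat \<lfloor>s\<rfloor>; \<sigma> = s - real k in
      ennreal_sqrt
        ((\<Sum>is | length is \<le> k. (L2_norm \<Omega> (weak_derivative \<Omega> is f))\<^sup>2) +
         (if \<sigma> = 0 then 0
          else (\<Sum>is | length is = k. (gagliardo_seminorm \<Omega> \<sigma> (weak_derivative \<Omega> is f))\<^sup>2))))"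

definition sobolev_space ::
    "(real^'n::finite) set \<Rightarrow> real \<Rightarrow> (real^'n \<Rightarrow> 'b::euclidean_space) set" where
  "sobolev_space \<Omega> s =
     {f. (\<forall>is. length is \<le> nat \<lfloor>s\<rfloor> \<longrightarrow> (\<exists>g. has_weak_derivative \<Omega> is f g)) \<and>
         sobolev_norm \<Omega> s f < \<infinity>}"

definition Linf_norm :: "real \<Rightarrow> ('a \<Rightarrow> ennreal) \<Rightarrow> (real \<Rightarrow> 'a) \<Rightarrow> ennreal" where
  "Linf_norm T N u = esssup (lebesgue_on {0<..<T}) (\<lambda>t. N (u t))"

text \<open>
  The space \<open>L\<^sup>\<infinity>(0,T; H\<^sup>s(\<Omega>))\<close>. As \<open>H\<^sup>s\<close> is a separable Hilbert space, strong measurability in time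
  is joint measurability in \<open>(t,x)\<close>.
\<close>

definition Linf_sobolev ::
    "real \<Rightarrow> (real^'n::finite) set \<Rightarrow> real \<Rightarrow> (real \<Rightarrow> real^'n \<Rightarrow> 'b::euclidean_space) set" where
  "Linf_sobolev T \<Omega> s =
     {u. (\<lambda>(t, x). u t x) \<in> borel_measurable (lebesgue_on ({0<..<T} \<times> \<Omega>)) \<and>
         (AE t in lebesgue_on {0<..<T}. u t \<in> sobolev_space \<Omega> s) \<and>
         Linf_norm T (sobolev_norm \<Omega> s) u < \<infinity>}"


section \<open>Flows in the upper half plane\<close>

definition half_plane :: "(real^2) set" ("\<H>") where
  "\<H> = {x. x $ 2 > 0}"

definition boundary_point :: "real \<Rightarrow> real^2" where
  "boundary_point x1 = vector [x1, 0]"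

text \<open>
  Fields on the half plane are represented by functions whose values on the closed half plane
  matter; traces are values at points of the boundary.
\<close>

abbreviation partial_H :: "2 \<Rightarrow> (real^2 \<Rightarrow> 'b::real_normed_vector) \<Rightarrow> real^2 \<Rightarrow> 'b" where
  "partial_H \<equiv> partial_deriv (closure \<H>)"

definition gradient :: "(real^2 \<Rightarrow> real) \<Rightarrow> real^2 \<Rightarrow> real^2" where
  "gradient q x = (\<chi> i. partial_H i q x)"

definition divergence :: "(real^2 \<Rightarrow> real^2) \<Rightarrow> real^2 \<Rightarrow> real" where
  "divergence v x = (\<Sum>i\<in>UNIV. partial_H i v x $ i)"

definition laplacian :: "(real^2 \<Rightarrow> real^2) \<Rightarrow> real^2 \<Rightarrow> real^2" where
  "laplacian v x = (\<Sum>i\<in>UNIV. partial_H i (partial_H i v) x)"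

definition convection :: "(real^2 \<Rightarrow> real^2) \<Rightarrow> (real^2 \<Rightarrow> real^2) \<Rightarrow> real^2 \<Rightarrow> real^2" where
  "convection v w x = (\<Sum>i\<in>UNIV. (v x $ i) *\<^sub>R partial_H i w x)"

definition vorticity :: "(real^2 \<Rightarrow> real^2) \<Rightarrow> real^2 \<Rightarrow> real" where
  "vorticity v x = partial_H 1 v x $ 2 - partial_H 2 v x $ 1"

definition time_deriv :: "(real \<Rightarrow> real^2 \<Rightarrow> real^2) \<Rightarrow> real \<Rightarrow> real^2 \<Rightarrow> real^2" where
  "time_deriv u t x = vector_derivative (\<lambda>\<tau>. u \<tau> x) (at t)"

text \<open>
  Classical regularity: \<open>u\<close> and \<open>\<nabla>u\<close> are continuous up to the boundary and up to the end points of
  the time interval (so the traces in the theorem are pointwise), while \<open>\<partial>\<^sub>t u\<close> and \<open>\<nabla>p\<close> exist and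
  are continuous in the interior. No decay is required of the pressure.
\<close>

definition classical_regularity ::
    "real \<Rightarrow> (real \<Rightarrow> real^2 \<Rightarrow> real^2) \<Rightarrow> (real \<Rightarrow> real^2 \<Rightarrow> real) \<Rightarrow> bool" where
  "classical_regularity T u p \<longleftrightarrow>
     continuous_on ({0..T} \<times> closure \<H>) (\<lambda>(t, x). u t x) \<and>
     (\<forall>t\<in>{0..T}. u t differentiable_on closure \<H>) \<and>
     (\<forall>i. continuous_on ({0..T} \<times> closure \<H>) (\<lambda>(t, x). partial_H i (u t) x)) \<and>
     (\<forall>t\<in>{0<..<T}. \<forall>x\<in>\<H>. (\<lambda>\<tau>. u \<tau> x) differentiable (at t)) \<and>
     continuous_on ({0<..<T} \<times> \<H>) (\<lambda>(t, x). time_deriv u t x) \<and>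
     (\<forall>t\<in>{0<..<T}. p t differentiable_on \<H>) \<and>
     continuous_on ({0<..<T} \<times> \<H>) (\<lambda>(t, x). gradient (p t) x)"

definition classical_second_order :: "real \<Rightarrow> (real \<Rightarrow> real^2 \<Rightarrow> real^2) \<Rightarrow> bool" where
  "classical_second_order T u \<longleftrightarrow>
     (\<forall>t\<in>{0<..<T}. \<forall>i. partial_H i (u t) differentiable_on \<H>) \<and>
     (\<forall>i j. continuous_on ({0<..<T} \<times> \<H>) (\<lambda>(t, x). partial_H j (partial_H i (u t)) x))"

definition classical_euler_solution ::
    "real \<Rightarrow> (real \<Rightarrow> real^2 \<Rightarrow> real^2) \<Rightarrow> (real \<Rightarrow> real^2 \<Rightarrow> real) \<Rightarrow> bool" where
  "classical_euler_solution T u p \<longleftrightarrow>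
     classical_regularity T u p \<and>
     (\<forall>t\<in>{0<..<T}. \<forall>x\<in>\<H>.
        time_deriv u t x + convection (u t) (u t) x + gradient (p t) x = 0 \<and>
        divergence (u t) x = 0) \<and>
     (\<forall>t\<in>{0..T}. \<forall>x\<in>frontier \<H>. u t x $ 2 = 0)"

definition classical_navier_stokes_solution ::
    "real \<Rightarrow> real \<Rightarrow> (real \<Rightarrow> real^2 \<Rightarrow> real^2) \<Rightarrow> (real \<Rightarrow> real^2 \<Rightarrow> real) \<Rightarrow> bool" where
  "classical_navier_stokes_solution \<nu> T u p \<longleftrightarrow>
     classical_regularity T u p \<and> classical_second_order T u \<and>
     (\<forall>t\<in>{0<..<T}. \<forall>x\<in>\<H>.
        time_deriv u t x - \<nu> *\<^sub>R laplacian (u t) x + convection (u t) (u t) x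
          + gradient (p t) x = 0 \<and>
        divergence (u t) x = 0) \<and>
     (\<forall>t\<in>{0..T}. \<forall>x\<in>frontier \<H>. u t x = 0)"

end

theory Submission
  imports Defs
begin

text \<open>
  The energy of the difference \<open>w = u - ubar\<close> is estimated. In the viscous term \<open>\<nu> \<integral> \<Delta>u \<bullet> w\<close> the
  boundary contributes \<open>- \<nu> \<integral> \<omega> U \<le> 0\<close>, so the boundary layer does no harm, and what
  remains is at most \<open>\<nu> / 4\<close> times the squared norm of \<open>\<nabla>ubar\<close>; the convective terms contribute
  at most a multiple of \<open>sup \<bar>\<nabla>ubar\<bar>\<close> times the energy. Gronwall's inequality bounds the energy by a multiple of \<open>\<nu>\<close>.

  The bound for \<open>\<nabla>ubar\<close> is the Sobolev embedding for \<open>s > 2\<close>, obtained by comparing averages over squares of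
  different sizes. The pressure is eliminated without any decay assumption: its time-integrated gradient is
  square integrable, and a solenoidal field tangential to the boundary is approximated by perpendicular
  gradients of its cut off stream function, to which every gradient is orthogonal.
\<close>

subsection \<open>Smooth functions of one variable\<close>

text \<open>The Sobolev bounds for \<open>u\<close> depend on \<nu>. They may therefore serve only
  to make integrals finite, to give continuity in time, and to control errors that vanish in a limit
  at fixed \<nu>; every surviving constant has to come from \<open>ubar\<close>. Hence the
  convective difference is split into \<open>u\<close> transporting w, which drops out by
  incompressibility, and w acting on the gradient of \<open>ubar\<close>. Likewise
  \<open>- a \<bullet> (a - b)\<close>, with a a derivative of \<open>u\<close> and b one of
  \<open>ubar\<close>, is at most a quarter of the squared norm of b, whatever a is. As the equation
  can be tested against square integrable fields only after integration over a time interval, the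
  energy obeys a difference inequality with a remainder quadratic in the length of the interval. The
  constant of the remainder depends on \<nu>, and refining the partition removes it. The hypotheses
  speak of weak derivatives picked by choice, at almost every time. These are matched with classical
  derivatives through averages against kernels, and the bounds reach all times by
  continuity.\<close>

fun Ck :: "nat \<Rightarrow> (real \<Rightarrow> real) \<Rightarrow> bool" where
  "Ck 0 f = True" |
  "Ck (Suc n) f = (\<exists>f'. (\<forall>x. (f has_real_derivative f' x) (at x)) \<and> Ck n f')"

text \<open>Level 0 of \<open>Ck\<close> demands nothing, not even continuity, so every induction on
  the level starts trivially. Requiring all levels repairs this.\<close>

definition smooth :: "(real \<Rightarrow> real) \<Rightarrow> bool" where
  "smooth f \<longleftrightarrow> (\<forall>n. Ck n f)"

lemma Ck_SucD: "Ck (Suc n) f \<Longrightarrow> Ck n f"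
  by (induction n arbitrary: f) (simp, metis Ck.simps(2))

lemma Ck_const: "Ck n (\<lambda>x. c)"
proof (induction n arbitrary: c)
  case (Suc n)
  show ?case by (simp, rule exI[of _ "\<lambda>x. 0"]) (auto intro: Suc)
qed auto

lemma Ck_add: "Ck n f \<Longrightarrow> Ck n g \<Longrightarrow> Ck n (\<lambda>x. f x + g x)"
proof (induction n arbitrary: f g)
  case (Suc n)
  then obtain f' g' where "\<forall>x. (f has_real_derivative f' x) (at x)" "Ck n f'"
     "\<forall>x. (g has_real_derivative g' x) (at x)" "Ck n g'" by auto
  then show ?case using Suc.IH[of f' g']
    by (auto intro!: exI[of _ "\<lambda>x. f' x + g' x"] derivative_eq_intros)
qed auto

lemma Ck_mult: "Ck n f \<Longrightarrow> Ck n g \<Longrightarrow> Ck n (\<lambda>x. f x * g x)"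
proof (induction n arbitrary: f g)
  case (Suc n)
  then obtain f' g' where fg: "\<forall>x. (f has_real_derivative f' x) (at x)" "Ck n f'"
     "\<forall>x. (g has_real_derivative g' x) (at x)" "Ck n g'" by auto
  have "Ck n f" "Ck n g" using Suc.prems by (auto dest!: Ck_SucD simp del: Ck.simps)
  then have "Ck n (\<lambda>x. f' x * g x + f x * g' x)"
    using Suc.IH fg by (intro Ck_add) auto
  then show ?case using fg
    by (auto intro!: exI[of _ "\<lambda>x. f' x * g x + f x * g' x"] derivative_eq_intros)
qed auto

lemma Ck_affine: "Ck n f \<Longrightarrow> Ck n (\<lambda>x. f (c * x + d))"
proof (induction n arbitrary: f)
  case (Suc n)
  then obtain f' where f': "\<forall>x. (f has_real_derivative f' x) (at x)" "Ck n f'" by auto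
  have "Ck n (\<lambda>x. c * f' (c * x + d))"
    using Ck_mult[OF Ck_const Suc.IH[OF f'(2)], of c] .
  moreover have "((\<lambda>x. f (c * x + d)) has_real_derivative c * f' (c * x + d)) (at x)" for x
  proof -
    have "(f has_real_derivative f' (c * x + d)) (at (c * x + d))" using f'(1) by blast
    moreover have "((\<lambda>x. c * x + d) has_real_derivative c) (at x)" by (auto intro!: derivative_eq_intros)
    ultimately show ?thesis
      using DERIV_chain2[of f "f' (c * x + d)" "\<lambda>x. c * x + d" x c UNIV] by (simp only: mult.commute)
  qed
  ultimately show ?case by (auto intro!: exI[of _ "\<lambda>x. c * f' (c * x + d)"])
qed auto

lemma smooth_const: "smooth (\<lambda>x. c)" by (simp add: smooth_def Ck_const)
lemma smooth_add: "smooth f \<Longrightarrow> smooth g \<Longrightarrow> smooth (\<lambda>x. f x + g x)" by (simp add: smooth_def Ck_add)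
lemma smooth_mult: "smooth f \<Longrightarrow> smooth g \<Longrightarrow> smooth (\<lambda>x. f x * g x)" by (simp add: smooth_def Ck_mult)
lemma smooth_affine: "smooth f \<Longrightarrow> smooth (\<lambda>x. f (c * x + d))" by (simp add: smooth_def Ck_affine)
lemma smooth_cmult: "smooth f \<Longrightarrow> smooth (\<lambda>x. c * f x)" by (simp add: smooth_mult smooth_const)
lemma smooth_diff: "smooth f \<Longrightarrow> smooth g \<Longrightarrow> smooth (\<lambda>x. f x - g x)"
  using smooth_add[of f "\<lambda>x. (-1) * g x"] smooth_cmult[of g "-1"] by simp

lemma smooth_antiderivative:
  assumes "\<And>x. (F has_real_derivative f x) (at x)" "smooth f"
  shows "smooth F"
  unfolding smooth_def
proof
  fix n show "Ck n F" using assms by (cases n) (auto simp: smooth_def)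
qed

lemma smooth_has_deriv:
  assumes "smooth f"
  shows "(f has_real_derivative deriv f x) (at x)"
proof -
  have "Ck (Suc 0) f" using assms by (simp only: smooth_def)
  then obtain f' where "(f has_real_derivative f' x) (at x)" by auto
  then show ?thesis by (simp add: DERIV_imp_deriv)
qed

lemma smooth_deriv:
  assumes "smooth f"
  shows "smooth (deriv f)"
  unfolding smooth_def
proof
  fix n
  have "Ck (Suc n) f" using assms by (simp only: smooth_def)
  then obtain f' where f': "\<forall>x. (f has_real_derivative f' x) (at x)" "Ck n f'" by auto
  then have "f' = deriv f" by (intro ext) (metis DERIV_imp_deriv)
  then show "Ck n (deriv f)" using f' by simp
qed

lemma smooth_continuous_on: "smooth f \<Longrightarrow> continuous_on A f"
  by (meson DERIV_isCont continuous_at_imp_continuous_on smooth_has_deriv)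

text \<open>The classical flat function \<open>exp (-1/x)\<close>, with powers of \<open>1/x\<close> to make the family closed
  under differentiation.\<close>

definition flat :: "nat \<Rightarrow> real \<Rightarrow> real" where
  "flat k x = (if x > 0 then (1/x) ^ k * exp (- (1/x)) else 0)"

lemma flat_tendsto_0: "(flat k \<longlongrightarrow> 0) (at_right 0)"
proof -
  have "((\<lambda>x. (inverse x) ^ k / exp (inverse x)) \<longlongrightarrow> (0::real)) (at_right 0)"
    using filterlim_compose[OF tendsto_power_div_exp_0 filterlim_inverse_at_top_right] .
  then show ?thesis
    by (rule Lim_transform_eventually)
       (auto simp: flat_def eventually_at_filter exp_minus field_simps inverse_eq_divide)
qed

lemma flat_has_deriv: "(flat k has_real_derivative flat (k + 2) x - real k * flat (k + 1) x) (at x)"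
proof -
  consider "x > 0" | "x < 0" | "x = 0" by linarith
  then show ?thesis
  proof cases
    case 1
    have "((\<lambda>x. (1/x) ^ k * exp (- (1/x))) has_real_derivative flat (k + 2) x - real k * flat (k + 1) x) (at x)"
    proof -
      have k: "(1/x)^(k - Suc 0) * real k = real k * (1/x)^k * x"
        using 1 by (cases k) (auto simp: field_simps)
      show ?thesis using 1
        apply (auto intro!: derivative_eq_intros simp: flat_def)
        using k apply (cases k) apply (simp_all add: power2_eq_square divide_simps)
        done
    qed
    moreover have "eventually (\<lambda>y. y > 0) (nhds x)" using 1 
      by (intro eventually_nhds_in_open[of "{0<..}" x, simplified]) auto
    ultimately show ?thesis
      by (subst DERIV_cong_ev[OF refl _ refl]) (auto elim!: eventually_mono simp: flat_def)
  next
    case 2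
    have "eventually (\<lambda>y. y < 0) (nhds x)" using 2
      by (intro eventually_nhds_in_open[of "{..<0}" x, simplified]) auto
    then have "eventually (\<lambda>y. flat k y = 0) (nhds x)" by (auto elim!: eventually_mono simp: flat_def)
    then have "(flat k has_real_derivative 0) (at x)"
      by (subst DERIV_cong_ev[OF refl _ refl]) (auto)
    then show ?thesis using 2 by (simp add: flat_def)
  next
    case 3
    \<comment> \<open>For h > 0 the difference quotient is exactly \<open>flat (Suc k) h\<close>,
      whose limit at 0 is already known.\<close>
    have "((\<lambda>h. (flat k (0 + h) - flat k 0) / h) \<longlongrightarrow> 0) (at_right 0)"
      by (rule Lim_transform_eventually[OF flat_tendsto_0[of "Suc k"]])
        (auto simp: flat_def eventually_at_filter)
    moreover have "((\<lambda>h. (flat k (0 + h) - flat k 0) / h) \<longlongrightarrow> 0) (at_left 0)"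
      by (rule Lim_transform_eventually[OF tendsto_const])
        (auto simp: flat_def eventually_at_filter)
    ultimately show ?thesis using 3
      by (simp add: DERIV_def filterlim_at_split flat_def)
  qed
qed

lemma smooth_flat: "smooth (flat k)"
  unfolding smooth_def
proof
  fix n show "Ck n (flat k)"
  proof (induction n arbitrary: k)
    case (Suc n)
    have "Ck n (\<lambda>x. flat (k+2) x + (- real k) * flat (k+1) x)"
      by (intro Ck_add Ck_mult Ck_const Suc)
    then show ?case using flat_has_deriv[of k]
      by (auto intro!: exI[of _ "\<lambda>x. flat (k+2) x - real k * flat (k+1) x"])
  qed auto
qed

section \<open>A smooth step function, bump profiles and the mollifier\<close>

definition bump0 :: "real \<Rightarrow> real" where "bump0 x = flat 0 x * flat 0 (1 - x)"

lemma smooth_bump0: "smooth bump0"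
  using smooth_mult[OF smooth_flat[of 0] smooth_affine[OF smooth_flat[of 0], of "-1" 1]]
  by (simp add: bump0_def[abs_def])

lemma bump0_nonneg: "bump0 x \<ge> 0" by (simp add: bump0_def flat_def)
lemma bump0_zero: "x \<notin> {0..1} \<Longrightarrow> bump0 x = 0" by (auto simp: bump0_def flat_def)

text \<open>\<open>bump0\<close> is nonnegative, positive inside the unit interval and zero outside.
  An antiderivative is thus monotone, constant on either side and strictly larger on the right;
  normalising its increment to 1 gives the step.\<close>

lemma exists_smooth_step:
  "\<exists>S :: real \<Rightarrow> real. smooth S \<and> (\<forall>x\<le>0. S x = 0) \<and> (\<forall>x\<ge>1. S x = 1) \<and> (\<forall>x. deriv S x \<ge> 0)"
proof -
  obtain F where F: "\<And>x. (F has_vector_derivative bump0 x) (at x)"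
    using einterval_antiderivative[of "-\<infinity>" "\<infinity>" bump0] 
      smooth_has_deriv[OF smooth_bump0] by (auto dest: DERIV_isCont)
  have F: "(F has_real_derivative bump0 x) (at x)" for x
    using F by (simp add: has_real_derivative_iff_has_vector_derivative)
  have mono: "F a \<le> F b" if "a \<le> b" for a b
    using that F by (metis DERIV_nonneg_imp_nondecreasing bump0_nonneg)
  have cont: "continuous_on A F" for A
    by (meson DERIV_continuous_on F has_field_derivative_at_within)
  have 0: "F x = F 0" if "x \<le> 0" for x
  proof (cases "x = 0")
    case False
    have "F 0 = F x"
    proof (rule DERIV_isconst_end[of x 0 F])
      fix y assume "x < y" "y < 0"
      then show "(F has_real_derivative 0) (at y)" using F[of y] bump0_zero[of y] by simp
    qed (use that False cont in auto)
    then show ?thesis by simp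
  qed auto
  have 1: "F x = F 1" if "x \<ge> 1" for x
  proof (cases "x = 1")
    case False
    show ?thesis
    proof (rule DERIV_isconst_end[of 1 x F])
      fix y assume "1 < y" "y < x"
      then show "(F has_real_derivative 0) (at y)" using F[of y] bump0_zero[of y] by simp
    qed (use that False cont in auto)
  qed auto
  have "F 0 < F 1"
  proof (rule DERIV_pos_imp_increasing_open[of 0 1 F])
    fix x :: real assume "0 < x" "x < 1"
    then show "\<exists>y. (F has_real_derivative y) (at x) \<and> 0 < y"
      using F[of x] by (auto intro!: exI[of _ "bump0 x"] simp: bump0_def flat_def)
  qed (use cont in auto)
  define c where "c = inverse (F 1 - F 0)"
  have c: "c > 0" using \<open>F 0 < F 1\<close> by (simp add: c_def)
  define S where "S x = c * (F x - F 0)" for x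
  have dS: "(S has_real_derivative c * bump0 x) (at x)" for x
    unfolding S_def by (auto intro!: derivative_eq_intros F)
  have "smooth S" using smooth_antiderivative[OF dS] smooth_cmult[OF smooth_bump0] by blast
  moreover have "deriv S x \<ge> 0" for x using DERIV_imp_deriv[OF dS[of x]] c bump0_nonneg[of x] by simp
  moreover have "S x = 0" if "x \<le> 0" for x using 0[OF that] by (simp add: S_def)
  moreover have "S x = 1" if "x \<ge> 1" for x using 1[OF that] \<open>F 0 < F 1\<close> by (simp add: S_def c_def)
  ultimately show ?thesis by blast
qed

definition step :: "real \<Rightarrow> real" where
  "step = (SOME S. smooth S \<and> (\<forall>x\<le>0. S x = 0) \<and> (\<forall>x\<ge>1. S x = 1) \<and> (\<forall>x. deriv S x \<ge> 0))"

lemma step_props: "smooth step" "x \<le> 0 \<Longrightarrow> step x = 0" "x \<ge> 1 \<Longrightarrow> step x = 1" "deriv step y \<ge> 0"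
  using someI_ex[OF exists_smooth_step] unfolding step_def[symmetric] by auto

lemma step_mono: "x \<le> y \<Longrightarrow> step x \<le> step y"
  by (metis DERIV_nonneg_imp_nondecreasing step_props(1,4) smooth_has_deriv)

lemma step_bounds: "0 \<le> step x" "step x \<le> 1"
  using step_mono[of "min x 0" x] step_mono[of x "max x 1"] by (auto simp: step_props)

text \<open>All profiles live on one fixed interval. Position and scale are added only in
  \<open>ker\<close>, so a bound on a profile is automatically uniform in both.\<close>

definition bump :: "(real \<Rightarrow> real) \<Rightarrow> bool" where
  "bump a \<longleftrightarrow> smooth a \<and> (\<forall>x. x \<notin> {0..1} \<longrightarrow> a x = 0)"

lemma deriv_eq_0_of_locally_0:
  fixes a :: "real \<Rightarrow> real"
  assumes "open U" "x \<in> U" "\<And>y. y \<in> U \<Longrightarrow> a y = c"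
  shows "deriv a x = 0"
proof -
  have "eventually (\<lambda>y. a y = c) (nhds x)" using assms eventually_nhds by blast
  then have "(a has_real_derivative 0) (at x)"
    by (subst DERIV_cong_ev[OF refl _ refl]) auto
  then show ?thesis by (rule DERIV_imp_deriv)
qed

lemma bump_deriv:
  assumes "bump a"
  shows "bump (deriv a)"
  unfolding bump_def
proof (intro conjI allI impI)
  show "smooth (deriv a)" using assms by (auto simp: bump_def smooth_deriv)
  fix x :: real assume "x \<notin> {0..1}"
  then show "deriv a x = 0" using assms
    by (intro deriv_eq_0_of_locally_0[of "- {0..1}" x a 0]) (auto simp: bump_def)
qed

lemma bump_bounded:
  assumes "bump a"
  obtains B where "B > 0" "\<And>x. \<bar>a x\<bar> \<le> B"
proof -
  have "compact (a ` {0..1})" using assms smooth_continuous_on by (intro compact_continuous_image) (auto simp: bump_def)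
  then obtain B where B: "B > 0" "\<forall>y\<in>a ` {0..1}. \<bar>y\<bar> \<le> B" by (metis bounded_pos compact_imp_bounded real_norm_def)
  have "\<bar>a x\<bar> \<le> B" for x using assms B by (cases "x \<in> {0..1}") (auto simp: bump_def)
  then show ?thesis using B that by blast
qed

text \<open>As the derivative of \<open>step\<close> this has integral 1 and an explicit
  antiderivative. The difference of two rescaled copies is then the derivative of a compactly
  supported profile, which is what allows integration by parts between different scales.\<close>

definition mol :: "real \<Rightarrow> real" where "mol = deriv step"

lemma mol_bump: "bump mol"
  unfolding bump_def mol_def
proof (intro conjI allI impI)
  show "smooth (deriv step)" by (simp add: smooth_deriv step_props)
  fix x :: real assume "x \<notin> {0..1}"
  then consider "x < 0" | "x > 1" by fastforce
  then show "deriv step x = 0"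
  proof cases
    case 1 then show ?thesis by (intro deriv_eq_0_of_locally_0[of "{..<0}" x step 0]) (auto simp: step_props)
  next
    case 2 then show ?thesis by (intro deriv_eq_0_of_locally_0[of "{1<..}" x step 1]) (auto simp: step_props)
  qed
qed

lemma mol_nonneg: "mol x \<ge> 0" by (simp add: mol_def step_props)

lemma step_deriv: "(step has_real_derivative mol x) (at x)"
  unfolding mol_def by (intro smooth_has_deriv step_props)


subsection \<open>Integration in the plane\<close>

definition pt :: "real \<Rightarrow> real \<Rightarrow> real^2" where "pt a b = vector [a, b]"

lemma pt_nth [simp]: "pt a b $ 1 = a" "pt a b $ 2 = b" by (simp_all add: pt_def)
lemma pt_eta [simp]: "pt (x $ 1) (x $ 2) = x" by (simp add: vec_eq_iff forall_2)
lemma pt_add_axis: "pt a b + t *\<^sub>R axis 1 1 = pt (a + t) b" "pt a b + t *\<^sub>R axis 2 1 = pt a (b + t)"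
  by (simp_all add: vec_eq_iff forall_2 axis_def)

lemma pt_eq_axis: "pt a b = a *\<^sub>R axis 1 1 + b *\<^sub>R axis 2 1"
  by (simp add: vec_eq_iff forall_2 axis_def)

lemma continuous_on_pt [continuous_intros]:
  "continuous_on A f \<Longrightarrow> continuous_on A g \<Longrightarrow> continuous_on A (\<lambda>x. pt (f x) (g x))"
  unfolding pt_eq_axis by (intro continuous_intros)

lemma measurable_pt2 [measurable (raw)]:
  assumes [measurable]: "f \<in> borel_measurable M" "g \<in> borel_measurable M"
  shows "(\<lambda>z. pt (f z) (g z)) \<in> borel_measurable M"
  unfolding pt_eq_axis by measurable

lemma Basis_real2: "(Basis :: (real^2) set) = {axis 1 1, axis 2 1}"
  by (auto simp: Basis_vec_def) (metis exhaust_2)+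

lemma axis_12_neq [simp]: "axis 1 (1::real) \<noteq> (axis 2 1 :: real^2)" "axis 2 (1::real) \<noteq> (axis 1 1 :: real^2)"
  by (simp_all add: axis_eq_axis)

lemma mem_box_real2:
  "x \<in> box a (b::real^2) \<longleftrightarrow> a$1 < x$1 \<and> x$1 < b$1 \<and> a$2 < x$2 \<and> x$2 < b$2"
  "x \<in> cbox a (b::real^2) \<longleftrightarrow> a$1 \<le> x$1 \<and> x$1 \<le> b$1 \<and> a$2 \<le> x$2 \<and> x$2 \<le> b$2"
  by (auto simp: mem_box_cart forall_2)

text \<open>Both measures give a box the product of its side lengths. As the image of a genuine
  product measure, Lebesgue measure on \<open>real^2\<close> inherits the theorems of Tonelli and
  Fubini in its coordinates, in either order.\<close>

lemma lborel_real2: "lborel = distr (lborel \<Otimes>\<^sub>M lborel) borel (\<lambda>z. pt (fst z) (snd z))"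
proof (rule lborel_eqI)
  fix l u :: "real^2" assume "\<And>b. b \<in> Basis \<Longrightarrow> l \<bullet> b \<le> u \<bullet> b"
  from this[of "axis 1 1"] this[of "axis 2 1"] have le: "l$1 \<le> u$1" "l$2 \<le> u$2"
    by (simp_all add: Basis_real2 inner_axis)
  have "emeasure (distr (lborel \<Otimes>\<^sub>M lborel) borel (\<lambda>z. pt (fst z) (snd z))) (box l u)
    = emeasure (lborel \<Otimes>\<^sub>M lborel) ({l$1<..<u$1} \<times> {l$2<..<u$2})"
  proof (subst emeasure_distr)
    show "(\<lambda>z. pt (fst z) (snd z)) \<in> lborel \<Otimes>\<^sub>M lborel \<rightarrow>\<^sub>M borel"
      by measurable
    have *: "(\<lambda>z. pt (fst z) (snd z)) -` box l u = {l$1<..<u$1} \<times> {l$2<..<u$2}"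
      by (auto simp: mem_box_real2)
    show "emeasure (lborel \<Otimes>\<^sub>M lborel) ((\<lambda>z. pt (fst z) (snd z)) -` box l u \<inter> space (lborel \<Otimes>\<^sub>M lborel)) =
      emeasure (lborel \<Otimes>\<^sub>M lborel) ({l$1<..<u$1} \<times> {l$2<..<u$2})"
      unfolding * by (simp add: space_pair_measure)
  qed simp
  also have "\<dots> = ennreal (u$1 - l$1) * ennreal (u$2 - l$2)"
    using le by (subst lborel.emeasure_pair_measure_Times) auto
  also have "\<dots> = (\<Prod>b\<in>Basis. (u - l) \<bullet> b)"
    using le by (simp add: Basis_real2 inner_axis ennreal_mult)
  finally show "emeasure (distr (lborel \<Otimes>\<^sub>M lborel) borel (\<lambda>z. pt (fst z) (snd z))) (box l u)
    = ennreal (\<Prod>b\<in>Basis. (u - l) \<bullet> b)" .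
qed simp

lemma nn_integral_real2:
  assumes [measurable]: "f \<in> borel_measurable (borel :: (real^2) measure)"
  shows "(\<integral>\<^sup>+x. f x \<partial>lborel) = (\<integral>\<^sup>+a. \<integral>\<^sup>+b. f (pt a b) \<partial>lborel \<partial>lborel)"
    and "(\<integral>\<^sup>+x. f x \<partial>lborel) = (\<integral>\<^sup>+b. \<integral>\<^sup>+a. f (pt a b) \<partial>lborel \<partial>lborel)"
proof -
  have *: "(\<integral>\<^sup>+x. f x \<partial>lborel) = (\<integral>\<^sup>+z. f (pt (fst z) (snd z)) \<partial>(lborel \<Otimes>\<^sub>M lborel))"
    by (subst lborel_real2, subst nn_integral_distr) simp_all
  show "(\<integral>\<^sup>+x. f x \<partial>lborel) = (\<integral>\<^sup>+a. \<integral>\<^sup>+b. f (pt a b) \<partial>lborel \<partial>lborel)"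
    unfolding * by (subst lborel.nn_integral_fst[symmetric]) simp_all
  show "(\<integral>\<^sup>+x. f x \<partial>lborel) = (\<integral>\<^sup>+b. \<integral>\<^sup>+a. f (pt a b) \<partial>lborel \<partial>lborel)"
    unfolding * using lborel_pair.nn_integral_snd[of "\<lambda>z. f (pt (fst z) (snd z))"] by simp
qed

lemma integral_real2:
  fixes f :: "real^2 \<Rightarrow> 'b::{banach, second_countable_topology}"
  assumes int: "integrable lborel f"
  shows "(LINT x|lborel. f x) = (LINT a|lborel. LINT b|lborel. f (pt a b))"
    and "(LINT x|lborel. f x) = (LINT b|lborel. LINT a|lborel. f (pt a b))"
proof -
  have [measurable]: "f \<in> borel_measurable borel" using int by auto
  have *: "(LINT x|lborel. f x) = (LINT z|(lborel \<Otimes>\<^sub>M lborel). f (pt (fst z) (snd z)))"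
    by (subst lborel_real2, subst integral_distr) simp_all
  have "integrable (distr (lborel \<Otimes>\<^sub>M lborel) borel (\<lambda>z. pt (fst z) (snd z))) f"
    using int by (simp add: lborel_real2[symmetric])
  then have i: "integrable (lborel \<Otimes>\<^sub>M lborel) (\<lambda>z. f (pt (fst z) (snd z)))"
    by (rule integrable_distr[rotated]) simp
  then have i': "integrable (lborel \<Otimes>\<^sub>M lborel) (\<lambda>(a, b). f (pt a b))" by (simp add: case_prod_beta')
  show "(LINT x|lborel. f x) = (LINT a|lborel. LINT b|lborel. f (pt a b))"
    unfolding * using lborel_pair.integral_fst[OF i'] by (simp add: case_prod_beta')
  show "(LINT x|lborel. f x) = (LINT b|lborel. LINT a|lborel. f (pt a b))"
    unfolding * using lborel_pair.integral_snd[OF i'] by (simp add: case_prod_beta')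
qed

text \<open>Differentiability along one coordinate line, with the value as an argument. This
  suffices for the fundamental theorem of calculus on lines, and it covers functions such as
  \<open>stream v\<close>, for which only the partial derivatives are computed.\<close>

definition has_pd :: "(real^2 \<Rightarrow> 'b::real_normed_vector) \<Rightarrow> 2 \<Rightarrow> 'b \<Rightarrow> real^2 \<Rightarrow> bool" where
  "has_pd f i D x \<longleftrightarrow> ((\<lambda>t. f (x + t *\<^sub>R axis i 1)) has_vector_derivative D) (at 0)"

lemma has_pd_line:
  assumes "has_pd f i D (x + t *\<^sub>R axis i 1)"
  shows "((\<lambda>s. f (x + s *\<^sub>R axis i 1)) has_vector_derivative D) (at t)"
proof -
  have "((\<lambda>s. f (x + t *\<^sub>R axis i 1 + s *\<^sub>R axis i 1)) has_vector_derivative D) (at (t - t))"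
    using assms unfolding has_pd_def by simp
  moreover have "((\<lambda>s. s - t) has_vector_derivative 1) (at t)" by (auto intro!: derivative_eq_intros)
  ultimately have "((\<lambda>s. f (x + t *\<^sub>R axis i 1 + s *\<^sub>R axis i 1)) \<circ> (\<lambda>s. s - t) has_vector_derivative 1 *\<^sub>R D) (at t)"
    by (rule vector_diff_chain_at[rotated])
  then show ?thesis by (simp add: o_def algebra_simps)
qed

lemma has_pd_pt1: "has_pd f 1 D (pt a b) \<Longrightarrow> ((\<lambda>s. f (pt s b)) has_vector_derivative D) (at a)"
  using has_pd_line[of f 1 D "pt 0 b" a] by (simp add: pt_add_axis)

lemma has_pd_pt2: "has_pd f 2 D (pt a b) \<Longrightarrow> ((\<lambda>s. f (pt a s)) has_vector_derivative D) (at b)"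
  using has_pd_line[of f 2 D "pt a 0" b] by (simp add: pt_add_axis)

lemma has_pd_iff_pt:
  "has_pd f 1 D (pt a b) \<longleftrightarrow> ((\<lambda>s. f (pt s b)) has_vector_derivative D) (at a)"
  "has_pd f 2 D (pt a b) \<longleftrightarrow> ((\<lambda>s. f (pt a s)) has_vector_derivative D) (at b)"
proof -
  have sh: "((\<lambda>t. g (c + t)) has_vector_derivative D) (at 0)" if "(g has_vector_derivative D) (at c)" for g :: "real \<Rightarrow> 'a" and c
  proof -
    have "(g has_vector_derivative D) (at (c + 0))" using that by simp
    moreover have "((\<lambda>t. c + t) has_vector_derivative 1) (at 0)" by (auto intro!: derivative_eq_intros)
    ultimately have "(g \<circ> (\<lambda>t. c + t) has_vector_derivative 1 *\<^sub>R D) (at 0)"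
      by (rule vector_diff_chain_at[rotated])
    then show ?thesis by (simp add: o_def)
  qed
  show "has_pd f 1 D (pt a b) \<longleftrightarrow> ((\<lambda>s. f (pt s b)) has_vector_derivative D) (at a)"
    using has_pd_pt1 sh[of "\<lambda>s. f (pt s b)" a] by (auto simp: has_pd_def pt_add_axis)
  show "has_pd f 2 D (pt a b) \<longleftrightarrow> ((\<lambda>s. f (pt a s)) has_vector_derivative D) (at b)"
    using has_pd_pt2 sh[of "\<lambda>s. f (pt a s)" b] by (auto simp: has_pd_def pt_add_axis)
qed

lemma has_pd_differentiable:
  assumes "(f has_derivative f') (at x)"
  shows "has_pd f i (f' (axis i 1)) x"
proof -
  have "(f has_derivative f') (at (x + 0 *\<^sub>R axis i 1))" using assms by simp
  moreover have "((\<lambda>t. x + t *\<^sub>R axis i 1) has_derivative (\<lambda>t. t *\<^sub>R axis i 1)) (at 0)"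
    by (auto intro!: derivative_eq_intros)
  ultimately have "(f \<circ> (\<lambda>t. x + t *\<^sub>R axis i 1) has_derivative f' \<circ> (\<lambda>t. t *\<^sub>R axis i 1)) (at 0)"
    by (rule diff_chain_at[rotated])
  moreover have "linear f'" using assms has_derivative_linear by blast
  ultimately show ?thesis
    by (simp add: has_pd_def has_vector_derivative_def o_def linear_scale)
qed

lemma has_pd_add: "has_pd f i D x \<Longrightarrow> has_pd g i E x \<Longrightarrow> has_pd (\<lambda>y. f y + g y) i (D + E) x"
  unfolding has_pd_def by (auto intro!: derivative_eq_intros)
lemma has_pd_diff: "has_pd f i D x \<Longrightarrow> has_pd g i E x \<Longrightarrow> has_pd (\<lambda>y. f y - g y) i (D - E) x"
  unfolding has_pd_def by (auto intro!: derivative_eq_intros)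
lemma has_pd_bilinear:
  assumes "bounded_bilinear bl" "has_pd f i D x" "has_pd g i E x"
  shows "has_pd (\<lambda>y. bl (f y) (g y)) i (bl (f x) E + bl D (g x)) x"
  using bounded_bilinear.has_vector_derivative[OF assms(1), of "\<lambda>t. f (x + t *\<^sub>R axis i 1)" D 0 UNIV "\<lambda>t. g (x + t *\<^sub>R axis i 1)" E]
    assms(2,3) unfolding has_pd_def by simp

lemmas has_pd_mult = has_pd_bilinear[OF bounded_bilinear_mult]
lemmas has_pd_scaleR = has_pd_bilinear[OF bounded_bilinear_scaleR]
lemmas has_pd_inner = has_pd_bilinear[OF bounded_bilinear_inner]

lemma has_pd_nth: "has_pd f i D x \<Longrightarrow> has_pd (\<lambda>y. f y $ j) i (D $ j) x"
  unfolding has_pd_def by (rule bounded_linear.has_vector_derivative[OF bounded_linear_vec_nth])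

lemma has_pd_coord:
  assumes "(a has_real_derivative D) (at (x $ j))"
  shows "has_pd (\<lambda>y. a (y $ j)) i (if i = j then D else 0) x"
proof (cases "i = j")
  case True
  have "((\<lambda>t. a (x $ j + t)) has_real_derivative D) (at 0)"
    using assms DERIV_at_within_shift[of a D "x $ j" 0 UNIV] by (simp add: add.commute)
  then show ?thesis using True
    by (simp add: has_pd_def axis_def has_real_derivative_iff_has_vector_derivative)
next
  case False
  then show ?thesis by (simp add: has_pd_def axis_def)
qed

text \<open>Integrate first in direction i: on each line the fundamental theorem gives the
  difference of \<open>f\<close> at two end points, which lie outside the open box, where
  \<open>f\<close> vanishes.\<close>

lemma integral_has_pd_compact_support:
  fixes f :: "real^2 \<Rightarrow> 'b::euclidean_space"
  assumes cont: "continuous_on (cbox a b) g"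
    and pd: "\<And>y. y \<in> cbox a b \<Longrightarrow> has_pd f i (g y) y"
    and zero: "\<And>y. y \<notin> box a b \<Longrightarrow> f y = 0"
  shows "(LINT y:cbox a b|lborel. g y) = 0"
proof -
  have int: "integrable lborel (\<lambda>y. indicator (cbox a b) y *\<^sub>R g y)"
    by (rule borel_integrable_compact) (use cont in auto)
  have ind: "indicator (cbox a b) (pt s t) = (indicator {a$1..b$1} s * indicator {a$2..b$2} t :: real)" for s t
    by (auto simp: indicator_def mem_box_real2)
  consider "i = 1" | "i = 2" using exhaust_2 by blast
  then show ?thesis
  proof cases
    case 1
    have "(LINT s|lborel. indicator (cbox a b) (pt s t) *\<^sub>R g (pt s t)) = 0" for t
    proof (cases "t \<in> {a$2..b$2} \<and> a$1 \<le> b$1")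
      case True
      have "(LINT s|lborel. indicator {a$1..b$1} s *\<^sub>R g (pt s t)) = f (pt (b$1) t) - f (pt (a$1) t)"
      proof (rule integral_FTC_Icc)
        fix s assume "a$1 \<le> s" "s \<le> b$1"
        then have "pt s t \<in> cbox a b" using True by (auto simp: mem_box_real2)
        then show "((\<lambda>s. f (pt s t)) has_vector_derivative g (pt s t)) (at s within {a$1..b$1})"
          using pd 1 has_pd_pt1 has_vector_derivative_at_within by blast
      next
        show "continuous_on {a$1..b$1} (\<lambda>s. g (pt s t))"
          by (rule continuous_on_compose2[OF cont]) (use True in \<open>auto intro!: continuous_intros simp: mem_box_real2\<close>)
      qed (use True in auto)
      also have "\<dots> = 0" by (subst (1 2) zero) (auto simp: mem_box_real2)
      finally show ?thesis using True by (simp add: ind)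
    qed (auto simp: ind)
    then show ?thesis unfolding set_lebesgue_integral_def by (subst integral_real2(2)[OF int]) simp
  next
    case 2
    have "(LINT t|lborel. indicator (cbox a b) (pt s t) *\<^sub>R g (pt s t)) = 0" for s
    proof (cases "s \<in> {a$1..b$1} \<and> a$2 \<le> b$2")
      case True
      have "(LINT t|lborel. indicator {a$2..b$2} t *\<^sub>R g (pt s t)) = f (pt s (b$2)) - f (pt s (a$2))"
      proof (rule integral_FTC_Icc)
        fix t assume "a$2 \<le> t" "t \<le> b$2"
        then have "pt s t \<in> cbox a b" using True by (auto simp: mem_box_real2)
        then show "((\<lambda>t. f (pt s t)) has_vector_derivative g (pt s t)) (at t within {a$2..b$2})"
          using pd 2 has_pd_pt2 has_vector_derivative_at_within by blast
      next
        show "continuous_on {a$2..b$2} (\<lambda>t. g (pt s t))"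
          by (rule continuous_on_compose2[OF cont]) (use True in \<open>auto intro!: continuous_intros simp: mem_box_real2\<close>)
      qed (use True in auto)
      also have "\<dots> = 0" by (subst (1 2) zero) (auto simp: mem_box_real2)
      finally show ?thesis using True by (simp add: ind)
    qed (auto simp: ind)
    then show ?thesis unfolding set_lebesgue_integral_def by (subst integral_real2(1)[OF int]) simp
  qed
qed


subsection \<open>The half plane and its test functions\<close>

lemma open_half_plane: "open \<H>"
  unfolding half_plane_def by (intro open_Collect_less continuous_intros)

lemma closure_half_plane: "closure \<H> = {x. x $ 2 \<ge> 0}"
proof
  have "closed {x :: real^2. x $ 2 \<ge> 0}" by (intro closed_Collect_le continuous_intros)
  then show "closure \<H> \<subseteq> {x. x $ 2 \<ge> 0}" by (intro closure_minimal) (auto simp: half_plane_def)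
  show "{x. x $ 2 \<ge> 0} \<subseteq> closure \<H>"
  proof
    fix x :: "real^2" assume x: "x \<in> {x. x $ 2 \<ge> 0}"
    have "(\<lambda>n. x + inverse (real (Suc n)) *\<^sub>R axis 2 1) \<longlonglongrightarrow> x + 0 *\<^sub>R axis 2 1"
      by (intro tendsto_intros LIMSEQ_inverse_real_of_nat)
    moreover have "x + inverse (real (Suc n)) *\<^sub>R axis 2 1 \<in> \<H>" for n
      using x by (simp add: half_plane_def axis_def add_nonneg_pos)
    ultimately show "x \<in> closure \<H>"
      by (auto simp: closure_sequential intro!: exI[of _ "\<lambda>n. x + inverse (real (Suc n)) *\<^sub>R axis 2 1"])
  qed
qed

lemma frontier_half_plane: "frontier \<H> = {x. x $ 2 = 0}"
  unfolding frontier_def closure_half_plane interior_open[OF open_half_plane] by (auto simp: half_plane_def)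

lemma boundary_point_eq: "boundary_point a = pt a 0" by (simp add: boundary_point_def pt_def)

lemma half_plane_subset_closure: "\<H> \<subseteq> closure \<H>" by (rule closure_subset)

lemma at_within_closure_half_plane: "x \<in> \<H> \<Longrightarrow> at x within closure \<H> = at x"
  using at_within_interior[of x "closure \<H>"] interior_maximal[OF closure_subset open_half_plane] by blast

lemma partial_H_has_pd:
  assumes "f differentiable (at x within A)" "x \<in> \<H>" "\<H> \<subseteq> A"
  shows "has_pd f i (partial_H i f x) x"
proof -
  have "at x within A = at x" using assms(2)
    at_within_interior[of x A] interior_maximal[OF assms(3) open_half_plane] by blast
  then have "(f has_derivative frechet_derivative f (at x)) (at x)"
    using assms(1) by (simp add: frechet_derivative_works)
  then show ?thesis using has_pd_differentiable[of f _ x i] assms(2)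
    by (simp add: partial_deriv_def at_within_closure_half_plane)
qed

text \<open>Products of functions of one variable are closed under partial differentiation, so
  smoothness in the plane reduces to smoothness on the line. The mollification kernels and the
  cutoffs are all of this form.\<close>

definition tp :: "(real \<Rightarrow> real) \<Rightarrow> (real \<Rightarrow> real) \<Rightarrow> real^2 \<Rightarrow> real" where
  "tp \<alpha> \<beta> y = \<alpha> (y $ 1) * \<beta> (y $ 2)"

lemma tp_has_derivative:
  assumes "smooth \<alpha>" "smooth \<beta>"
  shows "(tp \<alpha> \<beta> has_derivative (\<lambda>h. deriv \<alpha> (x$1) * h$1 * \<beta> (x$2) + \<alpha> (x$1) * (deriv \<beta> (x$2) * h$2))) (at x)"
proof -
  have c: "((\<lambda>y. y $ j) has_derivative (\<lambda>h. h $ j)) (at x)" for j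
    by (intro bounded_linear_imp_has_derivative bounded_linear_vec_nth)
  have "((\<lambda>y. \<gamma> (y $ j)) has_derivative (\<lambda>h. deriv \<gamma> (x $ j) * (h $ j))) (at x)" if "smooth \<gamma>" for \<gamma> j
  proof -
    have "(\<gamma> has_derivative (*) (deriv \<gamma> (x $ j))) (at (x $ j))"
      using smooth_has_deriv[OF that] by (simp add: has_field_derivative_def)
    from has_derivative_compose[OF c this] show ?thesis .
  qed
  from has_derivative_mult[OF this[OF assms(1), of 1] this[OF assms(2), of 2]]
  show ?thesis unfolding tp_def by (simp add: add.commute)
qed

lemma tp_continuous_on: "smooth \<alpha> \<Longrightarrow> smooth \<beta> \<Longrightarrow> continuous_on A (tp \<alpha> \<beta>)"
  using has_derivative_continuous[OF tp_has_derivative] by (intro continuous_at_imp_continuous_on) auto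

lemma tp_partial:
  assumes "smooth \<alpha>" "smooth \<beta>"
  shows "partial_deriv UNIV i (tp \<alpha> \<beta>) = (if i = 1 then tp (deriv \<alpha>) \<beta> else tp \<alpha> (deriv \<beta>))"
proof
  fix x
  have "partial_deriv UNIV i (tp \<alpha> \<beta>) x = deriv \<alpha> (x$1) * axis i 1$1 * \<beta> (x$2) + \<alpha> (x$1) * (deriv \<beta> (x$2) * axis i 1$2)"
    unfolding partial_deriv_def by (simp add: frechet_derivative_at[OF tp_has_derivative[OF assms], symmetric])
  then show "partial_deriv UNIV i (tp \<alpha> \<beta>) x = (if i = 1 then tp (deriv \<alpha>) \<beta> else tp \<alpha> (deriv \<beta>)) x"
    using exhaust_2[of i] by (auto simp: tp_def axis_def)
qed

lemma tp_iter_partial: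
  assumes "smooth \<alpha>" "smooth \<beta>"
  shows "\<exists>\<alpha>' \<beta>'. smooth \<alpha>' \<and> smooth \<beta>' \<and> iter_partial is (tp \<alpha> \<beta>) = tp \<alpha>' \<beta>'"
proof (induction "is")
  case Nil then show ?case using assms by (auto simp: iter_partial_def)
next
  case (Cons i "is")
  then obtain \<alpha>' \<beta>' where "smooth \<alpha>'" "smooth \<beta>'" "iter_partial is (tp \<alpha> \<beta>) = tp \<alpha>' \<beta>'" by blast
  then have "iter_partial (i # is) (tp \<alpha> \<beta>) = (if i = 1 then tp (deriv \<alpha>') \<beta>' else tp \<alpha>' (deriv \<beta>'))"
    by (simp add: iter_partial_def tp_partial)
  then show ?case using smooth_deriv \<open>smooth \<alpha>'\<close> \<open>smooth \<beta>'\<close> by (cases "i = 1") auto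
qed

lemma tp_test_function:
  assumes "smooth \<alpha>" "smooth \<beta>" "\<And>x. x \<notin> {a..b} \<Longrightarrow> \<alpha> x = 0" "\<And>x. x \<notin> {c..d} \<Longrightarrow> \<beta> x = 0" "c > 0"
  shows "test_function \<H> (tp \<alpha> \<beta>)"
proof -
  have "{x. tp \<alpha> \<beta> x \<noteq> 0} \<subseteq> cbox (pt a c) (pt b d)"
    using assms(3,4) by (force simp: tp_def mem_box_real2)
  then have "closure {x. tp \<alpha> \<beta> x \<noteq> 0} \<subseteq> cbox (pt a c) (pt b d)" by (intro closure_minimal) auto
  moreover have "cbox (pt a c) (pt b d) \<subseteq> \<H>" using assms(5) by (auto simp: mem_box_real2 half_plane_def)
  moreover have "iter_partial is (tp \<alpha> \<beta>) differentiable_on UNIV" for "is"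
    using tp_iter_partial[OF assms(1,2), of "is"] differentiableI[OF tp_has_derivative]
    by (auto simp: differentiable_on_def)
  ultimately show ?thesis unfolding test_function_def
    using bounded_subset[OF bounded_cbox] by (auto simp: compact_eq_bounded_closed)
qed

text \<open>The definitions integrate against completed Lebesgue measure on the half plane, whereas
  Fubini and the fundamental theorem are used for \<open>lborel\<close>. For integrands that are
  continuous on a box and zero elsewhere the two agree.\<close>

lemma lebesgue_on_integral_compact:
  fixes F :: "real^2 \<Rightarrow> 'b::euclidean_space"
  assumes "continuous_on (cbox a b) F" "\<And>x. x \<notin> cbox a b \<Longrightarrow> F x = 0" "cbox a b \<subseteq> \<H>"
  shows "(LINT x|lebesgue_on \<H>. F x) = (LINT x:cbox a b|lborel. F x)" "integrable (lebesgue_on \<H>) F"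
proof -
  have meas: "(\<lambda>x. indicator (cbox a b) x *\<^sub>R F x) \<in> borel_measurable borel"
    by (rule borel_measurable_continuous_on_indicator) (use assms in auto)
  have H: "\<H> \<inter> space lebesgue \<in> sets lebesgue"
    using open_half_plane by (simp add: borel_open sets_completionI_sets)
  have eq: "indicator \<H> x *\<^sub>R F x = indicator (cbox a b) x *\<^sub>R F x" for x
    using assms(2,3) by (auto simp: indicator_def)
  have "(LINT x|lebesgue_on \<H>. F x) = (LINT x|lebesgue. indicator \<H> x *\<^sub>R F x)"
    by (rule integral_restrict_space[OF H])
  also have "\<dots> = (LINT x:cbox a b|lborel. F x)"
    unfolding eq set_lebesgue_integral_def by (rule integral_completion) (use meas in simp)
  finally show "(LINT x|lebesgue_on \<H>. F x) = (LINT x:cbox a b|lborel. F x)" .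
  have "integrable lebesgue (\<lambda>x. indicator \<H> x *\<^sub>R F x)"
    unfolding eq using borel_integrable_compact[OF compact_cbox assms(1)] meas
    by (subst integrable_completion) auto
  then show "integrable (lebesgue_on \<H>) F"
    by (subst integrable_restrict_space[OF H])
qed

definition C1_half_plane :: "(real^2 \<Rightarrow> 'b::euclidean_space) \<Rightarrow> bool" where
  "C1_half_plane f \<longleftrightarrow> f differentiable_on \<H> \<and> (\<forall>i. continuous_on \<H> (partial_H i f))"

lemma C1_half_planeD:
  assumes "C1_half_plane f"
  shows "continuous_on \<H> f" "continuous_on \<H> (partial_H i f)" "x \<in> \<H> \<Longrightarrow> has_pd f i (partial_H i f x) x"
  using assms by (auto simp: C1_half_plane_def differentiable_imp_continuous_on differentiable_on_def 
      intro!: partial_H_has_pd[of _ _ \<H>])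

text \<open>The two integrands add up to a partial derivative of the product of
  \<open>tp \<alpha> \<beta>\<close> and \<open>f\<close>, which has compact support. The derivative
  \<open>D\<close> is kept general, since the rule is also applied to expressions whose derivatives
  are known only through \<open>has_pd\<close>.\<close>

lemma tp_ibp_pd:
  fixes f D :: "real^2 \<Rightarrow> 'b::euclidean_space"
  assumes sm: "smooth \<alpha>" "smooth \<beta>" and z: "\<And>x. x \<notin> {a..b} \<Longrightarrow> \<alpha> x = 0" "\<And>x. x \<notin> {c..d} \<Longrightarrow> \<beta> x = 0"
    and c: "c > 0" and f: "continuous_on \<H> f" "continuous_on \<H> D" "\<And>x. x \<in> \<H> \<Longrightarrow> has_pd f i (D x) x"
  shows "(LINT x|lebesgue_on \<H>. partial_deriv UNIV i (tp \<alpha> \<beta>) x *\<^sub>R f x) =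
      - (LINT x|lebesgue_on \<H>. tp \<alpha> \<beta> x *\<^sub>R D x)"
proof -
  \<comment> \<open>The margin around the support makes the product vanish outside the open box, and
    the lower edge c / 2 keeps the box inside the half plane.\<close>
  let ?B = "cbox (pt (a - 1) (c / 2)) (pt (b + 1) (d + 1))"
  have BH: "?B \<subseteq> \<H>" using c by (auto simp: mem_box_real2 half_plane_def)
  have zp: "tp \<alpha> \<beta> x = 0" if "x \<notin> box (pt (a - 1) (c / 2)) (pt (b + 1) (d + 1))" for x
  proof -
    have "x$1 \<notin> {a..b} \<or> x$2 \<notin> {c..d}" using that c by (auto simp: mem_box_real2)
    then show ?thesis using z by (auto simp: tp_def)
  qed
  have "\<exists>\<alpha>' \<beta>'. smooth \<alpha>' \<and> smooth \<beta>' \<and> partial_deriv UNIV i (tp \<alpha> \<beta>) = tp \<alpha>' \<beta>'"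
    using tp_iter_partial[OF sm, of "[i]"] by (simp add: iter_partial_def)
  then have contp: "continuous_on A (partial_deriv UNIV i (tp \<alpha> \<beta>))" for A
    using tp_continuous_on by auto
  have cont: "continuous_on A (tp \<alpha> \<beta>)" for A
    by (rule tp_continuous_on[OF sm])
  have zd: "partial_deriv UNIV i (tp \<alpha> \<beta>) x = 0" if "x \<notin> ?B" for x
  proof -
    have "deriv \<alpha> s = 0" if "s \<notin> {a..b}" for s
      using deriv_eq_0_of_locally_0[of "- {a..b}" s \<alpha> 0] that z by auto
    moreover have "deriv \<beta> s = 0" if "s \<notin> {c..d}" for s
      using deriv_eq_0_of_locally_0[of "- {c..d}" s \<beta> 0] that z by auto
    moreover have "x$1 \<notin> {a..b} \<or> x$2 \<notin> {c..d}" using that c by (auto simp: mem_box_real2)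
    ultimately show ?thesis using z by (auto simp: tp_partial[OF sm] tp_def)
  qed
  have pd: "has_pd (tp \<alpha> \<beta>) i (partial_deriv UNIV i (tp \<alpha> \<beta>) x) x" for x
    using has_pd_differentiable[OF tp_has_derivative[OF sm, of x], of i]
    unfolding partial_deriv_def by (simp add: frechet_derivative_at[OF tp_has_derivative[OF sm], symmetric])
  have c1: "continuous_on ?B (\<lambda>x. partial_deriv UNIV i (tp \<alpha> \<beta>) x *\<^sub>R f x)"
    and c2: "continuous_on ?B (\<lambda>x. tp \<alpha> \<beta> x *\<^sub>R D x)"
    by (auto intro!: continuous_intros contp cont continuous_on_subset[OF _ BH] f)
  have zp': "tp \<alpha> \<beta> x = 0" if "x \<notin> ?B" for x
    using zp that box_subset_cbox by blast
  have "(LINT x:?B|lborel. tp \<alpha> \<beta> x *\<^sub>R D x + partial_deriv UNIV i (tp \<alpha> \<beta>) x *\<^sub>R f x) = 0"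
  proof (rule integral_has_pd_compact_support)
    show "has_pd (\<lambda>x. tp \<alpha> \<beta> x *\<^sub>R f x) i (tp \<alpha> \<beta> y *\<^sub>R D y + partial_deriv UNIV i (tp \<alpha> \<beta>) y *\<^sub>R f y) y"
      if "y \<in> ?B" for y
      by (rule has_pd_scaleR[OF pd f(3)]) (use that BH in auto)
  qed (use c1 c2 zp in \<open>auto intro!: continuous_intros\<close>)
  moreover have "set_integrable lborel ?B (\<lambda>x. tp \<alpha> \<beta> x *\<^sub>R D x)"
    "set_integrable lborel ?B (\<lambda>x. partial_deriv UNIV i (tp \<alpha> \<beta>) x *\<^sub>R f x)"
    unfolding set_integrable_def by (intro borel_integrable_compact c1 c2 compact_cbox)+
  ultimately have "(LINT x:?B|lborel. tp \<alpha> \<beta> x *\<^sub>R D x) + (LINT x:?B|lborel. partial_deriv UNIV i (tp \<alpha> \<beta>) x *\<^sub>R f x) = 0"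
    by (simp add: set_integral_add)
  then show ?thesis
    using lebesgue_on_integral_compact(1)[OF c1 _ BH] lebesgue_on_integral_compact(1)[OF c2 _ BH] zd zp'
    by (simp add: eq_neg_iff_add_eq_0 add.commute)
qed

lemma tp_ibp:
  fixes f :: "real^2 \<Rightarrow> 'b::euclidean_space"
  assumes "smooth \<alpha>" "smooth \<beta>" "\<And>x. x \<notin> {a..b} \<Longrightarrow> \<alpha> x = 0" "\<And>x. x \<notin> {c..d} \<Longrightarrow> \<beta> x = 0"
    and "c > 0" and f: "C1_half_plane f"
  shows "(LINT x|lebesgue_on \<H>. partial_deriv UNIV i (tp \<alpha> \<beta>) x *\<^sub>R f x) =
      - (LINT x|lebesgue_on \<H>. tp \<alpha> \<beta> x *\<^sub>R partial_H i f x)"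
  using assms(1-5) C1_half_planeD[OF f] by (rule tp_ibp_pd)

lemma tp_integrable:
  fixes f :: "real^2 \<Rightarrow> 'b::euclidean_space"
  assumes "smooth \<alpha>" "smooth \<beta>" "\<And>x. x \<notin> {a..b} \<Longrightarrow> \<alpha> x = 0" "\<And>x. x \<notin> {c..d} \<Longrightarrow> \<beta> x = 0"
    and "c > 0" and "continuous_on \<H> f"
  shows "integrable (lebesgue_on \<H>) (\<lambda>x. tp \<alpha> \<beta> x *\<^sub>R f x)"
proof (rule lebesgue_on_integral_compact(2))
  show sub: "cbox (pt a c) (pt b d) \<subseteq> \<H>" using assms(5) by (auto simp: mem_box_real2 half_plane_def)
  show "continuous_on (cbox (pt a c) (pt b d)) (\<lambda>x. tp \<alpha> \<beta> x *\<^sub>R f x)"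
    by (intro continuous_intros tp_continuous_on assms continuous_on_subset[OF assms(6) sub])
  show "tp \<alpha> \<beta> x *\<^sub>R f x = 0" if "x \<notin> cbox (pt a c) (pt b d)" for x
    using that assms(3)[of "x$1"] assms(4)[of "x$2"] by (auto simp: mem_box_real2 tp_def)
qed

text \<open>The head of the list is the outermost derivative of the test function and is moved onto
  \<open>f\<close> by parts, which also absorbs one sign. So the weak derivatives of
  \<open>f\<close> up to order k supply those of \<open>partial_H i f\<close> up to order k - 1,
  whichever representatives were chosen.\<close>

lemma weak_derivative_pairing:
  fixes f :: "real^2 \<Rightarrow> 'b::euclidean_space"
  assumes sm: "smooth \<alpha>" "smooth \<beta>" and z: "\<And>x. x \<notin> {a..b} \<Longrightarrow> \<alpha> x = 0" "\<And>x. x \<notin> {c..d} \<Longrightarrow> \<beta> x = 0"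
    and c: "c > 0" and f: "C1_half_plane f" and h: "has_weak_derivative \<H> (i # is) f h"
  shows "(LINT x|lebesgue_on \<H>. iter_partial is (tp \<alpha> \<beta>) x *\<^sub>R partial_H i f x) =
     (-1) ^ length is *\<^sub>R (LINT x|lebesgue_on \<H>. tp \<alpha> \<beta> x *\<^sub>R h x)"
proof -
  have "\<exists>\<alpha>' \<beta>'. smooth \<alpha>' \<and> smooth \<beta>' \<and> (\<forall>x. x \<notin> {a..b} \<longrightarrow> \<alpha>' x = 0) \<and> (\<forall>x. x \<notin> {c..d} \<longrightarrow> \<beta>' x = 0)
      \<and> iter_partial is (tp \<alpha> \<beta>) = tp \<alpha>' \<beta>'"
  proof (induction "is")
    case Nil then show ?case using sm z by (auto simp: iter_partial_def)
  next
    case (Cons i "is")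
    then obtain \<alpha>' \<beta>' where ab: "smooth \<alpha>'" "smooth \<beta>'" "\<forall>x. x \<notin> {a..b} \<longrightarrow> \<alpha>' x = 0" 
      "\<forall>x. x \<notin> {c..d} \<longrightarrow> \<beta>' x = 0" "iter_partial is (tp \<alpha> \<beta>) = tp \<alpha>' \<beta>'" by blast
    have "deriv \<alpha>' s = 0" if "s \<notin> {a..b}" for s
      using deriv_eq_0_of_locally_0[of "- {a..b}" s \<alpha>' 0] that ab by auto
    moreover have "deriv \<beta>' s = 0" if "s \<notin> {c..d}" for s
      using deriv_eq_0_of_locally_0[of "- {c..d}" s \<beta>' 0] that ab by auto
    moreover have "iter_partial (i # is) (tp \<alpha> \<beta>) = (if i = 1 then tp (deriv \<alpha>') \<beta>' else tp \<alpha>' (deriv \<beta>'))"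
      using ab by (simp add: iter_partial_def tp_partial)
    ultimately show ?case using ab smooth_deriv[of \<alpha>'] smooth_deriv[of \<beta>']
      by (intro exI[of _ "if i = 1 then deriv \<alpha>' else \<alpha>'"] exI[of _ "if i = 1 then \<beta>' else deriv \<beta>'"]) auto
  qed
  then obtain \<alpha>' \<beta>' where ab: "smooth \<alpha>'" "smooth \<beta>'" "\<And>x. x \<notin> {a..b} \<Longrightarrow> \<alpha>' x = 0" 
      "\<And>x. x \<notin> {c..d} \<Longrightarrow> \<beta>' x = 0" "iter_partial is (tp \<alpha> \<beta>) = tp \<alpha>' \<beta>'" by blast
  have "(LINT x|lebesgue_on \<H>. iter_partial (i # is) (tp \<alpha> \<beta>) x *\<^sub>R f x) =
     (-1) ^ length (i # is) *\<^sub>R (LINT x|lebesgue_on \<H>. tp \<alpha> \<beta> x *\<^sub>R h x)"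
    using h tp_test_function[OF sm z c] unfolding has_weak_derivative_def by blast
  moreover have "iter_partial (i # is) (tp \<alpha> \<beta>) = partial_deriv UNIV i (tp \<alpha>' \<beta>')"
    using ab(5) by (simp add: iter_partial_def)
  ultimately show ?thesis using tp_ibp[OF ab(1-4) c f, where i = i] ab(5) by simp
qed


subsection \<open>Mollification kernels\<close>

abbreviation HH :: "(real^2) measure" where "HH \<equiv> lebesgue_on \<H>"

lemma sigma_finite_HH: "sigma_finite_measure HH"
proof (rule sigma_finite_measure_restrict_space)
  show "sigma_finite_measure (lebesgue :: (real^2) measure)"
  proof
    obtain A :: "(real^2) set set" where "countable A" "A \<subseteq> sets lborel" "\<Union>A = space lborel" "\<forall>a\<in>A. emeasure lborel a \<noteq> \<infinity>"
      using lborel.sigma_finite_countable by blast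
    then show "\<exists>A::(real^2) set set. countable A \<and> A \<subseteq> sets lebesgue \<and> \<Union>A = space lebesgue \<and> (\<forall>a\<in>A. emeasure lebesgue a \<noteq> \<infinity>)"
      by (intro exI[of _ A]) (auto simp: subset_eq)
  qed
  show "\<H> \<in> sets lebesgue" using open_half_plane by (simp add: borel_open sets_completionI_sets)
qed

interpretation HH: sigma_finite_measure HH by (rule sigma_finite_HH)
interpretation HHp: pair_sigma_finite HH HH ..

lemma space_HH [simp]: "space HH = \<H>" by (simp add: space_restrict_space)

lemma half_plane_borel [measurable]: "\<H> \<in> sets borel" using open_half_plane by (rule borel_open)

lemma half_plane_lebesgue: "\<H> \<inter> space lebesgue \<in> sets lebesgue"
  using half_plane_borel by (simp add: sets_completionI_sets)

lemma measurable_HH_borel: "f \<in> borel_measurable borel \<Longrightarrow> f \<in> borel_measurable HH"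
  by (intro measurable_restrict_space1 measurable_completion) simp

lemma measurable_HH_id [measurable]: "(\<lambda>x. x) \<in> HH \<rightarrow>\<^sub>M borel"
  by (rule measurable_HH_borel) simp

lemma continuous_measurable_HH:
  fixes f :: "real^2 \<Rightarrow> 'b::euclidean_space"
  assumes "continuous_on \<H> f"
  shows "f \<in> borel_measurable HH"
proof -
  have "(\<lambda>x. indicator \<H> x *\<^sub>R f x) \<in> borel_measurable borel"
    by (rule borel_measurable_continuous_on_indicator) (use assms in auto)
  then have "(\<lambda>x. indicator \<H> x *\<^sub>R f x) \<in> borel_measurable HH" by (rule measurable_HH_borel)
  then show ?thesis by (rule measurable_cong[THEN iffD1, rotated]) auto
qed

lemma nn_integral_HH:
  assumes [measurable]: "f \<in> borel_measurable borel"
  shows "(\<integral>\<^sup>+x. f x \<partial>HH) = (\<integral>\<^sup>+x. f x * indicator \<H> x \<partial>lborel)"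
  by (subst nn_integral_restrict_space[OF half_plane_lebesgue]) (simp add: nn_integral_completion)

lemma mol_measurable [measurable]: "mol \<in> borel_measurable borel"
  using mol_bump smooth_continuous_on by (intro borel_measurable_continuous_onI) (auto simp: bump_def)

lemma nn_integral_mol: "(\<integral>\<^sup>+s. ennreal (mol s) \<partial>lborel) = 1"
proof -
  have "(\<integral>\<^sup>+s. ennreal (mol s) \<partial>lborel) = (\<integral>\<^sup>+s. ennreal (mol s) * indicator {0..} s \<partial>lborel)"
    using mol_bump by (intro nn_integral_cong) (auto simp: bump_def indicator_def)
  also have "\<dots> = ennreal (1 - step 0)"
  proof (rule nn_integral_FTC_atLeast)
    show "(step \<longlongrightarrow> 1) at_top"
      by (rule Lim_transform_eventually[OF tendsto_const], rule eventually_mono[OF eventually_ge_at_top[of 1]])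
        (simp add: step_props)
  qed (auto simp: step_deriv mol_nonneg)
  finally show ?thesis by (simp add: step_props)
qed

lemma nn_integral_mol_affine:
  assumes "c \<noteq> 0" shows "(\<integral>\<^sup>+s. ennreal (mol (d + c * s)) \<partial>lborel) = ennreal (1 / \<bar>c\<bar>)"
proof -
  have "1 = ennreal \<bar>c\<bar> * (\<integral>\<^sup>+s. ennreal (mol (d + c * s)) \<partial>lborel)"
    using nn_integral_real_affine[of "\<lambda>s. ennreal (mol s)" c d] assms by (simp add: nn_integral_mol)
  then have "ennreal (1 / \<bar>c\<bar>) * 1 = (ennreal (1 / \<bar>c\<bar>) * ennreal \<bar>c\<bar>) * (\<integral>\<^sup>+s. ennreal (mol (d + c * s)) \<partial>lborel)"
    by (simp add: mult.assoc)
  also have "ennreal (1 / \<bar>c\<bar>) * ennreal \<bar>c\<bar> = 1" using assms by (simp add: ennreal_mult[symmetric])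
  finally show ?thesis by simp
qed

text \<open>The kernels at \<open>x\<close> are supported in the square \<open>x + [0,r]\<^sup>2\<close>, which lies in the half plane
  whenever \<open>x\<close> does; so they are admissible test functions up to the boundary and no extension
  operator is needed.\<close>

definition ker :: "(real \<Rightarrow> real) \<Rightarrow> (real \<Rightarrow> real) \<Rightarrow> real \<Rightarrow> real^2 \<Rightarrow> real^2 \<Rightarrow> real" where
  "ker \<alpha> \<beta> r x = tp (\<lambda>s. \<alpha> ((1/r) * s + (- (x$1) / r))) (\<lambda>s. \<beta> ((1/r) * s + (- (x$2) / r)))"

lemma ker_eq: "ker \<alpha> \<beta> r x y = \<alpha> ((y$1 - x$1) / r) * \<beta> ((y$2 - x$2) / r)"
  by (simp add: ker_def tp_def diff_divide_distrib)

definition Q :: "real \<Rightarrow> real^2 \<Rightarrow> (real^2) set" where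
  "Q r x = cbox x (pt (x$1 + r) (x$2 + r))"

lemma Q_subset: "x \<in> \<H> \<Longrightarrow> Q r x \<subseteq> \<H>"
  by (auto simp: Q_def mem_box_real2 half_plane_def)

lemma ker_zero:
  assumes "bump \<alpha>" "bump \<beta>" "r > 0" "y \<notin> Q r x"
  shows "ker \<alpha> \<beta> r x y = 0"
proof -
  have "(y$1 - x$1) / r \<notin> {0..1} \<or> (y$2 - x$2) / r \<notin> {0..1}"
    using assms(3,4) by (auto simp: Q_def mem_box_real2 field_simps)
  then show ?thesis using assms(1,2) by (auto simp: ker_eq bump_def)
qed

lemma ker_smooth:
  assumes "bump \<alpha>"
  shows "smooth (\<lambda>s. \<alpha> ((1/r) * s + d))"
  using assms smooth_affine by (simp only: bump_def)

lemma ker_supp: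
  assumes "bump \<alpha>" "r > 0" "s \<notin> {a..a + r}" shows "\<alpha> ((1/r) * s + (- a / r)) = 0"
proof -
  have "(1/r) * s + (- a / r) \<notin> {0..1}" using assms(2,3) by (auto simp: field_simps)
  then show ?thesis using assms(1) by (auto simp: bump_def)
qed

lemma ker_continuous: "bump \<alpha> \<Longrightarrow> bump \<beta> \<Longrightarrow> continuous_on A (ker \<alpha> \<beta> r x)"
  unfolding ker_def by (intro tp_continuous_on ker_smooth)

lemma ker_measurable2 [measurable]:
  assumes "bump \<alpha>" "bump \<beta>"
  shows "(\<lambda>(x, y). ker \<alpha> \<beta> r x y) \<in> borel_measurable (borel \<Otimes>\<^sub>M borel)"
proof -
  have [measurable]: "\<alpha> \<in> borel_measurable borel" "\<beta> \<in> borel_measurable borel"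
    using assms smooth_continuous_on by (auto simp: bump_def intro!: borel_measurable_continuous_onI)
  have [measurable]: "(\<lambda>x::real^2. x $ i) \<in> borel_measurable borel" for i
    by (intro borel_measurable_continuous_onI continuous_intros)
  show ?thesis unfolding ker_eq by measurable
qed

lemma ker_measurable_HH2: 
  assumes "bump \<alpha>" "bump \<beta>"
  shows "(\<lambda>(x, y). ker \<alpha> \<beta> r x y) \<in> borel_measurable (HH \<Otimes>\<^sub>M HH)"
proof -
  have "(\<lambda>z. (fst z, snd z)) \<in> HH \<Otimes>\<^sub>M HH \<rightarrow>\<^sub>M borel \<Otimes>\<^sub>M borel"
    by (intro measurable_Pair measurable_compose[OF measurable_fst measurable_HH_id] 
      measurable_compose[OF measurable_snd measurable_HH_id])
  from measurable_compose[OF this ker_measurable2[OF assms]] show ?thesis by (simp add: case_prod_beta')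
qed

lemma ker_measurable [measurable]:
  assumes "bump \<alpha>" "bump \<beta>"
  shows "ker \<alpha> \<beta> r x \<in> borel_measurable borel" "ker \<alpha> \<beta> r x \<in> borel_measurable HH"
  using ker_continuous[OF assms] by (auto intro!: measurable_HH_borel borel_measurable_continuous_onI)

lemma ker_bounded:
  assumes "bump \<alpha>" "bump \<beta>"
  obtains B where "B > 0" "\<And>r x y. \<bar>ker \<alpha> \<beta> r x y\<bar> \<le> B"
proof -
  obtain A where A: "A > 0" "\<And>x. \<bar>\<alpha> x\<bar> \<le> A" using bump_bounded[OF assms(1)] by blast
  obtain C where C: "C > 0" "\<And>x. \<bar>\<beta> x\<bar> \<le> C" using bump_bounded[OF assms(2)] by blast
  have "\<bar>ker \<alpha> \<beta> r x y\<bar> \<le> A * C" for r x y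
    unfolding ker_eq abs_mult by (intro mult_mono A C) (use A in auto)
  then show ?thesis using A C by (intro that[of "A * C"]) auto
qed

lemma nn_integral_ker_mol:
  assumes "r > 0"
  shows "(\<integral>\<^sup>+y. ennreal (ker mol mol r x y) \<partial>lborel) = ennreal (r\<^sup>2)"
    and "(\<integral>\<^sup>+x. ennreal (ker mol mol r x y) \<partial>lborel) = ennreal (r\<^sup>2)"
proof -
  have 1: "(\<integral>\<^sup>+s. ennreal (mol ((s - a) / r)) \<partial>lborel) = ennreal r" for a
    using nn_integral_mol_affine[of "1/r" "- a / r"] assms by (simp add: diff_divide_distrib)
  have 2: "(\<integral>\<^sup>+s. ennreal (mol ((a - s) / r)) \<partial>lborel) = ennreal r" for a
    using nn_integral_mol_affine[of "-1/r" "a / r"] assms by (simp add: diff_divide_distrib)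
  show "(\<integral>\<^sup>+y. ennreal (ker mol mol r x y) \<partial>lborel) = ennreal (r\<^sup>2)"
    using assms by (subst nn_integral_real2(1)) (simp_all add: ker_eq ennreal_mult mol_nonneg nn_integral_cmult nn_integral_multc 1 power2_eq_square)
  show "(\<integral>\<^sup>+x. ennreal (ker mol mol r x y) \<partial>lborel) = ennreal (r\<^sup>2)"
    using assms by (subst nn_integral_real2(1)) (simp_all add: ker_eq ennreal_mult mol_nonneg nn_integral_cmult nn_integral_multc 2 power2_eq_square)
qed

lemma ker_mol_nonneg: "ker mol mol r x y \<ge> 0" by (simp add: ker_eq mol_nonneg)

lemma nn_integral_ker_mol_HH:
  assumes "r > 0" "x \<in> \<H>"
  shows "(\<integral>\<^sup>+y. ennreal (ker mol mol r x y) \<partial>HH) = ennreal (r\<^sup>2)"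
proof -
  have "(\<integral>\<^sup>+y. ennreal (ker mol mol r x y) \<partial>HH) = (\<integral>\<^sup>+y. ennreal (ker mol mol r x y) * indicator \<H> y \<partial>lborel)"
    by (rule nn_integral_HH) (use ker_measurable[OF mol_bump mol_bump] in measurable)
  also have "\<dots> = (\<integral>\<^sup>+y. ennreal (ker mol mol r x y) \<partial>lborel)"
  proof (intro nn_integral_cong)
    fix y show "ennreal (ker mol mol r x y) * indicator \<H> y = ennreal (ker mol mol r x y)"
    proof (cases "y \<in> \<H>")
      case False
      then have "y \<notin> Q r x" using Q_subset[OF assms(2)] by blast
      then show ?thesis using ker_zero[OF mol_bump mol_bump assms(1)] by simp
    qed simp
  qed
  finally show ?thesis using nn_integral_ker_mol(1)[OF assms(1)] by simp
qed

lemma integral_ker_mol: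
  assumes "r > 0" "x \<in> \<H>"
  shows "integrable HH (ker mol mol r x)" "(LINT y|HH. ker mol mol r x y) = r\<^sup>2"
proof -
  have "has_bochner_integral HH (ker mol mol r x) (r\<^sup>2)"
    by (rule has_bochner_integral_nn_integral)
      (auto simp: ker_mol_nonneg nn_integral_ker_mol_HH[OF assms] ker_measurable[OF mol_bump mol_bump])
  then show "integrable HH (ker mol mol r x)" "(LINT y|HH. ker mol mol r x y) = r\<^sup>2"
    by (auto simp: has_bochner_integral_iff)
qed

lemma emeasure_Q:
  assumes "x \<in> \<H>" "r > 0" shows "emeasure HH (Q r x) = ennreal (r\<^sup>2)"
proof -
  have "emeasure HH (Q r x) = emeasure lborel (Q r x)"
    using Q_subset[OF assms(1)] half_plane_lebesgue
    by (subst emeasure_restrict_space) (auto simp: Q_def)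
  also have "\<dots> = ennreal (r\<^sup>2)"
    using assms(2) by (simp add: Q_def emeasure_lborel_cbox_eq Basis_real2 inner_axis power2_eq_square)
  finally show ?thesis .
qed

lemma Q_sets [measurable]: "x \<in> \<H> \<Longrightarrow> Q r x \<in> sets HH"
  using Q_subset half_plane_lebesgue by (subst sets_restrict_space_iff) (auto simp: Q_def)

lemma ker_L2:
  assumes "bump \<alpha>" "bump \<beta>" "x \<in> \<H>" "r > 0" "\<And>y. \<bar>ker \<alpha> \<beta> r x y\<bar> \<le> B"
  shows "(\<integral>\<^sup>+y. ennreal ((ker \<alpha> \<beta> r x y)\<^sup>2) \<partial>HH) \<le> ennreal (B\<^sup>2 * r\<^sup>2)"
proof -
  have "(\<integral>\<^sup>+y. ennreal ((ker \<alpha> \<beta> r x y)\<^sup>2) \<partial>HH) \<le> (\<integral>\<^sup>+y. ennreal (B\<^sup>2) * indicator (Q r x) y \<partial>HH)"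
    using ker_zero[OF assms(1,2,4)] assms(5)
    by (intro nn_integral_mono) (auto simp: indicator_def intro!: ennreal_leI, metis abs_le_square_iff abs_of_nonneg abs_ge_zero order_trans)
  also have "\<dots> = ennreal (B\<^sup>2 * r\<^sup>2)"
    using assms by (simp add: nn_integral_cmult_indicator emeasure_Q ennreal_mult)
  finally show ?thesis .
qed

text \<open>The integrand is bounded by the sum of the two squares. The resulting additive bound is
  cruder than the Cauchy-Schwarz inequality, but it is uniform in \<open>x\<close> and in
  \<open>h\<close>, and it is applied at scale 1 only.\<close>

lemma ker_L2H_bound:
  fixes h :: "real^2 \<Rightarrow> 'b::euclidean_space"
  assumes "bump \<alpha>" "bump \<beta>" "x \<in> \<H>" "r > 0" "\<And>y. \<bar>ker \<alpha> \<beta> r x y\<bar> \<le> B"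
    and h: "h \<in> borel_measurable HH" "(\<integral>\<^sup>+x. ennreal ((norm (h x))\<^sup>2) \<partial>HH) \<le> ennreal N" "N \<ge> 0"
  shows "integrable HH (\<lambda>y. ker \<alpha> \<beta> r x y *\<^sub>R h y)"
    and "norm (LINT y|HH. ker \<alpha> \<beta> r x y *\<^sub>R h y) \<le> B\<^sup>2 * r\<^sup>2 + N"
proof -
  note [measurable] = h(1) ker_measurable[OF assms(1,2)]
  have "(\<integral>\<^sup>+y. ennreal (norm (ker \<alpha> \<beta> r x y *\<^sub>R h y)) \<partial>HH) \<le>
     (\<integral>\<^sup>+y. ennreal ((ker \<alpha> \<beta> r x y)\<^sup>2) + ennreal ((norm (h y))\<^sup>2) \<partial>HH)"
  proof (intro nn_integral_mono)
    fix y
    have "2 * \<bar>ker \<alpha> \<beta> r x y\<bar> * norm (h y) \<le> \<bar>ker \<alpha> \<beta> r x y\<bar>\<^sup>2 + (norm (h y))\<^sup>2"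
      by (rule sum_squares_bound)
    moreover have "\<bar>ker \<alpha> \<beta> r x y\<bar> * norm (h y) \<le> 2 * \<bar>ker \<alpha> \<beta> r x y\<bar> * norm (h y)"
      by (intro mult_right_mono) auto
    ultimately have "norm (ker \<alpha> \<beta> r x y *\<^sub>R h y) \<le> (ker \<alpha> \<beta> r x y)\<^sup>2 + (norm (h y))\<^sup>2"
      unfolding norm_scaleR power2_abs by (rule order_trans[rotated])
    then show "ennreal (norm (ker \<alpha> \<beta> r x y *\<^sub>R h y)) \<le> ennreal ((ker \<alpha> \<beta> r x y)\<^sup>2) + ennreal ((norm (h y))\<^sup>2)"
      by (simp add: ennreal_plus[symmetric] ennreal_leI del: ennreal_plus)
  qed
  also have "\<dots> = (\<integral>\<^sup>+y. ennreal ((ker \<alpha> \<beta> r x y)\<^sup>2) \<partial>HH) + (\<integral>\<^sup>+y. ennreal ((norm (h y))\<^sup>2) \<partial>HH)"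
    by (rule nn_integral_add) measurable
  also have "\<dots> \<le> ennreal (B\<^sup>2 * r\<^sup>2) + ennreal N"
    by (intro add_mono ker_L2 assms h)
  finally have *: "(\<integral>\<^sup>+y. ennreal (norm (ker \<alpha> \<beta> r x y *\<^sub>R h y)) \<partial>HH) \<le> ennreal (B\<^sup>2 * r\<^sup>2 + N)"
    using h(3) by simp
  then show int: "integrable HH (\<lambda>y. ker \<alpha> \<beta> r x y *\<^sub>R h y)"
    by (intro integrableI_bounded) (auto simp: less_top[symmetric] top_unique)
  show "norm (LINT y|HH. ker \<alpha> \<beta> r x y *\<^sub>R h y) \<le> B\<^sup>2 * r\<^sup>2 + N"
    using order_trans[OF integral_norm_bound_ennreal[OF int] *] h(3)
    by (subst (asm) ennreal_le_iff) auto
qed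

text \<open>The kernel carries no normalising factor and has mass \<open>r\<^sup>2\<close>; after
  division it is a probability density on a square with corner \<open>x\<close>. The square shrinks
  to \<open>x\<close> inside the half plane, so continuity at \<open>x\<close> gives the
  limit.\<close>

lemma ker_average_tendsto:
  fixes c :: "real^2 \<Rightarrow> 'b::euclidean_space"
  assumes c: "continuous_on \<H> c" and x: "x \<in> \<H>" and r: "\<And>n. r n > 0" "r \<longlonglongrightarrow> 0"
  shows "(\<lambda>n. (1 / (r n)\<^sup>2) *\<^sub>R (LINT y|HH. ker mol mol (r n) x y *\<^sub>R c y)) \<longlonglongrightarrow> c x"
proof (rule metric_LIMSEQ_I)
  fix e :: real assume e: "e > 0"
  have "isCont c x" using c x open_half_plane continuous_on_eq_continuous_at by blast
  then obtain d where d: "d > 0" "\<And>y. dist y x < d \<Longrightarrow> dist (c y) (c x) < e / 2"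
    using e unfolding continuous_at_eps_delta by (metis half_gt_zero)
  obtain N where N: "\<And>n. n \<ge> N \<Longrightarrow> r n < d / 2" 
    using order_tendstoD(2)[OF r(2), of "d/2"] d(1) by (auto simp: eventually_sequentially)
  show "\<exists>N. \<forall>n\<ge>N. dist ((1 / (r n)\<^sup>2) *\<^sub>R (LINT y|HH. ker mol mol (r n) x y *\<^sub>R c y)) (c x) < e"
  proof (intro exI allI impI)
    fix n assume n: "n \<ge> N"
    let ?k = "ker mol mol (r n) x"
    have dQ: "dist y x < d" if "y \<in> Q (r n) x" for y
    proof -
      have "dist y x \<le> \<bar>y$1 - x$1\<bar> + \<bar>y$2 - x$2\<bar>"
        using norm_le_l1_cart[of "y - x"] by (simp add: dist_norm sum_2)
      also have "\<dots> \<le> r n + r n" using that by (auto simp: Q_def mem_box_real2)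
      also have "\<dots> < d" using N[OF n] by simp
      finally show ?thesis .
    qed
    have contc: "continuous_on (Q (r n) x) c" using c Q_subset[OF x] continuous_on_subset by blast
    have i1: "integrable HH (\<lambda>y. ?k y *\<^sub>R c y)"
      by (rule lebesgue_on_integral_compact(2)[where a = x and b = "pt (x$1 + r n) (x$2 + r n)", folded Q_def])
        (auto intro!: continuous_intros ker_continuous mol_bump contc Q_subset x ker_zero r)
    have i2: "integrable HH (\<lambda>y. ?k y *\<^sub>R c x)" using integral_ker_mol[OF r(1) x] by auto
    have "(LINT y|HH. ?k y *\<^sub>R c y) - (r n)\<^sup>2 *\<^sub>R c x = (LINT y|HH. ?k y *\<^sub>R c y) - (LINT y|HH. ?k y *\<^sub>R c x)"
      using integral_ker_mol[OF r(1) x] by simp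
    also have "\<dots> = (LINT y|HH. ?k y *\<^sub>R (c y - c x))"
      using i1 i2 by (simp add: scaleR_diff_right)
    also have "norm \<dots> \<le> (LINT y|HH. ?k y * (e / 2))"
    proof (rule order_trans[OF integral_norm_bound], rule integral_mono)
      show "integrable HH (\<lambda>y. norm (?k y *\<^sub>R (c y - c x)))" 
        using i1 i2 by (intro integrable_norm) (simp add: scaleR_diff_right)
      show "integrable HH (\<lambda>y. ?k y * (e / 2))" using integral_ker_mol[OF r(1) x] by auto
      fix y
      show "norm (?k y *\<^sub>R (c y - c x)) \<le> ?k y * (e / 2)"
      proof (cases "y \<in> Q (r n) x")
        case True
        then have "norm (c y - c x) \<le> e / 2" using d(2)[OF dQ[OF True]] by (simp add: dist_norm)
        then have "?k y * norm (c y - c x) \<le> ?k y * (e / 2)" by (intro mult_left_mono ker_mol_nonneg)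
        then show ?thesis using ker_mol_nonneg by simp
      next
        case False
        then show ?thesis using ker_zero[OF mol_bump mol_bump r(1), of y n x] by simp
      qed
    qed
    also have "\<dots> = (r n)\<^sup>2 * (e / 2)" using integral_ker_mol[OF r(1) x] by simp
    finally have *: "norm ((LINT y|HH. ?k y *\<^sub>R c y) - (r n)\<^sup>2 *\<^sub>R c x) \<le> (r n)\<^sup>2 * (e / 2)" .
    have "(1 / (r n)\<^sup>2) *\<^sub>R (LINT y|HH. ?k y *\<^sub>R c y) - c x = 
        (1 / (r n)\<^sup>2) *\<^sub>R ((LINT y|HH. ?k y *\<^sub>R c y) - (r n)\<^sup>2 *\<^sub>R c x)"
      using r(1)[of n] by (simp add: scaleR_diff_right)
    then have "dist ((1 / (r n)\<^sup>2) *\<^sub>R (LINT y|HH. ?k y *\<^sub>R c y)) (c x) \<le> (1 / (r n)\<^sup>2) * ((r n)\<^sup>2 * (e / 2))"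
      using mult_left_mono[OF *, of "1 / (r n)\<^sup>2"] by (simp only: dist_norm norm_scaleR) simp
    also have "\<dots> < e" using r(1)[of n] e by simp
    finally show "dist ((1 / (r n)\<^sup>2) *\<^sub>R (LINT y|HH. ?k y *\<^sub>R c y)) (c x) < e" .
  qed
qed

text \<open>Averaging a square-integrable function does not increase its norm, and the averages of a
  continuous function converge pointwise; so Fatou's lemma transfers the bound without any
  uniqueness theorem for weak derivatives.\<close>

lemma nn_integral_le_of_averages:
  fixes c h :: "real^2 \<Rightarrow> 'b::euclidean_space"
  assumes c: "continuous_on \<H> c" and h: "h \<in> borel_measurable HH"
    and eq: "\<And>x r. x \<in> \<H> \<Longrightarrow> r > 0 \<Longrightarrow> (LINT y|HH. ker mol mol r x y *\<^sub>R c y) = (LINT y|HH. ker mol mol r x y *\<^sub>R h y)"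
  shows "(\<integral>\<^sup>+x. ennreal ((norm (c x))\<^sup>2) \<partial>HH) \<le> (\<integral>\<^sup>+x. ennreal ((norm (h x))\<^sup>2) \<partial>HH)"
proof (cases "(\<integral>\<^sup>+x. ennreal ((norm (h x))\<^sup>2) \<partial>HH) = \<infinity>")
  case False
  then obtain N where N: "(\<integral>\<^sup>+x. ennreal ((norm (h x))\<^sup>2) \<partial>HH) = ennreal N" "N \<ge> 0"
    by (cases "(\<integral>\<^sup>+x. ennreal ((norm (h x))\<^sup>2) \<partial>HH)") auto
  obtain B where B: "B > 0" "\<And>r x y. \<bar>ker mol mol r x y\<bar> \<le> B" using ker_bounded[OF mol_bump mol_bump] by blast
  define r where "r n = inverse (real (Suc n))" for n
  have r: "r n > 0" "r \<longlonglongrightarrow> 0" for n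
    using LIMSEQ_inverse_real_of_nat by (auto simp: r_def[abs_def])
  define A where "A n x = (1 / (r n)\<^sup>2) *\<^sub>R (LINT y|HH. ker mol mol (r n) x y *\<^sub>R h y)" for n x
  note hm = h[measurable]
  have km [measurable]: "(\<lambda>(x, y). ker mol mol (r n) x y) \<in> borel_measurable (HH \<Otimes>\<^sub>M HH)" for n
    by (rule ker_measurable_HH2[OF mol_bump mol_bump])
  have [measurable]: "A n \<in> borel_measurable HH" for n
    unfolding A_def by measurable
  have bnd: "ennreal ((norm (A n x))\<^sup>2) \<le> (\<integral>\<^sup>+y. ennreal (1 / (r n)\<^sup>2 * ker mol mol (r n) x y * (norm (h y))\<^sup>2) \<partial>HH)"
    if x: "x \<in> \<H>" for n x
  proof -
    let ?k = "\<lambda>y. 1 / (r n)\<^sup>2 * ker mol mol (r n) x y" and ?v = "A n x"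
    have kn: "?k y \<ge> 0" for y using ker_mol_nonneg by simp
    have i1: "integrable HH (\<lambda>y. ?k y *\<^sub>R h y)"
      using integrable_scaleR_right[OF ker_L2H_bound(1)[OF mol_bump mol_bump x r(1) B(2) h eq_refl[OF N(1)] N(2)], of "1/(r n)\<^sup>2"] by simp
    have v: "?v = (LINT y|HH. ?k y *\<^sub>R h y)"
      unfolding A_def by (subst integral_scaleR_right[symmetric]) simp
    have i2: "integrable HH (\<lambda>y. ?k y * (norm (h y))\<^sup>2)"
    proof (rule Bochner_Integration.integrable_bound[where f="\<lambda>y. (1 / (r n)\<^sup>2 * B) * (norm (h y))\<^sup>2"])
      have "integrable HH (\<lambda>y. (norm (h y))\<^sup>2)"
        using N by (intro integrableI_bounded) (auto)
      then show "integrable HH (\<lambda>y. (1 / (r n)\<^sup>2 * B) * (norm (h y))\<^sup>2)" by auto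
      show "AE y in HH. norm (?k y * (norm (h y))\<^sup>2) \<le> norm ((1 / (r n)\<^sup>2 * B) * (norm (h y))\<^sup>2)"
        using B kn r(1) by (intro AE_I2) (auto simp: abs_mult intro!: mult_right_mono divide_right_mono)
    qed (use ker_measurable[OF mol_bump mol_bump] in measurable)
    have ik: "integrable HH ?k" "(LINT y|HH. ?k y) = 1"
      using integral_ker_mol[OF r(1) x] r(1)[of n] by (auto simp: field_simps)
    \<comment> \<open>Jensen's inequality by absorption: pair the average \<open>?v\<close> with
      itself, bound the inner product under the integral by half the sum of squares, and move half
      of the squared norm of \<open>?v\<close>, which is weighted by a kernel of mass 1, to the
      left.\<close>
    have "(norm ?v)\<^sup>2 = ?v \<bullet> (LINT y|HH. ?k y *\<^sub>R h y)" using v by (simp add: power2_norm_eq_inner)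
    also have "\<dots> = (LINT y|HH. ?v \<bullet> (?k y *\<^sub>R h y))" using i1 by (rule integral_inner_right[OF _, symmetric]) 
    also have "\<dots> \<le> (LINT y|HH. (1/2) * (?k y * (norm ?v)\<^sup>2) + (1/2) * (?k y * (norm (h y))\<^sup>2))"
    proof (rule integral_mono)
      show "integrable HH (\<lambda>y. ?v \<bullet> (?k y *\<^sub>R h y))" by (rule integrable_inner_right) (rule i1)
      show "integrable HH (\<lambda>y. (1/2) * (?k y * (norm ?v)\<^sup>2) + (1/2) * (?k y * (norm (h y))\<^sup>2))"
        by (intro Bochner_Integration.integrable_add integrable_mult_right integrable_mult_left ik i2)
      fix y
      have "?v \<bullet> h y \<le> norm ?v * norm (h y)" by (rule norm_cauchy_schwarz)
      also have "\<dots> \<le> ((norm ?v)\<^sup>2 + (norm (h y))\<^sup>2) / 2"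
        using sum_squares_bound[of "norm ?v" "norm (h y)"] by simp
      finally have "?k y * (?v \<bullet> h y) \<le> ?k y * (((norm ?v)\<^sup>2 + (norm (h y))\<^sup>2) / 2)"
        using kn by (rule mult_left_mono)
      then show "?v \<bullet> (?k y *\<^sub>R h y) \<le> (1/2) * (?k y * (norm ?v)\<^sup>2) + (1/2) * (?k y * (norm (h y))\<^sup>2)"
        by (simp add: distrib_left add_divide_distrib)
    qed
    also have "\<dots> = (1/2) * (norm ?v)\<^sup>2 + (1/2) * (LINT y|HH. ?k y * (norm (h y))\<^sup>2)"
      using ik i2 by (subst Bochner_Integration.integral_add) (auto simp del: times_divide_eq_left times_divide_eq_right)
    finally have "(norm ?v)\<^sup>2 \<le> (LINT y|HH. ?k y * (norm (h y))\<^sup>2)" by simp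
    then have "ennreal ((norm ?v)\<^sup>2) \<le> ennreal (LINT y|HH. ?k y * (norm (h y))\<^sup>2)" by (rule ennreal_leI)
    also have "\<dots> = (\<integral>\<^sup>+y. ennreal (?k y * (norm (h y))\<^sup>2) \<partial>HH)"
      by (rule nn_integral_eq_integral[symmetric, OF i2]) (intro AE_I2 mult_nonneg_nonneg kn zero_le_power2)
    finally show ?thesis .
  qed
  have An: "(\<integral>\<^sup>+x. ennreal ((norm (A n x))\<^sup>2) \<partial>HH) \<le> (\<integral>\<^sup>+x. ennreal ((norm (h x))\<^sup>2) \<partial>HH)" for n
  proof -
    have "(\<integral>\<^sup>+x. ennreal ((norm (A n x))\<^sup>2) \<partial>HH) \<le> (\<integral>\<^sup>+x. \<integral>\<^sup>+y. ennreal (1 / (r n)\<^sup>2 * ker mol mol (r n) x y * (norm (h y))\<^sup>2) \<partial>HH \<partial>HH)"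
      by (intro nn_integral_mono bnd) simp
    also have "\<dots> = (\<integral>\<^sup>+y. \<integral>\<^sup>+x. ennreal (1 / (r n)\<^sup>2 * ker mol mol (r n) x y * (norm (h y))\<^sup>2) \<partial>HH \<partial>HH)"
      by (rule HHp.Fubini'[symmetric]) measurable
    also have "\<dots> \<le> (\<integral>\<^sup>+y. ennreal ((norm (h y))\<^sup>2) \<partial>HH)"
    proof (rule nn_integral_mono)
      fix y
      have m [measurable]: "(\<lambda>x. ker mol mol (r n) x y) \<in> borel_measurable borel"
        using measurable_compose[OF measurable_Pair[OF measurable_ident_sets[OF refl] measurable_const[of y]] ker_measurable2[OF mol_bump mol_bump]]
        by (simp add: id_def)
      have "(\<integral>\<^sup>+x. ennreal (1 / (r n)\<^sup>2 * ker mol mol (r n) x y * (norm (h y))\<^sup>2) \<partial>HH) =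
         (\<integral>\<^sup>+x. ennreal (1 / (r n)\<^sup>2 * (norm (h y))\<^sup>2) * ennreal (ker mol mol (r n) x y) \<partial>HH)"
        by (intro nn_integral_cong) (simp add: ennreal_mult[symmetric] ker_mol_nonneg mult_ac)
      also have "\<dots> = ennreal (1 / (r n)\<^sup>2 * (norm (h y))\<^sup>2) * (\<integral>\<^sup>+x. ennreal (ker mol mol (r n) x y) \<partial>HH)"
        by (rule nn_integral_cmult) (use measurable_HH_borel[OF m] in measurable)
      \<comment> \<open>In the variable x the kernel lives on the square below and to the left of y.
        Part of that square may leave the half plane, hence only an inequality.\<close>
      also have "(\<integral>\<^sup>+x. ennreal (ker mol mol (r n) x y) \<partial>HH) \<le> (\<integral>\<^sup>+x. ennreal (ker mol mol (r n) x y) \<partial>lborel)"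
        by (subst nn_integral_HH) (auto intro!: nn_integral_mono simp: indicator_def)
      also have "\<dots> = ennreal ((r n)\<^sup>2)" by (rule nn_integral_ker_mol(2)[OF r(1)])
      finally have "(\<integral>\<^sup>+x. ennreal (1 / (r n)\<^sup>2 * ker mol mol (r n) x y * (norm (h y))\<^sup>2) \<partial>HH)
         \<le> ennreal (1 / (r n)\<^sup>2 * (norm (h y))\<^sup>2) * ennreal ((r n)\<^sup>2)" by (simp add: mult_left_mono)
      also have "\<dots> = ennreal ((norm (h y))\<^sup>2)" using r(1)[of n] by (simp add: ennreal_mult[symmetric])
      finally show "(\<integral>\<^sup>+x. ennreal (1 / (r n)\<^sup>2 * ker mol mol (r n) x y * (norm (h y))\<^sup>2) \<partial>HH) \<le> ennreal ((norm (h y))\<^sup>2)" .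
    qed
    finally show ?thesis .
  qed
  have lim: "(\<lambda>n. ennreal ((norm (A n x))\<^sup>2)) \<longlonglongrightarrow> ennreal ((norm (c x))\<^sup>2)" if "x \<in> \<H>" for x
    using ker_average_tendsto[OF c that r] unfolding A_def eq[OF that r(1), symmetric] 
    by (intro tendsto_intros) 
  have "(\<integral>\<^sup>+x. ennreal ((norm (c x))\<^sup>2) \<partial>HH) = (\<integral>\<^sup>+x. liminf (\<lambda>n. ennreal ((norm (A n x))\<^sup>2)) \<partial>HH)"
    by (intro nn_integral_cong lim_imp_Liminf[symmetric] lim) auto
  also have "\<dots> \<le> liminf (\<lambda>n. \<integral>\<^sup>+x. ennreal ((norm (A n x))\<^sup>2) \<partial>HH)"
    by (rule nn_integral_liminf) measurable
  also have "\<dots> \<le> liminf (\<lambda>n::nat. \<integral>\<^sup>+x. ennreal ((norm (h x))\<^sup>2) \<partial>HH)"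
    by (intro Liminf_mono always_eventually allI An)
  also have "\<dots> = (\<integral>\<^sup>+x. ennreal ((norm (h x))\<^sup>2) \<partial>HH)" by (simp add: Liminf_const)
  finally show ?thesis .
qed simp


subsection \<open>Pointwise bounds from Sobolev norms\<close>

text \<open>The defining property of a weak derivative, restricted to products of functions of one variable.\<close>

definition pairs :: "2 list \<Rightarrow> (real^2 \<Rightarrow> 'b::euclidean_space) \<Rightarrow> (real^2 \<Rightarrow> 'b) \<Rightarrow> bool" where
  "pairs is g h \<longleftrightarrow> (\<forall>\<alpha> \<beta> a b c d. smooth \<alpha> \<longrightarrow> smooth \<beta> \<longrightarrow> (\<forall>x. x \<notin> {a..b} \<longrightarrow> \<alpha> x = 0) \<longrightarrow>
     (\<forall>x. x \<notin> {c..d} \<longrightarrow> \<beta> x = 0) \<longrightarrow> c > 0 \<longrightarrow>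
     (LINT x|HH. iter_partial is (tp \<alpha> \<beta>) x *\<^sub>R g x) = (-1) ^ length is *\<^sub>R (LINT x|HH. tp \<alpha> \<beta> x *\<^sub>R h x))"

lemma pairs_weak_derivative:
  "C1_half_plane f \<Longrightarrow> has_weak_derivative \<H> (i # is) f h \<Longrightarrow> pairs is (partial_H i f) h"
  unfolding pairs_def using weak_derivative_pairing by blast

lemma pairs_weak_derivative_0:
  "has_weak_derivative \<H> is f h \<Longrightarrow> pairs is f h"
  unfolding pairs_def has_weak_derivative_def using tp_test_function by blast

lemma pairs_ker:
  assumes p: "pairs is g h" and "bump \<alpha>" "bump \<beta>" "x \<in> \<H>" "r > 0"
  shows "(LINT y|HH. iter_partial is (ker \<alpha> \<beta> r x) y *\<^sub>R g y) = (-1) ^ length is *\<^sub>R (LINT y|HH. ker \<alpha> \<beta> r x y *\<^sub>R h y)"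
  unfolding ker_def
proof (rule p[unfolded pairs_def, rule_format, where a = "x$1" and b = "x$1 + r" and c = "x$2" and d = "x$2 + r"])
  show "0 < x $ 2" using assms(4) by (simp add: half_plane_def)
qed (rule ker_smooth[OF assms(2)] ker_smooth[OF assms(3)] ker_supp[OF assms(2,5)] ker_supp[OF assms(3,5)], assumption?)+

lemma ker_deriv:
  assumes "bump \<alpha>" "r > 0"
  shows "deriv (\<lambda>s. \<alpha> ((1/r) * s + d)) = (\<lambda>s. (1/r) * deriv \<alpha> ((1/r) * s + d))"
proof
  fix s
  have "(\<alpha> has_real_derivative deriv \<alpha> ((1/r) * s + d)) (at ((1/r) * s + d))"
    using assms smooth_has_deriv by (auto simp: bump_def)
  moreover have "((\<lambda>s. (1/r) * s + d) has_real_derivative 1/r) (at s)"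
    using assms(2) by (auto intro!: derivative_eq_intros)
  ultimately have "((\<lambda>s. \<alpha> ((1/r) * s + d)) has_real_derivative deriv \<alpha> ((1/r) * s + d) * (1/r)) (at s)"
    by (rule DERIV_chain2)
  then show "deriv (\<lambda>s. \<alpha> ((1/r) * s + d)) s = (1/r) * deriv \<alpha> ((1/r) * s + d)"
    by (simp only: DERIV_imp_deriv mult.commute)
qed

lemma ker_partial:
  assumes "bump \<alpha>" "bump \<beta>" "r > 0"
  shows "partial_deriv UNIV 1 (ker \<alpha> \<beta> r x) = (\<lambda>y. (1/r) * ker (deriv \<alpha>) \<beta> r x y)"
    and "partial_deriv UNIV 2 (ker \<alpha> \<beta> r x) = (\<lambda>y. (1/r) * ker \<alpha> (deriv \<beta>) r x y)"
  unfolding ker_def tp_partial[OF ker_smooth[OF assms(1)] ker_smooth[OF assms(2)]]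
    ker_deriv[OF assms(1,3)] ker_deriv[OF assms(2,3)]
  by (simp_all add: tp_def fun_eq_iff)

lemma ker_cont_integrable:
  fixes g :: "real^2 \<Rightarrow> 'b::euclidean_space"
  assumes "continuous_on \<H> g" "bump \<alpha>" "bump \<beta>" "r > 0" "x \<in> \<H>"
  shows "integrable HH (\<lambda>y. ker \<alpha> \<beta> r x y *\<^sub>R g y)"
  using assms(1) Q_subset[OF assms(5), of r] continuous_on_subset
  by (intro lebesgue_on_integral_compact(2)[where a = x and b = "pt (x$1 + r) (x$2 + r)", folded Q_def])
    (auto intro!: continuous_intros ker_continuous assms ker_zero)

text \<open>An antiderivative of the difference of two mollifiers, at scale 1 and at scale 1 / c.
  Both have integral 1, so it has compact support, and it stays bounded by 1 however large c
  is.\<close>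

definition step_diff :: "real \<Rightarrow> real \<Rightarrow> real" where
  "step_diff c s = step s - step (c * s)"

lemma step_diff:
  assumes "c \<ge> 1"
  shows "bump (step_diff c)" "deriv (step_diff c) = (\<lambda>s. mol s - c * mol (c * s))" "\<bar>step_diff c s\<bar> \<le> 1"
proof -
  have sm: "smooth (\<lambda>s. step (c * s))" using smooth_affine[OF step_props(1), of c 0] by simp
  show "bump (step_diff c)" unfolding bump_def
  proof (intro conjI allI impI)
    show "smooth (step_diff c)" unfolding step_diff_def[abs_def] by (intro smooth_diff sm step_props)
    fix s :: real assume "s \<notin> {0..1}"
    then consider "s < 0" | "s > 1" by fastforce
    then show "step_diff c s = 0"
    proof cases
      case 1
      then have "c * s \<le> 0" using assms by (simp add: mult_nonneg_nonpos)
      then show ?thesis using 1 by (simp add: step_diff_def step_props)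
    next
      case 2
      then have "c * s \<ge> 1" using assms mult_mono[of 1 c 1 s] by simp
      then show ?thesis using 2 by (simp add: step_diff_def step_props)
    qed
  qed
  show "deriv (step_diff c) = (\<lambda>s. mol s - c * mol (c * s))"
  proof
    fix s
    have "((\<lambda>s. step (c * s)) has_real_derivative mol (c * s) * c) (at s)"
      by (rule DERIV_chain2[OF step_deriv]) (auto intro!: derivative_eq_intros)
    then show "deriv (step_diff c) s = mol s - c * mol (c * s)"
      unfolding step_diff_def[abs_def] by (intro DERIV_imp_deriv) (auto intro!: derivative_eq_intros step_deriv)
  qed
  show "\<bar>step_diff c s\<bar> \<le> 1" using step_bounds[of s] step_bounds[of "c * s"] by (auto simp: step_diff_def)
qed

definition L2le :: "real \<Rightarrow> (real^2 \<Rightarrow> 'b::euclidean_space) \<Rightarrow> bool" where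
  "L2le N h \<longleftrightarrow> h \<in> borel_measurable HH \<and> (\<integral>\<^sup>+x. ennreal ((norm (h x))\<^sup>2) \<partial>HH) \<le> ennreal N \<and> N \<ge> 0"

lemma ker_L2le_bound:
  assumes "bump \<alpha>" "bump \<beta>" "x \<in> \<H>" "r > 0" "\<And>y. \<bar>ker \<alpha> \<beta> r x y\<bar> \<le> B" "L2le N h"
  shows "integrable HH (\<lambda>y. ker \<alpha> \<beta> r x y *\<^sub>R h y)"
    and "norm (LINT y|HH. ker \<alpha> \<beta> r x y *\<^sub>R h y) \<le> B\<^sup>2 * r\<^sup>2 + N"
  using ker_L2H_bound[OF assms(1-5)] assms(6) unfolding L2le_def by blast+

text \<open>The mollified value at \<open>x\<close> is rewritten, by integrating by parts in each variable separately
  the difference of the kernel at scale \<open>r\<close> and at scale \<open>1\<close>, as a sum of integrals against kernels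
  that stay bounded as \<open>r\<close> tends to \<open>0\<close>.\<close>

lemma sup_bound_mixed_derivative:
  "\<exists>C. \<forall>(g::real^2 \<Rightarrow> 'b::euclidean_space) h0 h1 h2 h12. continuous_on \<H> g \<longrightarrow> pairs [] g h0 \<longrightarrow> pairs [1] g h1 \<longrightarrow> pairs [2] g h2 \<longrightarrow>
     pairs [1,2] g h12 \<longrightarrow> L2le N h0 \<longrightarrow> L2le N h1 \<longrightarrow> L2le N h2 \<longrightarrow> L2le N h12 \<longrightarrow> (\<forall>x\<in>\<H>. norm (g x) \<le> C)"
proof -
  obtain M where M: "M > 0" "\<And>x. \<bar>mol x\<bar> \<le> M" using bump_bounded[OF mol_bump] by blast
  define B where "B = (M + 1) * (M + 1)"
  have kb: "\<bar>ker \<alpha> \<beta> r x y\<bar> \<le> B" if "\<And>s. \<bar>\<alpha> s\<bar> \<le> M + 1" "\<And>s. \<bar>\<beta> s\<bar> \<le> M + 1" for \<alpha> \<beta> r x y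
    unfolding ker_eq abs_mult B_def by (intro mult_mono that) (use M in auto)
  have M': "\<bar>mol x\<bar> \<le> M + 1" for x using M(2)[of x] by simp
  show ?thesis
  proof (intro exI allI impI ballI)
    fix g h0 h1 h2 h12 :: "real^2 \<Rightarrow> 'b" and x
    assume g: "continuous_on \<H> g" and p: "pairs [] g h0" "pairs [1] g h1" "pairs [2] g h2" "pairs [1,2] g h12"
      and h: "L2le N h0" "L2le N h1" "L2le N h2" "L2le N h12" and x: "x \<in> \<H>"
    define r where "r n = inverse (real (Suc n))" for n
    have r: "r n > 0" "r n \<le> 1" "r \<longlonglongrightarrow> 0" for n
      using LIMSEQ_inverse_real_of_nat by (auto simp: r_def[abs_def] inverse_eq_divide)
    have bnd: "norm ((1 / (r n)\<^sup>2) *\<^sub>R (LINT y|HH. ker mol mol (r n) x y *\<^sub>R g y)) \<le> 4 * (B\<^sup>2 + N)" for n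
    proof -
      define c where "c = 1 / r n"
      have c: "c \<ge> 1" using r(1,2)[of n] by (simp add: c_def)
      note sd = step_diff[OF c]
      let ?P = "step_diff c" and ?P' = "deriv (step_diff c)"
      have P1: "\<bar>?P s\<bar> \<le> M + 1" for s using sd(3)[of s] M by linarith
      have b': "bump ?P'" by (rule bump_deriv[OF sd(1)])
      have rr: "1 / (r n)\<^sup>2 = c * c" by (simp add: c_def power2_eq_square)
      \<comment> \<open>In each variable c * mol (c * s) equals mol s - \<open>?P'\<close> s.
        Multiplying two such differences gives the four terms, in which every factor
        \<open>?P'\<close> can be integrated by parts.\<close>
      have k: "(1 / (r n)\<^sup>2) * ker mol mol (r n) x y = ker mol mol 1 x y - ker ?P' mol 1 x y
         - ker mol ?P' 1 x y + ker ?P' ?P' 1 x y" for y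
      proof -
        have q: "s / r n = c * s" for s by (simp add: c_def)
        show ?thesis unfolding rr ker_eq sd(2) q by (simp add: algebra_simps)
      qed
      note ii = ker_cont_integrable[OF g _ _ zero_less_one x]
      have "(1 / (r n)\<^sup>2) *\<^sub>R (LINT y|HH. ker mol mol (r n) x y *\<^sub>R g y) =
          (LINT y|HH. ((1 / (r n)\<^sup>2) * ker mol mol (r n) x y) *\<^sub>R g y)"
        by (simp only: scaleR_scaleR[symmetric] integral_scaleR_right)
      also have "\<dots> = (LINT y|HH. ker mol mol 1 x y *\<^sub>R g y) - (LINT y|HH. ker ?P' mol 1 x y *\<^sub>R g y)
         - (LINT y|HH. ker mol ?P' 1 x y *\<^sub>R g y) + (LINT y|HH. ker ?P' ?P' 1 x y *\<^sub>R g y)"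
        unfolding k scaleR_diff_left scaleR_add_left
        by (simp add: ii mol_bump b')
      also have "(LINT y|HH. ker mol mol 1 x y *\<^sub>R g y) = (LINT y|HH. ker mol mol 1 x y *\<^sub>R h0 y)"
        using pairs_ker[OF p(1) mol_bump mol_bump x, of 1] by (simp add: iter_partial_def)
      also have "(LINT y|HH. ker ?P' mol 1 x y *\<^sub>R g y) = - (LINT y|HH. ker ?P mol 1 x y *\<^sub>R h1 y)"
        using pairs_ker[OF p(2) sd(1) mol_bump x, of 1] by (simp add: iter_partial_def ker_partial sd(1) mol_bump)
      also have "(LINT y|HH. ker mol ?P' 1 x y *\<^sub>R g y) = - (LINT y|HH. ker mol ?P 1 x y *\<^sub>R h2 y)"
        using pairs_ker[OF p(3) mol_bump sd(1) x, of 1] by (simp add: iter_partial_def ker_partial sd(1) mol_bump)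
      also have "(LINT y|HH. ker ?P' ?P' 1 x y *\<^sub>R g y) = (LINT y|HH. ker ?P ?P 1 x y *\<^sub>R h12 y)"
        using pairs_ker[OF p(4) sd(1) sd(1) x, of 1] by (simp add: iter_partial_def ker_partial sd(1) b')
      finally have eq: "(1 / (r n)\<^sup>2) *\<^sub>R (LINT y|HH. ker mol mol (r n) x y *\<^sub>R g y) =
         (LINT y|HH. ker mol mol 1 x y *\<^sub>R h0 y) - - (LINT y|HH. ker ?P mol 1 x y *\<^sub>R h1 y)
         - - (LINT y|HH. ker mol ?P 1 x y *\<^sub>R h2 y) + (LINT y|HH. ker ?P ?P 1 x y *\<^sub>R h12 y)" .
      have "norm (LINT y|HH. ker mol mol 1 x y *\<^sub>R h0 y) \<le> B\<^sup>2 + N"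
        using ker_L2le_bound(2)[OF mol_bump mol_bump x zero_less_one kb[OF M' M'] h(1)] by simp
      moreover have "norm (LINT y|HH. ker ?P mol 1 x y *\<^sub>R h1 y) \<le> B\<^sup>2 + N"
        using ker_L2le_bound(2)[OF sd(1) mol_bump x zero_less_one kb[OF P1 M'] h(2)] by simp
      moreover have "norm (LINT y|HH. ker mol ?P 1 x y *\<^sub>R h2 y) \<le> B\<^sup>2 + N"
        using ker_L2le_bound(2)[OF mol_bump sd(1) x zero_less_one kb[OF M' P1] h(3)] by simp
      moreover have "norm (LINT y|HH. ker ?P ?P 1 x y *\<^sub>R h12 y) \<le> B\<^sup>2 + N"
        using ker_L2le_bound(2)[OF sd(1) sd(1) x zero_less_one kb[OF P1 P1] h(4)] by simp
      ultimately show ?thesis unfolding eq by norm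
    qed
    show "norm (g x) \<le> 4 * (B\<^sup>2 + N)"
      by (rule Lim_norm_ubound[OF _ ker_average_tendsto[OF g x r(1,3)]]) (use bnd in auto)
  qed
qed

section \<open>Supremum bounds from fractional regularity\<close>

definition gagliardo_le :: "real \<Rightarrow> real \<Rightarrow> (real^2 \<Rightarrow> 'b::euclidean_space) \<Rightarrow> bool" where
  "gagliardo_le \<sigma> N h \<longleftrightarrow>
     (\<integral>\<^sup>+x. \<integral>\<^sup>+y. ennreal ((norm (h x - h y))\<^sup>2 / norm (x - y) powr (2 + 2 * \<sigma>)) \<partial>HH \<partial>HH) \<le> ennreal N"

text \<open>The difference equals the double integral of the two kernels against h y - h z. Both
  points lie in one square of side r, where the norm of y - z is at most 2 * r; so the Gagliardo
  integral controls h y - h z with a gain of a power of r.\<close>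

lemma ker_compare:
  fixes h :: "real^2 \<Rightarrow> 'b::euclidean_space"
  assumes b: "bump \<alpha>" "bump \<beta>" and x: "x \<in> \<H>" and r: "r > 0" and \<sigma>: "0 < \<sigma>"
    and B: "\<And>y. \<bar>ker \<alpha> \<beta> r x y\<bar> \<le> B" "\<And>y. \<bar>ker mol mol r x y\<bar> \<le> B"
    and h: "L2le N h" and G: "gagliardo_le \<sigma> N h"
  shows "norm (r\<^sup>2 *\<^sub>R (LINT y|HH. ker \<alpha> \<beta> r x y *\<^sub>R h y) -
     (LINT y|HH. ker \<alpha> \<beta> r x y) *\<^sub>R (LINT y|HH. ker mol mol r x y *\<^sub>R h y)) 
     \<le> (B^4 * 2 powr (2 + 2 * \<sigma>) + N) * r powr (3 + \<sigma>)"
proof -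
  let ?a = "ker \<alpha> \<beta> r x" and ?m = "ker mol mol r x"
  have hm [measurable]: "h \<in> borel_measurable HH" and N: "N \<ge> 0" using h by (auto simp: L2le_def)
  note [measurable] = ker_measurable(2)[OF b] ker_measurable(2)[OF mol_bump mol_bump]
  have ia: "integrable HH (\<lambda>y. ?a y *\<^sub>R h y)" and im: "integrable HH (\<lambda>y. ?m y *\<^sub>R h y)"
    using ker_L2le_bound(1)[OF b x r B(1) h] ker_L2le_bound(1)[OF mol_bump mol_bump x r B(2) h] by auto
  have i1: "integrable HH ?a"
    using ker_cont_integrable[OF continuous_on_const b r x, of "1::real"] by simp
  note im1 = integral_ker_mol[OF r x]
  have inner: "(LINT z|HH. (?a y * ?m z) *\<^sub>R (h y - h z)) = r\<^sup>2 *\<^sub>R (?a y *\<^sub>R h y) - ?a y *\<^sub>R (LINT z|HH. ?m z *\<^sub>R h z)" for y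
  proof -
    have "(LINT z|HH. (?a y * ?m z) *\<^sub>R (h y - h z)) = (LINT z|HH. ?a y *\<^sub>R (?m z *\<^sub>R h y - ?m z *\<^sub>R h z))"
      by (simp add: scaleR_diff_right)
    also have "\<dots> = ?a y *\<^sub>R ((LINT z|HH. ?m z *\<^sub>R h y) - (LINT z|HH. ?m z *\<^sub>R h z))"
      using im im1 by (subst integral_scaleR_right, subst Bochner_Integration.integral_diff) auto
    also have "(LINT z|HH. ?m z *\<^sub>R h y) = r\<^sup>2 *\<^sub>R h y" using im1 by simp
    finally show ?thesis by (simp add: scaleR_diff_right)
  qed
  have iin: "integrable HH (\<lambda>z. (?a y * ?m z) *\<^sub>R (h y - h z))" for y
  proof -
    have "integrable HH (\<lambda>z. ?a y *\<^sub>R (?m z *\<^sub>R h y - ?m z *\<^sub>R h z))" using im im1 by auto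
    then show ?thesis by (simp add: scaleR_diff_right)
  qed
  have outer: "r\<^sup>2 *\<^sub>R (LINT y|HH. ?a y *\<^sub>R h y) - (LINT y|HH. ?a y) *\<^sub>R (LINT y|HH. ?m y *\<^sub>R h y)
      = (LINT y|HH. LINT z|HH. (?a y * ?m z) *\<^sub>R (h y - h z))"
  proof -
    have "integrable HH (\<lambda>y. r\<^sup>2 *\<^sub>R (?a y *\<^sub>R h y))" by (rule integrable_scaleR_right) (rule ia)
    moreover have "integrable HH (\<lambda>y. ?a y *\<^sub>R (LINT z|HH. ?m z *\<^sub>R h z))" by (rule integrable_scaleR_left) (rule i1)
    ultimately show ?thesis unfolding inner using i1
      by (subst Bochner_Integration.integral_diff) (simp_all only: integral_scaleR_right integral_scaleR_left)
  qed
  have iout: "integrable HH (\<lambda>y. LINT z|HH. (?a y * ?m z) *\<^sub>R (h y - h z))"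
    unfolding inner by (intro Bochner_Integration.integrable_diff integrable_scaleR_right integrable_scaleR_left ia i1)
  \<comment> \<open>The weight in the inequality between products and sums of squares. It balances
    the two sides: l times r powr (2 + 2 * \<sigma>) times the fourth power of r, and 1 / l, are
    both r powr (3 + \<sigma>).\<close>
  define l where "l = r powr (- (3 + \<sigma>))"
  have l: "l > 0" using r by (simp add: l_def)
  define D where "D y z = (norm (h y - h z))\<^sup>2 / norm (y - z) powr (2 + 2 * \<sigma>)" for y z
  define K where "K = l * (B^4 * (2 * r) powr (2 + 2 * \<sigma>))"
  have K: "K \<ge> 0" using l B(1)[of 0] by (auto simp: K_def)
  have Dm [measurable]: "(\<lambda>(y, z). D y z) \<in> borel_measurable (HH \<Otimes>\<^sub>M HH)"
  proof -
    have [measurable]: "fst \<in> HH \<Otimes>\<^sub>M HH \<rightarrow>\<^sub>M borel" "snd \<in> HH \<Otimes>\<^sub>M HH \<rightarrow>\<^sub>M borel"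
      using measurable_compose[OF measurable_fst measurable_HH_id] measurable_compose[OF measurable_snd measurable_HH_id] by auto
    have [measurable]: "(\<lambda>z. h (fst z)) \<in> borel_measurable (HH \<Otimes>\<^sub>M HH)" "(\<lambda>z. h (snd z)) \<in> borel_measurable (HH \<Otimes>\<^sub>M HH)"
      using measurable_compose[OF measurable_fst hm] measurable_compose[OF measurable_snd hm] by auto
    show ?thesis unfolding D_def case_prod_beta' by measurable
  qed
  have pw: "norm ((?a y * ?m z) *\<^sub>R (h y - h z)) \<le> K * indicator (Q r x) y * indicator (Q r x) z + (1/l) * D y z" for y z
  \<comment> \<open>The diagonal is set apart because the quotient in \<open>D\<close> has
    denominator 0 there; the left-hand side vanishes on it.\<close>
  proof (cases "y \<in> Q r x \<and> z \<in> Q r x \<and> y \<noteq> z")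
    case True
    define d where "d = norm (y - z)"
    have d0: "d > 0" using True by (simp add: d_def)
    have "d \<le> \<bar>y$1 - z$1\<bar> + \<bar>y$2 - z$2\<bar>"
      using norm_le_l1_cart[of "y - z"] by (simp add: d_def sum_2)
    also have "\<dots> \<le> 2 * r" using True by (auto simp: Q_def mem_box_real2)
    finally have d: "d \<le> 2 * r" .
    define e where "e = d powr (1 + \<sigma>)"
    have e: "e > 0" "e\<^sup>2 = d powr (2 + 2 * \<sigma>)" using d0 by (auto simp: e_def powr_power algebra_simps)
    have e2: "e\<^sup>2 \<le> (2 * r) powr (2 + 2 * \<sigma>)" unfolding e(2) using d d0 \<sigma> by (intro powr_mono2) auto
    define A where "A = \<bar>?a y\<bar> * \<bar>?m z\<bar>"
    have A: "A \<ge> 0" "A \<le> B\<^sup>2" unfolding A_def power2_eq_square by (auto intro!: mult_mono B order_trans[OF abs_ge_zero B(1)])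
    define t where "t = norm (h y - h z)"
    have "2 * (sqrt l * A * e) * (t / (sqrt l * e)) \<le> (sqrt l * A * e)\<^sup>2 + (t / (sqrt l * e))\<^sup>2"
      by (rule sum_squares_bound)
    then have "2 * (A * t) \<le> l * A\<^sup>2 * e\<^sup>2 + (1/l) * (t\<^sup>2 / e\<^sup>2)"
      using l e(1) by (simp add: power_mult_distrib power_divide field_simps)
    also have "l * A\<^sup>2 * e\<^sup>2 \<le> l * (B\<^sup>2)\<^sup>2 * (2 * r) powr (2 + 2 * \<sigma>)"
      using A l e2 by (intro mult_mono power_mono) auto
    finally have "2 * (A * t) \<le> K + (1/l) * D y z"
      by (simp add: K_def D_def e(2) d_def t_def mult.assoc power_mult[symmetric])
    moreover have "A * t \<ge> 0" using A by (simp add: t_def)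
    ultimately have "A * t \<le> K + (1/l) * D y z" by linarith
    then show ?thesis using True by (simp add: A_def t_def abs_mult)
  next
    case False
    have D0: "D y z \<ge> 0" by (simp add: D_def)
    have n0: "norm ((?a y * ?m z) *\<^sub>R (h y - h z)) = 0"
      using False ker_zero[OF b r, of y x] ker_zero[OF mol_bump mol_bump r, of z x] by auto
    have "0 \<le> K * indicator (Q r x) y * indicator (Q r x) z"
      using K by (simp add: indicator_def)
    moreover have "0 \<le> (1/l) * D y z" using l D0 by simp
    ultimately show ?thesis unfolding n0 by (rule add_nonneg_nonneg)
  qed
  have "ennreal (norm (LINT y|HH. LINT z|HH. (?a y * ?m z) *\<^sub>R (h y - h z)))
     \<le> (\<integral>\<^sup>+y. norm (LINT z|HH. (?a y * ?m z) *\<^sub>R (h y - h z)) \<partial>HH)"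
    by (rule integral_norm_bound_ennreal[OF iout])
  also have "\<dots> \<le> (\<integral>\<^sup>+y. \<integral>\<^sup>+z. norm ((?a y * ?m z) *\<^sub>R (h y - h z)) \<partial>HH \<partial>HH)"
    by (intro nn_integral_mono integral_norm_bound_ennreal iin)
  also have "\<dots> \<le> (\<integral>\<^sup>+y. \<integral>\<^sup>+z. ennreal K * indicator (Q r x) y * indicator (Q r x) z + ennreal (1/l) * ennreal (D y z) \<partial>HH \<partial>HH)"
  proof (intro nn_integral_mono)
    fix y z
    have "ennreal (norm ((?a y * ?m z) *\<^sub>R (h y - h z))) \<le> ennreal (K * indicator (Q r x) y * indicator (Q r x) z + (1/l) * D y z)"
      by (rule ennreal_leI[OF pw])
    also have "\<dots> = ennreal K * indicator (Q r x) y * indicator (Q r x) z + ennreal (1/l) * ennreal (D y z)"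
    proof -
      have "ennreal (K * indicator (Q r x) y * indicator (Q r x) z) = ennreal K * indicator (Q r x) y * indicator (Q r x) z"
        by (simp add: indicator_def)
      moreover have "ennreal ((1/l) * D y z) = ennreal (1/l) * ennreal (D y z)"
        using l by (intro ennreal_mult) (auto simp: D_def)
      moreover have "0 \<le> K * indicator (Q r x) y * indicator (Q r x) z" using K by (simp add: indicator_def)
      moreover have "0 \<le> (1/l) * D y z" using l by (simp add: D_def)
      ultimately show ?thesis using ennreal_plus by metis
    qed
    finally show "ennreal (norm ((?a y * ?m z) *\<^sub>R (h y - h z))) \<le> \<dots>" .
  qed
  also have "\<dots> = (\<integral>\<^sup>+y. ennreal K * ennreal (r\<^sup>2) * indicator (Q r x) y + ennreal (1/l) * (\<integral>\<^sup>+z. ennreal (D y z) \<partial>HH) \<partial>HH)"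
  proof (intro nn_integral_cong)
    fix y assume "y \<in> space HH"
    then have [measurable]: "D y \<in> borel_measurable HH"
      using measurable_compose[OF measurable_Pair1' Dm] by simp
    have "Q r x \<in> sets HH" using x by simp
    then show "(\<integral>\<^sup>+z. ennreal K * indicator (Q r x) y * indicator (Q r x) z + ennreal (1/l) * ennreal (D y z) \<partial>HH)
      = ennreal K * ennreal (r\<^sup>2) * indicator (Q r x) y + ennreal (1/l) * (\<integral>\<^sup>+z. ennreal (D y z) \<partial>HH)"
    proof (subst nn_integral_add)
      have "(\<integral>\<^sup>+z. (ennreal K * indicator (Q r x) y) * indicator (Q r x) z \<partial>HH) = ennreal K * indicator (Q r x) y * ennreal (r\<^sup>2)"
        using \<open>Q r x \<in> sets HH\<close> by (simp only: nn_integral_cmult_indicator emeasure_Q[OF x r])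
      moreover have "(\<integral>\<^sup>+z. ennreal (1/l) * ennreal (D y z) \<partial>HH) = ennreal (1/l) * (\<integral>\<^sup>+z. ennreal (D y z) \<partial>HH)"
        by (rule nn_integral_cmult) measurable
      ultimately show "(\<integral>\<^sup>+z. ennreal K * indicator (Q r x) y * indicator (Q r x) z \<partial>HH) + (\<integral>\<^sup>+z. ennreal (1/l) * ennreal (D y z) \<partial>HH)
        = ennreal K * ennreal (r\<^sup>2) * indicator (Q r x) y + ennreal (1/l) * (\<integral>\<^sup>+z. ennreal (D y z) \<partial>HH)"
        by (simp only: mult_ac)
    qed (use \<open>Q r x \<in> sets HH\<close> in measurable)
  qed
  also have "\<dots> = ennreal K * ennreal (r\<^sup>2) * ennreal (r\<^sup>2) + ennreal (1/l) * (\<integral>\<^sup>+y. \<integral>\<^sup>+z. ennreal (D y z) \<partial>HH \<partial>HH)"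
  proof -
    have [measurable]: "Q r x \<in> sets HH" using x by simp
    show ?thesis
      by (subst nn_integral_add) (auto simp: nn_integral_cmult nn_integral_cmult_indicator emeasure_Q[OF x r])
  qed
  also have "\<dots> \<le> ennreal K * ennreal (r\<^sup>2) * ennreal (r\<^sup>2) + ennreal (1/l) * ennreal N"
    using G unfolding gagliardo_le_def D_def by (intro add_mono mult_left_mono) auto
  also have "\<dots> = ennreal (K * r\<^sup>2 * r\<^sup>2 + (1/l) * N)"
    using K l N by (simp add: ennreal_plus ennreal_mult'[symmetric] ennreal_mult[symmetric] del: times_divide_eq_left)
  also have "K * r\<^sup>2 * r\<^sup>2 + (1/l) * N = (B^4 * 2 powr (2 + 2 * \<sigma>) + N) * r powr (3 + \<sigma>)"
  proof -
    have "l * r powr (2 + 2 * \<sigma>) * r powr 4 = r powr (3 + \<sigma>)"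
      unfolding l_def powr_add[symmetric] by (simp add: algebra_simps)
    moreover have "r powr 4 = r\<^sup>2 * r\<^sup>2" using r powr_realpow[OF r, of 4] by (simp add: power2_eq_square power4_eq_xxxx)
    moreover have "1 / l = r powr (3 + \<sigma>)" by (simp only: l_def powr_minus divide_inverse inverse_inverse_eq mult_1)
    moreover have "(2 * r) powr (2 + 2 * \<sigma>) = 2 powr (2 + 2 * \<sigma>) * r powr (2 + 2 * \<sigma>)"
      using r by (simp add: powr_mult)
    then have "K * r\<^sup>2 * r\<^sup>2 = B^4 * 2 powr (2 + 2 * \<sigma>) * (l * r powr (2 + 2 * \<sigma>) * (r\<^sup>2 * r\<^sup>2))"
      unfolding K_def by (simp only: mult_ac)
    ultimately have Kr: "K * r\<^sup>2 * r\<^sup>2 = B^4 * 2 powr (2 + 2 * \<sigma>) * r powr (3 + \<sigma>)"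
      and lr: "1 / l = r powr (3 + \<sigma>)" by (simp_all only:)
    show ?thesis unfolding Kr lr distrib_right by (simp only: mult.commute[of _ N])
  qed
  finally show ?thesis unfolding outer using N B(1)[of 0] by (subst (asm) ennreal_le_iff) auto
qed

text \<open>The mollifier compressed to half its scale, still of integral 1. It lets two consecutive
  dyadic scales be treated as two profiles at one common scale.\<close>

definition mol2 :: "real \<Rightarrow> real" where "mol2 s = 2 * mol (2 * s)"

lemma mol2_bump: "bump mol2"
  unfolding bump_def mol2_def[abs_def]
  using smooth_cmult[OF smooth_affine[of mol 2 0], of 2] mol_bump by (auto simp: bump_def)

lemma ker_mol2: "r > 0 \<Longrightarrow> ker mol2 mol2 r x y = 4 * ker mol mol (r / 2) x y"
proof -
  assume "r > 0"
  have "a / (r / 2) = 2 * (a / r)" for a by simp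
  then show ?thesis unfolding ker_eq mol2_def by (simp only: mult.assoc mult.left_commute)
qed

text \<open>Comparing averages at consecutive dyadic scales shows that averages of \<open>h\<close> grow at most like
  \<open>r powr (\<sigma> - 1)\<close>, which is integrable against \<open>dr\<close> since \<open>\<sigma> > 0\<close>.\<close>

lemma ker_growth_mol:
  assumes \<sigma>: "0 < \<sigma>" "\<sigma> < 1" and N: "N \<ge> 0"
  shows "\<exists>C. \<forall>(h::real^2 \<Rightarrow> 'b::euclidean_space) x k. L2le N h \<longrightarrow> gagliardo_le \<sigma> N h \<longrightarrow> x \<in> \<H> \<longrightarrow>
     norm (LINT y|HH. ker mol mol ((1/2)^k) x y *\<^sub>R h y) \<le> C * ((1/2)^k) powr (1 + \<sigma>)"
proof -
  obtain B1 where "B1 > 0" and B1: "\<And>r x y. \<bar>ker mol mol r x y\<bar> \<le> B1" using ker_bounded[OF mol_bump mol_bump] by blast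
  obtain B2 where "B2 > 0" and B2: "\<And>r x y. \<bar>ker mol2 mol2 r x y\<bar> \<le> B2" using ker_bounded[OF mol2_bump mol2_bump] by blast
  define B where "B = max B1 B2"
  have B: "\<bar>ker mol mol r x y\<bar> \<le> B" "\<bar>ker mol2 mol2 r x y\<bar> \<le> B" for r x y
    using B1[of r x y] B2[of r x y] by (auto simp: B_def)
  define K where "K = B^4 * 2 powr (2 + 2 * \<sigma>) + N"
  have K: "K \<ge> 0" using N by (simp add: K_def)
  \<comment> \<open>As 4 * (r/2) powr (1 + \<sigma>) = p * r powr (1 + \<sigma>), the induction step
    requires C + K \<le> C * p. Since \<sigma> < 1 gives p > 1, any C \<ge> K / (p - 1) will do; the
    other summands of C cover scale 1.\<close>
  define p where "p = (2::real) powr (1 - \<sigma>)"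
  have p: "p > 1" using \<sigma> by (simp add: p_def)
  define C where "C = B\<^sup>2 + N + K / (p - 1)"
  have "norm (LINT y|HH. ker mol mol ((1/2)^k) x y *\<^sub>R h y) \<le> C * ((1/2)^k) powr (1 + \<sigma>)"
    if h: "L2le N h" and G: "gagliardo_le \<sigma> N h" and x: "x \<in> \<H>" for h :: "real^2 \<Rightarrow> 'b" and x k
  proof (induction k)
    case 0
    have "norm (LINT y|HH. ker mol mol 1 x y *\<^sub>R h y) \<le> B\<^sup>2 * 1\<^sup>2 + N"
      by (rule ker_L2le_bound(2)[OF mol_bump mol_bump x zero_less_one B(1) h])
    also have "\<dots> \<le> C" using K p by (simp add: C_def)
    finally show ?case by simp
  next
    case (Suc k)
    define r where "r = (1/2::real)^k"
    have r: "r > 0" by (simp add: r_def)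
    let ?m = "\<lambda>r. LINT y|HH. ker mol mol r x y *\<^sub>R h y"
    have m2: "(LINT y|HH. ker mol2 mol2 r x y *\<^sub>R h y) = 4 *\<^sub>R ?m (r/2)"
      unfolding ker_mol2[OF r] scaleR_scaleR[symmetric] by (rule integral_scaleR_right)
    have "(LINT y|HH. ker mol2 mol2 r x y) = 4 * (LINT y|HH. ker mol mol (r/2) x y)"
      unfolding ker_mol2[OF r] by (rule integral_mult_right_zero)
    also have "\<dots> = r\<^sup>2" using integral_ker_mol(2)[of "r/2" x] r x by (simp add: power_divide)
    finally have I2: "(LINT y|HH. ker mol2 mol2 r x y) = r\<^sup>2" .
    have "norm (r\<^sup>2 *\<^sub>R (4 *\<^sub>R ?m (r/2)) - r\<^sup>2 *\<^sub>R ?m r) \<le> K * r powr (3 + \<sigma>)"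
      using ker_compare[OF mol2_bump mol2_bump x r \<sigma>(1) B(2) B(1) h G] unfolding m2 I2 K_def .
    then have "r\<^sup>2 * norm (4 *\<^sub>R ?m (r/2) - ?m r) \<le> r\<^sup>2 * (K * r powr (1 + \<sigma>))"
    proof -
      have "r powr (3 + \<sigma>) = r powr 2 * r powr (1 + \<sigma>)" by (simp add: powr_add[symmetric])
      also have "r powr 2 = r\<^sup>2" using r powr_realpow[OF r, of 2] by simp
      finally show ?thesis using \<open>norm (r\<^sup>2 *\<^sub>R (4 *\<^sub>R ?m (r/2)) - r\<^sup>2 *\<^sub>R ?m r) \<le> K * r powr (3 + \<sigma>)\<close>
        by (simp only: scaleR_diff_right[symmetric] norm_scaleR) (simp add: mult.left_commute)
    qed
    then have "norm (4 *\<^sub>R ?m (r/2) - ?m r) \<le> K * r powr (1 + \<sigma>)" using r by simp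
    moreover have "norm (4 *\<^sub>R ?m (r/2)) \<le> norm (4 *\<^sub>R ?m (r/2) - ?m r) + norm (?m r)"
      using norm_triangle_sub[of "4 *\<^sub>R ?m (r/2)" "?m r"] by (simp only: add.commute)
    ultimately have "4 * norm (?m (r/2)) \<le> (C + K) * r powr (1 + \<sigma>)"
      using Suc unfolding r_def[symmetric] by (simp add: algebra_simps)
    also have "\<dots> \<le> (C * p) * r powr (1 + \<sigma>)"
    proof (rule mult_right_mono)
      have "K = K / (p - 1) * (p - 1)" using p by simp
      also have "\<dots> \<le> C * (p - 1)" using p K N by (intro mult_right_mono) (auto simp: C_def)
      finally show "C + K \<le> C * p" by (simp add: algebra_simps)
    qed simp
    finally have 4: "4 * norm (?m (r/2)) \<le> C * p * r powr (1 + \<sigma>)" .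
    have R: "r powr (1 + \<sigma>) = (r/2) powr (1 + \<sigma>) * 2 powr (1 + \<sigma>)"
      using powr_mult[of "r/2" 2 "1 + \<sigma>"] r by simp
    have pT: "p * 2 powr (1 + \<sigma>) = 2 powr 2"
      unfolding p_def powr_add[symmetric] by (rule arg_cong[of _ _ "\<lambda>e. 2 powr e"]) simp
    have "C * p * r powr (1 + \<sigma>) = C * (p * 2 powr (1 + \<sigma>)) * (r/2) powr (1 + \<sigma>)"
      unfolding R by (simp only: mult_ac)
    then have "C * p * r powr (1 + \<sigma>) = C * (2 powr 2) * (r/2) powr (1 + \<sigma>)"
      unfolding pT .
    also have "\<dots> = 4 * (C * (r/2) powr (1 + \<sigma>))" by simp
    finally have "norm (?m (r/2)) \<le> C * (r/2) powr (1 + \<sigma>)" using 4 by linarith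
    then show ?case by (simp add: r_def)
  qed
  then show ?thesis by blast
qed

text \<open>An arbitrary profile is compared with \<open>mol\<close> at the same scale by
  \<open>ker_compare\<close>; its total mass is at most a multiple of \<open>r\<^sup>2\<close>, so
  the growth known for \<open>mol\<close> carries over.\<close>

lemma ker_growth:
  assumes \<sigma>: "0 < \<sigma>" "\<sigma> < 1" and N: "N \<ge> 0" and b: "bump \<alpha>" "bump \<beta>"
  shows "\<exists>C. \<forall>(h::real^2 \<Rightarrow> 'b::euclidean_space) x k. L2le N h \<longrightarrow> gagliardo_le \<sigma> N h \<longrightarrow> x \<in> \<H> \<longrightarrow>
     norm (LINT y|HH. ker \<alpha> \<beta> ((1/2)^k) x y *\<^sub>R h y) \<le> C * ((1/2)^k) powr (1 + \<sigma>)"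
proof -
  obtain B1 where "B1 > 0" and B1: "\<And>r x y. \<bar>ker mol mol r x y\<bar> \<le> B1" using ker_bounded[OF mol_bump mol_bump] by blast
  obtain B2 where "B2 > 0" and B2: "\<And>r x y. \<bar>ker \<alpha> \<beta> r x y\<bar> \<le> B2" using ker_bounded[OF b] by blast
  define B where "B = max B1 B2"
  have B: "\<bar>ker mol mol r x y\<bar> \<le> B" "\<bar>ker \<alpha> \<beta> r x y\<bar> \<le> B" for r x y
    using B1[of r x y] B2[of r x y] by (auto simp: B_def)
  define K where "K = B^4 * 2 powr (2 + 2 * \<sigma>) + N"
  obtain C where C: "\<And>(h::real^2 \<Rightarrow> 'b) x k. L2le N h \<Longrightarrow> gagliardo_le \<sigma> N h \<Longrightarrow> x \<in> \<H> \<Longrightarrow>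
     norm (LINT y|HH. ker mol mol ((1/2)^k) x y *\<^sub>R h y) \<le> C * ((1/2)^k) powr (1 + \<sigma>)"
    using ker_growth_mol[OF \<sigma> N, where 'b = 'b] by blast
  have "norm (LINT y|HH. ker \<alpha> \<beta> ((1/2)^k) x y *\<^sub>R h y) \<le> (B * C + K) * ((1/2)^k) powr (1 + \<sigma>)"
    if h: "L2le N h" and G: "gagliardo_le \<sigma> N h" and x: "x \<in> \<H>" for h :: "real^2 \<Rightarrow> 'b" and x k
  proof -
    define r where "r = (1/2::real)^k"
    have r: "r > 0" by (simp add: r_def)
    let ?m = "LINT y|HH. ker mol mol r x y *\<^sub>R h y" and ?a = "LINT y|HH. ker \<alpha> \<beta> r x y *\<^sub>R h y"
    let ?I = "LINT y|HH. ker \<alpha> \<beta> r x y"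
    have "integrable HH (ker \<alpha> \<beta> r x)"
      using ker_cont_integrable[OF continuous_on_const b r x, of "1::real"] by simp
    then have "ennreal (norm ?I) \<le> (\<integral>\<^sup>+y. ennreal (norm (ker \<alpha> \<beta> r x y)) \<partial>HH)" by (rule integral_norm_bound_ennreal)
    also have "\<dots> \<le> (\<integral>\<^sup>+y. ennreal B * indicator (Q r x) y \<partial>HH)"
    proof (intro nn_integral_mono)
      fix y show "ennreal (norm (ker \<alpha> \<beta> r x y)) \<le> ennreal B * indicator (Q r x) y"
        using B(2) ker_zero[OF b r, of y x] by (cases "y \<in> Q r x") (auto intro: ennreal_leI)
    qed
    also have "\<dots> = ennreal (B * r\<^sup>2)"
      using emeasure_Q[OF x r] x order_trans[OF abs_ge_zero B(1)] by (simp add: nn_integral_cmult_indicator ennreal_mult)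
    finally have I: "\<bar>?I\<bar> \<le> B * r\<^sup>2"
      using order_trans[OF abs_ge_zero B(1)] by (subst (asm) ennreal_le_iff) auto
    have "r\<^sup>2 * norm ?a = norm (r\<^sup>2 *\<^sub>R ?a)" by simp
    also have "\<dots> \<le> norm (r\<^sup>2 *\<^sub>R ?a - ?I *\<^sub>R ?m) + norm (?I *\<^sub>R ?m)"
      using norm_triangle_sub[of "r\<^sup>2 *\<^sub>R ?a" "?I *\<^sub>R ?m"] by (simp only: add.commute)
    also have "\<dots> \<le> K * r powr (3 + \<sigma>) + (B * r\<^sup>2) * (C * r powr (1 + \<sigma>))"
    proof (rule add_mono)
      show "norm (r\<^sup>2 *\<^sub>R ?a - ?I *\<^sub>R ?m) \<le> K * r powr (3 + \<sigma>)"
        using ker_compare[OF b x r \<sigma>(1) B(2) B(1) h G] unfolding K_def .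
      show "norm (?I *\<^sub>R ?m) \<le> (B * r\<^sup>2) * (C * r powr (1 + \<sigma>))"
        using I C[OF h G x, of k] unfolding norm_scaleR r_def[symmetric] by (intro mult_mono) auto
    qed
    also have "r powr (3 + \<sigma>) = r\<^sup>2 * r powr (1 + \<sigma>)"
    proof -
      have "r powr (3 + \<sigma>) = r powr 2 * r powr (1 + \<sigma>)" by (simp add: powr_add[symmetric])
      also have "r powr 2 = r\<^sup>2" using r powr_realpow[OF r, of 2] by simp
      finally show ?thesis .
    qed
    finally have "r\<^sup>2 * norm ?a \<le> r\<^sup>2 * ((B * C + K) * r powr (1 + \<sigma>))" by (simp add: algebra_simps)
    then show ?thesis using r unfolding r_def[symmetric] by simp
  qed
  then show ?thesis by blast
qed

text \<open>The averages of \<open>g\<close> over dyadic scales r telescope. By parts, a difference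
  of consecutive averages is 1 / r times integrals of \<open>h1\<close> and \<open>h2\<close>
  against fixed profiles, which are of size r powr (1 + \<sigma>). The increments are thus of size r
  powr \<sigma>, a geometric sequence because \<sigma> > 0, and the average at scale 1 is bounded
  through \<open>h0\<close>.\<close>

lemma sup_bound_gagliardo:
  assumes \<sigma>: "0 < \<sigma>" "\<sigma> < 1" and N: "N \<ge> 0"
  shows "\<exists>C. \<forall>(g::real^2 \<Rightarrow> 'b::euclidean_space) h0 h1 h2. continuous_on \<H> g \<longrightarrow> pairs [] g h0 \<longrightarrow> pairs [1] g h1 \<longrightarrow> pairs [2] g h2 \<longrightarrow>
     L2le N h0 \<longrightarrow> L2le N h1 \<longrightarrow> L2le N h2 \<longrightarrow> gagliardo_le \<sigma> N h1 \<longrightarrow> gagliardo_le \<sigma> N h2 \<longrightarrow> (\<forall>x\<in>\<H>. norm (g x) \<le> C)"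
proof -
  obtain B where "B > 0" and B: "\<And>r x y. \<bar>ker mol mol r x y\<bar> \<le> B" using ker_bounded[OF mol_bump mol_bump] by blast
  let ?P = "step_diff 2"
  have P: "bump ?P" and P': "deriv ?P = (\<lambda>s. mol s - mol2 s)" by (simp_all add: step_diff mol2_def fun_eq_iff)
  obtain C1 where C1: "\<And>(h::real^2 \<Rightarrow> 'b) x k. L2le N h \<Longrightarrow> gagliardo_le \<sigma> N h \<Longrightarrow> x \<in> \<H> \<Longrightarrow>
     norm (LINT y|HH. ker ?P mol ((1/2)^k) x y *\<^sub>R h y) \<le> C1 * ((1/2)^k) powr (1 + \<sigma>)"
    using ker_growth[OF \<sigma> N P mol_bump, where 'b = 'b] by blast
  obtain C2 where C2: "\<And>(h::real^2 \<Rightarrow> 'b) x k. L2le N h \<Longrightarrow> gagliardo_le \<sigma> N h \<Longrightarrow> x \<in> \<H> \<Longrightarrow>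
     norm (LINT y|HH. ker mol2 ?P ((1/2)^k) x y *\<^sub>R h y) \<le> C2 * ((1/2)^k) powr (1 + \<sigma>)"
    using ker_growth[OF \<sigma> N mol2_bump P, where 'b = 'b] by blast
  define q where "q = (1/2::real) powr \<sigma>"
  have q: "0 < q" "q < 1" using \<sigma> powr_less_mono2[of \<sigma> "1/2" 1] by (simp_all add: q_def)
  show ?thesis
  proof (intro exI allI impI ballI)
    fix g h0 h1 h2 :: "real^2 \<Rightarrow> 'b" and x
    assume g: "continuous_on \<H> g" and p: "pairs [] g h0" "pairs [1] g h1" "pairs [2] g h2"
      and h: "L2le N h0" "L2le N h1" "L2le N h2" and G: "gagliardo_le \<sigma> N h1" "gagliardo_le \<sigma> N h2" and x: "x \<in> \<H>"
    define A where "A k = (1 / ((1/2::real)^k)\<^sup>2) *\<^sub>R (LINT y|HH. ker mol mol ((1/2)^k) x y *\<^sub>R g y)" for k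
    have A0: "norm (A 0) \<le> B\<^sup>2 + N"
    proof -
      have "A 0 = (LINT y|HH. ker mol mol 1 x y *\<^sub>R h0 y)"
        using pairs_ker[OF p(1) mol_bump mol_bump x, of 1] by (simp add: iter_partial_def A_def)
      then show ?thesis using ker_L2le_bound(2)[OF mol_bump mol_bump x zero_less_one B h(1)] by simp
    qed
    have step: "norm (A (Suc k)) \<le> norm (A k) + (C1 + C2) * q ^ k" for k
    proof -
      define r where "r = (1/2::real)^k"
      have r: "r > 0" by (simp add: r_def)
      note ii = ker_cont_integrable[OF g _ _ r x]
      \<comment> \<open>A difference of products changed one factor at a time: the first variable
        against \<open>mol\<close>, then the second against \<open>mol2\<close>. The factors r and
        1/r are kept apart because the derivative of a kernel at scale r carries 1/r.\<close>
      have k: "r * ((1/r) * ker (deriv ?P) mol r x y) + r * ((1/r) * ker mol2 (deriv ?P) r x y)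
          = ker mol mol r x y - ker mol2 mol2 r x y" for y
        using r by (simp add: ker_eq P' algebra_simps)
      have Ak: "A k = (1/r\<^sup>2) *\<^sub>R (LINT y|HH. ker mol mol r x y *\<^sub>R g y)"
        unfolding A_def r_def ..
      have A': "A (Suc k) = (1/r\<^sup>2) *\<^sub>R (LINT y|HH. ker mol2 mol2 r x y *\<^sub>R g y)"
      proof -
        have "(LINT y|HH. ker mol2 mol2 r x y *\<^sub>R g y) = 4 *\<^sub>R (LINT y|HH. ker mol mol (r/2) x y *\<^sub>R g y)"
          unfolding ker_mol2[OF r] scaleR_scaleR[symmetric] by (rule integral_scaleR_right)
        moreover have "(1/2) ^ Suc k = r / 2" by (simp add: r_def)
        moreover have "1 / (r/2)\<^sup>2 = 1 / r\<^sup>2 * 4" by (simp add: power_divide)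
        ultimately show ?thesis by (simp only: A_def scaleR_scaleR[symmetric])
      qed
      have "(LINT y|HH. ker mol mol r x y *\<^sub>R g y) - (LINT y|HH. ker mol2 mol2 r x y *\<^sub>R g y)
         = (LINT y|HH. (ker mol mol r x y - ker mol2 mol2 r x y) *\<^sub>R g y)"
        by (simp add: scaleR_diff_left ii mol_bump mol2_bump)
      also have "\<dots> = (LINT y|HH. r *\<^sub>R (((1/r) * ker (deriv ?P) mol r x y) *\<^sub>R g y) + r *\<^sub>R (((1/r) * ker mol2 (deriv ?P) r x y) *\<^sub>R g y))"
        unfolding k[symmetric] scaleR_add_left scaleR_scaleR ..
      also have "\<dots> = r *\<^sub>R (LINT y|HH. ((1/r) * ker (deriv ?P) mol r x y) *\<^sub>R g y) + r *\<^sub>R (LINT y|HH. ((1/r) * ker mol2 (deriv ?P) r x y) *\<^sub>R g y)"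
      proof -
        have "integrable HH (\<lambda>y. r *\<^sub>R (((1/r) * ker \<alpha> \<beta> r x y) *\<^sub>R g y))" if "bump \<alpha>" "bump \<beta>" for \<alpha> \<beta>
          unfolding scaleR_scaleR[symmetric, of "1/r"] by (intro integrable_scaleR_right ii that)
        then show ?thesis
          by (subst Bochner_Integration.integral_add) (simp_all only: integral_scaleR_right bump_deriv P mol_bump mol2_bump)
      qed
      also have "(LINT y|HH. ((1/r) * ker (deriv ?P) mol r x y) *\<^sub>R g y) = - (LINT y|HH. ker ?P mol r x y *\<^sub>R h1 y)"
        using pairs_ker[OF p(2) P mol_bump x r] by (simp add: iter_partial_def ker_partial P mol_bump r)
      also have "(LINT y|HH. ((1/r) * ker mol2 (deriv ?P) r x y) *\<^sub>R g y) = - (LINT y|HH. ker mol2 ?P r x y *\<^sub>R h2 y)"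
        using pairs_ker[OF p(3) mol2_bump P x r] by (simp add: iter_partial_def ker_partial P mol2_bump r)
      finally have eq: "A k - A (Suc k) = (1/r\<^sup>2) *\<^sub>R (r *\<^sub>R (- (LINT y|HH. ker ?P mol r x y *\<^sub>R h1 y)) + r *\<^sub>R (- (LINT y|HH. ker mol2 ?P r x y *\<^sub>R h2 y)))"
        unfolding A' Ak scaleR_diff_right[symmetric] by (simp only:)
      have "norm (A k - A (Suc k)) \<le> (1/r\<^sup>2) * (r * (C1 * r powr (1 + \<sigma>)) + r * (C2 * r powr (1 + \<sigma>)))"
        unfolding eq norm_scaleR
      proof (intro mult_mono)
        have "norm (r *\<^sub>R (- (LINT y|HH. ker ?P mol r x y *\<^sub>R h1 y)) + r *\<^sub>R (- (LINT y|HH. ker mol2 ?P r x y *\<^sub>R h2 y)))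
          \<le> r * norm (LINT y|HH. ker ?P mol r x y *\<^sub>R h1 y) + r * norm (LINT y|HH. ker mol2 ?P r x y *\<^sub>R h2 y)"
          using r norm_triangle_ineq[of "r *\<^sub>R (- (LINT y|HH. ker ?P mol r x y *\<^sub>R h1 y))" "r *\<^sub>R (- (LINT y|HH. ker mol2 ?P r x y *\<^sub>R h2 y))"] by simp
        also have "\<dots> \<le> r * (C1 * r powr (1 + \<sigma>)) + r * (C2 * r powr (1 + \<sigma>))"
          using r C1[OF h(2) G(1) x, of k, folded r_def] C2[OF h(3) G(2) x, of k, folded r_def]
          by (intro add_mono mult_left_mono) auto
        finally show "norm (r *\<^sub>R (- (LINT y|HH. ker ?P mol r x y *\<^sub>R h1 y)) + r *\<^sub>R (- (LINT y|HH. ker mol2 ?P r x y *\<^sub>R h2 y)))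
          \<le> r * (C1 * r powr (1 + \<sigma>)) + r * (C2 * r powr (1 + \<sigma>))" .
      qed auto
      also have "\<dots> = (C1 + C2) * r powr \<sigma>"
      proof -
        have "r powr (1 + \<sigma>) = r * r powr \<sigma>" using r by (simp add: powr_add)
        then show ?thesis using r by (simp add: field_simps power2_eq_square)
      qed
      also have "r powr \<sigma> = q ^ k" unfolding r_def q_def by (simp add: powr_powr powr_realpow[symmetric] mult.commute)
      finally have "norm (A k - A (Suc k)) \<le> (C1 + C2) * q ^ k" .
      then show ?thesis using norm_triangle_sub[of "A (Suc k)" "A k"] by (simp add: norm_minus_commute)
    qed
    have C12: "C1 + C2 \<ge> 0"
    proof -
      have "0 \<le> C1" "0 \<le> C2" using order_trans[OF norm_ge_zero C1[OF h(2) G(1) x, of 0]] order_trans[OF norm_ge_zero C2[OF h(3) G(2) x, of 0]] by simp_all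
      then show ?thesis by simp
    qed
    have sum: "norm (A k) \<le> B\<^sup>2 + N + (C1 + C2) * ((1 - q ^ k) / (1 - q))" for k
    proof (induction k)
      case (Suc k)
      have "(1 - q ^ Suc k) / (1 - q) = (1 - q ^ k) / (1 - q) + q ^ k"
        using q by (simp add: field_simps)
      then show ?case using step[of k] Suc by (simp add: distrib_left)
    qed (use A0 in simp)
    have bnd: "norm (A k) \<le> B\<^sup>2 + N + (C1 + C2) * (1 / (1 - q))" for k
    proof -
      have "(1 - q ^ k) / (1 - q) \<le> 1 / (1 - q)" using q by (intro divide_right_mono) auto
      then have "(C1 + C2) * ((1 - q ^ k) / (1 - q)) \<le> (C1 + C2) * (1 / (1 - q))" using C12 by (rule mult_left_mono)
      then show ?thesis using sum[of k] by linarith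
    qed
    have "A \<longlonglongrightarrow> g x"
      unfolding A_def by (rule ker_average_tendsto[OF g x]) (auto intro!: LIMSEQ_power_zero)
    then show "norm (g x) \<le> B\<^sup>2 + N + (C1 + C2) * (1 / (1 - q))"
      by (rule Lim_norm_ubound[rotated]) (use bnd in auto)
  qed
qed


subsection \<open>Uniform bounds for the solutions\<close>

lemma ennreal_sqrt_power2: "(ennreal_sqrt a)\<^sup>2 = a"
proof (cases "a = \<infinity>")
  case False
  then have "ennreal (enn2real a) = a" by (simp add: less_top)
  then show ?thesis using False by (simp add: ennreal_sqrt_def ennreal_power)
qed (simp add: ennreal_sqrt_def)

lemma ennreal_sqrt_le: "ennreal_sqrt a \<le> ennreal n \<Longrightarrow> n \<ge> 0 \<Longrightarrow> a \<le> ennreal (n\<^sup>2)"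
  using power_mono[of "ennreal_sqrt a" "ennreal n" 2] by (simp add: ennreal_sqrt_power2 ennreal_power)

lemma L2_norm_power2: "(L2_norm \<Omega> f)\<^sup>2 = (\<integral>\<^sup>+x. ennreal ((norm (f x))\<^sup>2) \<partial>lebesgue_on \<Omega>)"
  by (simp add: L2_norm_def ennreal_sqrt_power2)

text \<open>The compact boxes \<open>K n\<close> exhaust the open half plane, so \<open>h\<close> is
  the pointwise limit of its measurable restrictions.\<close>

lemma locally_integrable_measurable:
  fixes h :: "real^2 \<Rightarrow> 'b::euclidean_space"
  assumes "locally_integrable_on h \<H>"
  shows "h \<in> borel_measurable HH"
proof -
  define K where "K n = cbox (pt (- real n) (1 / real (Suc n))) (pt (real n) (real n))" for n
  have K: "compact (K n)" "K n \<subseteq> \<H>" for n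
  proof -
    show "compact (K n)" by (simp add: K_def)
    have "0 < x $ 2" if "1 / real (Suc n) \<le> x $ 2" for x :: "real^2"
      by (rule less_le_trans[OF _ that]) simp
    then show "K n \<subseteq> \<H>" by (simp add: K_def mem_box_real2 half_plane_def subset_eq)
  qed
  have "(\<lambda>x. indicator (K n) x *\<^sub>R h x) \<in> borel_measurable lebesgue" for n
    using assms[unfolded locally_integrable_on_def, rule_format, OF conjI[OF K]]
    unfolding set_integrable_def by (rule borel_measurable_integrable)
  then have m: "(\<lambda>x. indicator (K n) x *\<^sub>R h x) \<in> borel_measurable HH" for n
    by (rule measurable_restrict_space1)
  have "(\<lambda>n. indicator (K n) x *\<^sub>R h x) \<longlonglongrightarrow> h x" if x: "x \<in> space HH" for x
  proof -
    have x2: "x $ 2 > 0" using x by (simp add: half_plane_def)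
    obtain N1 where N1: "\<bar>x $ 1\<bar> + x $ 2 \<le> real N1" using real_arch_simple by blast
    obtain N2 where N2: "1 / x $ 2 \<le> real N2" using real_arch_simple by blast
    have "x \<in> K n" if "n \<ge> max N1 N2" for n
    proof -
      have "real N1 \<le> real n" "real N2 \<le> real n" using that by simp_all
      then have n: "\<bar>x $ 1\<bar> + x $ 2 \<le> real n" and "1 / x $ 2 \<le> real (Suc n)" using N1 N2 by simp_all
      then have "1 / real (Suc n) \<le> x $ 2" using x2 by (simp add: field_simps)
      then show ?thesis using n x2 by (simp add: K_def mem_box_real2) arith
    qed
    then have "eventually (\<lambda>n. indicator (K n) x *\<^sub>R h x = h x) sequentially"
      unfolding eventually_sequentially by (intro exI[of _ "max N1 N2"]) auto
    then show ?thesis by (rule tendsto_eventually)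
  qed
  from borel_measurable_LIMSEQ_metric[OF m this] show ?thesis .
qed

lemma L2le_of_pairs:
  assumes "continuous_on \<H> c" "pairs [] c h" "L2le K h"
  shows "(\<integral>\<^sup>+x. ennreal ((norm (c x))\<^sup>2) \<partial>HH) \<le> ennreal K"
proof -
  have "(\<integral>\<^sup>+x. ennreal ((norm (c x))\<^sup>2) \<partial>HH) \<le> (\<integral>\<^sup>+x. ennreal ((norm (h x))\<^sup>2) \<partial>HH)"
  proof (rule nn_integral_le_of_averages[OF assms(1)])
    show "h \<in> borel_measurable HH" using assms(3) by (simp add: L2le_def)
    show "(LINT y|HH. ker mol mol r x y *\<^sub>R c y) = (LINT y|HH. ker mol mol r x y *\<^sub>R h y)" if "x \<in> \<H>" "r > 0" for x r
      using pairs_ker[OF assms(2) mol_bump mol_bump that] by (simp add: iter_partial_def)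
  qed
  also have "\<dots> \<le> ennreal K" using assms(3) by (simp add: L2le_def)
  finally show ?thesis .
qed

text \<open>Applied to a first derivative of the solution, this lets the classical second derivative
  and the weak one have the same averages, which is all that the comparison of their norms
  requires.\<close>

lemma pairs_ibp:
  assumes "C1_half_plane g" "pairs [j] g h"
  shows "pairs [] (partial_H j g) h"
  unfolding pairs_def
proof (intro allI impI)
  fix \<alpha> \<beta> a b c d
  assume *: "smooth \<alpha>" "smooth \<beta>" "\<forall>x. x \<notin> {a..b} \<longrightarrow> \<alpha> x = 0" "\<forall>x. x \<notin> {c..d} \<longrightarrow> \<beta> x = 0" "0 < (c::real)"
  have "(LINT x|HH. iter_partial [j] (tp \<alpha> \<beta>) x *\<^sub>R g x) = (-1) ^ length [j] *\<^sub>R (LINT x|HH. tp \<alpha> \<beta> x *\<^sub>R h x)"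
    using assms(2) * unfolding pairs_def by blast
  moreover have "(LINT x|HH. partial_deriv UNIV j (tp \<alpha> \<beta>) x *\<^sub>R g x) = - (LINT x|HH. tp \<alpha> \<beta> x *\<^sub>R partial_H j g x)"
    by (rule tp_ibp[where a = a and b = b and c = c and d = d]) (use * assms(1) in auto)
  ultimately show "(LINT x|HH. iter_partial [] (tp \<alpha> \<beta>) x *\<^sub>R partial_H j g x) = (-1) ^ length ([]::2 list) *\<^sub>R (LINT x|HH. tp \<alpha> \<beta> x *\<^sub>R h x)"
    by (simp add: iter_partial_def)
qed

text \<open>The squared norm is a sum of nonnegative terms, so each term is below it. Membership in
  the Sobolev space provides existence, whence the choice in \<open>weak_derivative\<close> is a
  genuine weak derivative.\<close>

lemma sobolev_norm_bounds:
  fixes f :: "real^2 \<Rightarrow> 'b::euclidean_space"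
  assumes f: "f \<in> sobolev_space \<H> s" and n: "sobolev_norm \<H> s f \<le> ennreal n" "n \<ge> 0" and s: "s \<ge> 0"
  shows "length is \<le> nat \<lfloor>s\<rfloor> \<Longrightarrow> has_weak_derivative \<H> is f (weak_derivative \<H> is f) \<and> L2le (n\<^sup>2) (weak_derivative \<H> is f)"
    and "length is = nat \<lfloor>s\<rfloor> \<Longrightarrow> s \<noteq> real (nat \<lfloor>s\<rfloor>) \<Longrightarrow> gagliardo_le (s - real (nat \<lfloor>s\<rfloor>)) (n\<^sup>2) (weak_derivative \<H> is f)"
proof -
  let ?k = "nat \<lfloor>s\<rfloor>" and ?w = "\<lambda>is. weak_derivative \<H> is f"
  let ?X = "(\<Sum>is | length is \<le> ?k. (L2_norm \<H> (?w is))\<^sup>2)"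
  let ?Y = "(if s - real ?k = 0 then 0 else (\<Sum>is | length is = ?k. (gagliardo_seminorm \<H> (s - real ?k) (?w is))\<^sup>2))"
  have XY: "?X + ?Y \<le> ennreal (n\<^sup>2)"
    using ennreal_sqrt_le[of "?X + ?Y" n] n by (simp add: sobolev_norm_def Let_def)
  have X: "?X \<le> ennreal (n\<^sup>2)" and Y: "?Y \<le> ennreal (n\<^sup>2)"
    using XY by (auto intro: order_trans[rotated])
  have fin: "finite {is :: 2 list. length is \<le> ?k}" "finite {is :: 2 list. length is = ?k}"
    using finite_lists_length_le[of "UNIV :: 2 set" ?k] finite_lists_length_eq[of "UNIV :: 2 set" ?k] by simp_all
  { assume l: "length is \<le> ?k"
    have w: "has_weak_derivative \<H> is f (?w is)"
      using f l someI_ex[of "has_weak_derivative \<H> is f"] unfolding sobolev_space_def weak_derivative_def by auto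
    have "(\<integral>\<^sup>+x. ennreal ((norm (?w is x))\<^sup>2) \<partial>HH) = (L2_norm \<H> (?w is))\<^sup>2" by (simp add: L2_norm_power2)
    also have "\<dots> \<le> ?X" using l fin by (intro member_le_sum) auto
    finally have "(\<integral>\<^sup>+x. ennreal ((norm (?w is x))\<^sup>2) \<partial>HH) \<le> ennreal (n\<^sup>2)" using X by (rule order_trans)
    then have "L2le (n\<^sup>2) (?w is)" using locally_integrable_measurable w
      unfolding L2le_def has_weak_derivative_def by auto
    then show "has_weak_derivative \<H> is f (?w is) \<and> L2le (n\<^sup>2) (?w is)" using w by blast }
  { assume l: "length is = ?k" and ns: "s \<noteq> real ?k"
    have "(\<integral>\<^sup>+x. \<integral>\<^sup>+y. ennreal ((norm (?w is x - ?w is y))\<^sup>2 / norm (x - y) powr (2 + 2 * (s - real ?k))) \<partial>HH \<partial>HH)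
       = (gagliardo_seminorm \<H> (s - real ?k) (?w is))\<^sup>2"
      unfolding gagliardo_seminorm_def ennreal_sqrt_power2 by simp
    also have "\<dots> \<le> (\<Sum>is | length is = ?k. (gagliardo_seminorm \<H> (s - real ?k) (?w is))\<^sup>2)"
      using l fin by (intro member_le_sum) auto
    also have "\<dots> \<le> ennreal (n\<^sup>2)" using Y ns by simp
    finally show "gagliardo_le (s - real ?k) (n\<^sup>2) (?w is)" unfolding gagliardo_le_def . }
qed

text \<open>A single constant bounds a supremum and a squared norm, so that one number can be
  carried through all estimates in both capacities.\<close>

definition sup_L2_le :: "real \<Rightarrow> (real^2 \<Rightarrow> 'b::euclidean_space) \<Rightarrow> bool" where
  "sup_L2_le M f \<longleftrightarrow> (\<forall>x\<in>\<H>. norm (f x) \<le> M) \<and> (\<integral>\<^sup>+x. ennreal ((norm (f x))\<^sup>2) \<partial>HH) \<le> ennreal M"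

lemma sup_L2_leI:
  assumes "\<forall>x\<in>\<H>. norm (f x) \<le> A" "(\<integral>\<^sup>+x. ennreal ((norm (f x))\<^sup>2) \<partial>HH) \<le> ennreal B" "A \<le> M" "B \<le> M"
  shows "sup_L2_le M f"
  unfolding sup_L2_le_def
proof
  show "\<forall>x\<in>\<H>. norm (f x) \<le> M" using assms(1,3) by (auto intro: order_trans)
  show "(\<integral>\<^sup>+x. ennreal ((norm (f x))\<^sup>2) \<partial>HH) \<le> ennreal M"
    by (rule order_trans[OF assms(2) ennreal_leI[OF assms(4)]])
qed

lemma sup_L2_le_mono: "sup_L2_le M f \<Longrightarrow> M \<le> M' \<Longrightarrow> sup_L2_le M' f"
  using sup_L2_leI[of f M M M'] unfolding sup_L2_le_def by auto

text \<open>The gradient bound splits at s = 3. Below, the integer part of s is 2 and the second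
  derivatives have only the fractional regularity \<sigma> = s - 2; from 3 on, the third derivatives
  are square integrable and the mixed derivative bound applies. For \<open>f\<close> itself second
  derivatives suffice in both cases.\<close>

lemma sobolev_C1_bounds:
  assumes s: "s > 2" and n: "n \<ge> 0"
  shows "\<exists>M. \<forall>f::real^2 \<Rightarrow> 'b::euclidean_space. f \<in> sobolev_space \<H> s \<longrightarrow> sobolev_norm \<H> s f \<le> ennreal n \<longrightarrow> C1_half_plane f \<longrightarrow>
    sup_L2_le M f \<and> (\<forall>i. sup_L2_le M (partial_H i f)) \<and>
    (\<forall>i j. C1_half_plane (partial_H i f) \<longrightarrow> (\<integral>\<^sup>+x. ennreal ((norm (partial_H j (partial_H i f) x))\<^sup>2) \<partial>HH) \<le> ennreal M)"
proof -
  let ?N = "n\<^sup>2"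
  have fl: "nat \<lfloor>s\<rfloor> \<ge> 2" using s by linarith
  obtain C0 where C0: "\<And>(g::real^2 \<Rightarrow> 'b) h0 h1 h2 h12. continuous_on \<H> g \<Longrightarrow> pairs [] g h0 \<Longrightarrow> pairs [1] g h1 \<Longrightarrow> pairs [2] g h2 \<Longrightarrow>
     pairs [1,2] g h12 \<Longrightarrow> L2le ?N h0 \<Longrightarrow> L2le ?N h1 \<Longrightarrow> L2le ?N h2 \<Longrightarrow> L2le ?N h12 \<Longrightarrow> (\<forall>x\<in>\<H>. norm (g x) \<le> C0)"
    using sup_bound_mixed_derivative[of ?N, where 'b = 'b] by blast
  have "\<exists>C1. \<forall>(f::real^2 \<Rightarrow> 'b) i. f \<in> sobolev_space \<H> s \<longrightarrow> sobolev_norm \<H> s f \<le> ennreal n \<longrightarrow> C1_half_plane f \<longrightarrow>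
      (\<forall>x\<in>\<H>. norm (partial_H i f x) \<le> C1)"
  proof (cases "s < 3")
    case True
    have k: "nat \<lfloor>s\<rfloor> = 2" using s True by linarith
    define \<sigma> where "\<sigma> = s - 2"
    have \<sigma>: "0 < \<sigma>" "\<sigma> < 1" using s True by (auto simp: \<sigma>_def)
    obtain C1 where C1: "\<And>(g::real^2 \<Rightarrow> 'b) h0 h1 h2. continuous_on \<H> g \<Longrightarrow> pairs [] g h0 \<Longrightarrow> pairs [1] g h1 \<Longrightarrow> pairs [2] g h2 \<Longrightarrow>
     L2le ?N h0 \<Longrightarrow> L2le ?N h1 \<Longrightarrow> L2le ?N h2 \<Longrightarrow> gagliardo_le \<sigma> ?N h1 \<Longrightarrow> gagliardo_le \<sigma> ?N h2 \<Longrightarrow> (\<forall>x\<in>\<H>. norm (g x) \<le> C1)"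
      using sup_bound_gagliardo[OF \<sigma> zero_le_power2[of n], where 'b = 'b] by blast
    show ?thesis
    proof (intro exI allI impI)
      fix f :: "real^2 \<Rightarrow> 'b" and i assume f: "f \<in> sobolev_space \<H> s" "sobolev_norm \<H> s f \<le> ennreal n" "C1_half_plane f"
      note b = sobolev_norm_bounds[OF f(1,2) n, unfolded k, simplified]
      have s0: "s \<ge> 0" "s \<noteq> 2" using s by auto
      show "\<forall>x\<in>\<H>. norm (partial_H i f x) \<le> C1"
        by (rule C1[of _ "weak_derivative \<H> [i] f" "weak_derivative \<H> [i,1] f" "weak_derivative \<H> [i,2] f"])
          (use b s0 f(3) pairs_weak_derivative[OF f(3)] C1_half_planeD(2)[OF f(3)] in \<open>auto simp: \<sigma>_def\<close>)
    qed
  next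
    case False
    then have k: "nat \<lfloor>s\<rfloor> \<ge> 3" by linarith
    show ?thesis
    proof (intro exI allI impI)
      fix f :: "real^2 \<Rightarrow> 'b" and i assume f: "f \<in> sobolev_space \<H> s" "sobolev_norm \<H> s f \<le> ennreal n" "C1_half_plane f"
      have s0: "s \<ge> 0" using s by auto
      note b = sobolev_norm_bounds(1)[OF f(1,2) n s0]
      show "\<forall>x\<in>\<H>. norm (partial_H i f x) \<le> C0"
        by (rule C0[of _ "weak_derivative \<H> [i] f" "weak_derivative \<H> [i,1] f" "weak_derivative \<H> [i,2] f" "weak_derivative \<H> [i,1,2] f"])
          (use b k pairs_weak_derivative[OF f(3)] C1_half_planeD(2)[OF f(3)] in auto)
    qed
  qed
  then obtain C1 where C1: "\<And>(f::real^2 \<Rightarrow> 'b) i. f \<in> sobolev_space \<H> s \<Longrightarrow> sobolev_norm \<H> s f \<le> ennreal n \<Longrightarrow> C1_half_plane f \<Longrightarrow>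
      (\<forall>x\<in>\<H>. norm (partial_H i f x) \<le> C1)" by blast
  define M where "M = max ?N (max C0 C1)"
  show ?thesis
  proof (intro exI allI impI)
    fix f :: "real^2 \<Rightarrow> 'b" assume f: "f \<in> sobolev_space \<H> s" "sobolev_norm \<H> s f \<le> ennreal n" "C1_half_plane f"
    have s0: "s \<ge> 0" using s by auto
    note b = sobolev_norm_bounds(1)[OF f(1,2) n s0]
    have p: "pairs is f (weak_derivative \<H> is f)" if "length is \<le> nat \<lfloor>s\<rfloor>" for "is"
      using pairs_weak_derivative_0 b[OF that] by blast
    have "\<forall>x\<in>\<H>. norm (f x) \<le> C0"
      by (rule C0[of _ "weak_derivative \<H> [] f" "weak_derivative \<H> [1] f" "weak_derivative \<H> [2] f" "weak_derivative \<H> [1,2] f"])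
          (use b fl p C1_half_planeD(1)[OF f(3)] in auto)
    moreover have "(\<integral>\<^sup>+x. ennreal ((norm (f x))\<^sup>2) \<partial>HH) \<le> ennreal ?N"
      by (rule L2le_of_pairs[of _ "weak_derivative \<H> [] f"]) (use b fl p C1_half_planeD(1)[OF f(3)] in auto)
    ultimately have 1: "sup_L2_le M f" by (rule sup_L2_leI) (auto simp: M_def)
    have 2: "sup_L2_le M (partial_H i f)" for i
    proof -
      have "(\<integral>\<^sup>+x. ennreal ((norm (partial_H i f x))\<^sup>2) \<partial>HH) \<le> ennreal ?N"
        by (rule L2le_of_pairs[of _ "weak_derivative \<H> [i] f"]) 
          (use b[of "[i]"] fl pairs_weak_derivative[OF f(3)] C1_half_planeD(2)[OF f(3)] in auto)
      with C1[OF f, of i] show ?thesis by (rule sup_L2_leI) (auto simp: M_def)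
    qed
    have 3: "(\<integral>\<^sup>+x. ennreal ((norm (partial_H j (partial_H i f) x))\<^sup>2) \<partial>HH) \<le> ennreal M" if "C1_half_plane (partial_H i f)" for i j
    proof -
      have "(\<integral>\<^sup>+x. ennreal ((norm (partial_H j (partial_H i f) x))\<^sup>2) \<partial>HH) \<le> ennreal ?N"
        by (rule L2le_of_pairs[of _ "weak_derivative \<H> [i,j] f"]) 
          (use b[of "[i,j]"] fl pairs_ibp[OF that] pairs_weak_derivative[OF f(3)] C1_half_planeD(2)[OF that] in auto)
      also have "\<dots> \<le> ennreal M" by (intro ennreal_leI) (simp add: M_def)
      finally show ?thesis .
    qed
    show "sup_L2_le M f \<and> (\<forall>i. sup_L2_le M (partial_H i f)) \<and>
    (\<forall>i j. C1_half_plane (partial_H i f) \<longrightarrow> (\<integral>\<^sup>+x. ennreal ((norm (partial_H j (partial_H i f) x))\<^sup>2) \<partial>HH) \<le> ennreal M)"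
      using 1 2 3 by blast
  qed
qed

text \<open>A null set contains no interval of positive length, so good times accumulate at every
  point of the closed interval, the end points included.\<close>

lemma AE_interval_dense:
  fixes P :: "real \<Rightarrow> bool"
  assumes "AE t in lebesgue_on {0<..<T}. P t" "T > 0" "t \<in> {0..T}"
  obtains \<tau> where "\<And>n. \<tau> n \<in> {0<..<T}" "\<And>n. P (\<tau> n)" "\<tau> \<longlonglongrightarrow> t"
proof -
  have AE: "AE t in lebesgue. t \<in> {0<..<T} \<longrightarrow> P t"
    using assms(1) by (subst (asm) AE_restrict_space_iff) auto
  have "\<exists>x. x \<in> {0<..<T} \<and> P x \<and> \<bar>x - t\<bar> < inverse (real (Suc n))" for n
  proof (rule ccontr)
    define e where "e = inverse (real (Suc n))"
    have e: "e > 0" by (simp add: e_def)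
    assume "\<not> (\<exists>x. x \<in> {0<..<T} \<and> P x \<and> \<bar>x - t\<bar> < inverse (real (Suc n)))"
    then have no: "\<And>x. x \<in> {0<..<T} \<Longrightarrow> \<bar>x - t\<bar> < e \<Longrightarrow> \<not> P x" unfolding e_def by blast
    define a b where "a = max 0 (t - e)" and "b = min T (t + e)"
    have ab: "a < b" using assms(2,3) e by (auto simp: a_def b_def)
    have "AE x in lebesgue. x \<notin> {a<..<b}"
      using AE by eventually_elim (use no in \<open>auto simp: abs_less_iff a_def b_def\<close>)
    then have "{x \<in> space lebesgue. \<not> (x \<notin> {a<..<b})} \<in> null_sets lebesgue"
      by (subst (asm) AE_iff_null) auto
    moreover have "{x \<in> space lebesgue. \<not> (x \<notin> {a<..<b})} = {a<..<b}" by auto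
    ultimately have "emeasure lebesgue {a<..<b} = 0" by (simp only: null_sets_def mem_Collect_eq)
    then show False using ab by simp
  qed
  then obtain \<tau> where \<tau>: "\<And>n. \<tau> n \<in> {0<..<T} \<and> P (\<tau> n) \<and> \<bar>\<tau> n - t\<bar> < inverse (real (Suc n))" by metis
  have "(\<lambda>n. \<tau> n - t) \<longlonglongrightarrow> 0"
    by (rule Lim_null_comparison[OF _ LIMSEQ_inverse_real_of_nat]) (use \<tau> less_imp_le in \<open>auto intro!: always_eventually\<close>)
  then have "\<tau> \<longlonglongrightarrow> t" by (simp add: LIM_zero_iff)
  with \<tau> show ?thesis by (intro that[of \<tau>]) auto
qed

lemma nn_integral_limit_le:
  fixes F :: "nat \<Rightarrow> real^2 \<Rightarrow> 'b::euclidean_space"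
  assumes "\<And>n. F n \<in> borel_measurable HH" "\<And>x. x \<in> \<H> \<Longrightarrow> (\<lambda>n. F n x) \<longlonglongrightarrow> f x"
    "\<And>n. (\<integral>\<^sup>+x. ennreal ((norm (F n x))\<^sup>2) \<partial>HH) \<le> K"
  shows "(\<integral>\<^sup>+x. ennreal ((norm (f x))\<^sup>2) \<partial>HH) \<le> K"
proof -
  have "(\<integral>\<^sup>+x. ennreal ((norm (f x))\<^sup>2) \<partial>HH) = (\<integral>\<^sup>+x. liminf (\<lambda>n. ennreal ((norm (F n x))\<^sup>2)) \<partial>HH)"
    by (intro nn_integral_cong lim_imp_Liminf[symmetric] tendsto_intros assms(2)) auto
  also have "\<dots> \<le> liminf (\<lambda>n. \<integral>\<^sup>+x. ennreal ((norm (F n x))\<^sup>2) \<partial>HH)"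
    by (rule nn_integral_liminf) (use assms(1) in measurable)
  also have "\<dots> \<le> liminf (\<lambda>n::nat. K)"
    by (intro Liminf_mono always_eventually allI assms(3))
  also have "\<dots> = K" by (simp add: Liminf_const)
  finally show ?thesis .
qed

lemma continuous_on_slice:
  assumes "continuous_on (A \<times> B) (\<lambda>(t, x). F t x)" "t \<in> A"
  shows "continuous_on B (F t)"
proof -
  have "continuous_on B (\<lambda>x. (\<lambda>(t, x). F t x) (t, x))"
    by (rule continuous_on_compose2[OF assms(1)]) (use assms(2) in \<open>auto intro!: continuous_intros\<close>)
  then show ?thesis by simp
qed

lemma continuous_on_slice_tendsto:
  assumes "continuous_on (A \<times> B) (\<lambda>(t, x). F t x)" "t \<in> A" "x \<in> B" "\<And>n. \<tau> n \<in> A" "\<tau> \<longlonglongrightarrow> t"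
  shows "(\<lambda>n. F (\<tau> n) x) \<longlonglongrightarrow> F t x"
proof -
  have "(\<lambda>n. (\<tau> n, x)) \<longlonglongrightarrow> (t, x)" by (intro tendsto_intros assms)
  from continuous_on_tendsto_compose[OF assms(1) this] show ?thesis using assms by auto
qed

lemma sup_L2_le_limit:
  fixes F :: "real \<Rightarrow> real^2 \<Rightarrow> 'b::euclidean_space"
  assumes F: "continuous_on (A \<times> \<H>) (\<lambda>(t, x). F t x)" and t: "t \<in> A" "\<And>n. \<tau> n \<in> A" "\<tau> \<longlonglongrightarrow> t"
    and b: "\<And>n. sup_L2_le M (F (\<tau> n))"
  shows "sup_L2_le M (F t)"
  unfolding sup_L2_le_def
proof (intro conjI ballI)
  fix x assume x: "x \<in> \<H>"
  show "norm (F t x) \<le> M"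
    by (rule Lim_norm_ubound[OF _ continuous_on_slice_tendsto[OF F t(1) x t(2,3)]]) (use b x in \<open>auto simp: sup_L2_le_def\<close>)
next
  show "(\<integral>\<^sup>+x. ennreal ((norm (F t x))\<^sup>2) \<partial>HH) \<le> ennreal M"
    by (rule nn_integral_limit_le[of "\<lambda>n. F (\<tau> n)"])
      (use b continuous_on_slice_tendsto[OF F t(1) _ t(2,3)] continuous_measurable_HH[OF continuous_on_slice[OF F t(2)]]
       in \<open>auto simp: sup_L2_le_def\<close>)
qed

lemma classical_regularityD:
  assumes "classical_regularity T u p"
  shows "continuous_on ({0..T} \<times> closure \<H>) (\<lambda>(t, x). u t x)"
    "continuous_on ({0..T} \<times> closure \<H>) (\<lambda>(t, x). partial_H i (u t) x)"
    "t \<in> {0..T} \<Longrightarrow> C1_half_plane (u t)"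
proof -
  show c: "continuous_on ({0..T} \<times> closure \<H>) (\<lambda>(t, x). u t x)"
    "continuous_on ({0..T} \<times> closure \<H>) (\<lambda>(t, x). partial_H i (u t) x)" for i
    using assms by (auto simp: classical_regularity_def)
  assume t: "t \<in> {0..T}"
  have "u t differentiable_on \<H>" using assms t half_plane_subset_closure 
    by (auto simp: classical_regularity_def intro: differentiable_on_subset)
  moreover have "continuous_on \<H> (partial_H i (u t))" for i
    using continuous_on_slice[OF c(2) t] half_plane_subset_closure continuous_on_subset by blast
  ultimately show "C1_half_plane (u t)" by (simp add: C1_half_plane_def)
qed

text \<open>The Sobolev norm is controlled at almost every time only. Fields and gradients are
  continuous on the closed time interval, so their bounds pass to every time, by Fatou's lemma for
  the integrals. Second derivatives are continuous at interior times, and there the same argument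
  applies.\<close>

lemma solution_bounds:
  assumes T: "T > 0" and s: "s > 2" and u: "u \<in> Linf_sobolev T \<H> s" and r: "classical_regularity T u p"
  shows "\<exists>M>0. (\<forall>t\<in>{0..T}. sup_L2_le M (u t) \<and> (\<forall>i. sup_L2_le M (partial_H i (u t)))) \<and>
    (classical_second_order T u \<longrightarrow> (\<forall>t\<in>{0<..<T}. \<forall>i j. (\<integral>\<^sup>+x. ennreal ((norm (partial_H j (partial_H i (u t)) x))\<^sup>2) \<partial>HH) \<le> ennreal M))"
proof -
  define N where "N = Linf_norm T (sobolev_norm \<H> s) u"
  have "N < \<infinity>" using u by (simp add: N_def Linf_sobolev_def)
  then obtain n where n: "N = ennreal n" "n \<ge> 0" by (cases N) auto
  have AE: "AE t in lebesgue_on {0<..<T}. u t \<in> sobolev_space \<H> s \<and> sobolev_norm \<H> s (u t) \<le> ennreal n"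
  proof -
    have "AE t in lebesgue_on {0<..<T}. u t \<in> sobolev_space \<H> s" using u by (simp add: Linf_sobolev_def)
    moreover have "AE t in lebesgue_on {0<..<T}. sobolev_norm \<H> s (u t) \<le> ennreal n"
      using esssup_AE[of "\<lambda>t. sobolev_norm \<H> s (u t)" "lebesgue_on {0<..<T}"] n(1) by (simp add: N_def Linf_norm_def)
    ultimately show ?thesis by eventually_elim simp
  qed
  obtain M0 where M0: "\<And>f::real^2 \<Rightarrow> real^2. f \<in> sobolev_space \<H> s \<Longrightarrow> sobolev_norm \<H> s f \<le> ennreal n \<Longrightarrow> C1_half_plane f \<Longrightarrow>
    sup_L2_le M0 f \<and> (\<forall>i. sup_L2_le M0 (partial_H i f)) \<and>
    (\<forall>i j. C1_half_plane (partial_H i f) \<longrightarrow> (\<integral>\<^sup>+x. ennreal ((norm (partial_H j (partial_H i f) x))\<^sup>2) \<partial>HH) \<le> ennreal M0)"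
    using sobolev_C1_bounds[OF s n(2), where 'b = "real^2"] by blast
  define M where "M = max M0 1"
  have M: "M > 0" "M0 \<le> M" by (auto simp: M_def)
  have sub: "{0..T} \<times> \<H> \<subseteq> {0..T} \<times> closure \<H>" using half_plane_subset_closure by auto
  note c = continuous_on_subset[OF classical_regularityD(1)[OF r] sub]
     continuous_on_subset[OF classical_regularityD(2)[OF r] sub]
  have 1: "sup_L2_le M (u t)" "sup_L2_le M (partial_H i (u t))" if t: "t \<in> {0..T}" for t i
  proof -
    obtain \<tau> where \<tau>: "\<And>k. \<tau> k \<in> {0<..<T}" "\<And>k. u (\<tau> k) \<in> sobolev_space \<H> s \<and> sobolev_norm \<H> s (u (\<tau> k)) \<le> ennreal n" "\<tau> \<longlonglongrightarrow> t"
      by (rule AE_interval_dense[OF AE T t]) blast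
    have \<tau>': "\<tau> k \<in> {0..T}" for k using \<tau>(1)[of k] by auto
    have g: "sup_L2_le M (u (\<tau> k)) \<and> sup_L2_le M (partial_H i (u (\<tau> k)))" for k i
      using M0[OF conjunct1[OF \<tau>(2)[of k]] conjunct2[OF \<tau>(2)[of k]] classical_regularityD(3)[OF r \<tau>'[of k]]]
      by (auto intro: sup_L2_le_mono[OF _ M(2)])
    show "sup_L2_le M (u t)" by (rule sup_L2_le_limit[OF c(1) t \<tau>' \<tau>(3)]) (use g in auto)
    show "sup_L2_le M (partial_H i (u t))" by (rule sup_L2_le_limit[OF c(2) t \<tau>' \<tau>(3)]) (use g in auto)
  qed
  have 2: "(\<integral>\<^sup>+x. ennreal ((norm (partial_H j (partial_H i (u t)) x))\<^sup>2) \<partial>HH) \<le> ennreal M"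
    if so: "classical_second_order T u" and t: "t \<in> {0<..<T}" for t i j
  proof -
    have t': "t \<in> {0..T}" using t by auto
    have AE': "AE x in lebesgue_on {0<..<T}. (u x \<in> sobolev_space \<H> s \<and> sobolev_norm \<H> s (u x) \<le> ennreal n)"
      by (rule AE)
    obtain \<tau> where \<tau>: "\<And>k. \<tau> k \<in> {0<..<T}" "\<And>k. u (\<tau> k) \<in> sobolev_space \<H> s \<and> sobolev_norm \<H> s (u (\<tau> k)) \<le> ennreal n" "\<tau> \<longlonglongrightarrow> t"
      by (rule AE_interval_dense[OF AE T t']) blast
    have \<tau>': "\<tau> k \<in> {0..T}" for k using \<tau>(1)[of k] by auto
    have cc: "continuous_on ({0<..<T} \<times> \<H>) (\<lambda>(t, x). partial_H j (partial_H i (u t)) x)" for j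
      using so by (simp add: classical_second_order_def)
    have C1: "C1_half_plane (partial_H i (u (\<tau> k)))" for k
      using so \<tau>(1)[of k] continuous_on_slice[OF cc \<tau>(1)[of k]]
      by (simp add: C1_half_plane_def classical_second_order_def)
    have g: "(\<integral>\<^sup>+x. ennreal ((norm (partial_H j (partial_H i (u (\<tau> k))) x))\<^sup>2) \<partial>HH) \<le> ennreal M" for k
    proof -
      have "(\<integral>\<^sup>+x. ennreal ((norm (partial_H j (partial_H i (u (\<tau> k))) x))\<^sup>2) \<partial>HH) \<le> ennreal M0"
        using M0[OF conjunct1[OF \<tau>(2)[of k]] conjunct2[OF \<tau>(2)[of k]] classical_regularityD(3)[OF r \<tau>'[of k]]] C1[of k] by simp
      then show ?thesis by (rule order_trans[OF _ ennreal_leI[OF M(2)]])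
    qed
    show ?thesis
      by (rule nn_integral_limit_le[of "\<lambda>k. partial_H j (partial_H i (u (\<tau> k)))"])
       (use g continuous_on_slice_tendsto[OF cc t _ \<tau>(1,3)] continuous_measurable_HH[OF continuous_on_slice[OF cc \<tau>(1)]] in auto)
  qed
  show ?thesis
    by (intro exI[of _ M] conjI ballI impI allI 1 2 M(1))
qed


section \<open>Square integrable fields on the half plane\<close>

lemma nn_integral_le_integrable:
  fixes f :: "'a \<Rightarrow> real"
  assumes "f \<in> borel_measurable M" "\<And>x. f x \<ge> 0" "(\<integral>\<^sup>+x. ennreal (f x) \<partial>M) \<le> ennreal B" "B \<ge> 0"
  shows "integrable M f" "(LINT x|M. f x) \<le> B"
proof -
  have fin: "(\<integral>\<^sup>+x. ennreal (f x) \<partial>M) < \<infinity>" using assms(3) by (auto simp: less_top[symmetric] top_unique)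
  show i: "integrable M f" using assms(1,2) fin by (intro integrableI_bounded) auto
  have "ennreal (LINT x|M. f x) = (\<integral>\<^sup>+x. ennreal (f x) \<partial>M)"
    by (rule nn_integral_eq_integral[symmetric, OF i]) (use assms(2) in auto)
  then have "ennreal (LINT x|M. f x) \<le> ennreal B" using assms(3) by (simp only:)
  then show "(LINT x|M. f x) \<le> B" using assms(4) by (simp only: ennreal_le_iff)
qed

lemma L2le_power2:
  assumes "L2le N f"
  shows "integrable HH (\<lambda>x. (norm (f x))\<^sup>2)" "(LINT x|HH. (norm (f x))\<^sup>2) \<le> N" "f \<in> borel_measurable HH" "N \<ge> 0"
proof -
  show f [measurable]: "f \<in> borel_measurable HH" and N: "N \<ge> 0" using assms by (auto simp: L2le_def)
  have m: "(\<lambda>x. (norm (f x))\<^sup>2) \<in> borel_measurable HH" by measurable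
  have b: "(\<integral>\<^sup>+x. ennreal ((norm (f x))\<^sup>2) \<partial>HH) \<le> ennreal N" using assms by (simp add: L2le_def)
  show "integrable HH (\<lambda>x. (norm (f x))\<^sup>2)" "(LINT x|HH. (norm (f x))\<^sup>2) \<le> N"
    by (rule nn_integral_le_integrable[OF m _ b N], simp)+
qed

lemma L2le_add:
  fixes f g :: "real^2 \<Rightarrow> 'b::euclidean_space"
  assumes f: "L2le A f" and g: "L2le B g"
  shows "L2le (2 * (A + B)) (\<lambda>x. f x + g x)"
proof -
  note [measurable] = L2le_power2(3)[OF f] L2le_power2(3)[OF g]
  note nn = L2le_power2(4)[OF f] L2le_power2(4)[OF g]
  have "(\<integral>\<^sup>+x. ennreal ((norm (f x + g x))\<^sup>2) \<partial>HH) \<le>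
     (\<integral>\<^sup>+x. ennreal 2 * ennreal ((norm (f x))\<^sup>2) + ennreal 2 * ennreal ((norm (g x))\<^sup>2) \<partial>HH)"
  proof (rule nn_integral_mono)
    fix x
    have "(norm (f x + g x))\<^sup>2 \<le> (norm (f x) + norm (g x))\<^sup>2"
      by (intro power_mono norm_triangle_ineq) simp
    also have "\<dots> \<le> 2 * (norm (f x))\<^sup>2 + 2 * (norm (g x))\<^sup>2"
      using sum_squares_bound[of "norm (f x)" "norm (g x)"] by (simp add: power2_sum)
    finally have "ennreal ((norm (f x + g x))\<^sup>2) \<le> ennreal (2 * (norm (f x))\<^sup>2 + 2 * (norm (g x))\<^sup>2)" by (rule ennreal_leI)
    also have "\<dots> = ennreal 2 * ennreal ((norm (f x))\<^sup>2) + ennreal 2 * ennreal ((norm (g x))\<^sup>2)"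
      by (subst ennreal_plus) (simp_all add: ennreal_mult)
    finally show "ennreal ((norm (f x + g x))\<^sup>2) \<le> ennreal 2 * ennreal ((norm (f x))\<^sup>2) + ennreal 2 * ennreal ((norm (g x))\<^sup>2)" .
  qed
  also have "\<dots> = ennreal 2 * (\<integral>\<^sup>+x. ennreal ((norm (f x))\<^sup>2) \<partial>HH) + ennreal 2 * (\<integral>\<^sup>+x. ennreal ((norm (g x))\<^sup>2) \<partial>HH)"
    by (subst nn_integral_add) (simp_all add: nn_integral_cmult)
  also have "\<dots> \<le> ennreal 2 * ennreal A + ennreal 2 * ennreal B"
    using f g unfolding L2le_def by (intro add_mono mult_left_mono) auto
  also have "\<dots> = ennreal (2 * (A + B))" using nn by (simp add: ennreal_mult distrib_left)
  finally show ?thesis using nn by (simp add: L2le_def)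
qed

lemma L2le_minus: "L2le A f \<Longrightarrow> L2le A (\<lambda>x. - f x)" by (simp add: L2le_def)

lemma sup_L2_le_L2le:
  fixes f :: "real^2 \<Rightarrow> 'b::euclidean_space"
  assumes "sup_L2_le M f" "continuous_on \<H> f" shows "L2le M f"
proof -
  have "pt 0 1 \<in> \<H>" by (simp add: half_plane_def)
  then have "M \<ge> 0" using assms(1) norm_ge_zero order_trans unfolding sup_L2_le_def by blast
  then show ?thesis using assms continuous_measurable_HH by (auto simp: L2le_def sup_L2_le_def)
qed

subsection \<open>Integration by parts on the half plane\<close>

text \<open>Horizontal cutoff: equal to 1 on the interval from -n to n and zero outside the interval
  from -2n to 2n.\<close>

definition cutA :: "real \<Rightarrow> real \<Rightarrow> real" where
  "cutA n s = step ((1/n) * s + 2) * step ((-1/n) * s + 2)"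

text \<open>Vertical cutoff: it rises from 0 to 1 between the heights 1/m and 2/m and falls back to
  0 between n and 2n. The two parameters are separate so that the layer along the boundary can be
  made as thin as the data require after n is fixed.\<close>

definition cutB :: "real \<Rightarrow> real \<Rightarrow> real \<Rightarrow> real" where
  "cutB m n s = step (m * s + (-1)) * step ((-1/n) * s + 2)"

lemma step_affine_deriv: "((\<lambda>s. step (c * s + d)) has_real_derivative c * mol (c * s + d)) (at s)"
proof -
  have "((\<lambda>s. c * s + d) has_real_derivative c) (at s)" by (auto intro!: derivative_eq_intros)
  from DERIV_chain2[OF step_deriv this] show ?thesis by (simp only: mult.commute)
qed

lemma cut_smooth: "smooth (cutA n)" "smooth (cutB m n)"
  unfolding cutA_def[abs_def] cutB_def[abs_def] by (intro smooth_mult smooth_affine step_props(1))+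

lemma cutA_deriv: "deriv (cutA n) s = (1/n) * mol ((1/n) * s + 2) * step ((-1/n) * s + 2) - (1/n) * step ((1/n) * s + 2) * mol ((-1/n) * s + 2)"
proof (rule DERIV_imp_deriv)
  show "(cutA n has_real_derivative (1/n) * mol ((1/n) * s + 2) * step ((-1/n) * s + 2) - (1/n) * step ((1/n) * s + 2) * mol ((-1/n) * s + 2)) (at s)"
    unfolding cutA_def[abs_def]
    by (rule DERIV_cong[OF DERIV_mult[OF step_affine_deriv step_affine_deriv]]) simp
qed

lemma cutB_deriv: "deriv (cutB m n) s = m * mol (m * s + (-1)) * step ((-1/n) * s + 2) - (1/n) * step (m * s + (-1)) * mol ((-1/n) * s + 2)"
proof (rule DERIV_imp_deriv)
  show "(cutB m n has_real_derivative m * mol (m * s + (-1)) * step ((-1/n) * s + 2) - (1/n) * step (m * s + (-1)) * mol ((-1/n) * s + 2)) (at s)"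
    unfolding cutB_def[abs_def]
    by (rule DERIV_cong[OF DERIV_mult[OF step_affine_deriv step_affine_deriv]]) simp
qed

lemma mol_zero: "s \<notin> {0..1} \<Longrightarrow> mol s = 0" using mol_bump by (auto simp: bump_def)

lemma cutA_bounds: "0 \<le> cutA n s" "cutA n s \<le> 1" "0 \<le> cutB m n s" "cutB m n s \<le> 1"
  unfolding cutA_def cutB_def by (auto intro!: mult_le_one step_bounds mult_nonneg_nonneg)

lemma cutA_zero: "n > 0 \<Longrightarrow> s \<notin> {-2*n..2*n} \<Longrightarrow> cutA n s = 0"
proof -
  assume n: "n > 0" and "s \<notin> {-2*n..2*n}"
  then consider "s < -2*n" | "s > 2*n" by fastforce
  then show ?thesis
  proof cases
    case 1
    then have "(1/n) * s + 2 \<le> 0" using n by (simp add: field_simps)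
    then show ?thesis by (simp only: cutA_def step_props(2) mult_zero_left)
  next
    case 2
    then have "(-1/n) * s + 2 \<le> 0" using n by (simp add: field_simps)
    then show ?thesis by (simp only: cutA_def step_props(2) mult_zero_right)
  qed
qed

lemma cutB_zero: "n > 0 \<Longrightarrow> m > 0 \<Longrightarrow> s \<notin> {1/m..2*n} \<Longrightarrow> cutB m n s = 0"
proof -
  assume n: "n > 0" "m > 0" and "s \<notin> {1/m..2*n}"
  then consider "s < 1/m" | "s > 2*n" by fastforce
  then show ?thesis
  proof cases
    case 1
    then have "m * s + (-1) \<le> 0" using n by (simp add: field_simps)
    then show ?thesis by (simp only: cutB_def step_props(2) mult_zero_left)
  next
    case 2
    then have "(-1/n) * s + 2 \<le> 0" using n by (simp add: field_simps)
    then show ?thesis by (simp only: cutB_def step_props(2) mult_zero_right)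
  qed
qed

lemma cutA_one: "n > 0 \<Longrightarrow> \<bar>s\<bar> \<le> n \<Longrightarrow> cutA n s = 1"
proof -
  assume n: "n > 0" "\<bar>s\<bar> \<le> n"
  then have "(1/n) * s + 2 \<ge> 1" "(-1/n) * s + 2 \<ge> 1" by (auto simp: field_simps)
  then show ?thesis by (simp only: cutA_def step_props(3) mult_1)
qed

lemma cutB_one: "n > 0 \<Longrightarrow> m > 0 \<Longrightarrow> 2/m \<le> s \<Longrightarrow> s \<le> n \<Longrightarrow> cutB m n s = 1"
proof -
  assume n: "n > 0" "m > 0" "2/m \<le> s" "s \<le> n"
  then have "m * s + (-1) \<ge> 1" "(-1/n) * s + 2 \<ge> 1" by (auto simp: field_simps)
  then show ?thesis by (simp only: cutB_def step_props(3) mult_1)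
qed

lemma cutA_deriv_bound:
  assumes n: "n > 0" and M: "\<And>s. \<bar>mol s\<bar> \<le> M"
  shows "\<bar>deriv (cutA n) s\<bar> \<le> 2 * M / n" "\<bar>s\<bar> < n \<Longrightarrow> deriv (cutA n) s = 0" 
    "2 * n < \<bar>s\<bar> \<Longrightarrow> deriv (cutA n) s = 0"
proof -
  have M0: "M \<ge> 0" by (rule order_trans[OF abs_ge_zero M])
  have b1: "\<bar>(1/n) * mol ((1/n) * s + 2) * step ((-1/n) * s + 2)\<bar> \<le> (1/n) * M * 1"
    unfolding abs_mult using n M M0 step_bounds by (intro mult_mono) auto
  have b2: "\<bar>(1/n) * step ((1/n) * s + 2) * mol ((-1/n) * s + 2)\<bar> \<le> (1/n) * 1 * M"
    unfolding abs_mult using n M M0 step_bounds by (intro mult_mono) auto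
  have b3: "2 * M / n = (1/n) * M * 1 + (1/n) * 1 * M" by simp
  show "\<bar>deriv (cutA n) s\<bar> \<le> 2 * M / n"
    unfolding cutA_deriv b3 by (rule order_trans[OF abs_triangle_ineq4 add_mono[OF b1 b2]])
  show "deriv (cutA n) s = 0" if "\<bar>s\<bar> < n"
  proof (rule deriv_eq_0_of_locally_0[of "{-n<..<n}" s _ 1])
    show "cutA n y = 1" if "y \<in> {-n<..<n}" for y using that n by (intro cutA_one) auto
  qed (use that in auto)
  show "deriv (cutA n) s = 0" if "2 * n < \<bar>s\<bar>"
  proof (rule deriv_eq_0_of_locally_0[of "- {-2*n..2*n}" s _ 0])
    show "cutA n y = 0" if "y \<in> - {-2*n..2*n}" for y using that n by (intro cutA_zero) auto
  qed (use that in auto)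
qed

lemma cut_ibp:
  fixes f D :: "real^2 \<Rightarrow> real"
  assumes n: "n > 0" "m > 0" and f: "continuous_on \<H> f" "continuous_on \<H> D" "\<And>x. x \<in> \<H> \<Longrightarrow> has_pd f i (D x) x"
  shows "(LINT x|HH. tp (cutA n) (cutB m n) x * D x) =
    - (LINT x|HH. (if i = 1 then tp (deriv (cutA n)) (cutB m n) else tp (cutA n) (deriv (cutB m n))) x * f x)"
  using tp_ibp_pd[OF cut_smooth cutA_zero[OF n(1)] cutB_zero[OF n] _ f] n
  by (simp add: tp_partial[OF cut_smooth])

lemma cut_integrable:
  fixes f :: "real^2 \<Rightarrow> 'b::euclidean_space"
  assumes n: "n > 0" "m > 0" and f: "continuous_on \<H> f"
  shows "integrable HH (\<lambda>x. tp (cutA n) (cutB m n) x *\<^sub>R f x)"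
    "integrable HH (\<lambda>x. tp (deriv (cutA n)) (cutB m n) x *\<^sub>R f x)"
    "integrable HH (\<lambda>x. tp (cutA n) (deriv (cutB m n)) x *\<^sub>R f x)"
proof -
  have A: "deriv (cutA n) s = 0" if "s \<notin> {-2*n..2*n}" for s
    using deriv_eq_0_of_locally_0[of "- {-2*n..2*n}" s "cutA n" 0] that cutA_zero[OF n(1)] by auto
  have B: "deriv (cutB m n) s = 0" if "s \<notin> {1/m..2*n}" for s
    using deriv_eq_0_of_locally_0[of "- {1/m..2*n}" s "cutB m n" 0] that cutB_zero[OF n] by auto
  have m: "0 < 1/m" using n by simp
  note c = cut_smooth[of n] smooth_deriv[OF cut_smooth(1)] cut_smooth(2)[of m n] smooth_deriv[OF cut_smooth(2)]
  show "integrable HH (\<lambda>x. tp (cutA n) (cutB m n) x *\<^sub>R f x)"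
    by (rule tp_integrable[OF _ _ cutA_zero[OF n(1)] cutB_zero[OF n] m f]) (rule c)+
  show "integrable HH (\<lambda>x. tp (deriv (cutA n)) (cutB m n) x *\<^sub>R f x)"
    by (rule tp_integrable[OF _ _ A cutB_zero[OF n] m f]) (rule c)+
  show "integrable HH (\<lambda>x. tp (cutA n) (deriv (cutB m n)) x *\<^sub>R f x)"
    by (rule tp_integrable[OF _ _ cutA_zero[OF n(1)] B m f]) (rule c)+
qed

lemma cut_tendsto_1:
  assumes x: "x \<in> \<H>" and m: "\<And>k. m k \<ge> real (Suc k)"
  shows "(\<lambda>k. tp (cutA (real (Suc k))) (cutB (m k) (real (Suc k))) x) \<longlonglongrightarrow> 1"
proof (rule tendsto_eventually)
  have x2: "x $ 2 > 0" using x by (simp add: half_plane_def)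
  obtain N where N: "max (\<bar>x $ 1\<bar> + x $ 2) (2 / x $ 2) \<le> real N" using real_arch_simple by blast
  show "eventually (\<lambda>k. tp (cutA (real (Suc k))) (cutB (m k) (real (Suc k))) x = 1) sequentially"
    unfolding eventually_sequentially
  proof (intro exI allI impI)
    fix k assume k: "N \<le> k"
    have n: "real (Suc k) > 0" "m k > 0" using m[of k] by (auto intro: less_le_trans[of 0 "real (Suc k)"])
    have *: "\<bar>x $ 1\<bar> + x $ 2 \<le> real (Suc k)" "2 / x $ 2 \<le> m k"
      using N k m[of k] by auto
    have "2 / m k \<le> x $ 2" using *(2) n x2 by (simp add: field_simps)
    then have "cutB (m k) (real (Suc k)) (x$2) = 1" using * x2 n by (intro cutB_one) auto
    moreover have "cutA (real (Suc k)) (x$1) = 1" using * x2 n by (intro cutA_one) auto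
    ultimately show "tp (cutA (real (Suc k))) (cutB (m k) (real (Suc k))) x = 1" by (simp add: tp_def)
  qed
qed

lemma cut_measurable [measurable]:
  "tp (cutA n) (cutB m n) \<in> borel_measurable HH"
  "tp (deriv (cutA n)) (cutB m n) \<in> borel_measurable HH"
  "tp (cutA n) (deriv (cutB m n)) \<in> borel_measurable HH"
  by (intro continuous_measurable_HH tp_continuous_on cut_smooth smooth_deriv)+

lemma cut_dominated:
  fixes f :: "real^2 \<Rightarrow> real"
  assumes f: "integrable HH f" and m: "\<And>k. m k \<ge> real (Suc k)"
  shows "(\<lambda>k. LINT x|HH. tp (cutA (real (Suc k))) (cutB (m k) (real (Suc k))) x * f x) \<longlonglongrightarrow> (LINT x|HH. f x)"
proof (rule integral_dominated_convergence[where w = "\<lambda>x. \<bar>f x\<bar>"])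
  show "AE x in HH. (\<lambda>k. tp (cutA (real (Suc k))) (cutB (m k) (real (Suc k))) x * f x) \<longlonglongrightarrow> f x"
  proof (rule AE_I2)
    fix x assume "x \<in> space HH"
    then have "(\<lambda>k. tp (cutA (real (Suc k))) (cutB (m k) (real (Suc k))) x * f x) \<longlonglongrightarrow> 1 * f x"
      by (intro tendsto_intros cut_tendsto_1 m) simp
    then show "(\<lambda>k. tp (cutA (real (Suc k))) (cutB (m k) (real (Suc k))) x * f x) \<longlonglongrightarrow> f x" by simp
  qed
  show "AE x in HH. norm (tp (cutA (real (Suc k))) (cutB (m k) (real (Suc k))) x * f x) \<le> \<bar>f x\<bar>" for k
  proof (rule AE_I2)
    fix x
    have "\<bar>tp (cutA (real (Suc k))) (cutB (m k) (real (Suc k))) x\<bar> \<le> 1"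
      unfolding tp_def abs_mult using cutA_bounds by (intro mult_le_one) auto
    then show "norm (tp (cutA (real (Suc k))) (cutB (m k) (real (Suc k))) x * f x) \<le> \<bar>f x\<bar>"
      by (simp add: abs_mult mult_left_le_one_le)
  qed
qed (use f in auto)

text \<open>The cutoff near the boundary produces the boundary integral of \<open>- Z2\<close>, which has a sign;
  its width is chosen after its horizontal extent.\<close>

lemma integral_divergence_nonpos:
  fixes Z1 Z2 D1 D2 :: "real^2 \<Rightarrow> real"
  assumes Z1: "continuous_on \<H> Z1" and Z2: "continuous_on (closure \<H>) Z2"
    and D: "continuous_on \<H> D1" "continuous_on \<H> D2"
    and pd: "\<And>x. x \<in> \<H> \<Longrightarrow> has_pd Z1 1 (D1 x) x" "\<And>x. x \<in> \<H> \<Longrightarrow> has_pd Z2 2 (D2 x) x"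
    and int: "integrable HH Z1" "integrable HH Z2" "integrable HH (\<lambda>x. D1 x + D2 x)"
    and bd: "\<And>a. Z2 (pt a 0) \<ge> 0"
  shows "(LINT x|HH. D1 x + D2 x) \<le> 0"
proof -
  obtain M where M: "M > 0" "\<And>x. \<bar>mol x\<bar> \<le> M" using bump_bounded[OF mol_bump] by blast
  have Z2': "continuous_on \<H> Z2" using Z2 half_plane_subset_closure continuous_on_subset by blast
  \<comment> \<open>Uniform continuity on a compact rectangle extends the sign of \<open>Z2\<close>
    on its lower edge to a thin strip, up to an error. The cutoff has slope of order m on a strip of
    measure 4 * n / m, so the error is multiplied by a constant times n; the tolerance
    \<open>1/n\<^sup>2\<close> leaves a quantity of order 1/n.\<close>
  have ex: "\<exists>m. m \<ge> n \<and> (\<forall>x\<in>cbox (pt (-2*n) 0) (pt (2*n) (2/m)). Z2 x \<ge> - (1/n\<^sup>2))" if n: "n \<ge> 1" for n :: real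
  proof -
    let ?K = "cbox (pt (-2*n) 0) (pt (2*n) 1)"
    have "?K \<subseteq> closure \<H>" by (auto simp: closure_half_plane mem_box_real2)
    then have "uniformly_continuous_on ?K Z2"
      using Z2 continuous_on_subset by (intro compact_uniformly_continuous) auto
    moreover have "1/n\<^sup>2 > 0" using n by simp
    ultimately obtain d where d: "d > 0" "\<And>x y. x \<in> ?K \<Longrightarrow> y \<in> ?K \<Longrightarrow> dist y x < d \<Longrightarrow> dist (Z2 y) (Z2 x) < 1/n\<^sup>2"
      unfolding uniformly_continuous_on_def by blast
    define m where "m = max n (max 2 (3/d))"
    have m: "m \<ge> n" "m \<ge> 2" "m \<ge> 3/d" by (auto simp: m_def)
    have m0: "m > 0" using m(2) by simp
    have m2: "2/m < d" "2/m \<le> 1" using m(2,3) m0 d(1) by (auto simp: field_simps)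
    have "Z2 x \<ge> - (1/n\<^sup>2)" if x: "x \<in> cbox (pt (-2*n) 0) (pt (2*n) (2/m))" for x
    proof -
      have x1: "x \<in> ?K" "pt (x$1) 0 \<in> ?K" using x m2 by (auto simp: mem_box_real2)
      have "dist x (pt (x$1) 0) \<le> \<bar>x$2\<bar>" using norm_le_l1_cart[of "x - pt (x$1) 0"] by (simp add: dist_norm sum_2)
      also have "\<dots> < d" using x m2 by (auto simp: mem_box_real2)
      finally have "dist (Z2 x) (Z2 (pt (x$1) 0)) < 1/n\<^sup>2" by (rule d(2)[OF x1(2,1)])
      then show ?thesis using bd[of "x$1"] by (simp add: dist_real_def)
    qed
    then show ?thesis using m(1) by blast
  qed
  have "\<exists>m. m \<ge> real (Suc k) \<and> (\<forall>x\<in>cbox (pt (-2*real (Suc k)) 0) (pt (2*real (Suc k)) (2/m)). Z2 x \<ge> - (1/(real (Suc k))\<^sup>2))" for k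
    by (rule ex) simp
  then obtain m where m: "\<And>k. m k \<ge> real (Suc k)"
     "\<And>k x. x \<in> cbox (pt (-2*real (Suc k)) 0) (pt (2*real (Suc k)) (2/m k)) \<Longrightarrow> Z2 x \<ge> - (1/(real (Suc k))\<^sup>2)"
    by metis
  define I1 where "I1 = (LINT x|HH. \<bar>Z1 x\<bar>)"
  define I2 where "I2 = (LINT x|HH. \<bar>Z2 x\<bar>)"
  have bnd: "(LINT x|HH. tp (cutA (real (Suc k))) (cutB (m k) (real (Suc k))) x * (D1 x + D2 x)) \<le> (2 * M * I1 + 4 * M + M * I2) * inverse (real (Suc k))" for k
  proof -
    define n where "n = real (Suc k)"
    have n: "n > 0" "m k > 0" using m(1)[of k] by (auto simp: n_def intro: less_le_trans[of 0 "real (Suc k)"])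
    let ?c = "tp (cutA n) (cutB (m k) n)" and ?c1 = "tp (deriv (cutA n)) (cutB (m k) n)" and ?c2 = "tp (cutA n) (deriv (cutB (m k) n))"
    \<comment> \<open>Splitting is legitimate only under the cutoff: separately \<open>D1\<close>
      and \<open>D2\<close> are merely continuous.\<close>
    have "(LINT x|HH. ?c x * (D1 x + D2 x)) = (LINT x|HH. ?c x * D1 x) + (LINT x|HH. ?c x * D2 x)"
      using cut_integrable(1)[OF n D(1)] cut_integrable(1)[OF n D(2)] by (simp add: distrib_left)
    also have "\<dots> = (LINT x|HH. - (?c1 x * Z1 x)) + (LINT x|HH. - (?c2 x * Z2 x))"
      using cut_ibp[OF n Z1 D(1) pd(1)] cut_ibp[OF n Z2' D(2) pd(2)] by simp
    also have "\<dots> \<le> 2 * M / n * I1 + ((1/n\<^sup>2) * m k * M * (4 * n * (1 / m k)) + M / n * I2)"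
    proof (rule add_mono)
      have "(LINT x|HH. - (?c1 x * Z1 x)) \<le> (LINT x|HH. 2 * M / n * \<bar>Z1 x\<bar>)"
      proof (rule integral_mono)
        show "integrable HH (\<lambda>x. - (?c1 x * Z1 x))" using cut_integrable(2)[OF n Z1] by simp
        show "integrable HH (\<lambda>x. 2 * M / n * \<bar>Z1 x\<bar>)" using int by simp
        fix x
        have "\<bar>?c1 x\<bar> \<le> 2 * M / n * 1" unfolding tp_def abs_mult
          using cutA_deriv_bound(1)[OF n(1) M(2)] cutA_bounds M n by (intro mult_mono) auto
        then have "\<bar>?c1 x\<bar> * \<bar>Z1 x\<bar> \<le> 2 * M / n * \<bar>Z1 x\<bar>" by (intro mult_right_mono) auto
        then show "- (?c1 x * Z1 x) \<le> 2 * M / n * \<bar>Z1 x\<bar>" by (simp only: abs_mult[symmetric])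
      qed
      then show "(LINT x|HH. - (?c1 x * Z1 x)) \<le> 2 * M / n * I1" by (simp add: I1_def)
      let ?B = "cbox (pt (-2*n) (1/m k)) (pt (2*n) (2/m k))"
      have BH: "?B \<subseteq> \<H>" using n by (auto simp: mem_box_real2 half_plane_def intro: less_le_trans[of 0 "1 / m k"])
      have Bs: "?B \<in> sets HH" using BH half_plane_lebesgue by (subst sets_restrict_space_iff) auto
      have eB: "emeasure HH ?B = ennreal (4 * n * (1 / m k))"
      proof -
        have "emeasure HH ?B = emeasure lborel ?B"
          using BH half_plane_lebesgue by (subst emeasure_restrict_space) auto
        also have "\<dots> = ennreal ((2*n - -2*n) * (2/m k - 1/m k))"
          using n by (subst emeasure_lborel_cbox_eq) (auto simp: Basis_real2 inner_axis field_simps)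
        finally show ?thesis by (simp add: diff_divide_distrib[symmetric])
      qed
      have mB: "measure HH ?B = 4 * n * (1 / m k)" using eB n by (simp add: measure_def)
      have iB: "integrable HH (\<lambda>x. indicator ?B x :: real)" by (rule integrable_real_indicator[OF Bs]) (simp only: eB ennreal_less_top infinity_ennreal_def)
      have "(LINT x|HH. - (?c2 x * Z2 x)) \<le> (LINT x|HH. (1/n\<^sup>2) * m k * M * indicator ?B x + M / n * \<bar>Z2 x\<bar>)"
      proof (rule integral_mono)
        show "integrable HH (\<lambda>x. - (?c2 x * Z2 x))" using cut_integrable(3)[OF n Z2'] by simp
        show "integrable HH (\<lambda>x. (1/n\<^sup>2) * m k * M * indicator ?B x + M / n * \<bar>Z2 x\<bar>)" using int iB by simp
        fix x assume "x \<in> space HH"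
        \<comment> \<open>The derivative of the vertical cutoff is m times \<open>P\<close>, from
          the layer along the boundary, minus 1/n times \<open>R\<close>, from large heights. As
          \<open>P\<close> is nonnegative, only a lower bound for \<open>Z2\<close> enters near the
          boundary.\<close>
        define P where "P = cutA n (x$1) * (mol (m k * x$2 + (-1)) * step ((-1/n) * x$2 + 2))"
        define R where "R = cutA n (x$1) * (step (m k * x$2 + (-1)) * mol ((-1/n) * x$2 + 2))"
        have R: "\<bar>R\<bar> \<le> 1 * (1 * M)" unfolding R_def abs_mult
          using cutA_bounds M step_bounds by (intro mult_mono) auto
        have P: "0 \<le> P" unfolding P_def
          by (intro mult_nonneg_nonneg cutA_bounds step_bounds mol_nonneg)
        have P': "P \<le> 1 * (M * 1)" unfolding P_def
          by (intro mult_mono mult_nonneg_nonneg cutA_bounds step_bounds mol_nonneg order_trans[OF abs_ge_self M(2)]) (use M in auto)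
        have PZ: "- (P * Z2 x) \<le> (1/n\<^sup>2) * M * indicator ?B x"
        proof (cases "x \<in> ?B")
          case True
          then have "x \<in> cbox (pt (-2*n) 0) (pt (2*n) (2/m k))" using n(2) by (auto simp: mem_box_real2 intro: order_trans[of 0 "1/m k"])
          then have "Z2 x \<ge> - (1/n\<^sup>2)" using m(2)[of x k] by (simp add: n_def)
          then have "- Z2 x \<le> 1/n\<^sup>2" by simp
          then have "P * (- Z2 x) \<le> P * (1/n\<^sup>2)" using P by (rule mult_left_mono)
          also have "\<dots> \<le> M * (1/n\<^sup>2)" using P' by (intro mult_right_mono) auto
          finally show ?thesis using True by (simp add: mult.commute)
        next
          case False
          then consider "x$1 \<notin> {-2*n..2*n}" | "x$2 < 1/m k" | "x$2 > 2/m k" by (fastforce simp: mem_box_real2)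
          then have "P = 0"
          proof cases
            case 1 then show ?thesis using cutA_zero[OF n(1)] by (simp add: P_def)
          next
            case 2 
            then have "m k * x$2 + (-1) \<notin> {0..1}" using n by (simp add: field_simps)
            then have "mol (m k * x$2 + (-1)) = 0" by (rule mol_zero)
            then show ?thesis by (simp only: P_def mult_zero_left mult_zero_right)
          next
            case 3
            then have "m k * x$2 + (-1) \<notin> {0..1}" using n by (simp add: field_simps)
            then have "mol (m k * x$2 + (-1)) = 0" by (rule mol_zero)
            then show ?thesis by (simp only: P_def mult_zero_left mult_zero_right)
          qed
          then show ?thesis using False by simp
        qed
        have "- (?c2 x * Z2 x) = m k * (- (P * Z2 x)) + (1/n) * (R * Z2 x)"
          unfolding tp_def cutB_deriv P_def R_def by (simp add: algebra_simps)
        also have "\<dots> \<le> m k * ((1/n\<^sup>2) * M * indicator ?B x) + (1/n) * (M * \<bar>Z2 x\<bar>)"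
        proof (intro add_mono mult_left_mono PZ)
          have "R * Z2 x \<le> \<bar>R\<bar> * \<bar>Z2 x\<bar>" by (simp only: abs_mult[symmetric] abs_ge_self)
          also have "\<dots> \<le> M * \<bar>Z2 x\<bar>" using R by (intro mult_right_mono) auto
          finally show "R * Z2 x \<le> M * \<bar>Z2 x\<bar>" .
        qed (use n in auto)
        finally show "- (?c2 x * Z2 x) \<le> (1/n\<^sup>2) * m k * M * indicator ?B x + M / n * \<bar>Z2 x\<bar>"
          by (simp add: mult_ac)
      qed
      also have "\<dots> = (1/n\<^sup>2) * m k * M * (4 * n * (1 / m k)) + M / n * I2"
      proof -
        have "?B \<inter> space HH = ?B" using BH by (simp only: space_HH Int_absorb2)
        then have intB: "(LINT x|HH. indicator ?B x) = 4 * n * (1 / m k)"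
          by (simp only: Bochner_Integration.integral_indicator mB)
        have i1: "integrable HH (\<lambda>x. (1/n\<^sup>2) * m k * M * indicator ?B x)" using iB by (rule integrable_mult_right)
        have i2: "integrable HH (\<lambda>x. M / n * \<bar>Z2 x\<bar>)" using int by simp
        show ?thesis unfolding Bochner_Integration.integral_add[OF i1 i2] integral_mult_right_zero intB I2_def ..
      qed
      finally show "(LINT x|HH. - (?c2 x * Z2 x)) \<le> (1/n\<^sup>2) * m k * M * (4 * n * (1 / m k)) + M / n * I2" .
    qed
    also have "\<dots> = (2 * M * I1 + 4 * M + M * I2) * inverse n"
      using n by (simp add: field_simps power2_eq_square)
    finally show ?thesis by (simp only: n_def)
  qed
  have "(\<lambda>k. (2 * M * I1 + 4 * M + M * I2) * inverse (real (Suc k))) \<longlonglongrightarrow> (2 * M * I1 + 4 * M + M * I2) * 0"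
    by (intro tendsto_intros LIMSEQ_inverse_real_of_nat)
  then have "(\<lambda>k. (2 * M * I1 + 4 * M + M * I2) * inverse (real (Suc k))) \<longlonglongrightarrow> 0" by simp
  from LIMSEQ_le[OF cut_dominated[OF int(3) m(1)] this] bnd show ?thesis by blast
qed


subsection \<open>Gradients are orthogonal to solenoidal fields\<close>

text \<open>Moving in the tangential direction stays in the closed half plane. So the derivative
  within that set is an ordinary derivative along the line, even at boundary points.\<close>

lemma partial_H_has_pd_1:
  assumes "f differentiable (at x within closure \<H>)" "x \<in> closure \<H>"
  shows "has_pd f 1 (partial_H 1 f x) x"
proof -
  let ?f' = "frechet_derivative f (at x within closure \<H>)" and ?l = "\<lambda>t. x + t *\<^sub>R axis 1 1 :: real^2"
  have f: "(f has_derivative ?f') (at x within closure \<H>)" using assms(1) by (simp add: frechet_derivative_works)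
  have "range ?l \<subseteq> closure \<H>" using assms(2) by (auto simp: closure_half_plane axis_def)
  then have "(f has_derivative ?f') (at (?l 0) within range ?l)"
    using has_derivative_subset[OF f] by simp
  moreover have "(?l has_derivative (\<lambda>t. t *\<^sub>R axis 1 1)) (at 0)" by (auto intro!: derivative_eq_intros)
  ultimately have "((\<lambda>t. f (?l t)) has_derivative (\<lambda>t. ?f' (t *\<^sub>R axis 1 1))) (at 0)"
    by (rule has_derivative_in_compose[rotated])
  moreover have "linear ?f'" using f has_derivative_linear by blast
  ultimately show ?thesis
    by (simp add: has_pd_def has_vector_derivative_def partial_deriv_def linear_scale)
qed

text \<open>The derivatives are a separate argument because sums of such fields are needed: at boundary
  points \<^const>\<open>partial_deriv\<close> selects some derivative, and its additivity would require uniqueness there.\<close>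

definition solenoidal :: "real \<Rightarrow> (real^2 \<Rightarrow> real^2) \<Rightarrow> (2 \<Rightarrow> real^2 \<Rightarrow> real^2) \<Rightarrow> bool" where
  "solenoidal M v Dv \<longleftrightarrow> continuous_on (closure \<H>) v \<and> (\<forall>i. continuous_on (closure \<H>) (Dv i)) \<and>
     (\<forall>x\<in>\<H>. \<forall>i. has_pd v i (Dv i x) x) \<and> (\<forall>x\<in>closure \<H>. has_pd v 1 (Dv 1 x) x) \<and>
     (\<forall>x\<in>\<H>. Dv 1 x $ 1 + Dv 2 x $ 2 = 0) \<and> (\<forall>a. v (pt a 0) $ 2 = 0) \<and> sup_L2_le M v"

lemma solenoidalD:
  assumes "solenoidal M v Dv"
  shows "continuous_on (closure \<H>) v" "continuous_on (closure \<H>) (Dv i)"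
    "continuous_on \<H> v" "continuous_on \<H> (Dv i)"
    "x \<in> \<H> \<Longrightarrow> has_pd v i (Dv i x) x" "x \<in> closure \<H> \<Longrightarrow> has_pd v 1 (Dv 1 x) x"
    "x \<in> \<H> \<Longrightarrow> Dv 1 x $ 1 + Dv 2 x $ 2 = 0" "v (pt a 0) $ 2 = 0" 
    "x \<in> \<H> \<Longrightarrow> norm (v x) \<le> M" "(\<integral>\<^sup>+x. ennreal ((norm (v x))\<^sup>2) \<partial>HH) \<le> ennreal M"
proof -
  show c: "continuous_on (closure \<H>) v" "continuous_on (closure \<H>) (Dv i)" for i
    using assms by (auto simp: solenoidal_def)
  show "continuous_on \<H> v" "continuous_on \<H> (Dv i)"
    using c half_plane_subset_closure continuous_on_subset by blast+
qed (use assms in \<open>auto simp: solenoidal_def sup_L2_le_def\<close>)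

lemma sup_L2_le_add:
  fixes f g :: "real^2 \<Rightarrow> 'b::euclidean_space"
  assumes f: "sup_L2_le M f" "continuous_on \<H> f" and g: "sup_L2_le N g" "continuous_on \<H> g"
    and c: "c \<in> {-1, 1}"
  shows "sup_L2_le (2 * (M + N)) (\<lambda>x. f x + c *\<^sub>R g x)"
proof -
  have lf: "L2le M f" and lg: "L2le N g" by (intro sup_L2_le_L2le f g)+
  have "L2le N (\<lambda>x. c *\<^sub>R g x)" using lg L2le_minus[OF lg] c by auto
  from L2le_add[OF lf this] have L: "(\<integral>\<^sup>+x. ennreal ((norm (f x + c *\<^sub>R g x))\<^sup>2) \<partial>HH) \<le> ennreal (2 * (M + N))"
    by (simp only: L2le_def)
  have "norm (f x + c *\<^sub>R g x) \<le> 2 * (M + N)" if "x \<in> \<H>" for x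
  proof -
    have "norm (f x) \<le> M" "norm (g x) \<le> N" using f(1) g(1) that by (auto simp: sup_L2_le_def)
    moreover have "\<bar>c\<bar> = 1" using c by auto
    ultimately show ?thesis
      using norm_triangle_ineq[of "f x" "c *\<^sub>R g x"] L2le_power2(4)[OF lf] L2le_power2(4)[OF lg] by simp
  qed
  then show ?thesis using L unfolding sup_L2_le_def by blast
qed

lemma has_pd_scaleR_const: "has_pd f i D x \<Longrightarrow> has_pd (\<lambda>y. c *\<^sub>R f y) i (c *\<^sub>R D) x"
  unfolding has_pd_def by (auto intro!: derivative_eq_intros)

text \<open>The two signs serve the difference of the two velocities, and then both the difference
  and the sum of that field at two times.\<close>

lemma solenoidal_add:
  assumes v: "solenoidal M v Dv" and w: "solenoidal N w Dw" and c: "c \<in> {-1, 1}"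
  shows "solenoidal (2 * (M + N)) (\<lambda>x. v x + c *\<^sub>R w x) (\<lambda>i x. Dv i x + c *\<^sub>R Dw i x)"
  unfolding solenoidal_def
proof (intro conjI allI ballI)
  show "continuous_on (closure \<H>) (\<lambda>x. v x + c *\<^sub>R w x)" "continuous_on (closure \<H>) (\<lambda>x. Dv i x + c *\<^sub>R Dw i x)" for i
    by (intro continuous_intros solenoidalD[OF v] solenoidalD[OF w])+
  show "has_pd (\<lambda>x. v x + c *\<^sub>R w x) i (Dv i x + c *\<^sub>R Dw i x) x" if "x \<in> \<H>" for i x
    by (intro has_pd_add has_pd_scaleR_const solenoidalD(5)[OF v that] solenoidalD(5)[OF w that])
  show "has_pd (\<lambda>x. v x + c *\<^sub>R w x) 1 (Dv 1 x + c *\<^sub>R Dw 1 x) x" if "x \<in> closure \<H>" for x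
    by (intro has_pd_add has_pd_scaleR_const solenoidalD(6)[OF v that] solenoidalD(6)[OF w that])
  show "(Dv 1 x + c *\<^sub>R Dw 1 x) $ 1 + (Dv 2 x + c *\<^sub>R Dw 2 x) $ 2 = 0" if "x \<in> \<H>" for x
  proof -
    have "Dv 2 x $ 2 = - (Dv 1 x $ 1)" "Dw 2 x $ 2 = - (Dw 1 x $ 1)"
      using solenoidalD(7)[OF v that] solenoidalD(7)[OF w that] by simp_all
    then show ?thesis by (simp add: algebra_simps)
  qed
  show "(v (pt a 0) + c *\<^sub>R w (pt a 0)) $ 2 = 0" for a
    using solenoidalD(8)[OF v] solenoidalD(8)[OF w] by simp
  show "sup_L2_le (2 * (M + N)) (\<lambda>x. v x + c *\<^sub>R w x)"
    by (rule sup_L2_le_add[OF _ solenoidalD(3)[OF v] _ solenoidalD(3)[OF w] c])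
      (use v w in \<open>auto simp: solenoidal_def\<close>)
qed

text \<open>The flux through the vertical segment from the boundary up to \<open>x\<close>. Starting
  at the boundary fixes the additive constant and makes the function vanish there, which the
  estimates near the boundary exploit.\<close>

definition stream :: "(real^2 \<Rightarrow> real^2) \<Rightarrow> real^2 \<Rightarrow> real" where
  "stream v x = integral {0..x $ 2} (\<lambda>y. v (pt (x $ 1) y) $ 1)"

lemma column_continuous:
  assumes "continuous_on (closure \<H>) f" "A \<subseteq> {0..}"
  shows "continuous_on A (\<lambda>y. f (pt a y))"
  by (rule continuous_on_compose2[OF assms(1)]) (use assms(2) in \<open>auto intro!: continuous_intros simp: closure_half_plane\<close>)

lemma stream_pd2:
  assumes v: "solenoidal M v Dv" and x: "x \<in> \<H>"
  shows "has_pd (stream v) 2 (v x $ 1) x"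
proof -
  define a b where "a = x$1" and "b = x$2"
  have xab: "x = pt a b" and b: "b > 0" using x by (simp_all add: a_def b_def half_plane_def)
  have "continuous_on {0..b + 1} (\<lambda>y. v (pt a y) $ 1)"
    using column_continuous[OF solenoidalD(1)[OF v], of "{0..b+1}" a] by (auto intro!: continuous_intros)
  then have "((\<lambda>s. integral {0..s} (\<lambda>y. v (pt a y) $ 1)) has_vector_derivative v (pt a b) $ 1) (at b within {0..b + 1})"
    by (rule integral_has_vector_derivative) (use b in auto)
  moreover have "at b within {0..b + 1} = at b" using b by (intro at_within_interior) auto
  ultimately show ?thesis unfolding xab has_pd_iff_pt by (simp add: stream_def)
qed

text \<open>Differentiation under the integral produces the integral of the tangential derivative of
  the first component. By incompressibility this is minus the vertical derivative of the second one,
  which integrates to a boundary difference; the normal component vanishes at the bottom. The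
  segment touches the boundary, so tangential derivatives are required there too.\<close>

lemma stream_pd1:
  assumes v: "solenoidal M v Dv" and x: "x \<in> \<H>"
  shows "has_pd (stream v) 1 (- v x $ 2) x"
proof -
  define a b where "a = x$1" and "b = x$2"
  have xab: "x = pt a b" and b: "b > 0" using x by (simp_all add: a_def b_def half_plane_def)
  have cl: "pt s y \<in> closure \<H>" if "y \<in> cbox 0 b" for s y using that by (simp add: closure_half_plane)
  have "((\<lambda>s. integral (cbox 0 b) (\<lambda>y. v (pt s y) $ 1)) has_vector_derivative
      integral (cbox 0 b) (\<lambda>y. Dv 1 (pt a y) $ 1)) (at a within UNIV)"
  proof (rule leibniz_rule_vector_derivative)
    fix s y assume "y \<in> cbox 0 b"
    then have "has_pd v 1 (Dv 1 (pt s y)) (pt s y)" using solenoidalD(6)[OF v cl] by blast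
    then show "((\<lambda>s. v (pt s y) $ 1) has_vector_derivative Dv 1 (pt s y) $ 1) (at s within UNIV)"
      using has_pd_nth[of v 1 _ "pt s y" 1] unfolding has_pd_iff_pt by simp
  next
    fix s show "(\<lambda>y. v (pt s y) $ 1) integrable_on cbox 0 b"
      using column_continuous[OF solenoidalD(1)[OF v], of "cbox 0 b" s]
      by (intro integrable_continuous continuous_intros) auto
  next
    show "continuous_on (UNIV \<times> cbox 0 b) (\<lambda>(s, y). Dv 1 (pt s y) $ 1)"
      unfolding case_prod_beta'
      by (intro continuous_intros continuous_on_compose2[OF solenoidalD(2)[OF v]]) (auto simp: closure_half_plane)
  qed auto
  moreover have "integral (cbox 0 b) (\<lambda>y. Dv 1 (pt a y) $ 1) = - v (pt a b) $ 2"
  proof -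
    have "((\<lambda>y. - (Dv 1 (pt a y) $ 1)) has_integral v (pt a b) $ 2 - v (pt a 0) $ 2) {0..b}"
    proof (rule fundamental_theorem_of_calculus_interior)
      show "continuous_on {0..b} (\<lambda>y. v (pt a y) $ 2)"
        using column_continuous[OF solenoidalD(1)[OF v], of "{0..b}" a] by (auto intro!: continuous_intros)
      fix y assume "y \<in> {0<..<b}"
      then have y: "pt a y \<in> \<H>" by (simp add: half_plane_def)
      have "has_pd (\<lambda>x. v x $ 2) 2 (Dv 2 (pt a y) $ 2) (pt a y)"
        by (intro has_pd_nth solenoidalD(5)[OF v] y)
      moreover have "Dv 2 (pt a y) $ 2 = - (Dv 1 (pt a y) $ 1)"
        using solenoidalD(7)[OF v y] by simp
      ultimately show "((\<lambda>y. v (pt a y) $ 2) has_vector_derivative - (Dv 1 (pt a y) $ 1)) (at y)"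
        unfolding has_pd_iff_pt by simp
    qed (use b in simp)
    then have "((\<lambda>y. - (Dv 1 (pt a y) $ 1)) has_integral v (pt a b) $ 2) (cbox 0 b)"
      using solenoidalD(8)[OF v] by simp
    from integral_unique[OF has_integral_neg[OF this]] show ?thesis by simp
  qed
  ultimately show ?thesis unfolding xab has_pd_iff_pt by (simp add: stream_def)
qed

text \<open>Existence of partial derivatives does not give continuity, but they are bounded by
  \<open>M\<close>. Moving from \<open>x\<close> to \<open>y\<close> along an L-shaped path inside
  the half plane yields a Lipschitz bound.\<close>

lemma stream_continuous:
  assumes v: "solenoidal M v Dv"
  shows "continuous_on \<H> (stream v)"
proof -
  have pt: "pt a b \<in> \<H>" if "b > 0" for a b using that by (simp add: half_plane_def)
  have nv: "\<bar>v (pt a b) $ i\<bar> \<le> M" if "b > 0" for a b i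
    using solenoidalD(9)[OF v pt[OF that]] component_le_norm_cart order_trans by blast
  have l1: "\<bar>stream v (pt a' b) - stream v (pt a b)\<bar> \<le> M * \<bar>a' - a\<bar>" if b: "b > 0" for a a' b
  proof -
    have "norm (stream v (pt a' b) - stream v (pt a b)) \<le> M * norm (a' - a)"
    proof (rule field_differentiable_bound[of UNIV])
      show "((\<lambda>s. stream v (pt s b)) has_field_derivative - v (pt s b) $ 2) (at s within UNIV)" for s
        using stream_pd1[OF v pt[OF b]] unfolding has_pd_iff_pt
        by (simp add: has_real_derivative_iff_has_vector_derivative)
    qed (use nv[OF b] in auto)
    then show ?thesis by simp
  qed
  have l2: "\<bar>stream v (pt a b') - stream v (pt a b)\<bar> \<le> M * \<bar>b' - b\<bar>" if b: "b > 0" "b' > 0" for a b b'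
  proof -
    have "norm (stream v (pt a b') - stream v (pt a b)) \<le> M * norm (b' - b)"
    proof (rule field_differentiable_bound[of "{0<..}"])
      show "((\<lambda>s. stream v (pt a s)) has_field_derivative v (pt a s) $ 1) (at s within {0<..})" if "s \<in> {0<..}" for s
        using stream_pd2[OF v pt, of s a] that unfolding has_pd_iff_pt
        by (auto simp: has_real_derivative_iff_has_vector_derivative intro: has_vector_derivative_at_within)
    qed (use nv b in auto)
    then show ?thesis by simp
  qed
  have "\<bar>stream v y - stream v x\<bar> \<le> M * (\<bar>y$1 - x$1\<bar> + \<bar>y$2 - x$2\<bar>)" if "x \<in> \<H>" "y \<in> \<H>" for x y
  proof -
    have b: "x$2 > 0" "y$2 > 0" using that by (auto simp: half_plane_def)
    have "\<bar>stream v (pt (y$1) (y$2)) - stream v (pt (x$1) (x$2))\<bar> \<le> 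
      \<bar>stream v (pt (y$1) (y$2)) - stream v (pt (x$1) (y$2))\<bar> + \<bar>stream v (pt (x$1) (y$2)) - stream v (pt (x$1) (x$2))\<bar>" by simp
    also have "\<dots> \<le> M * \<bar>y$1 - x$1\<bar> + M * \<bar>y$2 - x$2\<bar>" by (intro add_mono l1 l2 b)
    finally show ?thesis by (simp add: distrib_left)
  qed
  then have lip: "\<bar>stream v y - stream v x\<bar> \<le> M * (\<bar>y$1 - x$1\<bar> + \<bar>y$2 - x$2\<bar>)" if "x \<in> \<H>" "y \<in> \<H>" for x y
    using that by blast
  show ?thesis unfolding continuous_on_def
  proof
    fix x assume x: "x \<in> \<H>"
    have "((\<lambda>y. M * (\<bar>y$1 - x$1\<bar> + \<bar>y$2 - x$2\<bar>)) \<longlongrightarrow> M * (\<bar>x$1 - x$1\<bar> + \<bar>x$2 - x$2\<bar>)) (at x within \<H>)"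
      by (intro tendsto_intros)
    then have lim: "((\<lambda>y. M * (\<bar>y$1 - x$1\<bar> + \<bar>y$2 - x$2\<bar>)) \<longlongrightarrow> 0) (at x within \<H>)" by simp
    have "((\<lambda>y. stream v y - stream v x) \<longlongrightarrow> 0) (at x within \<H>)"
      by (rule Lim_null_comparison[OF _ lim]) (use lip x in \<open>auto simp: eventually_at_filter\<close>)
    then show "(stream v \<longlongrightarrow> stream v x) (at x within \<H>)" by (rule Lim_null[THEN iffD2])
  qed
qed

text \<open>Cauchy-Schwarz on the column below the point: the factor b is its length, and the
  right-hand integral runs over the whole vertical line so that it no longer depends on b.\<close>

lemma stream_column_bound:
  assumes v: "solenoidal M v Dv" and b: "b > 0"
  shows "ennreal ((stream v (pt a b))\<^sup>2) \<le> ennreal b * (\<integral>\<^sup>+y. ennreal ((norm (v (pt a y)))\<^sup>2) * indicator {0<..} y \<partial>lborel)"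
proof -
  let ?f = "\<lambda>y. v (pt a y) $ 1"
  define p where "p = stream v (pt a b)"
  \<comment> \<open>The mean of \<open>?f\<close> on the column. Expanding the integral of the
    nonnegative function \<open>(?f y - m)\<^sup>2\<close> at this value is the Cauchy-Schwarz
    inequality.\<close>
  define m where "m = p / b"
  have cv: "continuous_on {0..b} (\<lambda>y. v (pt a y))"
    by (rule column_continuous[OF solenoidalD(1)[OF v]]) auto
  have cf: "continuous_on {0..b} ?f" by (intro continuous_intros cv)
  have i1: "?f integrable_on {0..b}" "(\<lambda>y. (?f y)\<^sup>2) integrable_on {0..b}"
    by (intro integrable_continuous_interval continuous_intros cf)+
  have p: "integral {0..b} ?f = p" by (simp add: p_def stream_def)
  have hi: "((\<lambda>y. (?f y)\<^sup>2 - 2 * m * ?f y + m\<^sup>2) has_integral (integral {0..b} (\<lambda>y. (?f y)\<^sup>2) - 2 * m * p + m\<^sup>2 * b)) {0..b}"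
  proof (intro has_integral_add has_integral_diff)
    show "((\<lambda>y. (?f y)\<^sup>2) has_integral integral {0..b} (\<lambda>y. (?f y)\<^sup>2)) {0..b}" using i1(2) by (rule integrable_integral)
    show "((\<lambda>y. 2 * m * ?f y) has_integral 2 * m * p) {0..b}"
      using has_integral_mult_right[OF integrable_integral[OF i1(1)], of "2 * m"] p by simp
    show "((\<lambda>y. m\<^sup>2) has_integral m\<^sup>2 * b) {0..b}" using has_integral_const_real[of "m\<^sup>2" 0 b] b by (simp add: mult.commute)
  qed
  have "0 \<le> integral {0..b} (\<lambda>y. (?f y)\<^sup>2) - 2 * m * p + m\<^sup>2 * b"
  proof (rule has_integral_nonneg[OF hi])
    fix y show "0 \<le> (?f y)\<^sup>2 - 2 * m * ?f y + m\<^sup>2"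
      using zero_le_power2[of "?f y - m"] by (simp add: power2_diff mult_ac)
  qed
  then have "p\<^sup>2 \<le> b * integral {0..b} (\<lambda>y. (?f y)\<^sup>2)"
    using b by (simp add: m_def power2_eq_square field_simps)
  then have "ennreal (p\<^sup>2) \<le> ennreal (b * integral {0..b} (\<lambda>y. (?f y)\<^sup>2))" by (rule ennreal_leI)
  also have "\<dots> = ennreal b * ennreal (integral {0..b} (\<lambda>y. (?f y)\<^sup>2))"
    using b by (intro ennreal_mult integral_nonneg i1) auto
  also have "ennreal (integral {0..b} (\<lambda>y. (?f y)\<^sup>2)) \<le> (\<integral>\<^sup>+y. ennreal ((norm (v (pt a y)))\<^sup>2) * indicator {0<..} y \<partial>lborel)"
  proof -
    have si: "set_integrable lborel {0..b} (\<lambda>y. (?f y)\<^sup>2)"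
      by (intro borel_integrable_atLeastAtMost' continuous_intros cf)
    have "integral {0..b} (\<lambda>y. (?f y)\<^sup>2) = (LINT y|lborel. indicator {0..b} y *\<^sub>R (?f y)\<^sup>2)"
      using set_borel_integral_eq_integral(2)[OF si] by (simp add: set_lebesgue_integral_def)
    also have "ennreal \<dots> = (\<integral>\<^sup>+y. ennreal (indicator {0..b} y *\<^sub>R (?f y)\<^sup>2) \<partial>lborel)"
      using si by (intro nn_integral_eq_integral[symmetric]) (auto simp: set_integrable_def)
    also have "\<dots> \<le> (\<integral>\<^sup>+y. ennreal ((norm (v (pt a y)))\<^sup>2) * indicator {0<..} y \<partial>lborel)"
    proof (rule nn_integral_mono_AE, rule AE_mp[OF AE_lborel_singleton[of 0]], rule AE_I2, rule impI)
      fix y :: real assume "y \<noteq> 0"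
      have "\<bar>?f y\<bar> \<le> \<bar>norm (v (pt a y))\<bar>" using component_le_norm_cart[of "v (pt a y)" 1] by simp
      then have "(?f y)\<^sup>2 \<le> (norm (v (pt a y)))\<^sup>2" by (rule abs_le_square_iff[THEN iffD1])
      then show "ennreal (indicator {0..b} y *\<^sub>R (?f y)\<^sup>2) \<le> ennreal ((norm (v (pt a y)))\<^sup>2) * indicator {0<..} y"
        using \<open>y \<noteq> 0\<close> by (auto simp: indicator_def intro: ennreal_leI)
    qed
    finally show ?thesis .
  qed
  finally show ?thesis by (simp add: p_def mult_left_mono)
qed

lemma nn_integral_HH_pt:
  fixes f :: "real^2 \<Rightarrow> ennreal"
  assumes [measurable]: "(\<lambda>x. f x * indicator \<H> x) \<in> borel_measurable borel"
  shows "(\<integral>\<^sup>+x. f x \<partial>HH) = (\<integral>\<^sup>+a. \<integral>\<^sup>+b. f (pt a b) * indicator {0<..} b \<partial>lborel \<partial>lborel)"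
proof -
  have "(\<integral>\<^sup>+x. f x \<partial>HH) = (\<integral>\<^sup>+x. f x * indicator \<H> x \<partial>HH)"
    by (intro nn_integral_cong) (auto simp: indicator_def)
  also have "\<dots> = (\<integral>\<^sup>+x. (f x * indicator \<H> x) * indicator \<H> x \<partial>lborel)" by (rule nn_integral_HH) simp
  also have "\<dots> = (\<integral>\<^sup>+x. f x * indicator \<H> x \<partial>lborel)"
    by (intro nn_integral_cong) (auto simp: indicator_def)
  also have "\<dots> = (\<integral>\<^sup>+a. \<integral>\<^sup>+b. f (pt a b) * indicator \<H> (pt a b) \<partial>lborel \<partial>lborel)" by (rule nn_integral_real2(1)) simp
  also have "\<dots> = (\<integral>\<^sup>+a. \<integral>\<^sup>+b. f (pt a b) * indicator {0<..} b \<partial>lborel \<partial>lborel)"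
    by (intro nn_integral_cong) (simp add: indicator_def half_plane_def)
  finally show ?thesis .
qed

lemma continuous_indicator_borel:
  fixes f :: "real^2 \<Rightarrow> 'b::euclidean_space"
  assumes "continuous_on \<H> f"
  shows "(\<lambda>x. ennreal ((norm (f x))\<^sup>2) * indicator \<H> x) \<in> borel_measurable borel"
proof -
  have [measurable]: "(\<lambda>x. indicator \<H> x *\<^sub>R f x) \<in> borel_measurable borel"
    by (rule borel_measurable_continuous_on_indicator) (use assms in auto)
  have "(\<lambda>x. ennreal ((norm (f x))\<^sup>2) * indicator \<H> x) = (\<lambda>x. ennreal ((norm (indicator \<H> x *\<^sub>R f x))\<^sup>2))"
    by (auto simp: indicator_def fun_eq_iff)
  then show ?thesis by (simp only:) measurable
qed

text \<open>A substitute for Hardy's inequality on a strip along the boundary.\<close>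

lemma stream_strip_bound:
  assumes v: "solenoidal M v Dv" and c: "c > 0"
  shows "(\<integral>\<^sup>+x. ennreal ((c * stream v x * indicator {x. x $ 2 \<le> 2/c} x)\<^sup>2) \<partial>HH) \<le> ennreal 4 * ennreal M"
proof -
  have [measurable]: "(\<lambda>x. ennreal ((norm (stream v x))\<^sup>2) * indicator \<H> x) \<in> borel_measurable borel"
    by (rule continuous_indicator_borel[OF stream_continuous[OF v]])
  have [measurable]: "(\<lambda>x::real^2. x $ 2) \<in> borel_measurable borel"
    by (intro borel_measurable_continuous_onI continuous_intros)
  have eq: "ennreal ((c * stream v x * indicator {x. x $ 2 \<le> 2/c} x)\<^sup>2) * indicator \<H> x =
      ennreal (c\<^sup>2) * (ennreal ((norm (stream v x))\<^sup>2) * indicator \<H> x) * (if x $ 2 \<le> 2/c then 1 else 0)" for x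
    by (auto simp: indicator_def power_mult_distrib ennreal_mult)
  have "(\<lambda>x. ennreal ((c * stream v x * indicator {x. x $ 2 \<le> 2/c} x)\<^sup>2) * indicator \<H> x) \<in> borel_measurable borel"
    unfolding eq by measurable
  from nn_integral_HH_pt[OF this]
  have "(\<integral>\<^sup>+x. ennreal ((c * stream v x * indicator {x. x $ 2 \<le> 2/c} x)\<^sup>2) \<partial>HH) =
     (\<integral>\<^sup>+a. \<integral>\<^sup>+b. ennreal ((c * stream v (pt a b) * indicator {x. x $ 2 \<le> 2/c} (pt a b))\<^sup>2) * indicator {0<..} b \<partial>lborel \<partial>lborel)" .
  also have "\<dots> \<le> (\<integral>\<^sup>+a. ennreal 4 * (\<integral>\<^sup>+y. ennreal ((norm (v (pt a y)))\<^sup>2) * indicator {0<..} y \<partial>lborel) \<partial>lborel)"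
  proof (rule nn_integral_mono)
    fix a
    let ?A = "\<integral>\<^sup>+y. ennreal ((norm (v (pt a y)))\<^sup>2) * indicator {0<..} y \<partial>lborel"
    have "(\<integral>\<^sup>+b. ennreal ((c * stream v (pt a b) * indicator {x. x $ 2 \<le> 2/c} (pt a b))\<^sup>2) * indicator {0<..} b \<partial>lborel)
      \<le> (\<integral>\<^sup>+b. ennreal (2 * c) * ?A * indicator {0..2/c} b \<partial>lborel)"
    proof (rule nn_integral_mono)
      fix b
      show "ennreal ((c * stream v (pt a b) * indicator {x. x $ 2 \<le> 2/c} (pt a b))\<^sup>2) * indicator {0<..} b
        \<le> ennreal (2 * c) * ?A * indicator {0..2/c} b"
      proof (cases "0 < b \<and> b \<le> 2/c")
        case True
        have "ennreal ((c * stream v (pt a b))\<^sup>2) = ennreal (c\<^sup>2) * ennreal ((stream v (pt a b))\<^sup>2)"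
          by (simp add: power_mult_distrib ennreal_mult)
        also have "\<dots> \<le> ennreal (c\<^sup>2) * (ennreal b * ?A)" using True by (intro mult_left_mono stream_column_bound[OF v]) auto
        also have "\<dots> = ennreal (c\<^sup>2 * b) * ?A" using True by (simp add: ennreal_mult mult.assoc)
        also have "\<dots> \<le> ennreal (2 * c) * ?A"
        proof (intro mult_right_mono ennreal_leI)
          have "c\<^sup>2 * b \<le> c\<^sup>2 * (2/c)" using True by (intro mult_left_mono) auto
          also have "\<dots> = 2 * c" using c by (simp add: power2_eq_square)
          finally show "c\<^sup>2 * b \<le> 2 * c" .
        qed simp
        finally show ?thesis using True by simp
      next
        case False
        then have "(indicator {x. x $ 2 \<le> 2/c} (pt a b) :: real) = 0 \<or> (indicator {0<..} b :: ennreal) = 0"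
          by (auto simp: indicator_def)
        then show ?thesis by auto
      qed
    qed
    \<comment> \<open>The height factor 2 * c meets the strip width 2/c, and their product is 4 for
      every c. This scale invariance lets one estimate serve a thin strip along the boundary (c = n)
      and a tall one (c = 1/n).\<close>
    also have "\<dots> = ennreal (2 * c) * ?A * ennreal (2/c)"
      using c by (subst nn_integral_cmult_indicator) auto
    also have "\<dots> = ennreal 4 * ?A"
    proof -
      have "ennreal (2 * c) * ennreal (2/c) = ennreal (2 * c * (2/c))" using c by (intro ennreal_mult[symmetric]) auto
      also have "2 * c * (2/c) = 4" using c by simp
      finally have e4: "ennreal (2 * c) * ennreal (2/c) = ennreal 4" .
      have "ennreal (2 * c) * ?A * ennreal (2/c) = ennreal (2 * c) * ennreal (2/c) * ?A" by (simp only: mult_ac)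
      then show ?thesis unfolding e4 .
    qed
    finally show "(\<integral>\<^sup>+b. ennreal ((c * stream v (pt a b) * indicator {x. x $ 2 \<le> 2/c} (pt a b))\<^sup>2) * indicator {0<..} b \<partial>lborel)
      \<le> ennreal 4 * ?A" .
  qed
  also have "\<dots> = ennreal 4 * (\<integral>\<^sup>+a. \<integral>\<^sup>+y. ennreal ((norm (v (pt a y)))\<^sup>2) * indicator {0<..} y \<partial>lborel \<partial>lborel)"
  proof (rule nn_integral_cmult)
    have vm [measurable]: "(\<lambda>x. ennreal ((norm (v x))\<^sup>2) * indicator \<H> x) \<in> borel_measurable borel"
      by (rule continuous_indicator_borel[OF solenoidalD(3)[OF v]])
    have "(\<lambda>a. \<integral>\<^sup>+y. (\<lambda>x. ennreal ((norm (v x))\<^sup>2) * indicator \<H> x) (pt a y) \<partial>lborel) \<in> borel_measurable lborel"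
    proof (rule lborel.borel_measurable_nn_integral)
      show "(\<lambda>(a, y). ennreal ((norm (v (pt a y)))\<^sup>2) * indicator \<H> (pt a y)) \<in> borel_measurable (lborel \<Otimes>\<^sub>M lborel)"
        unfolding case_prod_beta' by (rule measurable_compose[OF _ vm]) measurable
    qed
    moreover have "indicator \<H> (pt a b) = (indicator {0<..} b :: ennreal)" for a b by (simp add: indicator_def half_plane_def)
    ultimately show "(\<lambda>a. \<integral>\<^sup>+y. ennreal ((norm (v (pt a y)))\<^sup>2) * indicator {0<..} y \<partial>lborel) \<in> borel_measurable lborel" by simp
  qed
  also have "(\<integral>\<^sup>+a. \<integral>\<^sup>+y. ennreal ((norm (v (pt a y)))\<^sup>2) * indicator {0<..} y \<partial>lborel \<partial>lborel) = (\<integral>\<^sup>+x. ennreal ((norm (v x))\<^sup>2) \<partial>HH)"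
    by (rule nn_integral_HH_pt[symmetric], rule continuous_indicator_borel[OF solenoidalD(3)[OF v]])
  also have "ennreal 4 * \<dots> \<le> ennreal 4 * ennreal M" by (intro mult_left_mono solenoidalD(10)[OF v]) simp
  finally show ?thesis .
qed


section \<open>Compactly supported test fields and passage to general solenoidal fields\<close>

lemma abs_inner_le: "\<bar>a \<bullet> b\<bar> \<le> ((norm a)\<^sup>2 + (norm b)\<^sup>2) / 2" for a :: "'a::real_inner"
proof -
  have "\<bar>a \<bullet> b\<bar> \<le> norm a * norm b" by (rule Cauchy_Schwarz_ineq2)
  also have "\<dots> \<le> ((norm a)\<^sup>2 + (norm b)\<^sup>2) / 2" using sum_squares_bound[of "norm a" "norm b"] by simp
  finally show ?thesis .
qed

lemma L2le_inner:
  fixes f g :: "real^2 \<Rightarrow> 'b::euclidean_space"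
  assumes "L2le N f" "L2le N' g"
  shows "integrable HH (\<lambda>x. f x \<bullet> g x)"
proof (rule Bochner_Integration.integrable_bound)
  show "integrable HH (\<lambda>x. ((norm (f x))\<^sup>2 + (norm (g x))\<^sup>2) / 2)"
    using L2le_power2(1)[OF assms(1)] L2le_power2(1)[OF assms(2)] by simp
  show "(\<lambda>x. f x \<bullet> g x) \<in> borel_measurable HH"
    using L2le_power2(3)[OF assms(1)] L2le_power2(3)[OF assms(2)] by measurable
  show "AE x in HH. norm (f x \<bullet> g x) \<le> norm (((norm (f x))\<^sup>2 + (norm (g x))\<^sup>2) / 2)"
    by (intro AE_I2) (use abs_inner_le in \<open>auto intro: order_trans\<close>)
qed

text \<open>Only the two derivatives that occur in the divergence are recorded. For
  \<open>cut_field\<close> these are exactly what the partial derivatives of the stream function and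
  of \<open>v\<close> provide.\<close>

definition test_field :: "(real^2 \<Rightarrow> real^2) \<Rightarrow> bool" where
  "test_field V \<longleftrightarrow> (\<exists>a b g1 g2. cbox a b \<subseteq> \<H> \<and> (\<forall>x. x \<notin> box a b \<longrightarrow> V x = 0) \<and> continuous_on \<H> V \<and>
     continuous_on \<H> g1 \<and> continuous_on \<H> g2 \<and>
     (\<forall>x\<in>\<H>. has_pd (\<lambda>y. V y $ 1) 1 (g1 x) x \<and> has_pd (\<lambda>y. V y $ 2) 2 (g2 x) x \<and> g1 x + g2 x = (0::real)))"

text \<open>The integrand is the divergence of q times \<open>V\<close>, since \<open>V\<close>
  itself has divergence zero. The product has compact support in the open half plane, so the
  behaviour of q at infinity and at the boundary is invisible.\<close>

lemma gradient_orthogonal: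
  assumes q: "q differentiable_on \<H>" "continuous_on \<H> (gradient q)" and V: "test_field V"
  shows "(LINT x|HH. gradient q x \<bullet> V x) = 0"
proof -
  obtain a b g1 g2 where K: "cbox a b \<subseteq> \<H>" and z: "\<And>x. x \<notin> box a b \<Longrightarrow> V x = 0" and cV: "continuous_on \<H> V"
    and cg: "continuous_on \<H> g1" "continuous_on \<H> g2"
    and pV: "\<And>x. x \<in> \<H> \<Longrightarrow> has_pd (\<lambda>y. V y $ 1) 1 (g1 x) x" "\<And>x. x \<in> \<H> \<Longrightarrow> has_pd (\<lambda>y. V y $ 2) 2 (g2 x) x"
    and g: "\<And>x. x \<in> \<H> \<Longrightarrow> g1 x + g2 x = 0"
    using V unfolding test_field_def by blast
  let ?K = "cbox a b"
  have cp: "continuous_on \<H> (partial_H i q)" for i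
  proof -
    have "continuous_on \<H> (\<lambda>x. gradient q x $ i)" by (intro continuous_intros q)
    then show ?thesis by (simp add: gradient_def)
  qed
  have pq: "has_pd q i (partial_H i q x) x" if "x \<in> \<H>" for i x
    by (rule partial_H_has_pd[of _ _ \<H>]) (use q(1) that in \<open>auto simp: differentiable_on_def\<close>)
  note c = continuous_on_subset[OF cp K] continuous_on_subset[OF cV K] continuous_on_subset[OF cg(1) K]
    continuous_on_subset[OF cg(2) K] continuous_on_subset[OF differentiable_imp_continuous_on[OF q(1)] K]
  have c1: "continuous_on ?K (\<lambda>x. q x * g1 x + partial_H 1 q x * V x $ 1)"
    and c2: "continuous_on ?K (\<lambda>x. q x * g2 x + partial_H 2 q x * V x $ 2)" by (intro continuous_intros c)+
  have 1: "(LINT x:?K|lborel. q x * g1 x + partial_H 1 q x * V x $ 1) = 0"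
    by (rule integral_has_pd_compact_support[of a b _ "\<lambda>x. q x * V x $ 1" 1])
       (use c1 K z pq pV in \<open>auto intro!: has_pd_mult\<close>)
  have 2: "(LINT x:?K|lborel. q x * g2 x + partial_H 2 q x * V x $ 2) = 0"
    by (rule integral_has_pd_compact_support[of a b _ "\<lambda>x. q x * V x $ 2" 2])
       (use c2 K z pq pV in \<open>auto intro!: has_pd_mult\<close>)
  have "continuous_on ?K (\<lambda>x. gradient q x \<bullet> V x)"
    by (intro continuous_intros continuous_on_subset[OF q(2) K] c)
  then have "(LINT x|HH. gradient q x \<bullet> V x) = (LINT x:?K|lborel. gradient q x \<bullet> V x)"
  proof (rule lebesgue_on_integral_compact(1)[OF _ _ K])
    fix x assume "x \<notin> cbox a b"
    then have "V x = 0" using z box_subset_cbox by blast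
    then show "gradient q x \<bullet> V x = 0" by simp
  qed
  also have "\<dots> = (LINT x:?K|lborel. (q x * g1 x + partial_H 1 q x * V x $ 1) + (q x * g2 x + partial_H 2 q x * V x $ 2))"
  proof (rule set_lebesgue_integral_cong)
    show "\<forall>x. x \<in> ?K \<longrightarrow> gradient q x \<bullet> V x = (q x * g1 x + partial_H 1 q x * V x $ 1) + (q x * g2 x + partial_H 2 q x * V x $ 2)"
    proof (intro allI impI)
      fix x assume "x \<in> ?K"
      then have "q x * (g1 x + g2 x) = 0" using g K by auto
      then show "gradient q x \<bullet> V x = (q x * g1 x + partial_H 1 q x * V x $ 1) + (q x * g2 x + partial_H 2 q x * V x $ 2)"
        by (simp add: inner_vec_def sum_2 gradient_def distrib_left)
    qed
  qed simp
  also have "\<dots> = 0"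
  proof -
    have "set_integrable lborel ?K (\<lambda>x. q x * g1 x + partial_H 1 q x * V x $ 1)" 
      "set_integrable lborel ?K (\<lambda>x. q x * g2 x + partial_H 2 q x * V x $ 2)"
      unfolding set_integrable_def by (intro borel_integrable_compact c1 c2 compact_cbox)+
    from set_integral_add(2)[OF this] show ?thesis using 1 2 by simp
  qed
  finally show ?thesis .
qed

text \<open>The perpendicular gradient of the cut off stream function.\<close>

definition cut_field :: "real \<Rightarrow> (real^2 \<Rightarrow> real^2) \<Rightarrow> real^2 \<Rightarrow> real^2" where
  "cut_field n v x = pt
     (cutA n (x$1) * (deriv (cutB n n) (x$2) * stream v x + cutB n n (x$2) * v x $ 1))
     (cutA n (x$1) * (cutB n n (x$2) * v x $ 2) - deriv (cutA n) (x$1) * (cutB n n (x$2) * stream v x))"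

lemma has_pd_eq: "has_pd f i D x \<Longrightarrow> D = E \<Longrightarrow> has_pd f i E x" by simp

text \<open>The components are the derivative in direction 2, and minus the derivative in direction
  1, of the product of both cutoffs with the stream function. So \<open>g1\<close> and
  \<open>g2\<close> are mixed second derivatives of opposite sign; incompressibility of
  \<open>v\<close> identifies the terms in which the stream function is differentiated
  twice.\<close>

lemma cut_field_test:
  assumes v: "solenoidal M v Dv" and n: "n > 0"
  shows "test_field (cut_field n v)"
proof -
  let ?A = "cutA n" and ?B = "cutB n n" and ?A' = "deriv (cutA n)" and ?B' = "deriv (cutB n n)"
  define g1 where "g1 x = ?A' (x$1) * (?B' (x$2) * stream v x + ?B (x$2) * v x $ 1) +
     ?A (x$1) * (?B (x$2) * Dv 1 x $ 1 - ?B' (x$2) * v x $ 2)" for x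
  define g2 where "g2 x = ?A (x$1) * (?B' (x$2) * v x $ 2 + ?B (x$2) * Dv 2 x $ 2) -
     ?A' (x$1) * (?B' (x$2) * stream v x + ?B (x$2) * v x $ 1)" for x
  have sA: "smooth ?A" and sB: "smooth ?B" using cut_smooth by auto
  have pA: "has_pd (\<lambda>y. ?A (y$1)) i (if i = 1 then ?A' (x$1) else 0) x" for i x
    using has_pd_coord[where x = x and j = 1 and i = i, OF smooth_has_deriv[OF sA]] by simp
  have pA': "has_pd (\<lambda>y. ?A' (y$1)) 2 0 x" for x
    using has_pd_coord[where x = x and j = 1 and i = 2, OF smooth_has_deriv[OF smooth_deriv[OF sA]]] by simp
  have pB: "has_pd (\<lambda>y. ?B (y$2)) i (if i = 2 then ?B' (x$2) else 0) x" for i x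
    using has_pd_coord[where x = x and j = 2 and i = i, OF smooth_has_deriv[OF sB]] by simp
  have pB': "has_pd (\<lambda>y. ?B' (y$2)) 1 0 x" for x
    using has_pd_coord[where x = x and j = 2 and i = 1, OF smooth_has_deriv[OF smooth_deriv[OF sB]]] by simp
  have pv: "has_pd (\<lambda>y. v y $ j) i (Dv i x $ j) x" if "x \<in> \<H>" for i j x
    by (rule has_pd_nth[OF solenoidalD(5)[OF v that]])
  have ps1: "has_pd (stream v) 1 (- v x $ 2) x" and ps2: "has_pd (stream v) 2 (v x $ 1) x" if "x \<in> \<H>" for x
    using stream_pd1[OF v that] stream_pd2[OF v that] by auto
  have p1: "has_pd (\<lambda>y. cut_field n v y $ 1) 1 (g1 x) x" if x: "x \<in> \<H>" for x
    unfolding cut_field_def pt_nth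
    by (rule has_pd_eq[OF has_pd_mult[OF pA has_pd_add[OF has_pd_mult[OF pB' ps1[OF x]] has_pd_mult[OF pB pv[OF x]]]]])
      (simp add: g1_def algebra_simps)
  have p2: "has_pd (\<lambda>y. cut_field n v y $ 2) 2 (g2 x) x" if x: "x \<in> \<H>" for x
    unfolding cut_field_def pt_nth
    by (rule has_pd_eq[OF has_pd_diff[OF has_pd_mult[OF pA has_pd_mult[OF pB pv[OF x]]] has_pd_mult[OF pA' has_pd_mult[OF pB ps2[OF x]]]]])
      (simp add: g2_def algebra_simps)
  have coord: "continuous_on \<H> (\<lambda>x. \<gamma> (x $ j))" if "smooth \<gamma>" for \<gamma> :: "real \<Rightarrow> real" and j
    by (rule continuous_on_compose2[OF smooth_continuous_on[OF that, of UNIV]]) (auto intro!: continuous_intros)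
  note cc = coord[OF sA] coord[OF sB] coord[OF smooth_deriv[OF sA]] coord[OF smooth_deriv[OF sB]]
    stream_continuous[OF v] solenoidalD(3,4)[OF v]
  have "continuous_on \<H> (cut_field n v)" unfolding cut_field_def by (intro continuous_intros cc)
  moreover have "continuous_on \<H> g1" "continuous_on \<H> g2"
    unfolding g1_def[abs_def] g2_def[abs_def] by (intro continuous_intros cc)+
  moreover have "g1 x + g2 x = 0" if "x \<in> \<H>" for x
  proof -
    have "Dv 2 x $ 2 = - (Dv 1 x $ 1)" using solenoidalD(7)[OF v that] by simp
    then show ?thesis by (simp add: g1_def g2_def algebra_simps)
  qed
  moreover have "cut_field n v x = 0" if x: "x \<notin> box (pt (-2*n - 1) (1/(2*n))) (pt (2*n + 1) (2*n + 1))" for x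
  proof -
    have n2: "1/(2*n) < 1/n" using n by (simp add: field_simps)
    have zA': "?A' s = 0" if "s \<notin> {-2*n..2*n}" for s
      using deriv_eq_0_of_locally_0[of "- {-2*n..2*n}" s "cutA n" 0] that cutA_zero[OF n] by auto
    have zB': "?B' s = 0" if "s \<notin> {1/n..2*n}" for s
      using deriv_eq_0_of_locally_0[of "- {1/n..2*n}" s "cutB n n" 0] that cutB_zero[OF n n] by auto
    have "x$1 \<notin> {-2*n..2*n} \<or> x$2 \<notin> {1/n..2*n}" using x n2 by (auto simp: mem_box_real2)
    then show ?thesis
    proof
      assume "x$1 \<notin> {-2*n..2*n}"
      from cutA_zero[OF n this] zA'[OF this] show ?thesis by (simp add: cut_field_def vec_eq_iff forall_2)
    next
      assume "x$2 \<notin> {1/n..2*n}"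
      from cutB_zero[OF n n this] zB'[OF this] show ?thesis by (simp add: cut_field_def vec_eq_iff forall_2)
    qed
  qed
  moreover have "cbox (pt (-2*n - 1) (1/(2*n))) (pt (2*n + 1) (2*n + 1)) \<subseteq> \<H>"
  proof
    fix x assume "x \<in> cbox (pt (-2*n - 1) (1/(2*n))) (pt (2*n + 1) (2*n + 1))"
    then have "1/(2*n) \<le> x$2" by (simp add: mem_box_real2)
    moreover have "0 < 1/(2*n)" using n by simp
    ultimately show "x \<in> \<H>" unfolding half_plane_def by (simp only: mem_Collect_eq less_le_trans)
  qed
  ultimately show ?thesis using p1 p2 unfolding test_field_def by blast
qed

text \<open>What distinguishes the field from the cut off \<open>v\<close> are the terms in which a
  cutoff is differentiated, and these live where the cutoffs vary. There the stream function terms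
  are bounded but not small in square mean; the weight e makes them small, while 1/(2*e) falls on
  the part of \<open>g\<close> in a region that recedes as n grows.\<close>

lemma cut_field_error:
  assumes v: "solenoidal M v Dv" and n: "n > 0" and K: "\<And>s. \<bar>mol s\<bar> \<le> K" and x: "x \<in> \<H>" and e: "e > 0"
  shows "\<bar>g \<bullet> cut_field n v x - tp (cutA n) (cutB n n) x * (g \<bullet> v x)\<bar> \<le>
     e * (K\<^sup>2 * (n * stream v x * indicator {x. x $ 2 \<le> 2/n} x)\<^sup>2 + 9 * K\<^sup>2 * ((1/n) * stream v x * indicator {x. x $ 2 \<le> 2/(1/n)} x)\<^sup>2)
     + 1/(2*e) * (indicator {x. x $ 2 \<le> 2/n \<or> x $ 2 \<ge> n \<or> \<bar>x $ 1\<bar> \<ge> n} x * (norm g)\<^sup>2)"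
proof -
  let ?A = "cutA n (x$1)" and ?B = "cutB n n (x$2)" and ?A' = "deriv (cutA n) (x$1)" and ?B' = "deriv (cutB n n) (x$2)"
  \<comment> \<open>2/(1/n) is the height 2 * n, spelled so as to match the strip estimate with c =
    1/n.\<close>
  let ?i1 = "indicator {x. x $ 2 \<le> 2/n} x :: real" and ?i2 = "indicator {x. x $ 2 \<le> 2/(1/n)} x :: real"
  let ?iD = "indicator {x. x $ 2 \<le> 2/n \<or> x $ 2 \<ge> n \<or> \<bar>x $ 1\<bar> \<ge> n} x :: real"
  have K0: "K \<ge> 0" by (rule order_trans[OF abs_ge_zero K])
  define E where "E = g \<bullet> cut_field n v x - tp (cutA n) (cutB n n) x * (g \<bullet> v x)"
  have E: "E = stream v x * (?A * ?B' * g$1 - ?A' * ?B * g$2)"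
    by (simp add: E_def cut_field_def tp_def inner_vec_def sum_2 algebra_simps)
  have bB: "\<bar>?B'\<bar> \<le> K * (n * ?i1) + K * ((1/n) * ?i2)"
  proof -
    have 1: "\<bar>n * mol (n * x$2 + (-1)) * step ((-1/n) * x$2 + 2)\<bar> \<le> K * (n * ?i1)"
    proof (cases "x$2 \<le> 2/n")
      case True
      have "\<bar>n * mol (n * x$2 + (-1)) * step ((-1/n) * x$2 + 2)\<bar> \<le> n * K * 1"
        unfolding abs_mult using n K K0 step_bounds by (intro mult_mono) auto
      then show ?thesis using True by (simp add: mult.commute)
    next
      case False
      then have "n * x$2 + (-1) \<notin> {0..1}" using n by (simp add: field_simps)
      then have "mol (n * x$2 + (-1)) = 0" by (rule mol_zero)
      then show ?thesis using False by (simp only: mult_zero_right mult_zero_left) simp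
    qed
    have 2: "\<bar>(1/n) * step (n * x$2 + (-1)) * mol ((-1/n) * x$2 + 2)\<bar> \<le> K * ((1/n) * ?i2)"
    proof (cases "x$2 \<le> 2/(1/n)")
      case True
      have "\<bar>(1/n) * step (n * x$2 + (-1)) * mol ((-1/n) * x$2 + 2)\<bar> \<le> (1/n) * 1 * K"
        unfolding abs_mult using n K K0 step_bounds by (intro mult_mono) auto
      then show ?thesis using True by (simp add: mult.commute)
    next
      case False
      then have "(-1/n) * x$2 + 2 \<notin> {0..1}" using n by (simp add: field_simps)
      then have "mol ((-1/n) * x$2 + 2) = 0" by (rule mol_zero)
      then show ?thesis using False by (simp only: mult_zero_right mult_zero_left) simp
    qed
    show ?thesis unfolding cutB_deriv by (rule order_trans[OF abs_triangle_ineq4 add_mono[OF 1 2]])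
  qed
  have bA: "\<bar>?A' * ?B\<bar> \<le> 2 * K * ((1/n) * ?i2)"
  proof (cases "x$2 \<le> 2/(1/n)")
    case True
    have "\<bar>?A' * ?B\<bar> \<le> 2 * K / n * 1"
      unfolding abs_mult using cutA_deriv_bound(1)[OF n K] cutA_bounds K0 n by (intro mult_mono) auto
    then show ?thesis using True by simp
  next
    case False
    then have "?B = 0" using n by (intro cutB_zero) auto
    then show ?thesis using False by simp
  qed
  \<comment> \<open>The 3 collects one contribution from the upper end of the vertical cutoff and
    two from the slopes of the horizontal one; its square is the 9 in the statement.\<close>
  have "\<bar>E\<bar> \<le> ?iD * norm g * (K * (n * \<bar>stream v x\<bar> * ?i1) + 3 * K * ((1/n) * \<bar>stream v x\<bar> * ?i2))"
  proof (cases "x \<in> {x. x $ 2 \<le> 2/n \<or> x $ 2 \<ge> n \<or> \<bar>x $ 1\<bar> \<ge> n}")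
    case False
    then have "?A' = 0" by (intro cutA_deriv_bound(2)[OF n K]) auto
    moreover have "?B' = 0"
    proof (rule deriv_eq_0_of_locally_0[of "{2/n<..<n}" _ _ 1])
      show "cutB n n y = 1" if "y \<in> {2/n<..<n}" for y using that n by (intro cutB_one) auto
    qed (use False in auto)
    ultimately show ?thesis using False by (simp add: E)
  next
    case True
    have "\<bar>?A * ?B' * g$1 - ?A' * ?B * g$2\<bar> \<le> \<bar>?A * ?B' * g$1\<bar> + \<bar>?A' * ?B * g$2\<bar>" by (rule abs_triangle_ineq4)
    also have "\<dots> \<le> (1 * (K * (n * ?i1) + K * ((1/n) * ?i2))) * norm g + (2 * K * ((1/n) * ?i2)) * norm g"
    proof (rule add_mono)
      have "\<bar>?A * ?B'\<bar> \<le> 1 * (K * (n * ?i1) + K * ((1/n) * ?i2))"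
        unfolding abs_mult by (intro mult_mono bB) (use cutA_bounds in auto)
      then show "\<bar>?A * ?B' * g$1\<bar> \<le> (1 * (K * (n * ?i1) + K * ((1/n) * ?i2))) * norm g"
        unfolding abs_mult[of _ "g$1"] by (intro mult_mono component_le_norm_cart) auto
      show "\<bar>?A' * ?B * g$2\<bar> \<le> (2 * K * ((1/n) * ?i2)) * norm g"
        unfolding abs_mult[of _ "g$2"] by (intro mult_mono component_le_norm_cart bA) (use K0 n in auto)
    qed
    finally have "\<bar>stream v x\<bar> * \<bar>?A * ?B' * g$1 - ?A' * ?B * g$2\<bar> \<le>
        \<bar>stream v x\<bar> * ((1 * (K * (n * ?i1) + K * ((1/n) * ?i2))) * norm g + (2 * K * ((1/n) * ?i2)) * norm g)"
      by (rule mult_left_mono) simp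
    also have "\<dots> = 1 * norm g * (K * (n * \<bar>stream v x\<bar> * ?i1) + 3 * K * ((1/n) * \<bar>stream v x\<bar> * ?i2))"
      by (simp add: algebra_simps)
    finally have "\<bar>E\<bar> \<le> 1 * norm g * (K * (n * \<bar>stream v x\<bar> * ?i1) + 3 * K * ((1/n) * \<bar>stream v x\<bar> * ?i2))"
      unfolding E abs_mult .
    moreover have "?iD = 1" using True by (rule indicator_simps(1))
    ultimately show ?thesis by (simp only:)
  qed
  also have "\<dots> \<le> e * (K\<^sup>2 * (n * stream v x * ?i1)\<^sup>2 + 9 * K\<^sup>2 * ((1/n) * stream v x * ?i2)\<^sup>2) + 1/(2*e) * (?iD * (norm g)\<^sup>2)"
  proof -
    define P where "P = K * (n * \<bar>stream v x\<bar> * ?i1)"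
    define R where "R = 3 * K * ((1/n) * \<bar>stream v x\<bar> * ?i2)"
    define a where "a = ?iD * norm g"
    have P2: "P\<^sup>2 = K\<^sup>2 * (n * stream v x * ?i1)\<^sup>2" by (simp add: P_def power_mult_distrib)
    have R2: "R\<^sup>2 = 9 * K\<^sup>2 * ((1/n) * stream v x * ?i2)\<^sup>2" by (simp add: R_def power_mult_distrib power_divide)
    have a2: "a\<^sup>2 = ?iD * (norm g)\<^sup>2" by (simp add: a_def power_mult_distrib indicator_def)
    have "2 * (a * (P + R)) \<le> 1/e * a\<^sup>2 + e * (P + R)\<^sup>2"
    proof -
      have "0 \<le> (a - e * (P + R))\<^sup>2 / e" using e by simp
      also have "\<dots> = 1/e * a\<^sup>2 + e * (P + R)\<^sup>2 - 2 * (a * (P + R))"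
        using e by (simp add: power2_eq_square field_simps)
      finally show ?thesis by simp
    qed
    also have "e * (P + R)\<^sup>2 \<le> e * (2 * P\<^sup>2 + 2 * R\<^sup>2)"
    proof (rule mult_left_mono)
      show "(P + R)\<^sup>2 \<le> 2 * P\<^sup>2 + 2 * R\<^sup>2" using sum_squares_bound[of P R] by (simp add: power2_sum)
    qed (use e in simp)
    finally have "a * (P + R) \<le> e * (P\<^sup>2 + R\<^sup>2) + 1/(2*e) * a\<^sup>2" using e by (simp add: field_simps)
    then show ?thesis unfolding P2 R2 a2 by (simp only: a_def P_def R_def)
  qed
  finally show ?thesis unfolding E_def .
qed


lemma measurable_coord_HH [measurable]: "(\<lambda>x. x $ j) \<in> borel_measurable HH"
  by (intro continuous_measurable_HH continuous_intros)

text \<open>The order of limits matters. At fixed e, letting n grow sends the tail \<open>h\<close>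
  of the square integrable \<open>G\<close> to 0 and leaves e * C, where C is uniform in n by the
  strip estimate. Only then is e made small.\<close>

lemma pressure_orthogonal:
  assumes v: "solenoidal M v Dv" and G: "L2le N G" and orth: "\<And>V. test_field V \<Longrightarrow> (LINT x|HH. G x \<bullet> V x) = 0"
  shows "(LINT x|HH. G x \<bullet> v x) = 0"
proof -
  obtain K where K: "K > 0" "\<And>x. \<bar>mol x\<bar> \<le> K" using bump_bounded[OF mol_bump] by blast
  have "pt 0 1 \<in> \<H>" by (simp add: half_plane_def)
  then have M: "M \<ge> 0" using solenoidalD(9)[OF v] norm_ge_zero order_trans by blast
  have vm [measurable]: "v \<in> borel_measurable HH" by (rule continuous_measurable_HH[OF solenoidalD(3)[OF v]])
  have sm [measurable]: "stream v \<in> borel_measurable HH" by (rule continuous_measurable_HH[OF stream_continuous[OF v]])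
  have Gm [measurable]: "G \<in> borel_measurable HH" by (rule L2le_power2(3)[OF G])
  have vL: "L2le M v" using M vm solenoidalD(10)[OF v] by (simp add: L2le_def)
  have Gv: "integrable HH (\<lambda>x. G x \<bullet> v x)" by (rule L2le_inner[OF G vL])
  define S where "S c x = (c * stream v x * indicator {x. x $ 2 \<le> 2/c} x)\<^sup>2" for c x
  have S: "integrable HH (S c)" "(LINT x|HH. S c x) \<le> 4 * M" if c: "c > 0" for c
  proof -
    have m: "S c \<in> borel_measurable HH" unfolding S_def[abs_def] indicator_def mem_Collect_eq by measurable
    have b: "(\<integral>\<^sup>+x. ennreal (S c x) \<partial>HH) \<le> ennreal (4 * M)"
      using stream_strip_bound[OF v c] M by (simp add: S_def ennreal_mult)
    have nn: "S c x \<ge> 0" for x by (simp add: S_def)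
    show "integrable HH (S c)" "(LINT x|HH. S c x) \<le> 4 * M"
      by (rule nn_integral_le_integrable[OF m nn b], use M in simp)+
  qed
  define D where "D n = {x :: real^2. x $ 2 \<le> 2/n \<or> x $ 2 \<ge> n \<or> \<bar>x $ 1\<bar> \<ge> n}" for n :: real
  define h where "h n = (LINT x|HH. indicator (D n) x * (norm (G x))\<^sup>2)" for n
  have mD: "(\<lambda>x. indicator (D n) x * (norm (G x))\<^sup>2) \<in> borel_measurable HH" for n
    unfolding D_def indicator_def mem_Collect_eq by measurable
  have iD: "integrable HH (\<lambda>x. indicator (D n) x * (norm (G x))\<^sup>2)" for n
    by (rule Bochner_Integration.integrable_bound[OF L2le_power2(1)[OF G] mD]) (auto simp: indicator_def)
  define C where "C = K\<^sup>2 * (4 * M) + 9 * K\<^sup>2 * (4 * M)"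
  have main: "\<bar>LINT x|HH. tp (cutA n) (cutB n n) x * (G x \<bullet> v x)\<bar> \<le> e * C + 1/(2*e) * h n" if n: "n > 0" and e: "e > 0" for n e
  proof -
    define E where "E x = G x \<bullet> cut_field n v x - tp (cutA n) (cutB n n) x * (G x \<bullet> v x)" for x
    define W where "W x = e * (K\<^sup>2 * S n x + 9 * K\<^sup>2 * S (1/n) x) + 1/(2*e) * (indicator (D n) x * (norm (G x))\<^sup>2)" for x
    have EW: "\<bar>E x\<bar> \<le> W x" if "x \<in> \<H>" for x
      using cut_field_error[OF v n K(2) that e] unfolding E_def W_def S_def D_def .
    have n1: "1/n > 0" using n by simp
    have iS: "integrable HH (\<lambda>x. K\<^sup>2 * S n x)" "integrable HH (\<lambda>x. 9 * K\<^sup>2 * S (1/n) x)"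
      by (intro integrable_mult_right S n n1)+
    have iW: "integrable HH W" unfolding W_def[abs_def]
      by (intro Bochner_Integration.integrable_add integrable_mult_right iS iD)
    have "continuous_on \<H> (cut_field n v)" using cut_field_test[OF v n] unfolding test_field_def by blast
    then have [measurable]: "cut_field n v \<in> borel_measurable HH" by (rule continuous_measurable_HH)
    have Em: "E \<in> borel_measurable HH" unfolding E_def[abs_def] by measurable
    have iE: "integrable HH E"
    proof (rule Bochner_Integration.integrable_bound[OF iW Em AE_I2])
      fix x assume "x \<in> space HH"
      then have "\<bar>E x\<bar> \<le> W x" by (intro EW) simp
      then show "norm (E x) \<le> norm (W x)" by simp
    qed
    have iX: "integrable HH (\<lambda>x. tp (cutA n) (cutB n n) x * (G x \<bullet> v x))"
    proof (rule Bochner_Integration.integrable_bound[OF Gv _ AE_I2])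
      fix x
      have "\<bar>tp (cutA n) (cutB n n) x\<bar> \<le> 1"
        unfolding tp_def abs_mult using cutA_bounds by (intro mult_le_one) auto
      then show "norm (tp (cutA n) (cutB n n) x * (G x \<bullet> v x)) \<le> norm (G x \<bullet> v x)"
        by (simp add: abs_mult mult_left_le_one_le)
    qed measurable
    have "0 = (LINT x|HH. G x \<bullet> cut_field n v x)" using orth[OF cut_field_test[OF v n]] by simp
    also have "\<dots> = (LINT x|HH. E x + tp (cutA n) (cutB n n) x * (G x \<bullet> v x))" by (simp add: E_def)
    also have "\<dots> = (LINT x|HH. E x) + (LINT x|HH. tp (cutA n) (cutB n n) x * (G x \<bullet> v x))"
      by (rule Bochner_Integration.integral_add[OF iE iX])
    finally have "\<bar>LINT x|HH. tp (cutA n) (cutB n n) x * (G x \<bullet> v x)\<bar> = \<bar>LINT x|HH. E x\<bar>" by simp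
    also have "\<dots> \<le> (LINT x|HH. \<bar>E x\<bar>)" by (rule integral_abs_bound)
    also have "\<dots> \<le> (LINT x|HH. W x)"
      by (rule integral_mono) (use iE iW EW in auto)
    also have "\<dots> = e * (K\<^sup>2 * (LINT x|HH. S n x) + 9 * K\<^sup>2 * (LINT x|HH. S (1/n) x)) + 1/(2*e) * h n"
    proof -
      have "(LINT x|HH. W x) = (LINT x|HH. e * (K\<^sup>2 * S n x + 9 * K\<^sup>2 * S (1/n) x)) + (LINT x|HH. 1/(2*e) * (indicator (D n) x * (norm (G x))\<^sup>2))"
        unfolding W_def by (intro Bochner_Integration.integral_add integrable_mult_right Bochner_Integration.integrable_add iS iD)
      moreover have "(LINT x|HH. K\<^sup>2 * S n x + 9 * K\<^sup>2 * S (1/n) x) = K\<^sup>2 * (LINT x|HH. S n x) + 9 * K\<^sup>2 * (LINT x|HH. S (1/n) x)"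
        using Bochner_Integration.integral_add[OF iS] by simp
      ultimately show ?thesis unfolding h_def by (simp only: integral_mult_right_zero)
    qed
    also have "\<dots> \<le> e * C + 1/(2*e) * h n"
      unfolding C_def using S(2)[OF n] S(2)[OF n1] e by (intro add_mono mult_left_mono order_refl) auto
    finally show ?thesis .
  qed
  have h0: "(\<lambda>k. h (real (Suc k))) \<longlonglongrightarrow> 0"
  proof -
    have "(\<lambda>k. LINT x|HH. indicator (D (real (Suc k))) x * (norm (G x))\<^sup>2) \<longlonglongrightarrow> (LINT x|HH. 0)"
    proof (rule integral_dominated_convergence[where w = "\<lambda>x. (norm (G x))\<^sup>2"])
      show "AE x in HH. (\<lambda>k. indicator (D (real (Suc k))) x * (norm (G x))\<^sup>2) \<longlonglongrightarrow> 0"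
      proof (rule AE_I2, rule tendsto_eventually)
        fix x assume "x \<in> space HH"
        then have x2: "x $ 2 > 0" by (simp add: half_plane_def)
        obtain N where N: "max (\<bar>x $ 1\<bar> + x $ 2) (2 / x $ 2) \<le> real N" using real_arch_simple by blast
        show "eventually (\<lambda>k. indicator (D (real (Suc k))) x * (norm (G x))\<^sup>2 = 0) sequentially"
          unfolding eventually_sequentially
        proof (intro exI allI impI)
          fix k assume k: "N \<le> k"
          have *: "\<bar>x $ 1\<bar> + x $ 2 < real (Suc k)" "2 / x $ 2 < real (Suc k)" using N k by auto
          then have "2 / real (Suc k) < x $ 2" using x2 by (simp add: field_simps)
          then have "x \<notin> D (real (Suc k))" using * x2 unfolding D_def by auto
          then show "indicator (D (real (Suc k))) x * (norm (G x))\<^sup>2 = 0" by simp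
        qed
      qed
    qed (use L2le_power2(1)[OF G] mD in \<open>auto simp: indicator_def\<close>)
    then show ?thesis by (simp add: h_def)
  qed
  let ?L = "\<bar>LINT x|HH. G x \<bullet> v x\<bar>"
  have lim: "?L \<le> e * C" if e: "e > 0" for e
  proof (rule LIMSEQ_le)
    show "(\<lambda>k. \<bar>LINT x|HH. tp (cutA (real (Suc k))) (cutB (real (Suc k)) (real (Suc k))) x * (G x \<bullet> v x)\<bar>) \<longlonglongrightarrow> ?L"
      by (intro tendsto_rabs cut_dominated[OF Gv]) simp
    have "(\<lambda>k. e * C + 1/(2*e) * h (real (Suc k))) \<longlonglongrightarrow> e * C + 1/(2*e) * 0" by (intro tendsto_intros h0)
    then show "(\<lambda>k. e * C + 1/(2*e) * h (real (Suc k))) \<longlonglongrightarrow> e * C" by simp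
    show "\<exists>N. \<forall>k\<ge>N. \<bar>LINT x|HH. tp (cutA (real (Suc k))) (cutB (real (Suc k)) (real (Suc k))) x * (G x \<bullet> v x)\<bar> \<le> e * C + 1/(2*e) * h (real (Suc k))"
      using main[OF _ e] by (intro exI[of _ 0] allI impI) simp
  qed
  have C0: "C \<ge> 0" using M by (simp add: C_def)
  have "?L \<le> 0"
  proof (rule field_le_epsilon)
    fix d :: real assume d: "d > 0"
    have "?L \<le> d / (C + 1) * C" using d C0 by (intro lim) auto
    also have "\<dots> \<le> d" using d C0 by (simp add: field_simps)
    finally show "?L \<le> 0 + d" by simp
  qed
  then show ?thesis by simp
qed


subsection \<open>The velocity increment tested against a solenoidal field\<close>

interpretation tx: pair_sigma_finite "lborel :: real measure" HH ..

lemma measurable_time_space: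
  fixes F :: "real \<Rightarrow> real^2 \<Rightarrow> 'b::euclidean_space"
  assumes "continuous_on ({t1..t2} \<times> \<H>) (\<lambda>(t, x). F t x)"
  shows "(\<lambda>z. indicator {t1..t2} (fst z) *\<^sub>R F (fst z) (snd z)) \<in> borel_measurable (lborel \<Otimes>\<^sub>M HH)"
proof -
  have "{t1..t2} \<times> \<H> \<in> sets (borel \<Otimes>\<^sub>M borel)" by (intro pair_measureI) auto
  then have "{t1..t2} \<times> \<H> \<in> sets (borel :: (real \<times> (real^2)) measure)" unfolding borel_prod .
  from borel_measurable_continuous_on_indicator[OF this assms]
  have *: "(\<lambda>z. indicator ({t1..t2} \<times> \<H>) z *\<^sub>R F (fst z) (snd z)) \<in> borel_measurable (borel \<Otimes>\<^sub>M borel)"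
    by (simp add: borel_prod case_prod_beta')
  have id: "(\<lambda>z. (fst z, snd z)) \<in> lborel \<Otimes>\<^sub>M HH \<rightarrow>\<^sub>M borel \<Otimes>\<^sub>M borel"
    by (intro measurable_Pair measurable_compose[OF measurable_snd measurable_HH_id]) simp
  have "(\<lambda>z. indicator ({t1..t2} \<times> \<H>) z *\<^sub>R F (fst z) (snd z)) \<in> borel_measurable (lborel \<Otimes>\<^sub>M HH)"
    using measurable_compose[OF id *] by simp
  then show ?thesis
    by (rule measurable_cong[THEN iffD1, rotated]) (auto simp: space_pair_measure indicator_def)
qed

text \<open>Cauchy-Schwarz for a vector-valued integral: pair it with itself, apply the weighted
  inequality with weight t2 - t1 inside the integral, and absorb half of its squared norm.\<close>

lemma power2_norm_time_integral:
  fixes f :: "real \<Rightarrow> 'b::euclidean_space"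
  assumes f: "continuous_on {t1..t2} f" and t: "t1 < t2"
  shows "(norm (LINT t:{t1..t2}|lborel. f t))\<^sup>2 \<le> (t2 - t1) * (LINT t:{t1..t2}|lborel. (norm (f t))\<^sup>2)"
proof -
  let ?v = "LINT t:{t1..t2}|lborel. f t"
  define h where "h = t2 - t1"
  have h: "h > 0" using t by (simp add: h_def)
  have i1: "set_integrable lborel {t1..t2} f" by (rule borel_integrable_atLeastAtMost'[OF f])
  have i2: "set_integrable lborel {t1..t2} (\<lambda>t. (norm (f t))\<^sup>2)"
    by (intro borel_integrable_atLeastAtMost' continuous_intros f)
  have i3: "set_integrable lborel {t1..t2} (\<lambda>t. ?v \<bullet> f t)"
    by (intro borel_integrable_atLeastAtMost' continuous_intros f)
  have i4: "set_integrable lborel {t1..t2} (\<lambda>t. 1 / (2 * h) * (norm ?v)\<^sup>2 + h / 2 * (norm (f t))\<^sup>2)"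
    by (intro borel_integrable_atLeastAtMost' continuous_intros f)
  have c: "(LINT t:{t1..t2}|lborel. 1 / (2 * h) * (norm ?v)\<^sup>2) = (norm ?v)\<^sup>2 / 2"
  proof -
    have "(LINT s:{t1..t2}|lborel. y) = h * y" for y :: real using t by (simp add: set_integral_const h_def)
    then show ?thesis using h by (simp only:) simp
  qed
  have ic: "set_integrable lborel {t1..t2} (\<lambda>t. 1 / (2 * h) * (norm ?v)\<^sup>2)"
    by (intro borel_integrable_atLeastAtMost' continuous_intros)
  have ih: "set_integrable lborel {t1..t2} (\<lambda>t. h / 2 * (norm (f t))\<^sup>2)"
    by (intro borel_integrable_atLeastAtMost' continuous_intros f)
  have "(norm ?v)\<^sup>2 = ?v \<bullet> ?v" by (simp add: power2_norm_eq_inner)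
  also have "\<dots> = (LINT t:{t1..t2}|lborel. ?v \<bullet> f t)"
  proof -
    have "?v \<bullet> (LINT t|lborel. indicator {t1..t2} t *\<^sub>R f t) = (LINT t|lborel. ?v \<bullet> (indicator {t1..t2} t *\<^sub>R f t))"
      by (rule integral_inner_right[symmetric]) (use i1 in \<open>simp add: set_integrable_def\<close>)
    then show ?thesis by (simp add: set_lebesgue_integral_def)
  qed
  also have "\<dots> \<le> (LINT t:{t1..t2}|lborel. 1 / (2 * h) * (norm ?v)\<^sup>2 + h / 2 * (norm (f t))\<^sup>2)"
  proof (rule set_integral_mono[OF i3 i4])
    fix t
    have cs: "?v \<bullet> f t \<le> norm ?v * norm (f t)" by (rule norm_cauchy_schwarz)
    have "2 * (norm ?v * norm (f t)) \<le> 1 / h * (norm ?v)\<^sup>2 + h * (norm (f t))\<^sup>2"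
    proof -
      have "0 \<le> (norm ?v - h * norm (f t))\<^sup>2 / h" using h by simp
      also have "\<dots> = 1 / h * (norm ?v)\<^sup>2 + h * (norm (f t))\<^sup>2 - 2 * (norm ?v * norm (f t))"
        using h by (simp add: power2_eq_square field_simps)
      finally show ?thesis by simp
    qed
    then have "norm ?v * norm (f t) \<le> (1 / h * (norm ?v)\<^sup>2 + h * (norm (f t))\<^sup>2) / 2" by simp
    also have "\<dots> = 1 / (2 * h) * (norm ?v)\<^sup>2 + h / 2 * (norm (f t))\<^sup>2" using h by (simp add: field_simps)
    finally have "norm ?v * norm (f t) \<le> 1 / (2 * h) * (norm ?v)\<^sup>2 + h / 2 * (norm (f t))\<^sup>2" .
    with cs show "?v \<bullet> f t \<le> 1 / (2 * h) * (norm ?v)\<^sup>2 + h / 2 * (norm (f t))\<^sup>2" by (rule order_trans)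
  qed
  also have "\<dots> = (norm ?v)\<^sup>2 / 2 + h / 2 * (LINT t:{t1..t2}|lborel. (norm (f t))\<^sup>2)"
    unfolding set_integral_add(2)[OF ic ih] c by (simp only: set_integral_mult_right)
  finally show ?thesis by (simp add: h_def)
qed

text \<open>Neither \<open>\<partial>\<^sub>t u\<close> nor the pressure gradient is known to be square integrable at a fixed time, but
  the time integral of the latter is, being expressed by the equation through the increment of the velocity.
  Hence the equation is tested in its time-integrated form.\<close>

lemma increment_bound:
  fixes F R :: "real \<Rightarrow> real^2 \<Rightarrow> real^2"
  assumes t: "t1 < t2"
    and F: "continuous_on ({t1..t2} \<times> \<H>) (\<lambda>(t, x). F t x)" and R: "continuous_on ({t1..t2} \<times> \<H>) (\<lambda>(t, x). R t x)"
    and N: "\<And>t. t \<in> {t1..t2} \<Longrightarrow> L2le N (F t)"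
    and orth: "\<And>t V. t \<in> {t1..t2} \<Longrightarrow> test_field V \<Longrightarrow> (LINT x|HH. R t x \<bullet> V x) = 0"
    and d: "L2le Nd d" "\<And>x. x \<in> \<H> \<Longrightarrow> d x = (LINT t:{t1..t2}|lborel. F t x - R t x)"
    and v: "solenoidal M v Dv"
    and B: "\<And>t. t \<in> {t1..t2} \<Longrightarrow> (LINT x|HH. F t x \<bullet> v x) \<le> B"
  shows "(LINT x|HH. d x \<bullet> v x) \<le> (t2 - t1) * B"
proof -
  have "pt 0 1 \<in> \<H>" by (simp add: half_plane_def)
  then have M: "M \<ge> 0" using solenoidalD(9)[OF v] norm_ge_zero order_trans by blast
  have N0: "N \<ge> 0" using L2le_power2(4)[OF N] t by force
  have vm [measurable]: "v \<in> borel_measurable HH" by (rule continuous_measurable_HH[OF solenoidalD(3)[OF v]])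
  have vL: "L2le M v" using M vm solenoidalD(10)[OF v] by (simp add: L2le_def)
  have cF: "continuous_on {t1..t2} (\<lambda>t. F t x)" and cR: "continuous_on {t1..t2} (\<lambda>t. R t x)" if x: "x \<in> \<H>" for x
  proof -
    have "continuous_on {t1..t2} (\<lambda>t. (\<lambda>(t, x). F t x) (t, x))" "continuous_on {t1..t2} (\<lambda>t. (\<lambda>(t, x). R t x) (t, x))"
      by (rule continuous_on_compose2[OF F] continuous_on_compose2[OF R]; use x in \<open>auto intro!: continuous_intros\<close>)+
    then show "continuous_on {t1..t2} (\<lambda>t. F t x)" "continuous_on {t1..t2} (\<lambda>t. R t x)" by simp_all
  qed
  define Fb where "Fb x = (LINT t:{t1..t2}|lborel. F t x)" for x
  define G where "G x = Fb x - d x" for x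
  note Fm = measurable_time_space[OF F, measurable] and Rm = measurable_time_space[OF R, measurable]
  have Fm2: "(\<lambda>(x, t). indicator {t1..t2} t *\<^sub>R F t x) \<in> borel_measurable (HH \<Otimes>\<^sub>M lborel)"
    using measurable_compose[OF measurable_pair_swap' Fm] by (simp add: case_prod_beta')
  have Fbm [measurable]: "Fb \<in> borel_measurable HH"
    unfolding Fb_def[abs_def] set_lebesgue_integral_def
    by (rule lborel.borel_measurable_lebesgue_integral[OF Fm2])
  have dm [measurable]: "d \<in> borel_measurable HH" by (rule L2le_power2(3)[OF d(1)])
  have FbL: "L2le ((t2 - t1)\<^sup>2 * N) Fb"
  proof -
    have "(\<integral>\<^sup>+x. ennreal ((norm (Fb x))\<^sup>2) \<partial>HH) \<le> (\<integral>\<^sup>+x. ennreal (t2 - t1) * (\<integral>\<^sup>+t. ennreal ((norm (indicator {t1..t2} t *\<^sub>R F t x))\<^sup>2) \<partial>lborel) \<partial>HH)"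
    proof (rule nn_integral_mono)
      fix x assume "x \<in> space HH"
      then have x: "x \<in> \<H>" by simp
      have si: "set_integrable lborel {t1..t2} (\<lambda>t. (norm (F t x))\<^sup>2)"
        by (intro borel_integrable_atLeastAtMost' continuous_intros cF x)
      have "ennreal ((norm (Fb x))\<^sup>2) \<le> ennreal ((t2 - t1) * (LINT t:{t1..t2}|lborel. (norm (F t x))\<^sup>2))"
        unfolding Fb_def by (rule ennreal_leI[OF power2_norm_time_integral[OF cF[OF x] t]])
      also have "\<dots> = ennreal (t2 - t1) * ennreal (LINT t:{t1..t2}|lborel. (norm (F t x))\<^sup>2)"
        using t by (intro ennreal_mult) (auto simp: set_lebesgue_integral_def)
      also have "ennreal (LINT t:{t1..t2}|lborel. (norm (F t x))\<^sup>2) = (\<integral>\<^sup>+t. ennreal (indicator {t1..t2} t *\<^sub>R (norm (F t x))\<^sup>2) \<partial>lborel)"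
        unfolding set_lebesgue_integral_def by (rule nn_integral_eq_integral[symmetric]) (use si in \<open>auto simp: set_integrable_def\<close>)
      also have "\<dots> = (\<integral>\<^sup>+t. ennreal ((norm (indicator {t1..t2} t *\<^sub>R F t x))\<^sup>2) \<partial>lborel)"
        by (intro nn_integral_cong) (simp add: indicator_def)
      finally show "ennreal ((norm (Fb x))\<^sup>2) \<le> ennreal (t2 - t1) * (\<integral>\<^sup>+t. ennreal ((norm (indicator {t1..t2} t *\<^sub>R F t x))\<^sup>2) \<partial>lborel)" .
    qed
    also have "\<dots> = ennreal (t2 - t1) * (\<integral>\<^sup>+x. \<integral>\<^sup>+t. ennreal ((norm (indicator {t1..t2} t *\<^sub>R F t x))\<^sup>2) \<partial>lborel \<partial>HH)"
    proof (rule nn_integral_cmult)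
      have "(\<lambda>z. ennreal ((norm (indicator {t1..t2} (snd z) *\<^sub>R F (snd z) (fst z)))\<^sup>2)) \<in> borel_measurable (HH \<Otimes>\<^sub>M lborel)"
        using Fm2 unfolding case_prod_beta' by measurable
      then show "(\<lambda>x. \<integral>\<^sup>+t. ennreal ((norm (indicator {t1..t2} t *\<^sub>R F t x))\<^sup>2) \<partial>lborel) \<in> borel_measurable HH"
        by (intro lborel.borel_measurable_nn_integral) (simp only: case_prod_beta')
    qed
    also have "(\<integral>\<^sup>+x. \<integral>\<^sup>+t. ennreal ((norm (indicator {t1..t2} t *\<^sub>R F t x))\<^sup>2) \<partial>lborel \<partial>HH)
       = (\<integral>\<^sup>+t. \<integral>\<^sup>+x. ennreal ((norm (indicator {t1..t2} t *\<^sub>R F t x))\<^sup>2) \<partial>HH \<partial>lborel)"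
    proof (rule tx.Fubini')
      show "(\<lambda>(t, x). ennreal ((norm (indicator {t1..t2} t *\<^sub>R F t x))\<^sup>2)) \<in> borel_measurable (lborel \<Otimes>\<^sub>M HH)"
        unfolding case_prod_beta' using Fm by measurable
    qed
    also have "\<dots> \<le> (\<integral>\<^sup>+t. ennreal N * indicator {t1..t2} t \<partial>lborel)"
    proof (rule nn_integral_mono)
      fix t
      show "(\<integral>\<^sup>+x. ennreal ((norm (indicator {t1..t2} t *\<^sub>R F t x))\<^sup>2) \<partial>HH) \<le> ennreal N * indicator {t1..t2} t"
        using N[of t] by (cases "t \<in> {t1..t2}") (auto simp: L2le_def)
    qed
    also have "\<dots> = ennreal (N * (t2 - t1))" using t N0 by (simp add: nn_integral_cmult_indicator ennreal_mult)
    finally have "(\<integral>\<^sup>+x. ennreal ((norm (Fb x))\<^sup>2) \<partial>HH) \<le> ennreal (t2 - t1) * ennreal (N * (t2 - t1))"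
      by (simp add: mult_left_mono)
    also have "\<dots> = ennreal ((t2 - t1)\<^sup>2 * N)" using t N0 by (simp add: ennreal_mult[symmetric] power2_eq_square mult_ac)
    finally show ?thesis using N0 by (simp add: L2le_def)
  qed
  have GL: "\<exists>N'. L2le N' G"
  proof -
    have "integrable HH (\<lambda>x. 2 * ((norm (Fb x))\<^sup>2 + (norm (d x))\<^sup>2))"
      using L2le_power2(1)[OF FbL] L2le_power2(1)[OF d(1)] by simp
    then have i: "integrable HH (\<lambda>x. (norm (G x))\<^sup>2)"
    proof (rule Bochner_Integration.integrable_bound)
      show "(\<lambda>x. (norm (G x))\<^sup>2) \<in> borel_measurable HH" unfolding G_def by measurable
      show "AE x in HH. norm ((norm (G x))\<^sup>2) \<le> norm (2 * ((norm (Fb x))\<^sup>2 + (norm (d x))\<^sup>2))"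
      proof (rule AE_I2)
        fix x
        have "(norm (G x))\<^sup>2 \<le> (norm (Fb x) + norm (d x))\<^sup>2" unfolding G_def by (intro power_mono norm_triangle_ineq4) simp
        also have "\<dots> \<le> 2 * ((norm (Fb x))\<^sup>2 + (norm (d x))\<^sup>2)"
          using sum_squares_bound[of "norm (Fb x)" "norm (d x)"] by (simp add: power2_sum)
        finally show "norm ((norm (G x))\<^sup>2) \<le> norm (2 * ((norm (Fb x))\<^sup>2 + (norm (d x))\<^sup>2))" by simp
      qed
    qed
    have "(\<integral>\<^sup>+x. ennreal ((norm (G x))\<^sup>2) \<partial>HH) = ennreal (LINT x|HH. (norm (G x))\<^sup>2)"
      by (rule nn_integral_eq_integral[OF i]) simp
    then have "L2le (LINT x|HH. (norm (G x))\<^sup>2) G" unfolding L2le_def using Fbm dm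
      by (auto simp: G_def[abs_def] intro!: integral_nonneg_AE)
    then show ?thesis by blast
  qed
  then obtain N' where GL: "L2le N' G" by blast
  have GR: "G x = (LINT t:{t1..t2}|lborel. R t x)" if x: "x \<in> \<H>" for x
  proof -
    have "set_integrable lborel {t1..t2} (\<lambda>t. F t x)" "set_integrable lborel {t1..t2} (\<lambda>t. R t x)"
      by (intro borel_integrable_atLeastAtMost' cF cR x)+
    then show ?thesis unfolding G_def Fb_def d(2)[OF x] by (simp add: set_integral_diff)
  qed
  \<comment> \<open>Compactly supported fields come first: on the compact product of the time
    interval with the box \<open>R\<close> is bounded, so the time and space integrals may be
    exchanged. The square integrability of \<open>G\<close> then carries orthogonality over to
    \<open>v\<close>.\<close>
  have Gv: "(LINT x|HH. G x \<bullet> v x) = 0"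
  proof (rule pressure_orthogonal[OF v GL])
    fix V assume V: "test_field V"
    obtain a b where K: "cbox a b \<subseteq> \<H>" and z: "\<And>x. x \<notin> box a b \<Longrightarrow> V x = 0" and cV: "continuous_on \<H> V"
      using V unfolding test_field_def by blast
    have Vm [measurable]: "V \<in> borel_measurable HH" by (rule continuous_measurable_HH[OF cV])
    let ?f = "\<lambda>z. (indicator {t1..t2} (fst z) *\<^sub>R R (fst z) (snd z)) \<bullet> V (snd z)"
    have "compact ({t1..t2} \<times> cbox a b)" by (intro compact_Times compact_Icc compact_cbox)
    moreover have "continuous_on ({t1..t2} \<times> cbox a b) (\<lambda>z. R (fst z) (snd z) \<bullet> V (snd z))"
    proof (intro continuous_intros)
      show "continuous_on ({t1..t2} \<times> cbox a b) (\<lambda>z. R (fst z) (snd z))"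
        using continuous_on_subset[OF R, of "{t1..t2} \<times> cbox a b"] K by (auto simp: case_prod_beta')
      show "continuous_on ({t1..t2} \<times> cbox a b) (\<lambda>z. V (snd z))"
        by (rule continuous_on_compose2[OF cV]) (use K in \<open>auto intro!: continuous_intros\<close>)
    qed
    ultimately have "bounded ((\<lambda>z. R (fst z) (snd z) \<bullet> V (snd z)) ` ({t1..t2} \<times> cbox a b))"
      by (intro compact_imp_bounded compact_continuous_image)
    then obtain C where C: "C > 0" "\<And>z. z \<in> {t1..t2} \<times> cbox a b \<Longrightarrow> norm (R (fst z) (snd z) \<bullet> V (snd z)) \<le> C"
      unfolding bounded_pos by auto
    have Ks: "cbox a b \<in> sets HH" using K half_plane_lebesgue by (subst sets_restrict_space_iff) auto
    have eK: "emeasure HH (cbox a b) < \<infinity>"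
      using K half_plane_lebesgue emeasure_lborel_cbox_finite[of a b] by (subst emeasure_restrict_space) auto
    have int: "integrable (lborel \<Otimes>\<^sub>M HH) ?f"
    proof (rule integrableI_bounded_set[where A = "{t1..t2} \<times> cbox a b" and B = C])
      show "{t1..t2} \<times> cbox a b \<in> sets (lborel \<Otimes>\<^sub>M HH)" using Ks by (intro pair_measureI) auto
      show "emeasure (lborel \<Otimes>\<^sub>M HH) ({t1..t2} \<times> cbox a b) < \<infinity>"
        using Ks eK t by (subst HH.emeasure_pair_measure_Times) (auto simp: ennreal_mult_eq_top_iff less_top[symmetric])
      show "AE x in lborel \<Otimes>\<^sub>M HH. x \<in> {t1..t2} \<times> cbox a b \<longrightarrow> norm (?f x) \<le> C"
        using C by (intro AE_I2) auto
      show "AE x in lborel \<Otimes>\<^sub>M HH. x \<notin> {t1..t2} \<times> cbox a b \<longrightarrow> ?f x = 0"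
      proof (intro AE_I2 impI)
        fix x assume "x \<notin> {t1..t2} \<times> cbox a b"
        then have "fst x \<notin> {t1..t2} \<or> V (snd x) = 0" using z box_subset_cbox[of a b] by (cases x) auto
        then show "?f x = 0" by auto
      qed
    qed (use Rm in measurable)
    have int': "integrable (lborel \<Otimes>\<^sub>M HH) (\<lambda>(t, x). (indicator {t1..t2} t *\<^sub>R R t x) \<bullet> V x)"
      using int by (simp only: case_prod_beta')
    have "(LINT x|HH. G x \<bullet> V x) = (LINT x|HH. LINT t|lborel. (indicator {t1..t2} t *\<^sub>R R t x) \<bullet> V x)"
    proof (rule Bochner_Integration.integral_cong[OF refl])
      fix x assume "x \<in> space HH"
      then have x: "x \<in> \<H>" by simp
      have "integrable lborel (\<lambda>t. indicator {t1..t2} t *\<^sub>R R t x)"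
        using borel_integrable_atLeastAtMost'[OF cR[OF x]] by (simp add: set_integrable_def)
      then show "G x \<bullet> V x = (LINT t|lborel. (indicator {t1..t2} t *\<^sub>R R t x) \<bullet> V x)"
        unfolding GR[OF x] set_lebesgue_integral_def by (rule integral_inner_left[OF _, symmetric])
    qed
    also have "\<dots> = (LINT t|lborel. LINT x|HH. (indicator {t1..t2} t *\<^sub>R R t x) \<bullet> V x)"
      using tx.Fubini_integral[OF int'] by simp
    also have "\<dots> = integral\<^sup>L lborel (\<lambda>t::real. 0::real)"
    proof (rule Bochner_Integration.integral_cong[OF refl])
      fix t show "(LINT x|HH. (indicator {t1..t2} t *\<^sub>R R t x) \<bullet> V x) = 0"
        using orth[OF _ V, of t] by (cases "t \<in> {t1..t2}") auto
    qed
    finally show "(LINT x|HH. G x \<bullet> V x) = 0" by simp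
  qed
  have int: "integrable (lborel \<Otimes>\<^sub>M HH) (\<lambda>z. (indicator {t1..t2} (fst z) *\<^sub>R F (fst z) (snd z)) \<bullet> v (snd z))"
  proof (rule integrableI_bounded)
    show "(\<lambda>z. (indicator {t1..t2} (fst z) *\<^sub>R F (fst z) (snd z)) \<bullet> v (snd z)) \<in> borel_measurable (lborel \<Otimes>\<^sub>M HH)"
      using Fm by measurable
    have "(\<integral>\<^sup>+z. ennreal (norm ((indicator {t1..t2} (fst z) *\<^sub>R F (fst z) (snd z)) \<bullet> v (snd z))) \<partial>(lborel \<Otimes>\<^sub>M HH))
      = (\<integral>\<^sup>+t. \<integral>\<^sup>+x. ennreal (norm ((indicator {t1..t2} t *\<^sub>R F t x) \<bullet> v x)) \<partial>HH \<partial>lborel)"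
    proof -
      have "(\<lambda>z. v (snd z)) \<in> borel_measurable (lborel \<Otimes>\<^sub>M HH)" by (rule measurable_compose[OF measurable_snd vm])
      then have "(\<lambda>z. ennreal (norm ((indicator {t1..t2} (fst z) *\<^sub>R F (fst z) (snd z)) \<bullet> v (snd z)))) \<in> borel_measurable (lborel \<Otimes>\<^sub>M HH)"
        using Fm by measurable
      from HH.nn_integral_fst[OF this] show ?thesis by simp
    qed
    also have "\<dots> \<le> (\<integral>\<^sup>+t. ennreal (N + M) * indicator {t1..t2} t \<partial>lborel)"
    proof (rule nn_integral_mono)
      fix t
      show "(\<integral>\<^sup>+x. ennreal (norm ((indicator {t1..t2} t *\<^sub>R F t x) \<bullet> v x)) \<partial>HH) \<le> ennreal (N + M) * indicator {t1..t2} t"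
      proof (cases "t \<in> {t1..t2}")
        case True
        have [measurable]: "F t \<in> borel_measurable HH" using L2le_power2(3)[OF N[OF True]] .
        have "(\<integral>\<^sup>+x. ennreal (norm (F t x \<bullet> v x)) \<partial>HH) \<le> (\<integral>\<^sup>+x. ennreal ((norm (F t x))\<^sup>2) + ennreal ((norm (v x))\<^sup>2) \<partial>HH)"
        proof (rule nn_integral_mono)
          fix x
          have "norm (F t x \<bullet> v x) \<le> ((norm (F t x))\<^sup>2 + (norm (v x))\<^sup>2) / 2" using abs_inner_le by simp
          also have "\<dots> \<le> (norm (F t x))\<^sup>2 + (norm (v x))\<^sup>2" by simp
          finally have "ennreal (norm (F t x \<bullet> v x)) \<le> ennreal ((norm (F t x))\<^sup>2 + (norm (v x))\<^sup>2)" by (rule ennreal_leI)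
          then show "ennreal (norm (F t x \<bullet> v x)) \<le> ennreal ((norm (F t x))\<^sup>2) + ennreal ((norm (v x))\<^sup>2)" by simp
        qed
        also have "\<dots> = (\<integral>\<^sup>+x. ennreal ((norm (F t x))\<^sup>2) \<partial>HH) + (\<integral>\<^sup>+x. ennreal ((norm (v x))\<^sup>2) \<partial>HH)"
          by (rule nn_integral_add) measurable
        also have "\<dots> \<le> ennreal N + ennreal M" using N[OF True] vL by (intro add_mono) (auto simp: L2le_def)
        finally show ?thesis using True N0 M by simp
      qed simp
    qed
    also have "\<dots> < \<infinity>" using t by (simp add: nn_integral_cmult_indicator ennreal_mult_less_top)
    finally show "(\<integral>\<^sup>+z. ennreal (norm ((indicator {t1..t2} (fst z) *\<^sub>R F (fst z) (snd z)) \<bullet> v (snd z))) \<partial>(lborel \<Otimes>\<^sub>M HH)) < \<infinity>" .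
  qed
  then have int': "integrable (lborel \<Otimes>\<^sub>M HH) (\<lambda>(t, x). (indicator {t1..t2} t *\<^sub>R F t x) \<bullet> v x)"
    by (simp only: case_prod_beta')
  have "(LINT x|HH. Fb x \<bullet> v x) = (LINT x|HH. LINT t|lborel. (indicator {t1..t2} t *\<^sub>R F t x) \<bullet> v x)"
  proof (rule Bochner_Integration.integral_cong[OF refl])
    fix x assume "x \<in> space HH"
    then have x: "x \<in> \<H>" by simp
    have "integrable lborel (\<lambda>t. indicator {t1..t2} t *\<^sub>R F t x)"
      using borel_integrable_atLeastAtMost'[OF cF[OF x]] by (simp add: set_integrable_def)
    then show "Fb x \<bullet> v x = (LINT t|lborel. (indicator {t1..t2} t *\<^sub>R F t x) \<bullet> v x)"
      unfolding Fb_def set_lebesgue_integral_def by (rule integral_inner_left[OF _, symmetric])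
  qed
  also have "\<dots> = (LINT t|lborel. LINT x|HH. (indicator {t1..t2} t *\<^sub>R F t x) \<bullet> v x)"
    using tx.Fubini_integral[OF int'] by simp
  also have "\<dots> \<le> (LINT t|lborel. indicator {t1..t2} t * B)"
  proof (rule integral_mono)
    show "integrable lborel (\<lambda>t. LINT x|HH. (indicator {t1..t2} t *\<^sub>R F t x) \<bullet> v x)"
      using tx.integrable_fst[OF int'] by simp
    show "integrable lborel (\<lambda>t. indicator {t1..t2} t * B)" using t by simp
    fix t show "(LINT x|HH. (indicator {t1..t2} t *\<^sub>R F t x) \<bullet> v x) \<le> indicator {t1..t2} t * B"
      using B[of t] by (cases "t \<in> {t1..t2}") auto
  qed
  also have "\<dots> = (t2 - t1) * B" using t by simp
  finally have 1: "(LINT x|HH. Fb x \<bullet> v x) \<le> (t2 - t1) * B" .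
  have "(LINT x|HH. G x \<bullet> v x) = (LINT x|HH. Fb x \<bullet> v x) - (LINT x|HH. d x \<bullet> v x)"
    unfolding G_def inner_diff_left using L2le_inner[OF FbL vL] L2le_inner[OF d(1) vL] by simp
  then show ?thesis using 1 Gv by simp
qed


subsection \<open>The energy estimate at a fixed time\<close>

lemma L2le_mult:
  fixes f :: "real^2 \<Rightarrow> 'b::euclidean_space"
  assumes f: "L2le A f" and c: "c \<in> borel_measurable HH" "\<And>x. x \<in> \<H> \<Longrightarrow> \<bar>c x\<bar> \<le> C"
  shows "L2le (C\<^sup>2 * A) (\<lambda>x. c x *\<^sub>R f x)"
proof -
  note [measurable] = L2le_power2(3)[OF f] c(1)
  note nn = L2le_power2(4)[OF f]
  have "(\<integral>\<^sup>+x. ennreal ((norm (c x *\<^sub>R f x))\<^sup>2) \<partial>HH) \<le> (\<integral>\<^sup>+x. ennreal (C\<^sup>2) * ennreal ((norm (f x))\<^sup>2) \<partial>HH)"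
  proof (rule nn_integral_mono)
    fix x assume "x \<in> space HH"
    then have "\<bar>c x\<bar> \<le> C" using c(2) by simp
    then have "(\<bar>c x\<bar> * norm (f x))\<^sup>2 \<le> (C * norm (f x))\<^sup>2" by (intro power_mono mult_right_mono) auto
    then have "(norm (c x *\<^sub>R f x))\<^sup>2 \<le> C\<^sup>2 * (norm (f x))\<^sup>2" by (simp add: power_mult_distrib)
    then have "ennreal ((norm (c x *\<^sub>R f x))\<^sup>2) \<le> ennreal (C\<^sup>2 * (norm (f x))\<^sup>2)" by (rule ennreal_leI)
    also have "\<dots> = ennreal (C\<^sup>2) * ennreal ((norm (f x))\<^sup>2)" by (rule ennreal_mult) simp_all
    finally show "ennreal ((norm (c x *\<^sub>R f x))\<^sup>2) \<le> ennreal (C\<^sup>2) * ennreal ((norm (f x))\<^sup>2)" .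
  qed
  also have "\<dots> = ennreal (C\<^sup>2) * (\<integral>\<^sup>+x. ennreal ((norm (f x))\<^sup>2) \<partial>HH)"
    by (rule nn_integral_cmult) measurable
  also have "\<dots> \<le> ennreal (C\<^sup>2) * ennreal A" using f unfolding L2le_def by (intro mult_left_mono) auto
  also have "\<dots> = ennreal (C\<^sup>2 * A)" using nn by (simp add: ennreal_mult)
  finally show ?thesis using nn by (simp add: L2le_def)
qed

lemma L2le_mono: "L2le A f \<Longrightarrow> A \<le> B \<Longrightarrow> L2le B f"
  unfolding L2le_def by (auto intro: order_trans[OF _ ennreal_leI])

lemma integrable_bounded_mult:
  fixes f :: "real^2 \<Rightarrow> real"
  assumes "integrable HH f" "c \<in> borel_measurable HH" "\<And>x. x \<in> \<H> \<Longrightarrow> \<bar>c x\<bar> \<le> C"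
  shows "integrable HH (\<lambda>x. c x * f x)"
proof (rule Bochner_Integration.integrable_bound)
  show "integrable HH (\<lambda>x. C * f x)" using assms(1) by simp
  show "(\<lambda>x. c x * f x) \<in> borel_measurable HH" using assms(1,2) by measurable
  show "AE x in HH. norm (c x * f x) \<le> norm (C * f x)"
  proof (rule AE_I2)
    fix x assume "x \<in> space HH"
    then have "\<bar>c x\<bar> \<le> \<bar>C\<bar>" using assms(3)[of x] by simp
    then show "norm (c x * f x) \<le> norm (C * f x)" by (simp add: abs_mult mult_right_mono)
  qed
qed

lemma sup_L2_le_solenoidal: "solenoidal M v Dv \<Longrightarrow> sup_L2_le M v" by (simp add: solenoidal_def)

text \<open>Six terms, each with squared norm at most K, are added pairwise by
  \<open>L2le_add\<close>, which doubles at every stage; the nesting yields 40. Only finiteness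
  matters, since this constant is removed later by refining the time partition.\<close>

lemma forcing_L2le:
  fixes u ub :: "real^2 \<Rightarrow> real^2"
  assumes \<nu>: "\<nu> > 0" and u: "solenoidal Mu u Du" and ub: "solenoidal Mb ub Db"
    and Du: "\<And>i. sup_L2_le Mu (Du i)" and Db: "\<And>i. sup_L2_le Mb (Db i)"
    and L: "\<And>i. L2le N (L i)"
  shows "L2le (40 * (\<nu>\<^sup>2 * N + Mu\<^sup>2 * Mu + Mb\<^sup>2 * Mb)) (\<lambda>x. \<nu> *\<^sub>R (L 1 x + L (2::2) x) - (u x $ 1 *\<^sub>R Du 1 x + u x $ 2 *\<^sub>R Du 2 x)
    + (ub x $ 1 *\<^sub>R Db 1 x + ub x $ 2 *\<^sub>R Db 2 x))"
proof -
  define K where "K = \<nu>\<^sup>2 * N + Mu\<^sup>2 * Mu + Mb\<^sup>2 * Mb"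
  note lu = sup_L2_le_L2le[OF Du solenoidalD(4)[OF u]] and lb = sup_L2_le_L2le[OF Db solenoidalD(4)[OF ub]]
  have nn: "Mu \<ge> 0" "Mb \<ge> 0" "N \<ge> 0" using L2le_power2(4)[OF lu] L2le_power2(4)[OF lb] L2le_power2(4)[OF L] by auto
  have le: "\<nu>\<^sup>2 * N \<le> K" "Mu\<^sup>2 * Mu \<le> K" "Mb\<^sup>2 * Mb \<le> K" using nn by (auto simp: K_def)
  have m: "(\<lambda>x. u x $ i) \<in> borel_measurable HH" "(\<lambda>x. ub x $ i) \<in> borel_measurable HH" for i
    by (intro continuous_measurable_HH continuous_intros solenoidalD(3)[OF u] solenoidalD(3)[OF ub])+
  have b: "\<bar>u x $ i\<bar> \<le> Mu" "\<bar>ub x $ i\<bar> \<le> Mb" if "x \<in> \<H>" for x i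
    using order_trans[OF component_le_norm_cart solenoidalD(9)[OF u that]] order_trans[OF component_le_norm_cart solenoidalD(9)[OF ub that]] by auto
  have 1: "L2le K (\<lambda>x. \<nu> *\<^sub>R L i x)" for i
    by (rule L2le_mono[OF L2le_mult[OF L, of "\<lambda>x. \<nu>" \<nu>] le(1)]) (use \<nu> in auto)
  have 2: "L2le K (\<lambda>x. u x $ i *\<^sub>R Du i x)" for i by (rule L2le_mono[OF L2le_mult[OF lu m(1) b(1)] le(2)])
  have 3: "L2le K (\<lambda>x. ub x $ i *\<^sub>R Db i x)" for i by (rule L2le_mono[OF L2le_mult[OF lb m(2) b(2)] le(3)])
  have "L2le (2 * (2 * (2 * (K + K) + 2 * (K + K)) + 2 * (K + K))) (\<lambda>x. ((\<nu> *\<^sub>R L 1 x + \<nu> *\<^sub>R L 2 x) + - (u x $ 1 *\<^sub>R Du 1 x + u x $ 2 *\<^sub>R Du 2 x))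
    + (ub x $ 1 *\<^sub>R Db 1 x + ub x $ 2 *\<^sub>R Db 2 x))"
    by (intro L2le_add L2le_minus 1 2 3)
  then show ?thesis unfolding K_def[symmetric] by (simp add: scaleR_add_right algebra_simps)
qed

text \<open>With w = u - ub the convective difference is u transporting w plus w acting on the
  gradient of \<open>ub\<close>. The integrand is therefore \<nu> times a divergence whose boundary
  term has the right sign, a transport term that is the divergence of minus half the squared norm of
  w times u, minus \<nu> times the product of the gradients of u and w, and a term quadratic in w
  with coefficient bounded by \<open>Mb\<close>.\<close>

lemma energy_estimate:
  fixes u ub :: "real^2 \<Rightarrow> real^2"
  assumes \<nu>: "\<nu> > 0" and u: "solenoidal Mu u Du" and ub: "solenoidal Mb ub Db"
    and Du: "\<And>i. sup_L2_le Mu (Du i)" and Db: "\<And>i. sup_L2_le Mb (Db i)"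
    and L: "\<And>i. L2le N (L i)" "\<And>i. continuous_on \<H> (L i)" "\<And>i x. x \<in> \<H> \<Longrightarrow> has_pd (Du i) i (L i x) x"
    and noslip: "\<And>a. u (pt a 0) = 0"
    and sign: "\<And>a. Du 2 (pt a 0) \<bullet> (u (pt a 0) - ub (pt a 0)) \<ge> 0"
  shows "(LINT x|HH. (\<nu> *\<^sub>R (L 1 x + L (2::2) x) - (u x $ 1 *\<^sub>R Du 1 x + u x $ 2 *\<^sub>R Du 2 x)
    + (ub x $ 1 *\<^sub>R Db 1 x + ub x $ 2 *\<^sub>R Db 2 x)) \<bullet> (u x - ub x)) \<le> \<nu> * Mb / 2 + 2 * Mb * (LINT x|HH. (norm (u x - ub x))\<^sup>2)"
proof -
  define w where "w x = u x - ub x" for x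
  define Dw where "Dw i x = Du i x - Db i x" for i x
  let ?F = "\<lambda>x. \<nu> *\<^sub>R (L 1 x + L 2 x) - (u x $ 1 *\<^sub>R Du 1 x + u x $ 2 *\<^sub>R Du 2 x) + (ub x $ 1 *\<^sub>R Db 1 x + ub x $ 2 *\<^sub>R Db 2 x)"
  note lu = sup_L2_le_L2le[OF Du solenoidalD(4)[OF u]] and lb = sup_L2_le_L2le[OF Db solenoidalD(4)[OF ub]]
  have cw: "continuous_on (closure \<H>) w" unfolding w_def[abs_def] by (intro continuous_intros solenoidalD(1)[OF u] solenoidalD(1)[OF ub])
  have cw': "continuous_on \<H> w" using cw half_plane_subset_closure continuous_on_subset by blast
  have cDw: "continuous_on \<H> (Dw i)" for i unfolding Dw_def[abs_def] by (intro continuous_intros solenoidalD(4)[OF u] solenoidalD(4)[OF ub])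
  have pw: "has_pd w i (Dw i x) x" if "x \<in> \<H>" for i x
    unfolding w_def[abs_def] Dw_def by (intro has_pd_diff solenoidalD(5)[OF u that] solenoidalD(5)[OF ub that])
  have lw: "\<exists>A. L2le A w" "\<exists>A. L2le A (Dw i)" for i
    using L2le_add[OF sup_L2_le_L2le[OF sup_L2_le_solenoidal[OF u] solenoidalD(3)[OF u]] L2le_minus[OF sup_L2_le_L2le[OF sup_L2_le_solenoidal[OF ub] solenoidalD(3)[OF ub]]]]
     L2le_add[OF lu[of i] L2le_minus[OF lb[of i]]] unfolding w_def[abs_def] Dw_def[abs_def] by auto
  obtain A where A: "L2le A w" using lw(1) by blast
  define A1 where "A1 = (\<lambda>i. SOME a. L2le a (Dw i))"
  have A1: "L2le (A1 i) (Dw i)" for i unfolding A1_def by (rule someI_ex[OF lw(2)])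
  have m: "(\<lambda>x. u x $ i) \<in> borel_measurable HH" "(\<lambda>x. ub x $ i) \<in> borel_measurable HH" for i
    by (intro continuous_measurable_HH continuous_intros solenoidalD(3)[OF u] solenoidalD(3)[OF ub])+
  have b: "\<bar>u x $ i\<bar> \<le> Mu" "\<bar>ub x $ i\<bar> \<le> Mb" if "x \<in> \<H>" for x i
    using order_trans[OF component_le_norm_cart solenoidalD(9)[OF u that]] order_trans[OF component_le_norm_cart solenoidalD(9)[OF ub that]] by auto
  define D where "D i x = Du i x \<bullet> Dw i x + L i x \<bullet> w x" for i x
  have iD: "integrable HH (D i)" for i
    unfolding D_def[abs_def] by (intro Bochner_Integration.integrable_add L2le_inner[OF lu A1] L2le_inner[OF L(1) A])
  have I1: "(LINT x|HH. D 1 x + D 2 x) \<le> 0"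
  proof (rule integral_divergence_nonpos[of "\<lambda>x. Du 1 x \<bullet> w x" "\<lambda>x. Du 2 x \<bullet> w x"])
    show "continuous_on \<H> (\<lambda>x. Du 1 x \<bullet> w x)" by (intro continuous_intros solenoidalD(4)[OF u] cw')
    show "continuous_on (closure \<H>) (\<lambda>x. Du 2 x \<bullet> w x)" by (intro continuous_intros solenoidalD(2)[OF u] cw)
    show "continuous_on \<H> (D 1)" "continuous_on \<H> (D 2)" unfolding D_def[abs_def]
      by (intro continuous_intros solenoidalD(4)[OF u] cw' cDw L)+
    show "has_pd (\<lambda>x. Du 1 x \<bullet> w x) 1 (D 1 x) x" "has_pd (\<lambda>x. Du 2 x \<bullet> w x) 2 (D 2 x) x" if "x \<in> \<H>" for x
      unfolding D_def by (intro has_pd_inner L(3) pw that)+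
    show "integrable HH (\<lambda>x. Du 1 x \<bullet> w x)" "integrable HH (\<lambda>x. Du 2 x \<bullet> w x)" by (intro L2le_inner[OF lu A])+
    show "integrable HH (\<lambda>x. D 1 x + D 2 x)" by (intro Bochner_Integration.integrable_add iD)
    show "0 \<le> Du 2 (pt a 0) \<bullet> w (pt a 0)" for a using sign by (simp add: w_def)
  qed
  define X where "X x = - (u x $ 1 * (w x \<bullet> Dw 1 x) + u x $ 2 * (w x \<bullet> Dw 2 x))" for x
  have iX: "integrable HH X" unfolding X_def[abs_def]
    by (intro integrable_minus Bochner_Integration.integrable_add integrable_bounded_mult[OF L2le_inner[OF A A1] m(1) b(1)])
  define E where "E i x = - (1/2) * ((w x \<bullet> w x) * (Du i x $ i) + (w x \<bullet> Dw i x + Dw i x \<bullet> w x) * (u x $ i))" for i x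
  \<comment> \<open>Incompressibility cancels the terms in which u is differentiated. The sum
    becomes the transport term, whose integrability is already known.\<close>
  have EX: "E 1 x + E 2 x = X x" if "x \<in> \<H>" for x
  proof -
    have d: "Du 2 x $ 2 = - (Du 1 x $ 1)" using solenoidalD(7)[OF u that] by simp
    show ?thesis by (simp add: E_def X_def d inner_commute algebra_simps)
  qed
  have iE: "integrable HH (\<lambda>x. E 1 x + E 2 x)"
    using iX by (subst Bochner_Integration.integrable_cong[OF refl, of HH _ X]) (auto simp: EX)
  have "(LINT x|HH. E 1 x + E 2 x) \<le> 0"
  proof (rule integral_divergence_nonpos[of "\<lambda>x. - (1/2) * ((w x \<bullet> w x) * (u x $ 1))" "\<lambda>x. - (1/2) * ((w x \<bullet> w x) * (u x $ 2))"])
    show "continuous_on \<H> (\<lambda>x. - (1/2) * ((w x \<bullet> w x) * (u x $ 1)))" by (intro continuous_intros solenoidalD(3)[OF u] cw')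
    show "continuous_on (closure \<H>) (\<lambda>x. - (1/2) * ((w x \<bullet> w x) * (u x $ 2)))" by (intro continuous_intros solenoidalD(1)[OF u] cw)
    show "continuous_on \<H> (E 1)" "continuous_on \<H> (E 2)" unfolding E_def[abs_def]
      by (intro continuous_intros solenoidalD(4)[OF u] solenoidalD(3)[OF u] cw' cDw)+
    have p: "has_pd (\<lambda>x. - (1/2) * ((w x \<bullet> w x) * (u x $ i))) i (E i x) x" if "x \<in> \<H>" for i x
    proof -
      have "has_pd (\<lambda>x. (- (1/2)) *\<^sub>R ((w x \<bullet> w x) * (u x $ i))) i ((- (1/2)) *\<^sub>R ((w x \<bullet> w x) * (Du i x $ i) + (w x \<bullet> Dw i x + Dw i x \<bullet> w x) * (u x $ i))) x"
        by (intro has_pd_scaleR_const has_pd_mult has_pd_inner has_pd_nth pw that solenoidalD(5)[OF u that])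
      then show ?thesis by (simp add: E_def)
    qed
    show "has_pd (\<lambda>x. - (1/2) * ((w x \<bullet> w x) * (u x $ 1))) 1 (E 1 x) x" "has_pd (\<lambda>x. - (1/2) * ((w x \<bullet> w x) * (u x $ 2))) 2 (E 2 x) x" if "x \<in> \<H>" for x
      using p that by auto
    have i: "integrable HH (\<lambda>x. - (1/2) * ((w x \<bullet> w x) * (u x $ i)))" for i
      using integrable_bounded_mult[OF L2le_inner[OF A A] m(1)[of i] b(1)] by (simp add: mult.commute)
    show "integrable HH (\<lambda>x. - (1/2) * ((w x \<bullet> w x) * (u x $ 1)))" "integrable HH (\<lambda>x. - (1/2) * ((w x \<bullet> w x) * (u x $ 2)))" by (rule i)+
    show "integrable HH (\<lambda>x. E 1 x + E 2 x)" by (rule iE)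
    show "0 \<le> - (1/2) * ((w (pt a 0) \<bullet> w (pt a 0)) * (u (pt a 0) $ 2))" for a by (simp add: noslip)
  qed
  also have "(LINT x|HH. E 1 x + E 2 x) = (LINT x|HH. X x)"
    by (rule Bochner_Integration.integral_cong) (auto simp: EX)
  finally have I2: "(LINT x|HH. X x) \<le> 0" .
  have pw2: "?F x \<bullet> w x \<le> \<nu> * (D 1 x + D 2 x) + X x + \<nu> / 4 * ((norm (Db 1 x))\<^sup>2 + (norm (Db 2 x))\<^sup>2) + 2 * Mb * (norm (w x))\<^sup>2"
    if x: "x \<in> \<H>" for x
  proof -
    have id: "?F x \<bullet> w x = \<nu> * (D 1 x + D 2 x) + X x - \<nu> * (Du 1 x \<bullet> Dw 1 x + Du 2 x \<bullet> Dw 2 x)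
       - (w x $ 1 * (Db 1 x \<bullet> w x) + w x $ 2 * (Db 2 x \<bullet> w x))"
      unfolding D_def X_def Dw_def
      by (simp add: inner_add_left inner_diff_left inner_diff_right inner_commute[of "w x"] algebra_simps)
        (simp add: w_def algebra_simps)
    \<comment> \<open>Completing the square in \<open>Du i x - (1/2) *\<^sub>R Db i x\<close>: the
      dissipation absorbs the gradient of u entirely, so no bound on that gradient reaches the
      right-hand side.\<close>
    have q: "- (Du i x \<bullet> Dw i x) \<le> (norm (Db i x))\<^sup>2 / 4" for i
    proof -
      have "0 \<le> (Du i x - (1/2) *\<^sub>R Db i x) \<bullet> (Du i x - (1/2) *\<^sub>R Db i x)" by simp
      then show ?thesis unfolding Dw_def
        by (simp add: inner_diff_left inner_diff_right power2_norm_eq_inner inner_commute[of "Db i x" "Du i x"])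
    qed
    have r: "- (w x $ i * (Db i x \<bullet> w x)) \<le> Mb * (norm (w x))\<^sup>2" for i
    proof -
      have "- (w x $ i * (Db i x \<bullet> w x)) \<le> \<bar>w x $ i\<bar> * \<bar>Db i x \<bullet> w x\<bar>" by (simp only: abs_mult[symmetric] abs_ge_minus_self)
      also have "\<dots> \<le> norm (w x) * (Mb * norm (w x))"
      proof (intro mult_mono component_le_norm_cart)
        have "norm (Db i x) \<le> Mb" using Db[of i] x by (auto simp: sup_L2_le_def)
        then show "\<bar>Db i x \<bullet> w x\<bar> \<le> Mb * norm (w x)"
          using order_trans[OF Cauchy_Schwarz_ineq2 mult_right_mono] by auto
      qed auto
      finally show ?thesis by (simp add: power2_eq_square mult_ac)
    qed
    have "\<nu> * (- (Du 1 x \<bullet> Dw 1 x) - (Du 2 x \<bullet> Dw 2 x)) \<le> \<nu> * ((norm (Db 1 x))\<^sup>2 / 4 + (norm (Db 2 x))\<^sup>2 / 4)"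
      using q[of 1] q[of 2] \<nu> by (intro mult_left_mono) auto
    then have "- \<nu> * (Du 1 x \<bullet> Dw 1 x + Du 2 x \<bullet> Dw 2 x) \<le> \<nu> / 4 * ((norm (Db 1 x))\<^sup>2 + (norm (Db 2 x))\<^sup>2)"
      by (simp add: algebra_simps)
    then show ?thesis unfolding id using r[of 1] r[of 2] by (simp add: algebra_simps)
  qed
  note iw = L2le_power2(1)[OF A] and ib = L2le_power2(1)[OF lb]
  have iF: "integrable HH (\<lambda>x. ?F x \<bullet> w x)"
    by (rule L2le_inner[OF forcing_L2le[OF \<nu> u ub Du Db L(1)] A])
  have i1: "integrable HH (\<lambda>x. \<nu> * (D 1 x + D 2 x))" by (intro integrable_mult_right Bochner_Integration.integrable_add iD)
  have i2: "integrable HH (\<lambda>x. \<nu> / 4 * ((norm (Db 1 x))\<^sup>2 + (norm (Db 2 x))\<^sup>2))" by (intro integrable_mult_right Bochner_Integration.integrable_add ib)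
  have i3: "integrable HH (\<lambda>x. 2 * Mb * (norm (w x))\<^sup>2)" by (intro integrable_mult_right iw)
  have "(LINT x|HH. ?F x \<bullet> w x) \<le> (LINT x|HH. \<nu> * (D 1 x + D 2 x) + X x + \<nu> / 4 * ((norm (Db 1 x))\<^sup>2 + (norm (Db 2 x))\<^sup>2) + 2 * Mb * (norm (w x))\<^sup>2)"
  proof (rule integral_mono[OF iF])
    show "integrable HH (\<lambda>x. \<nu> * (D 1 x + D 2 x) + X x + \<nu> / 4 * ((norm (Db 1 x))\<^sup>2 + (norm (Db 2 x))\<^sup>2) + 2 * Mb * (norm (w x))\<^sup>2)"
      by (intro Bochner_Integration.integrable_add i1 i2 i3 iX)
  qed (use pw2 in simp)
  also have "\<dots> = \<nu> * (LINT x|HH. D 1 x + D 2 x) + (LINT x|HH. X x) + \<nu> / 4 * ((LINT x|HH. (norm (Db 1 x))\<^sup>2) + (LINT x|HH. (norm (Db 2 x))\<^sup>2)) + 2 * Mb * (LINT x|HH. (norm (w x))\<^sup>2)"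
  proof -
    have "(LINT x|HH. \<nu> * (D 1 x + D 2 x) + X x + \<nu> / 4 * ((norm (Db 1 x))\<^sup>2 + (norm (Db 2 x))\<^sup>2) + 2 * Mb * (norm (w x))\<^sup>2)
      = (LINT x|HH. \<nu> * (D 1 x + D 2 x)) + (LINT x|HH. X x) + (LINT x|HH. \<nu> / 4 * ((norm (Db 1 x))\<^sup>2 + (norm (Db 2 x))\<^sup>2)) + (LINT x|HH. 2 * Mb * (norm (w x))\<^sup>2)"
      by (simp only: Bochner_Integration.integral_add Bochner_Integration.integrable_add i1 i2 i3 iX)
    moreover have "(LINT x|HH. (norm (Db 1 x))\<^sup>2 + (norm (Db 2 x))\<^sup>2) = (LINT x|HH. (norm (Db 1 x))\<^sup>2) + (LINT x|HH. (norm (Db 2 x))\<^sup>2)"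
      by (rule Bochner_Integration.integral_add[OF ib ib])
    ultimately show ?thesis by (simp only: integral_mult_right_zero)
  qed
  also have "\<dots> \<le> \<nu> * 0 + 0 + \<nu> / 4 * (Mb + Mb) + 2 * Mb * (LINT x|HH. (norm (w x))\<^sup>2)"
    using I1 I2 L2le_power2(2)[OF lb] \<nu> by (intro add_mono mult_left_mono order_refl) auto
  finally show ?thesis by (simp add: w_def mult.commute[of Mb \<nu>])
qed


subsection \<open>Growth of the energy in time\<close>

text \<open>Divide the interval into n equal steps of length h and iterate. The errors
  \<open>C * h\<^sup>2\<close> add up to a quantity of order 1/n, before growth, and vanish in the
  limit, while the n-th power of 1 + b * h stays below the exponential.\<close>

lemma discrete_gronwall:
  fixes f :: "real \<Rightarrow> real"
  assumes t: "t1 \<le> t2" and nn: "a \<ge> 0" "b \<ge> 0" "C \<ge> 0" "f t1 \<ge> 0"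
    and f: "\<And>s s'. t1 \<le> s \<Longrightarrow> s < s' \<Longrightarrow> s' \<le> t2 \<Longrightarrow> f s' \<le> f s + (s' - s) * (a + b * f s) + C * (s' - s)\<^sup>2"
  shows "f t2 \<le> (f t1 + a * (t2 - t1)) * exp (b * (t2 - t1))"
proof (cases "t1 = t2")
  case False
  define \<Delta> where "\<Delta> = t2 - t1"
  have \<Delta>: "\<Delta> > 0" using False t by (simp add: \<Delta>_def)
  have n: "f t2 \<le> (f t1 + a * \<Delta> + C * \<Delta>\<^sup>2 * inverse (real (Suc m))) * exp (b * \<Delta>)" for m
  proof -
    define n where "n = Suc m"
    define h where "h = \<Delta> / real n"
    have h: "h > 0" "real n * h = \<Delta>" using \<Delta> by (simp_all add: h_def n_def)
    have k: "f (t1 + real k * h) \<le> (f t1 + real k * (a * h + C * h\<^sup>2)) * (1 + b * h) ^ k" if "k \<le> n" for k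
      using that
    proof (induction k)
      case (Suc k)
      have kh: "real (Suc k) * h \<le> \<Delta>"
        using Suc.prems h by (metis mult_right_mono of_nat_le_iff less_imp_le)
      have "f (t1 + real (Suc k) * h) \<le> f (t1 + real k * h) + h * (a + b * f (t1 + real k * h)) + C * h\<^sup>2"
      proof -
        have e: "t1 + real (Suc k) * h - (t1 + real k * h) = h" by (simp add: algebra_simps)
        have "f (t1 + real (Suc k) * h) \<le> f (t1 + real k * h) + (t1 + real (Suc k) * h - (t1 + real k * h)) * (a + b * f (t1 + real k * h)) + C * (t1 + real (Suc k) * h - (t1 + real k * h))\<^sup>2"
        proof (rule f)
          show "t1 \<le> t1 + real k * h" using h by simp
          show "t1 + real k * h < t1 + real (Suc k) * h" using h by simp
          show "t1 + real (Suc k) * h \<le> t2" using kh by (simp only: \<Delta>_def)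
        qed
        then show ?thesis unfolding e .
      qed
      also have "\<dots> = (1 + b * h) * f (t1 + real k * h) + (a * h + C * h\<^sup>2)" by (simp add: algebra_simps)
      also have "\<dots> \<le> (1 + b * h) * ((f t1 + real k * (a * h + C * h\<^sup>2)) * (1 + b * h) ^ k) + (a * h + C * h\<^sup>2) * (1 + b * h) ^ Suc k"
      proof (rule add_mono)
        show "(1 + b * h) * f (t1 + real k * h) \<le> (1 + b * h) * ((f t1 + real k * (a * h + C * h\<^sup>2)) * (1 + b * h) ^ k)"
          using Suc nn h by (intro mult_left_mono) auto
        have "1 \<le> (1 + b * h) ^ Suc k" using nn h by (intro one_le_power) simp
        then have "(a * h + C * h\<^sup>2) * 1 \<le> (a * h + C * h\<^sup>2) * (1 + b * h) ^ Suc k" using nn h by (intro mult_left_mono) auto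
        then show "a * h + C * h\<^sup>2 \<le> (a * h + C * h\<^sup>2) * (1 + b * h) ^ Suc k" by simp
      qed
      also have "\<dots> = (f t1 + real (Suc k) * (a * h + C * h\<^sup>2)) * (1 + b * h) ^ Suc k" by (simp add: algebra_simps)
      finally show ?case .
    qed simp
    have "f t2 = f (t1 + real n * h)" using h(2) by (simp add: \<Delta>_def)
    also have "\<dots> \<le> (f t1 + real n * (a * h + C * h\<^sup>2)) * (1 + b * h) ^ n" by (rule k) simp
    also have "\<dots> \<le> (f t1 + real n * (a * h + C * h\<^sup>2)) * exp (b * \<Delta>)"
    proof (rule mult_left_mono)
      have "(1 + b * h) ^ n \<le> exp (b * h) ^ n" using nn h by (intro power_mono exp_ge_add_one_self) auto
      also have "\<dots> = exp (b * \<Delta>)" unfolding exp_of_nat_mult[symmetric] h(2)[symmetric] by (simp only: mult_ac)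
      finally show "(1 + b * h) ^ n \<le> exp (b * \<Delta>)" .
      show "0 \<le> f t1 + real n * (a * h + C * h\<^sup>2)" using nn h by simp
    qed
    also have "real n * (a * h + C * h\<^sup>2) = a * \<Delta> + C * \<Delta>\<^sup>2 * inverse (real (Suc m))"
    proof -
      have "real n * (a * h + C * h\<^sup>2) = a * (real n * h) + C * h * (real n * h)" by (simp add: algebra_simps power2_eq_square)
      also have "\<dots> = a * \<Delta> + C * (\<Delta> * inverse (real (Suc m))) * \<Delta>" by (simp only: h(2)) (simp only: h_def n_def divide_inverse)
      also have "C * (\<Delta> * inverse (real (Suc m))) * \<Delta> = C * \<Delta>\<^sup>2 * inverse (real (Suc m))" by (simp only: power2_eq_square mult_ac)
      finally show ?thesis .
    qed
    finally show ?thesis by (simp only: add.assoc)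
  qed
  have "(\<lambda>m. (f t1 + a * \<Delta> + C * \<Delta>\<^sup>2 * inverse (real (Suc m))) * exp (b * \<Delta>)) \<longlonglongrightarrow> (f t1 + a * \<Delta> + C * \<Delta>\<^sup>2 * 0) * exp (b * \<Delta>)"
    by (intro tendsto_intros LIMSEQ_inverse_real_of_nat)
  then have "f t2 \<le> (f t1 + a * \<Delta> + C * \<Delta>\<^sup>2 * 0) * exp (b * \<Delta>)"
    by (rule LIMSEQ_le_const) (use n in blast)
  then show ?thesis by (simp add: \<Delta>_def)
qed simp

text \<open>The weight l is free because later it is taken to be the length of a time interval, or
  its inverse, so that a small increment can be paired with a field of order one.\<close>

lemma inner_integral_le:
  fixes f g :: "real^2 \<Rightarrow> 'b::euclidean_space"
  assumes f: "L2le A f" and g: "L2le B g" and l: "l > 0"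
  shows "\<bar>LINT x|HH. f x \<bullet> g x\<bar> \<le> l / 2 * (LINT x|HH. (norm (f x))\<^sup>2) + 1 / (2 * l) * (LINT x|HH. (norm (g x))\<^sup>2)"
proof -
  note i = L2le_power2(1)[OF f] L2le_power2(1)[OF g]
  have "\<bar>LINT x|HH. f x \<bullet> g x\<bar> \<le> (LINT x|HH. \<bar>f x \<bullet> g x\<bar>)" by (rule integral_abs_bound)
  also have "\<dots> \<le> (LINT x|HH. l / 2 * (norm (f x))\<^sup>2 + 1 / (2 * l) * (norm (g x))\<^sup>2)"
  proof (rule integral_mono)
    show "integrable HH (\<lambda>x. \<bar>f x \<bullet> g x\<bar>)" using L2le_inner[OF f g] by simp
    show "integrable HH (\<lambda>x. l / 2 * (norm (f x))\<^sup>2 + 1 / (2 * l) * (norm (g x))\<^sup>2)"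
      by (intro Bochner_Integration.integrable_add integrable_mult_right i)
    fix x
    have "\<bar>f x \<bullet> g x\<bar> \<le> norm (f x) * norm (g x)" by (rule Cauchy_Schwarz_ineq2)
    moreover have "0 \<le> (l * norm (f x) - norm (g x))\<^sup>2 / (2 * l)" using l by simp
    moreover have "(l * norm (f x) - norm (g x))\<^sup>2 / (2 * l) = l / 2 * (norm (f x))\<^sup>2 + 1 / (2 * l) * (norm (g x))\<^sup>2 - norm (f x) * norm (g x)"
      using l by (simp add: power2_eq_square field_simps)
    ultimately show "\<bar>f x \<bullet> g x\<bar> \<le> l / 2 * (norm (f x))\<^sup>2 + 1 / (2 * l) * (norm (g x))\<^sup>2" by linarith
  qed
  also have "\<dots> = l / 2 * (LINT x|HH. (norm (f x))\<^sup>2) + 1 / (2 * l) * (LINT x|HH. (norm (g x))\<^sup>2)"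
    using Bochner_Integration.integral_add[OF integrable_mult_right[OF i(1), of "l/2"] integrable_mult_right[OF i(2), of "1/(2*l)"]]
    by (simp only: integral_mult_right_zero)
  finally show ?thesis .
qed

text \<open>First w is shown to be Lipschitz in time with values in square integrable fields. The
  difference of energies is then the increment tested with the sum of w at the two end times, which
  up to second order in the interval length is twice the tested forcing at one time. The Lipschitz
  bound also turns pointwise vanishing at time 0 into vanishing of the energy.\<close>

lemma energy_growth:
  fixes w F R :: "real \<Rightarrow> real^2 \<Rightarrow> real^2"
  assumes w: "\<And>t. t \<in> {0<..<T} \<Longrightarrow> solenoidal M (w t) (Dw t)"
    and F: "continuous_on ({0<..<T} \<times> \<H>) (\<lambda>(t, x). F t x)" and R: "continuous_on ({0<..<T} \<times> \<H>) (\<lambda>(t, x). R t x)"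
    and N: "\<And>t. t \<in> {0<..<T} \<Longrightarrow> L2le N (F t)"
    and orth: "\<And>t V. t \<in> {0<..<T} \<Longrightarrow> test_field V \<Longrightarrow> (LINT x|HH. R t x \<bullet> V x) = 0"
    and ftc: "\<And>t1 t2 x. 0 < t1 \<Longrightarrow> t1 < t2 \<Longrightarrow> t2 < T \<Longrightarrow> x \<in> \<H> \<Longrightarrow> w t2 x - w t1 x = (LINT t:{t1..t2}|lborel. F t x - R t x)"
    and ab: "a \<ge> 0" "b \<ge> 0"
    and est: "\<And>t. t \<in> {0<..<T} \<Longrightarrow> (LINT x|HH. F t x \<bullet> w t x) \<le> a + b * (LINT x|HH. (norm (w t x))\<^sup>2)"
    and init: "\<And>x. x \<in> \<H> \<Longrightarrow> ((\<lambda>t. w t x) \<longlongrightarrow> 0) (at_right 0)"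
  shows "t \<in> {0<..<T} \<Longrightarrow> (LINT x|HH. (norm (w t x))\<^sup>2) \<le> 2 * a * T * exp (2 * b * T)"
    and "continuous_on {0<..<T} (\<lambda>t. LINT x|HH. (norm (w t x))\<^sup>2)"
proof -
  define E where "E t = (LINT x|HH. (norm (w t x))\<^sup>2)" for t
  have E0: "E t \<ge> 0" for t unfolding E_def by (intro integral_nonneg_AE) auto
  have lw: "L2le M (w t)" if "t \<in> {0<..<T}" for t
    by (rule sup_L2_le_L2le[OF sup_L2_le_solenoidal[OF w[OF that]] solenoidalD(3)[OF w[OF that]]])
  have ld: "L2le (4 * M) (\<lambda>x. w t x - w s x)" and ls: "L2le (4 * M) (\<lambda>x. w t x + w s x)"
    if "t \<in> {0<..<T}" "s \<in> {0<..<T}" for t s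
    using L2le_add[OF lw[OF that(1)] L2le_minus[OF lw[OF that(2)]]] L2le_add[OF lw[OF that(1)] lw[OF that(2)]] by simp_all
  have inc: "(LINT x|HH. (w t2 x - w t1 x) \<bullet> v x) \<le> (t2 - t1) * B"
    if t: "0 < t1" "t1 < t2" "t2 < T" and v: "solenoidal M' v Dv" and B: "\<And>t. t \<in> {t1..t2} \<Longrightarrow> (LINT x|HH. F t x \<bullet> v x) \<le> B"
    for t1 t2 M' v Dv B
  proof (rule increment_bound[OF t(2) _ _ N orth _ _ v B])
    have sub: "{t1..t2} \<times> \<H> \<subseteq> {0<..<T} \<times> \<H>" using t by auto
    show "continuous_on ({t1..t2} \<times> \<H>) (\<lambda>(t, x). F t x)" "continuous_on ({t1..t2} \<times> \<H>) (\<lambda>(t, x). R t x)"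
      by (rule continuous_on_subset[OF F sub] continuous_on_subset[OF R sub])+
    show "L2le (4 * M) (\<lambda>x. w t2 x - w t1 x)" using t by (intro ld) auto
    show "w t2 x - w t1 x = (LINT t:{t1..t2}|lborel. F t x - R t x)" if "x \<in> \<H>" for x by (rule ftc[OF t that])
  qed (use t in auto)
  \<comment> \<open>The increment is itself solenoidal, hence an admissible test field. Tested with
    itself, its squared norm appears on both sides; the weight h leaves the coefficient 1/2 on the
    right, which is absorbed.\<close>
  have X: "(LINT x|HH. (norm (w t2 x - w t1 x))\<^sup>2) \<le> (t2 - t1)\<^sup>2 * N" if t: "0 < t1" "t1 \<le> t2" "t2 < T" for t1 t2
  proof (cases "t1 = t2")
    case False
    define X where "X = (LINT x|HH. (norm (w t2 x - w t1 x))\<^sup>2)"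
    have t': "t1 < t2" "t1 \<in> {0<..<T}" "t2 \<in> {0<..<T}" using t False by auto
    define h where "h = t2 - t1"
    have h: "h > 0" using t' by (simp add: h_def)
    have sol: "solenoidal (2 * (M + M)) (\<lambda>x. w t2 x - w t1 x) (\<lambda>i x. Dw t2 i x - Dw t1 i x)"
      using solenoidal_add[OF w[OF t'(3)] w[OF t'(2)], of "-1"] by simp
    have "X = (LINT x|HH. (w t2 x - w t1 x) \<bullet> (w t2 x - w t1 x))" by (simp add: X_def power2_norm_eq_inner)
    also have "\<dots> \<le> (t2 - t1) * (h / 2 * N + 1 / (2 * h) * X)"
    proof (rule inc[OF t(1) t'(1) t(3) sol])
      fix t assume "t \<in> {t1..t2}"
      then have tt: "t \<in> {0<..<T}" using t by auto
      have "(LINT x|HH. F t x \<bullet> (w t2 x - w t1 x)) \<le> h / 2 * (LINT x|HH. (norm (F t x))\<^sup>2) + 1 / (2 * h) * X"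
        unfolding X_def by (rule order_trans[OF abs_ge_self inner_integral_le[OF N[OF tt] ld[OF t'(3,2)] h]])
      also have "\<dots> \<le> h / 2 * N + 1 / (2 * h) * X"
        using L2le_power2(2)[OF N[OF tt]] h by (intro add_mono mult_left_mono order_refl) auto
      finally show "(LINT x|HH. F t x \<bullet> (w t2 x - w t1 x)) \<le> h / 2 * N + 1 / (2 * h) * X" .
    qed
    also have "\<dots> = h\<^sup>2 * N / 2 + X / 2" unfolding h_def[symmetric] using h by (simp add: power2_eq_square field_simps)
    finally show ?thesis unfolding X_def[symmetric] h_def[symmetric] by simp
  qed simp
  \<comment> \<open>A difference of squares written as an inner product of the increment with the
    sum of the two fields, which is again solenoidal. So no time derivative of the energy has to be
    formed.\<close>
  have diff: "E t2 - E t1 = (LINT x|HH. (w t2 x - w t1 x) \<bullet> (w t2 x + w t1 x))" if t: "t1 \<in> {0<..<T}" "t2 \<in> {0<..<T}" for t1 t2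
  proof -
    have "(LINT x|HH. (w t2 x - w t1 x) \<bullet> (w t2 x + w t1 x)) = (LINT x|HH. (norm (w t2 x))\<^sup>2 - (norm (w t1 x))\<^sup>2)"
      by (simp add: power2_norm_eq_inner inner_diff_left inner_add_right inner_commute algebra_simps)
    also have "\<dots> = E t2 - E t1"
      unfolding E_def by (rule Bochner_Integration.integral_diff[OF L2le_power2(1)[OF lw[OF t(2)]] L2le_power2(1)[OF lw[OF t(1)]]])
    finally show ?thesis by simp
  qed
  define C1 where "C1 = N / 2 + 2 * M"
  have lip: "\<bar>E t2 - E t1\<bar> \<le> C1 * (t2 - t1)" if t: "0 < t1" "t1 < t2" "t2 < T" for t1 t2
  proof -
    have tt: "t1 \<in> {0<..<T}" "t2 \<in> {0<..<T}" using t by auto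
    define h where "h = t2 - t1"
    have h: "h > 0" "1 / h > 0" using t by (simp_all add: h_def)
    have "\<bar>E t2 - E t1\<bar> \<le> (1/h) / 2 * (LINT x|HH. (norm (w t2 x - w t1 x))\<^sup>2) + 1 / (2 * (1/h)) * (LINT x|HH. (norm (w t2 x + w t1 x))\<^sup>2)"
      unfolding diff[OF tt] by (rule inner_integral_le[OF ld[OF tt(2,1)] ls[OF tt(2,1)] h(2)])
    also have "\<dots> \<le> (1/h) / 2 * (h\<^sup>2 * N) + 1 / (2 * (1/h)) * (4 * M)"
      using X[of t1 t2] t L2le_power2(2)[OF ls[OF tt(2,1)]] h by (intro add_mono mult_left_mono) (auto simp: h_def)
    also have "\<dots> = C1 * h" using h by (simp add: C1_def power2_eq_square field_simps)
    finally show ?thesis by (simp only: h_def)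
  qed
  show cont: "continuous_on {0<..<T} (\<lambda>t. LINT x|HH. (norm (w t x))\<^sup>2)"
    unfolding E_def[symmetric] continuous_on_def
  proof
    fix t assume t: "t \<in> {0<..<T}"
    have "((\<lambda>s. C1 * \<bar>s - t\<bar>) \<longlongrightarrow> C1 * \<bar>t - t\<bar>) (at t within {0<..<T})" by (intro tendsto_intros)
    then have lim: "((\<lambda>s. C1 * \<bar>s - t\<bar>) \<longlongrightarrow> 0) (at t within {0<..<T})" by simp
    have "((\<lambda>s. E s - E t) \<longlongrightarrow> 0) (at t within {0<..<T})"
    proof (rule Lim_null_comparison[OF _ lim])
      have "norm (E s - E t) \<le> C1 * \<bar>s - t\<bar>" if "s \<in> {0<..<T}" "s \<noteq> t" for s
        using lip[of s t] lip[of t s] that t by (cases "s < t") (auto simp: abs_minus_commute)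
      then show "\<forall>\<^sub>F s in at t within {0<..<T}. norm (E s - E t) \<le> C1 * \<bar>s - t\<bar>" by (simp add: eventually_at_filter)
    qed
    then show "(E \<longlongrightarrow> E t) (at t within {0<..<T})" by (rule Lim_null[THEN iffD2])
  qed
  have "\<exists>C\<ge>0. \<forall>t1 t2. 0 < t1 \<longrightarrow> t1 < t2 \<longrightarrow> t2 < T \<longrightarrow> E t2 \<le> E t1 + (t2 - t1) * (2 * a + 2 * b * E t1) + C * (t2 - t1)\<^sup>2"
  proof (cases "T > 0")
    case True
    then have hT: "T/2 \<in> {0<..<T}" by simp
    have nn: "N \<ge> 0" "M \<ge> 0" using L2le_power2(4)[OF N[OF hT]] L2le_power2(4)[OF lw[OF hT]] by auto
    show ?thesis
    proof (intro exI conjI allI impI)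
      show "0 \<le> 2 * b * C1 + 2 * N" using nn ab by (simp add: C1_def)
      fix t1 t2 assume t: "0 < t1" "t1 < t2" "t2 < T"
      then have tt: "t1 \<in> {0<..<T}" "t2 \<in> {0<..<T}" by auto
      define h where "h = t2 - t1"
      have h: "h > 0" using t by (simp add: h_def)
      have sol: "solenoidal (2 * (M + M)) (\<lambda>x. w t2 x + w t1 x) (\<lambda>i x. Dw t2 i x + Dw t1 i x)"
        using solenoidal_add[OF w[OF tt(2)] w[OF tt(1)], of 1] by simp
      \<comment> \<open>At an intermediate time t the sum \<open>w t2 + w t1\<close> is replaced by
        2 * w t at the cost of h * N for each end point, and E t by E t1 at the cost of C1 * h.
        Multiplied by the length of the interval, these errors become quadratic.\<close>
      have "E t2 - E t1 \<le> (t2 - t1) * (2 * (a + b * (E t1 + C1 * h)) + 2 * (h * N))"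
        unfolding diff[OF tt]
      proof (rule inc[OF t sol])
        fix t assume t': "t \<in> {t1..t2}"
        then have ti: "t \<in> {0<..<T}" using t by auto
        have Xh: "(LINT x|HH. (norm (w s' x - w s x))\<^sup>2) \<le> h\<^sup>2 * N" if s: "s \<in> {t1..t2}" "s' \<in> {t1..t2}" for s s'
        proof -
          have "(LINT x|HH. (norm (w s' x - w s x))\<^sup>2) \<le> (s' - s)\<^sup>2 * N"
          proof (cases "s \<le> s'")
            case True
            then show ?thesis using X[of s s'] s t by auto
          next
            case False
            then show ?thesis using X[of s' s] s t
              unfolding norm_minus_commute[of "w s' _"] power2_commute[of s'] by auto
          qed
          also have "\<dots> \<le> h\<^sup>2 * N"
          proof (rule mult_right_mono[OF _ nn(1)])
            have "\<bar>s' - s\<bar> \<le> \<bar>h\<bar>" using s by (auto simp: h_def)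
            then show "(s' - s)\<^sup>2 \<le> h\<^sup>2" by (simp only: abs_le_square_iff)
          qed
          finally show ?thesis .
        qed
        have FX: "(LINT x|HH. F t x \<bullet> (w s x - w t x)) \<le> h * N" if s: "s \<in> {t1..t2}" for s
        proof -
          have ss: "s \<in> {0<..<T}" using s t by auto
          have "(LINT x|HH. F t x \<bullet> (w s x - w t x)) \<le> h / 2 * (LINT x|HH. (norm (F t x))\<^sup>2) + 1 / (2 * h) * (LINT x|HH. (norm (w s x - w t x))\<^sup>2)"
            by (rule order_trans[OF abs_ge_self inner_integral_le[OF N[OF ti] ld[OF ss ti] h]])
          also have "\<dots> \<le> h / 2 * N + 1 / (2 * h) * (h\<^sup>2 * N)"
            using L2le_power2(2)[OF N[OF ti]] Xh[OF t' s] h by (intro add_mono mult_left_mono) auto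
          also have "\<dots> = h * N" using h by (simp add: power2_eq_square field_simps)
          finally show ?thesis .
        qed
        have Et: "E t \<le> E t1 + C1 * h"
        proof (cases "t = t1")
          case False
          then have "E t - E t1 \<le> C1 * (t - t1)" using lip[of t1 t] t t' by auto
          also have "\<dots> \<le> C1 * h" using t' nn by (intro mult_left_mono) (auto simp: C1_def h_def)
          finally show ?thesis by simp
        qed (use nn h in \<open>simp add: C1_def\<close>)
        note i = L2le_inner[OF N[OF ti] lw[OF ti]] L2le_inner[OF N[OF ti] ld[OF tt(2) ti]] L2le_inner[OF N[OF ti] ld[OF tt(1) ti]]
        have "(LINT x|HH. F t x \<bullet> (w t2 x + w t1 x)) = (LINT x|HH. 2 * (F t x \<bullet> w t x) + (F t x \<bullet> (w t2 x - w t x) + F t x \<bullet> (w t1 x - w t x)))"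
          by (simp add: inner_add_right inner_diff_right algebra_simps)
        also have "\<dots> = 2 * (LINT x|HH. F t x \<bullet> w t x) + ((LINT x|HH. F t x \<bullet> (w t2 x - w t x)) + (LINT x|HH. F t x \<bullet> (w t1 x - w t x)))"
          using Bochner_Integration.integral_add[OF integrable_mult_right[OF i(1), of 2] Bochner_Integration.integrable_add[OF i(2,3)]]
            Bochner_Integration.integral_add[OF i(2,3)] by (simp only: integral_mult_right_zero)
        also have "\<dots> \<le> 2 * (a + b * (E t1 + C1 * h)) + (h * N + h * N)"
        proof (intro add_mono FX mult_left_mono)
          have "(LINT x|HH. F t x \<bullet> w t x) \<le> a + b * E t" unfolding E_def by (rule est[OF ti])
          also have "\<dots> \<le> a + b * (E t1 + C1 * h)" using Et ab by (intro add_mono mult_left_mono order_refl) auto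
          finally show "(LINT x|HH. F t x \<bullet> w t x) \<le> a + b * (E t1 + C1 * h)" .
        qed (use t in auto)
        finally show "(LINT x|HH. F t x \<bullet> (w t2 x + w t1 x)) \<le> 2 * (a + b * (E t1 + C1 * h)) + 2 * (h * N)" by (simp only: mult_2[of "h * N"])
      qed
      then show "E t2 \<le> E t1 + (t2 - t1) * (2 * a + 2 * b * E t1) + (2 * b * C1 + 2 * N) * (t2 - t1)\<^sup>2"
        unfolding h_def[symmetric] by (simp add: algebra_simps power2_eq_square)
    qed
  qed (auto intro: exI[of _ 0])
  then obtain C where C: "C \<ge> 0" and step: "\<And>t1 t2. 0 < t1 \<Longrightarrow> t1 < t2 \<Longrightarrow> t2 < T \<Longrightarrow>
     E t2 \<le> E t1 + (t2 - t1) * (2 * a + 2 * b * E t1) + C * (t2 - t1)\<^sup>2" by blast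
  \<comment> \<open>The fields agree at time 0 only pointwise. Fatou's lemma along times tending to
    0 converts the Lipschitz bound for increments into a bound for w t itself.\<close>
  have small: "E t \<le> t\<^sup>2 * N" if t: "t \<in> {0<..<T}" for t
  proof -
    \<comment> \<open>The double successor keeps every \<tau> n strictly below t, also for n =
      0.\<close>
    define \<tau> where "\<tau> n = t * inverse (real (Suc (Suc n)))" for n
    have \<tau>: "0 < \<tau> n" "\<tau> n < t" for n
    proof -
      have r: "0 < inverse (real (Suc (Suc n)))" "inverse (real (Suc (Suc n))) < 1"
        by (simp_all add: inverse_less_1_iff)
      have t0: "t > 0" using t by simp
      show "0 < \<tau> n" unfolding \<tau>_def by (rule mult_pos_pos[OF t0 r(1)])
      show "\<tau> n < t" unfolding \<tau>_def using mult_strict_left_mono[OF r(2) t0] by simp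
    qed
    have \<tau>T: "\<tau> n \<in> {0<..<T}" for n using \<tau>[of n] t by auto
    have "\<tau> \<longlonglongrightarrow> t * 0" unfolding \<tau>_def
      by (intro tendsto_intros LIMSEQ_Suc[OF LIMSEQ_inverse_real_of_nat])
    then have lim: "filterlim \<tau> (at_right 0) sequentially"
    proof -
      have "\<tau> n \<in> {0<..} \<and> \<tau> n \<noteq> 0" for n using \<tau>(1)[of n] by simp
      with \<open>\<tau> \<longlonglongrightarrow> t * 0\<close> show ?thesis by (simp add: filterlim_at del: greaterThan_iff)
    qed
    have nn: "N \<ge> 0" using L2le_power2(4)[OF N[OF t]] .
    have "(\<integral>\<^sup>+x. ennreal ((norm (w t x))\<^sup>2) \<partial>HH) \<le> ennreal (t\<^sup>2 * N)"
    proof (rule nn_integral_limit_le[of "\<lambda>n x. w t x - w (\<tau> n) x"])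
      show "(\<lambda>x. w t x - w (\<tau> n) x) \<in> borel_measurable HH" for n by (rule L2le_power2(3)[OF ld[OF t \<tau>T]])
      fix x assume "x \<in> \<H>"
      have "(\<lambda>n. w (\<tau> n) x) \<longlonglongrightarrow> 0" by (rule filterlim_compose[OF init[OF \<open>x \<in> \<H>\<close>] lim])
      from tendsto_diff[OF tendsto_const[of "w t x"] this] show "(\<lambda>n. w t x - w (\<tau> n) x) \<longlonglongrightarrow> w t x" by simp
    next
      fix n
      have "(\<integral>\<^sup>+x. ennreal ((norm (w t x - w (\<tau> n) x))\<^sup>2) \<partial>HH) = ennreal (LINT x|HH. (norm (w t x - w (\<tau> n) x))\<^sup>2)"
        by (rule nn_integral_eq_integral[OF L2le_power2(1)[OF ld[OF t \<tau>T]]]) simp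
      also have "\<dots> \<le> ennreal (t\<^sup>2 * N)"
      proof (rule ennreal_leI)
        have "(LINT x|HH. (norm (w t x - w (\<tau> n) x))\<^sup>2) \<le> (t - \<tau> n)\<^sup>2 * N" using X[of "\<tau> n" t] \<tau>[of n] t by auto
        also have "\<dots> \<le> t\<^sup>2 * N" using \<tau>[of n] nn by (intro mult_right_mono power_mono) auto
        finally show "(LINT x|HH. (norm (w t x - w (\<tau> n) x))\<^sup>2) \<le> t\<^sup>2 * N" .
      qed
      finally show "(\<integral>\<^sup>+x. ennreal ((norm (w t x - w (\<tau> n) x))\<^sup>2) \<partial>HH) \<le> ennreal (t\<^sup>2 * N)" .
    qed
    moreover have "(\<integral>\<^sup>+x. ennreal ((norm (w t x))\<^sup>2) \<partial>HH) = ennreal (E t)"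
      unfolding E_def by (rule nn_integral_eq_integral[OF L2le_power2(1)[OF lw[OF t]]]) simp
    ultimately have "ennreal (E t) \<le> ennreal (t\<^sup>2 * N)" by (simp only:)
    then show ?thesis using nn by (subst (asm) ennreal_le_iff) auto
  qed
  show "(LINT x|HH. (norm (w t x))\<^sup>2) \<le> 2 * a * T * exp (2 * b * T)" if t: "t \<in> {0<..<T}"
  proof -
    define \<tau> where "\<tau> n = t * inverse (real (Suc (Suc n)))" for n
    have \<tau>: "0 < \<tau> n" "\<tau> n < t" for n
    proof -
      have r: "0 < inverse (real (Suc (Suc n)))" "inverse (real (Suc (Suc n))) < 1"
        by (simp_all add: inverse_less_1_iff)
      have t0: "t > 0" using t by simp
      show "0 < \<tau> n" unfolding \<tau>_def by (rule mult_pos_pos[OF t0 r(1)])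
      show "\<tau> n < t" unfolding \<tau>_def using mult_strict_left_mono[OF r(2) t0] by simp
    qed
    have nn: "N \<ge> 0" using L2le_power2(4)[OF N[OF t]] .
    have lim: "\<tau> \<longlonglongrightarrow> t * 0" unfolding \<tau>_def
      by (intro tendsto_intros LIMSEQ_Suc[OF LIMSEQ_inverse_real_of_nat])
    \<comment> \<open>The step inequality holds on the open time interval, so the Gronwall argument
      starts at the positive time \<tau> n. The starting energy is at most
      \<open>(\<tau> n)\<^sup>2 * N\<close>, whose constant depends on \<nu> through N but which
      disappears as n grows.\<close>
    have bd: "E t \<le> ((\<tau> n)\<^sup>2 * N + 2 * a * T) * exp (2 * b * T)" for n
    proof -
      have "E t \<le> (E (\<tau> n) + 2 * a * (t - \<tau> n)) * exp (2 * b * (t - \<tau> n))"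
      proof (rule discrete_gronwall[of "\<tau> n" t "2 * a" "2 * b" C E])
        fix s s' assume "\<tau> n \<le> s" "s < s'" "s' \<le> t"
        then show "E s' \<le> E s + (s' - s) * (2 * a + 2 * b * E s) + C * (s' - s)\<^sup>2"
          using \<tau>[of n] t by (intro step) auto
      qed (use \<tau>[of n] ab C E0 in auto)
      also have "\<dots> \<le> ((\<tau> n)\<^sup>2 * N + 2 * a * T) * exp (2 * b * T)"
      proof (rule mult_mono)
        have tn: "\<tau> n \<in> {0<..<T}" using \<tau>[of n] t by auto
        have "2 * a * (t - \<tau> n) \<le> 2 * a * T" using \<tau>[of n] t ab by (intro mult_left_mono) auto
        with small[OF tn] show "E (\<tau> n) + 2 * a * (t - \<tau> n) \<le> (\<tau> n)\<^sup>2 * N + 2 * a * T" by (rule add_mono)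
        have "2 * b * (t - \<tau> n) \<le> 2 * b * T" using \<tau>[of n] t ab by (intro mult_left_mono) auto
        then show "exp (2 * b * (t - \<tau> n)) \<le> exp (2 * b * T)" by simp
        show "0 \<le> (\<tau> n)\<^sup>2 * N + 2 * a * T" using nn ab t by simp
      qed simp
      finally show ?thesis .
    qed
    have l2: "(\<lambda>n. ((\<tau> n)\<^sup>2 * N + 2 * a * T) * exp (2 * b * T)) \<longlonglongrightarrow> ((t * 0)\<^sup>2 * N + 2 * a * T) * exp (2 * b * T)"
      by (intro tendsto_intros lim)
    have "E t \<le> ((t * 0)\<^sup>2 * N + 2 * a * T) * exp (2 * b * T)"
      by (rule LIMSEQ_le_const[OF l2]) (use bd in blast)
    then show ?thesis by (simp add: E_def)
  qed
qed


subsection \<open>The inviscid limit\<close>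

lemma test_field_integrable:
  assumes g: "continuous_on \<H> g" and V: "test_field V"
  shows "integrable HH (\<lambda>x. g x \<bullet> V x)"
proof -
  obtain a b where K: "cbox a b \<subseteq> \<H>" and z: "\<And>x. x \<notin> box a b \<Longrightarrow> V x = 0" and cV: "continuous_on \<H> V"
    using V unfolding test_field_def by blast
  show ?thesis
  proof (rule lebesgue_on_integral_compact(2)[OF _ _ K])
    show "continuous_on (cbox a b) (\<lambda>x. g x \<bullet> V x)"
      by (intro continuous_intros continuous_on_subset[OF g K] continuous_on_subset[OF cV K])
    fix x assume "x \<notin> cbox a b"
    then have "V x = 0" using z box_subset_cbox by blast
    then show "g x \<bullet> V x = 0" by simp
  qed
qed

lemma UNIV_2_sum: "(\<Sum>i\<in>UNIV. f i) = f (1::2) + f 2" for f :: "2 \<Rightarrow> 'a::ab_group_add"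
  by (simp add: UNIV_2)

lemma classical_solenoidal:
  assumes r: "classical_regularity T u p" and t: "t \<in> {0<..<T}"
    and div: "\<And>x. x \<in> \<H> \<Longrightarrow> divergence (u t) x = 0" and bd: "\<And>x. x \<in> frontier \<H> \<Longrightarrow> u t x $ 2 = 0"
    and M: "sup_L2_le M (u t)"
  shows "solenoidal M (u t) (\<lambda>i. partial_H i (u t))"
proof -
  have t': "t \<in> {0..T}" using t by auto
  have d: "u t differentiable (at x within closure \<H>)" if "x \<in> closure \<H>" for x
    using r t' that by (auto simp: classical_regularity_def differentiable_on_def)
  show ?thesis unfolding solenoidal_def
  proof (intro conjI allI ballI M)
    show "continuous_on (closure \<H>) (u t)" by (rule continuous_on_slice[OF classical_regularityD(1)[OF r] t'])
    show "continuous_on (closure \<H>) (partial_H i (u t))" for i by (rule continuous_on_slice[OF classical_regularityD(2)[OF r] t'])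
    show "has_pd (u t) i (partial_H i (u t) x) x" if "x \<in> \<H>" for i x
      by (rule C1_half_planeD(3)[OF classical_regularityD(3)[OF r t'] that])
    show "has_pd (u t) 1 (partial_H 1 (u t) x) x" if "x \<in> closure \<H>" for x
      by (rule partial_H_has_pd_1[OF d[OF that] that])
    show "partial_H 1 (u t) x $ 1 + partial_H 2 (u t) x $ 2 = 0" if "x \<in> \<H>" for x
      using div[OF that] by (simp add: divergence_def UNIV_2_sum)
    show "u t (pt a 0) $ 2 = 0" for a by (rule bd) (simp add: frontier_half_plane)
  qed
qed

lemma classical_time_deriv:
  assumes r: "classical_regularity T u p" and t: "t \<in> {0<..<T}" and x: "x \<in> \<H>"
  shows "((\<lambda>\<tau>. u \<tau> x) has_vector_derivative time_deriv u t x) (at t)"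
  using r t x unfolding classical_regularity_def time_deriv_def by (simp add: vector_derivative_works)

text \<open>On the boundary \<open>\<partial>\<^sub>1 u\<^sub>2 = 0\<close>, hence the vorticity of a field satisfying the no-slip condition
  is \<open>- \<partial>\<^sub>2 u\<^sub>1\<close> there.\<close>

lemma noslip_partial_1:
  assumes "has_pd v 1 D (pt a 0)" "\<And>s. v (pt s 0) = 0"
  shows "D = 0"
proof -
  have "((\<lambda>s. v (pt s 0)) has_vector_derivative D) (at a)" using assms(1) by (simp only: has_pd_iff_pt)
  then have "((\<lambda>s. 0) has_vector_derivative D) (at a)" by (simp only: assms(2))
  from vector_derivative_unique_at[OF this has_vector_derivative_const] show ?thesis .
qed

text \<open>\<open>F\<close> collects viscosity and convection, \<open>R\<close> the difference of
  the pressure gradients. The bound \<open>Mu\<close> for the viscous flow may depend on \<nu> and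
  is absent from the conclusion. Continuity and integrability are carried along for the essential
  supremum and the extended-real norm.\<close>

lemma inviscid_energy_bound:
  fixes u ub :: "real \<Rightarrow> real^2 \<Rightarrow> real^2"
  assumes \<nu>: "\<nu> > 0" and T: "T > 0" and Mb0: "Mb > 0"
    and eu: "classical_euler_solution T ub pb" and ns: "classical_navier_stokes_solution \<nu> T u p"
    and bb: "\<And>t. t \<in> {0..T} \<Longrightarrow> sup_L2_le Mb (ub t)" "\<And>t i. t \<in> {0..T} \<Longrightarrow> sup_L2_le Mb (partial_H i (ub t))"
    and bu: "\<And>t. t \<in> {0..T} \<Longrightarrow> sup_L2_le Mu (u t)" "\<And>t i. t \<in> {0..T} \<Longrightarrow> sup_L2_le Mu (partial_H i (u t))"
    and bL: "\<And>t i j. t \<in> {0<..<T} \<Longrightarrow> (\<integral>\<^sup>+x. ennreal ((norm (partial_H j (partial_H i (u t)) x))\<^sup>2) \<partial>HH) \<le> ennreal Mu"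
    and init: "\<And>x. x \<in> \<H> \<Longrightarrow> u 0 x = ub 0 x"
    and U: "\<And>a t. t \<in> {0..T} \<Longrightarrow> ub t (boundary_point a) $ 1 \<ge> 0"
    and vort: "\<And>a t. t \<in> {0..T} \<Longrightarrow> vorticity (u t) (boundary_point a) \<ge> 0"
  shows "t \<in> {0<..<T} \<Longrightarrow> (LINT x|HH. (norm (u t x - ub t x))\<^sup>2) \<le> \<nu> * (Mb * T * exp (4 * Mb * T))"
    and "continuous_on {0<..<T} (\<lambda>t. LINT x|HH. (norm (u t x - ub t x))\<^sup>2)"
    and "t \<in> {0<..<T} \<Longrightarrow> integrable HH (\<lambda>x. (norm (u t x - ub t x))\<^sup>2)"
proof -
  have ru: "classical_regularity T u p" and rb: "classical_regularity T ub pb"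
    and so: "classical_second_order T u"
    using eu ns by (simp_all add: classical_euler_solution_def classical_navier_stokes_solution_def)
  have ti: "t \<in> {0..T}" if "t \<in> {0<..<T}" for t using that by auto
  have noslip: "u t (pt a 0) = 0" if "t \<in> {0<..<T}" for t a
    using ns ti[OF that] by (simp add: classical_navier_stokes_solution_def frontier_half_plane)
  have su: "solenoidal Mu (u t) (\<lambda>i. partial_H i (u t))" if t: "t \<in> {0<..<T}" for t
  proof (rule classical_solenoidal[OF ru t _ _ bu(1)[OF ti[OF t]]])
    show "divergence (u t) x = 0" if "x \<in> \<H>" for x
      using ns t that by (simp add: classical_navier_stokes_solution_def)
    show "u t x $ 2 = 0" if "x \<in> frontier \<H>" for x
      using ns ti[OF t] that by (simp add: classical_navier_stokes_solution_def)
  qed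
  have sb: "solenoidal Mb (ub t) (\<lambda>i. partial_H i (ub t))" if t: "t \<in> {0<..<T}" for t
  proof (rule classical_solenoidal[OF rb t _ _ bb(1)[OF ti[OF t]]])
    show "divergence (ub t) x = 0" if "x \<in> \<H>" for x
      using eu t that by (simp add: classical_euler_solution_def)
    show "ub t x $ 2 = 0" if "x \<in> frontier \<H>" for x
      using eu ti[OF t] that by (simp add: classical_euler_solution_def)
  qed
  define w where "w t x = u t x - ub t x" for t x
  define L where "L t i = partial_H i (partial_H i (u t))" for t and i :: 2
  define F where "F t x = \<nu> *\<^sub>R (L t 1 x + L t 2 x) - (u t x $ 1 *\<^sub>R partial_H 1 (u t) x + u t x $ 2 *\<^sub>R partial_H 2 (u t) x)
    + (ub t x $ 1 *\<^sub>R partial_H 1 (ub t) x + ub t x $ 2 *\<^sub>R partial_H 2 (ub t) x)" for t x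
  define R where "R t x = gradient (p t) x - gradient (pb t) x" for t x
  have sub: "{0<..<T} \<times> \<H> \<subseteq> {0..T} \<times> closure \<H>" using half_plane_subset_closure by auto
  have cL: "continuous_on ({0<..<T} \<times> \<H>) (\<lambda>(t, x). L t i x)" for i
    using so by (simp add: classical_second_order_def L_def)
  note c = continuous_on_subset[OF classical_regularityD(1)[OF ru] sub] continuous_on_subset[OF classical_regularityD(2)[OF ru] sub]
    continuous_on_subset[OF classical_regularityD(1)[OF rb] sub] continuous_on_subset[OF classical_regularityD(2)[OF rb] sub] cL
  have cF: "continuous_on ({0<..<T} \<times> \<H>) (\<lambda>(t, x). F t x)"
    using c unfolding case_prod_beta' F_def by (intro continuous_intros) 
  have cp: "continuous_on ({0<..<T} \<times> \<H>) (\<lambda>(t, x). gradient (p t) x)" "continuous_on ({0<..<T} \<times> \<H>) (\<lambda>(t, x). gradient (pb t) x)"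
    using ru rb by (simp_all add: classical_regularity_def)
  have cR: "continuous_on ({0<..<T} \<times> \<H>) (\<lambda>(t, x). R t x)"
    using cp unfolding case_prod_beta' R_def by (intro continuous_intros)
  have lL: "L2le Mu (L t i)" if t: "t \<in> {0<..<T}" for t i
    using bL[OF t, of i i] continuous_measurable_HH[OF continuous_on_slice[OF cL t]] L2le_power2(4)[OF sup_L2_le_L2le[OF bu(1)[OF ti[OF t]] solenoidalD(3)[OF su[OF t]]]]
    by (simp add: L2le_def L_def)
  define N where "N = 40 * (\<nu>\<^sup>2 * Mu + Mu\<^sup>2 * Mu + Mb\<^sup>2 * Mb)"
  have lF: "L2le N (F t)" if t: "t \<in> {0<..<T}" for t
    unfolding N_def F_def[abs_def]
    by (rule forcing_L2le[OF \<nu> su[OF t] sb[OF t] bu(2)[OF ti[OF t]] bb(2)[OF ti[OF t]] lL[OF t]])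
  have sw: "solenoidal (2 * (Mu + Mb)) (w t) (\<lambda>i x. partial_H i (u t) x - partial_H i (ub t) x)" if t: "t \<in> {0<..<T}" for t
    using solenoidal_add[OF su[OF t] sb[OF t], of "-1"] by (simp add: w_def[abs_def])
  have orth: "(LINT x|HH. R t x \<bullet> V x) = 0" if t: "t \<in> {0<..<T}" and V: "test_field V" for t V
  proof -
    have g: "p t differentiable_on \<H>" "continuous_on \<H> (gradient (p t))" "pb t differentiable_on \<H>" "continuous_on \<H> (gradient (pb t))"
      using ru rb t continuous_on_slice[OF cp(1) t] continuous_on_slice[OF cp(2) t] by (auto simp: classical_regularity_def)
    have "(LINT x|HH. R t x \<bullet> V x) = (LINT x|HH. gradient (p t) x \<bullet> V x) - (LINT x|HH. gradient (pb t) x \<bullet> V x)"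
      unfolding R_def inner_diff_left
      by (rule Bochner_Integration.integral_diff[OF test_field_integrable[OF g(2) V] test_field_integrable[OF g(4) V]])
    then show ?thesis using gradient_orthogonal[OF g(1,2) V] gradient_orthogonal[OF g(3,4) V] by simp
  qed
  have dw: "((\<lambda>t. w t x) has_vector_derivative F t x - R t x) (at t)" if t: "t \<in> {0<..<T}" and x: "x \<in> \<H>" for t x
  proof -
    have "time_deriv u t x - \<nu> *\<^sub>R laplacian (u t) x + convection (u t) (u t) x + gradient (p t) x = 0"
      using ns t x by (simp add: classical_navier_stokes_solution_def)
    then have e1: "time_deriv u t x = \<nu> *\<^sub>R laplacian (u t) x - convection (u t) (u t) x - gradient (p t) x" by (simp add: algebra_simps)
    have "time_deriv ub t x + convection (ub t) (ub t) x + gradient (pb t) x = 0"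
      using eu t x by (simp add: classical_euler_solution_def)
    then have e2: "time_deriv ub t x = - (convection (ub t) (ub t) x + gradient (pb t) x)"
      by (simp only: eq_neg_iff_add_eq_0 add.assoc)
    have "time_deriv u t x - time_deriv ub t x = F t x - R t x"
      unfolding e1 e2 F_def R_def L_def laplacian_def convection_def UNIV_2_sum by simp
    then show ?thesis
      using has_vector_derivative_diff[OF classical_time_deriv[OF ru t x] classical_time_deriv[OF rb t x]] by (simp add: w_def)
  qed
  have ftc: "w t2 x - w t1 x = (LINT t:{t1..t2}|lborel. F t x - R t x)" if t: "0 < t1" "t1 < t2" "t2 < T" and x: "x \<in> \<H>" for t1 t2 x
  proof -
    have "(LINT t|lborel. indicator {t1..t2} t *\<^sub>R (F t x - R t x)) = w t2 x - w t1 x"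
    proof (rule integral_FTC_Icc)
      show "((\<lambda>t. w t x) has_vector_derivative F s x - R s x) (at s within {t1..t2})" if "t1 \<le> s" "s \<le> t2" for s
        using dw[of s x] that t x by (auto intro: has_vector_derivative_at_within)
      have sl: "continuous_on {t1..t2} (\<lambda>t. G t x)" if "continuous_on ({0<..<T} \<times> \<H>) (\<lambda>(t, x). G t x)" for G :: "real \<Rightarrow> real^2 \<Rightarrow> real^2"
      proof -
        have "continuous_on {t1..t2} (\<lambda>t. (\<lambda>(t, x). G t x) (t, x))"
          by (rule continuous_on_compose2[OF that]) (use t x in \<open>auto intro!: continuous_intros\<close>)
        then show ?thesis by simp
      qed
      show "continuous_on {t1..t2} (\<lambda>t. F t x - R t x)" by (intro continuous_intros sl cF cR)
    qed (use t in auto)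
    then show ?thesis by (simp add: set_lebesgue_integral_def)
  qed
  have est: "(LINT x|HH. F t x \<bullet> w t x) \<le> \<nu> * Mb / 2 + 2 * Mb * (LINT x|HH. (norm (w t x))\<^sup>2)" if t: "t \<in> {0<..<T}" for t
    unfolding F_def w_def
  proof (rule energy_estimate[OF \<nu> su[OF t] sb[OF t] bu(2)[OF ti[OF t]] bb(2)[OF ti[OF t]] lL[OF t] _ _ noslip[OF t]])
    show "continuous_on \<H> (L t i)" for i by (rule continuous_on_slice[OF cL t])
    show "has_pd (partial_H i (u t)) i (L t i x) x" if "x \<in> \<H>" for i x
      unfolding L_def by (rule partial_H_has_pd[of _ _ \<H>]) (use so t that in \<open>auto simp: classical_second_order_def differentiable_on_def\<close>)
    fix a
    have cl: "pt a 0 \<in> closure \<H>" by (simp add: closure_half_plane)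
    have D1: "partial_H 1 (u t) (pt a 0) = 0"
      by (rule noslip_partial_1[OF solenoidalD(6)[OF su[OF t] cl] noslip[OF t]])
    have "vorticity (u t) (pt a 0) \<ge> 0" using vort[OF ti[OF t], of a] by (simp add: boundary_point_eq)
    then have "- (partial_H 2 (u t) (pt a 0) $ 1) \<ge> 0" by (simp add: vorticity_def D1)
    moreover have "ub t (pt a 0) $ 1 \<ge> 0" using U[OF ti[OF t], of a] by (simp add: boundary_point_eq)
    ultimately have "0 \<le> - (partial_H 2 (u t) (pt a 0) $ 1) * (ub t (pt a 0) $ 1)" by (rule mult_nonneg_nonneg)
    \<comment> \<open>On the boundary u - ub has first component -U and second component 0. The
      inner product is therefore the vorticity times U.\<close>
    then show "0 \<le> partial_H 2 (u t) (pt a 0) \<bullet> (u t (pt a 0) - ub t (pt a 0))"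
      by (simp add: noslip[OF t] inner_vec_def UNIV_2_sum solenoidalD(8)[OF sb[OF t]])
  qed
  have init': "((\<lambda>t. w t x) \<longlongrightarrow> 0) (at_right 0)" if x: "x \<in> \<H>" for x
  proof -
    have x': "x \<in> closure \<H>" using x half_plane_subset_closure by blast
    have l: "((\<lambda>t. G t x) \<longlongrightarrow> G 0 x) (at_right 0)" if G: "continuous_on ({0..T} \<times> closure \<H>) (\<lambda>(t, x). G t x)" for G :: "real \<Rightarrow> real^2 \<Rightarrow> real^2"
    proof -
      have "continuous_on {0..T} (\<lambda>t. (\<lambda>(t, x). G t x) (t, x))"
        by (rule continuous_on_compose2[OF G]) (use x' in \<open>auto intro!: continuous_intros\<close>)
      then have "continuous_on {0..T} (\<lambda>t. G t x)" by simp
      then show ?thesis using T by (rule continuous_on_Icc_at_rightD)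
    qed
    from tendsto_diff[OF l[OF classical_regularityD(1)[OF ru]] l[OF classical_regularityD(1)[OF rb]]]
    show ?thesis by (simp add: w_def init[OF x])
  qed
  have ab: "\<nu> * Mb / 2 \<ge> 0" "2 * Mb \<ge> 0" using \<nu> Mb0 by auto
  have g1: "(LINT x|HH. (norm (w t x))\<^sup>2) \<le> 2 * (\<nu> * Mb / 2) * T * exp (2 * (2 * Mb) * T)" if t: "t \<in> {0<..<T}" for t
    by (rule energy_growth(1)[where F = F and R = R]; (rule sw cF cR lF orth ftc ab est init' t; assumption))
  have g2: "continuous_on {0<..<T} (\<lambda>t. LINT x|HH. (norm (w t x))\<^sup>2)"
    by (rule energy_growth(2)[where F = F and R = R]; (rule sw cF cR lF orth ftc ab est init'; assumption))
  show "(LINT x|HH. (norm (u t x - ub t x))\<^sup>2) \<le> \<nu> * (Mb * T * exp (4 * Mb * T))" if t: "t \<in> {0<..<T}"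
    using g1[OF t] by (simp add: w_def mult_ac)
  show "continuous_on {0<..<T} (\<lambda>t. LINT x|HH. (norm (u t x - ub t x))\<^sup>2)" using g2 by (simp add: w_def)
  show "integrable HH (\<lambda>x. (norm (u t x - ub t x))\<^sup>2)" if t: "t \<in> {0<..<T}"
    using L2le_power2(1)[OF sup_L2_le_L2le[OF sup_L2_le_solenoidal[OF sw[OF t]] solenoidalD(3)[OF sw[OF t]]]] by (simp add: w_def)
qed

theorem theorem1p1:
  fixes T s :: real
    and ubar :: "real \<Rightarrow> real^2 \<Rightarrow> real^2" and pbar :: "real \<Rightarrow> real^2 \<Rightarrow> real"
    and u :: "real \<Rightarrow> real \<Rightarrow> real^2 \<Rightarrow> real^2" and p :: "real \<Rightarrow> real \<Rightarrow> real^2 \<Rightarrow> real"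
  assumes "T > 0" and "s > 2"
    and "ubar \<in> Linf_sobolev T \<H> s"
    and "classical_euler_solution T ubar pbar"
    and "\<And>\<nu>. \<nu> > 0 \<Longrightarrow> u \<nu> \<in> Linf_sobolev T \<H> s"
    and "\<And>\<nu>. \<nu> > 0 \<Longrightarrow> classical_navier_stokes_solution \<nu> T (u \<nu>) (p \<nu>)"
    and "\<And>\<nu> x. \<nu> > 0 \<Longrightarrow> x \<in> \<H> \<Longrightarrow> u \<nu> 0 x = ubar 0 x"
    and "\<And>x1 t. t \<in> {0..T} \<Longrightarrow> ubar t (boundary_point x1) $ 1 \<ge> 0"
    and "\<forall>\<^sub>F \<nu> in at_right 0. \<forall>x1. \<forall>t\<in>{0..T}. vorticity (u \<nu> t) (boundary_point x1) \<ge> 0"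
  shows "((\<lambda>\<nu>. (Linf_norm T (L2_norm \<H>) (\<lambda>t x. u \<nu> t x - ubar t x))\<^sup>2) \<longlongrightarrow> 0) (at_right 0)"
proof -
  have "classical_regularity T ubar pbar" using assms(4) by (simp add: classical_euler_solution_def)
  from solution_bounds[OF assms(1,2,3) this]
  obtain Mb where Mb: "Mb > 0" "\<And>t. t \<in> {0..T} \<Longrightarrow> sup_L2_le Mb (ubar t)" "\<And>t i. t \<in> {0..T} \<Longrightarrow> sup_L2_le Mb (partial_H i (ubar t))"
    by auto
  define C where "C = Mb * T * exp (4 * Mb * T)"
  have C: "C \<ge> 0" using Mb(1) assms(1) by (simp add: C_def)
  have bound: "(Linf_norm T (L2_norm \<H>) (\<lambda>t x. u \<nu> t x - ubar t x))\<^sup>2 \<le> ennreal (\<nu> * C)"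
    if \<nu>: "\<nu> > 0" and vort: "\<forall>x1. \<forall>t\<in>{0..T}. vorticity (u \<nu> t) (boundary_point x1) \<ge> 0" for \<nu>
  proof -
    have ru: "classical_regularity T (u \<nu>) (p \<nu>)" and so: "classical_second_order T (u \<nu>)"
      using assms(6)[OF \<nu>] by (simp_all add: classical_navier_stokes_solution_def)
    \<comment> \<open>Chosen anew for each \<nu>. The constant C, fixed before \<nu>, involves only
      \<open>Mb\<close> and \<open>T\<close>.\<close>
    obtain Mu where M1: "\<forall>t\<in>{0..T}. sup_L2_le Mu (u \<nu> t) \<and> (\<forall>i. sup_L2_le Mu (partial_H i (u \<nu> t)))"
      and M2: "\<forall>t\<in>{0<..<T}. \<forall>i j. (\<integral>\<^sup>+x. ennreal ((norm (partial_H j (partial_H i (u \<nu> t)) x))\<^sup>2) \<partial>HH) \<le> ennreal Mu"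
      using solution_bounds[OF assms(1,2) assms(5)[OF \<nu>] ru] so by blast
    have Mu: "\<And>t. t \<in> {0..T} \<Longrightarrow> sup_L2_le Mu (u \<nu> t)" "\<And>t i. t \<in> {0..T} \<Longrightarrow> sup_L2_le Mu (partial_H i (u \<nu> t))"
      "\<And>t i j. t \<in> {0<..<T} \<Longrightarrow> (\<integral>\<^sup>+x. ennreal ((norm (partial_H j (partial_H i (u \<nu> t)) x))\<^sup>2) \<partial>HH) \<le> ennreal Mu"
      using M1 M2 by blast+
    define E where "E t = (LINT x|HH. (norm (u \<nu> t x - ubar t x))\<^sup>2)" for t
    have vort': "vorticity (u \<nu> t) (boundary_point a) \<ge> 0" if "t \<in> {0..T}" for a t using vort that by blast
    have g1: "E t \<le> \<nu> * C" if t: "t \<in> {0<..<T}" for t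
      unfolding E_def C_def
      by (rule inviscid_energy_bound(1)[where u = "u \<nu>" and p = "p \<nu>" and pb = pbar and Mu = Mu];
        (rule \<nu> assms(1) Mb assms(4) assms(6)[OF \<nu>] Mu assms(7)[OF \<nu>] assms(8) vort' t; assumption))
    have g2: "continuous_on {0<..<T} E"
      unfolding E_def
      by (rule inviscid_energy_bound(2)[where u = "u \<nu>" and p = "p \<nu>" and pb = pbar and Mu = Mu and Mb = Mb];
        (rule \<nu> assms(1) Mb assms(4) assms(6)[OF \<nu>] Mu assms(7)[OF \<nu>] assms(8) vort'; assumption))
    have g3: "integrable HH (\<lambda>x. (norm (u \<nu> t x - ubar t x))\<^sup>2)" if t: "t \<in> {0<..<T}" for t
      by (rule inviscid_energy_bound(3)[where u = "u \<nu>" and p = "p \<nu>" and pb = pbar and Mu = Mu and Mb = Mb];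
        (rule \<nu> assms(1) Mb assms(4) assms(6)[OF \<nu>] Mu assms(7)[OF \<nu>] assms(8) vort' t; assumption))
    have n: "L2_norm \<H> (\<lambda>x. u \<nu> t x - ubar t x) = ennreal (sqrt (E t))" if t: "t \<in> {0<..<T}" for t
    proof -
      have "(\<integral>\<^sup>+x. ennreal ((norm (u \<nu> t x - ubar t x))\<^sup>2) \<partial>HH) = ennreal (E t)"
        unfolding E_def by (rule nn_integral_eq_integral[OF g3[OF t]]) auto
      moreover have "E t \<ge> 0" unfolding E_def by (intro integral_nonneg_AE) auto
      ultimately show ?thesis by (simp add: L2_norm_def ennreal_sqrt_def)
    qed
    have "(\<lambda>t. ennreal (sqrt (E t))) \<in> borel_measurable (lebesgue_on {0<..<T})"
    proof -
      have "continuous_on {0<..<T} (\<lambda>t. sqrt (E t))"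
        by (intro continuous_intros g2)
      then have "(\<lambda>t. sqrt (E t)) \<in> borel_measurable (lebesgue_on {0<..<T})"
        by (intro continuous_imp_measurable_on_sets_lebesgue) auto
      then show ?thesis by measurable
    qed
    \<comment> \<open>\<open>esssup\<close> takes the value top on functions that are not
      measurable, so measurability in time must be established; it comes from the continuity of the
      energy on the open interval.\<close>
    then have m: "(\<lambda>t. L2_norm \<H> (\<lambda>x. u \<nu> t x - ubar t x)) \<in> borel_measurable (lebesgue_on {0<..<T})"
      by (rule measurable_cong[THEN iffD1, rotated]) (simp add: n)
    have "Linf_norm T (L2_norm \<H>) (\<lambda>t x. u \<nu> t x - ubar t x) \<le> ennreal (sqrt (\<nu> * C))"
      unfolding Linf_norm_def
    proof (rule esssup_I[OF m AE_I2])
      fix t assume "t \<in> space (lebesgue_on {0<..<T})"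
      then have t: "t \<in> {0<..<T}" by simp
      have "E t \<le> \<nu> * C" by (rule g1[OF t])
      then show "L2_norm \<H> (\<lambda>x. u \<nu> t x - ubar t x) \<le> ennreal (sqrt (\<nu> * C))"
        unfolding n[OF t] by (intro ennreal_leI real_sqrt_le_mono)
    qed
    then have "(Linf_norm T (L2_norm \<H>) (\<lambda>t x. u \<nu> t x - ubar t x))\<^sup>2 \<le> (ennreal (sqrt (\<nu> * C)))\<^sup>2"
      by (intro power_mono) auto
    also have "\<dots> = ennreal (\<nu> * C)" using \<nu> C by (simp add: ennreal_power)
    finally show ?thesis .
  qed
  have pos: "\<forall>\<^sub>F \<nu> in at_right (0::real). \<nu> > 0" by (simp add: eventually_at_filter)
  have "((\<lambda>\<nu>. ennreal (\<nu> * C)) \<longlongrightarrow> ennreal (0 * C)) (at_right 0)"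
    by (intro tendsto_ennrealI tendsto_intros)
  then have lim: "((\<lambda>\<nu>. ennreal (\<nu> * C)) \<longlongrightarrow> 0) (at_right 0)" by simp
  show ?thesis
  proof (rule tendsto_sandwich[OF _ _ tendsto_const lim])
    show "\<forall>\<^sub>F \<nu> in at_right 0. (Linf_norm T (L2_norm \<H>) (\<lambda>t x. u \<nu> t x - ubar t x))\<^sup>2 \<le> ennreal (\<nu> * C)"
      using assms(9) pos by eventually_elim (rule bound)
  qed simp
qed

end
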